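(* Let $d\ge 2$ and let $\mathbb{A}^d$ be the set of all monic polynomials $f(x)=x^d+a_{d-1}x^{d-1}+\ldots+a_0\in\mathbb{Q}[x]$. There exists a Zariski dense subset $\mathcal{U}$ of $\mathbb{A}^d$ such that for all $f(x)\in\mathcal{U}$ the Artin-Schreier curves $X/\mathbb{F}_p$ defined by $y^p-y=f(x)\bmod p$ satisfy $$\lim_{p\rightarrow\infty}\mathrm{NP}_1(X/\mathbb{F}_p)=\frac1d,$$ where $p$ runs over the primes coprime to $d$ such that all coefficients of $f$ are $p$-integral (i.e. $f\in(\mathbb{Z}_p\cap\mathbb{Q})[x]$).
   Context: $\mathbb{A}^d$ is identified with $\mathbb{Q}^d$ via the coefficients $(a_0,\dots,a_{d-1})$, with the Zariski topology. A curve is a smooth, projective, geometrically integral variety of dimension one; "the curve with affine equation $y^p-y=\tilde f(x)$" is the smooth projective model; it has genus $(p-1)(d-1)/2$ when $p\nmid d=\deg\tilde f$. Newton polygon: for a curve $X$ of genus $g$ over $\mathbb{F}_q$, $q=p^\nu$, write $\exp\big(\sum_{n\ge1}(q^n+1-\#X(\mathbb{F}_{q^n}))\frac{T^n}{n}\big)=\frac{1}{P(T)}$ with $P(T)=1+\sum_{\ell=1}^{2g}b_\ell T^\ell\in\mathbb{Z}[T]$. $\mathrm{NP}(X/\mathbb{F}_q)$ is the lower convex hull in $\mathbb{R}^2$ of $(0,0)$ and the points $(\ell,\frac{\mathrm{ord}_p b_\ell}{\nu})$, $1\le\ell\le 2g$ (with $\mathrm{ord}_p 0=\infty$). $\mathrm{NP}_1(X/\mathbb{F}_q)$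 is its first (smallest) slope. *)

theory Defs
  imports
    "HOL-Analysis.Analysis"
    "HOL-Algebra.UnivPoly"
    "HOL-Algebra.QuotRing"
    "HOL-Algebra.Algebraic_Closure"
    "HOL-Number_Theory.Residues"
    "HOL-Computational_Algebra.Computational_Algebra"
begin

hide_const (open) Divisibility.prime

section \<open>The affine space of monic polynomials and its Zariski topology\<close>

definition monic_polys :: "nat \<Rightarrow> rat Polynomial.poly set" where
  "monic_polys d = {f. Polynomial.degree f = d \<and> Polynomial.lead_coeff f = 1}"

text \<open>The polynomial functions in the coordinates \<open>a 0, \<dots>, a (d - 1)\<close>. Since \<open>\<rat>\<close> is infinite,
  these are the same thing as polynomials in \<open>d\<close> variables over \<open>\<rat>\<close>.\<close>

inductive_set polyfuns :: "nat \<Rightarrow> ((nat \<Rightarrow> rat) \<Rightarrow> rat) set" for d :: nat where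
  const: "(\<lambda>a. c) \<in> polyfuns d"
| coord: "i < d \<Longrightarrow> (\<lambda>a. a i) \<in> polyfuns d"
| add: "P \<in> polyfuns d \<Longrightarrow> Q \<in> polyfuns d \<Longrightarrow> (\<lambda>a. P a + Q a) \<in> polyfuns d"
| mult: "P \<in> polyfuns d \<Longrightarrow> Q \<in> polyfuns d \<Longrightarrow> (\<lambda>a. P a * Q a) \<in> polyfuns d"

definition zero_locus ::
    "nat \<Rightarrow> ((nat \<Rightarrow> rat) \<Rightarrow> rat) set \<Rightarrow> rat Polynomial.poly set" where
  "zero_locus d S = {f \<in> monic_polys d. \<forall>P\<in>S. P (Polynomial.coeff f) = 0}"

definition zariski :: "nat \<Rightarrow> rat Polynomial.poly topology" where
  "zariski d = topology (\<lambda>W. \<exists>S \<subseteq> polyfuns d. W = monic_polys d - zero_locus d S)"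

lemma openin_zariski:
  "openin (zariski d) W \<longleftrightarrow> (\<exists>S \<subseteq> polyfuns d. W = monic_polys d - zero_locus d S)"
proof -
  let ?L = "\<lambda>W. \<exists>S \<subseteq> polyfuns d. W = monic_polys d - zero_locus d S"
  have "istopology ?L"
    unfolding istopology_def
  proof (intro conjI allI impI)
    fix V W assume "?L V" "?L W"
    then obtain S T where S: "S \<subseteq> polyfuns d" "V = monic_polys d - zero_locus d S"
      and T: "T \<subseteq> polyfuns d" "W = monic_polys d - zero_locus d T" by blast
    define R where "R = {\<lambda>a. P a * Q a | P Q. P \<in> S \<and> Q \<in> T}"
    have "R \<subseteq> polyfuns d"
      using S T by (auto simp: R_def intro!: polyfuns.mult)
    moreover have "zero_locus d R = zero_locus d S \<union> zero_locus d T"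
      unfolding zero_locus_def R_def by fastforce
    ultimately show "?L (V \<inter> W)"
      using S T by (intro exI[of _ R]) auto
  next
    fix \<K> assume *: "\<forall>K\<in>\<K>. ?L K"
    define S where "S = {P \<in> polyfuns d. \<exists>K\<in>\<K>. \<forall>f \<in> monic_polys d - K. P (Polynomial.coeff f) = 0}"
    have "\<Union>\<K> = monic_polys d - zero_locus d S"
    proof (intro equalityI subsetI)
      fix f assume "f \<in> \<Union>\<K>"
      then obtain K where K: "K \<in> \<K>" "f \<in> K" by blast
      with * obtain T where T: "T \<subseteq> polyfuns d" "K = monic_polys d - zero_locus d T" by blast
      with K obtain P where P: "P \<in> T" "P (Polynomial.coeff f) \<noteq> 0" "f \<in> monic_polys d"
        by (auto simp: zero_locus_def)
      have "\<forall>g \<in> monic_polys d - K. P (Polynomial.coeff g) = 0"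
        using P T by (auto simp: zero_locus_def)
      then have "P \<in> S"
        using P T K unfolding S_def by blast
      with P show "f \<in> monic_polys d - zero_locus d S"
        by (auto simp: zero_locus_def)
    next
      fix f assume "f \<in> monic_polys d - zero_locus d S"
      then show "f \<in> \<Union>\<K>"
        unfolding zero_locus_def S_def by blast
    qed
    moreover have "S \<subseteq> polyfuns d" by (auto simp: S_def)
    ultimately show "?L (\<Union>\<K>)" by blast
  qed
  then show ?thesis by (simp add: zariski_def)
qed

lemma topspace_zariski [simp]: "topspace (zariski d) = monic_polys d"
proof -
  have "openin (zariski d) (monic_polys d)"
    unfolding openin_zariski
    by (rule exI[of _ "{\<lambda>_. 1}"]) (auto simp: zero_locus_def intro: polyfuns.const)
  then show ?thesis
    unfolding topspace_def openin_zariski by blast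
qed

section \<open>Function fields and points of smooth projective curves\<close>

definition fraction :: "('a, 'm) ring_scheme \<Rightarrow> 'a \<Rightarrow> 'a \<Rightarrow> ('a \<times> 'a) set" where
  "fraction R a b = {(c, d). c \<in> carrier R \<and> d \<in> carrier R - {\<zero>\<^bsub>R\<^esub>} \<and> a \<otimes>\<^bsub>R\<^esub> d = c \<otimes>\<^bsub>R\<^esub> b}"

definition fraction_field :: "('a, 'm) ring_scheme \<Rightarrow> ('a \<times> 'a) set ring" where
  "fraction_field R =
    \<lparr>carrier = {fraction R a b | a b. a \<in> carrier R \<and> b \<in> carrier R - {\<zero>\<^bsub>R\<^esub>}},
     monoid.mult = (\<lambda>C D. \<Union>(a, b)\<in>C. \<Union>(c, d)\<in>D. fraction R (a \<otimes>\<^bsub>R\<^esub> c) (b \<otimes>\<^bsub>R\<^esub> d)),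
     one = fraction R \<one>\<^bsub>R\<^esub> \<one>\<^bsub>R\<^esub>,
     ring.zero = fraction R \<zero>\<^bsub>R\<^esub> \<one>\<^bsub>R\<^esub>,
     add = (\<lambda>C D. \<Union>(a, b)\<in>C. \<Union>(c, d)\<in>D.
              fraction R (a \<otimes>\<^bsub>R\<^esub> d \<oplus>\<^bsub>R\<^esub> c \<otimes>\<^bsub>R\<^esub> b) (b \<otimes>\<^bsub>R\<^esub> d))\<rparr>"

lemma fraction_mem_iff:
  "(c, d) \<in> fraction R a b \<longleftrightarrow>
     c \<in> carrier R \<and> d \<in> carrier R - {\<zero>\<^bsub>R\<^esub>} \<and> a \<otimes>\<^bsub>R\<^esub> d = c \<otimes>\<^bsub>R\<^esub> b"
  by (simp add: fraction_def)

lemma UN2_const: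
  assumes "\<And>x y u v. (x, y) \<in> A \<Longrightarrow> (u, v) \<in> B \<Longrightarrow> G x y u v = F" "(a, b) \<in> A" "(c, d) \<in> B"
  shows "(\<Union>(x, y)\<in>A. \<Union>(u, v)\<in>B. G x y u v) = F"
proof (intro equalityI subsetI)
  fix z assume "z \<in> (\<Union>(x, y)\<in>A. \<Union>(u, v)\<in>B. G x y u v)"
  then obtain x y u v where "(x, y) \<in> A" "(u, v) \<in> B" "z \<in> G x y u v" by blast
  with assms(1) show "z \<in> F" by blast
next
  fix z assume "z \<in> F"
  with assms have "z \<in> G a b c d" by blast
  with assms(2,3) show "z \<in> (\<Union>(x, y)\<in>A. \<Union>(u, v)\<in>B. G x y u v)" by blast
qed

context "domain"
begin

lemma fraction_eq_iff:
  assumes "a \<in> carrier R" "b \<in> carrier R - {\<zero>}" "c \<in> carrier R" "d \<in> carrier R - {\<zero>}"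
  shows "fraction R a b = fraction R c d \<longleftrightarrow> a \<otimes> d = c \<otimes> b"
proof
  assume "fraction R a b = fraction R c d"
  moreover have "(c, d) \<in> fraction R c d" using assms by (simp add: fraction_mem_iff)
  ultimately show "a \<otimes> d = c \<otimes> b" by (metis fraction_mem_iff)
next
  have *: "fraction R a b \<subseteq> fraction R c d"
    if eq: "a \<otimes> d = c \<otimes> b" and abcd: "a \<in> carrier R" "b \<in> carrier R - {\<zero>}"
      "c \<in> carrier R" "d \<in> carrier R - {\<zero>}" for a b c d
  proof
    fix z assume "z \<in> fraction R a b"
    then obtain x y where z: "z = (x, y)" "x \<in> carrier R" "y \<in> carrier R - {\<zero>}" "a \<otimes> y = x \<otimes> b"
      by (cases z) (auto simp: fraction_mem_iff)
    have "b \<otimes> (c \<otimes> y) = (c \<otimes> b) \<otimes> y" using z abcd by (simp add: m_ac)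
    also have "\<dots> = (a \<otimes> d) \<otimes> y" by (simp only: eq)
    also have "\<dots> = d \<otimes> (a \<otimes> y)" using z(2,3) abcd by (simp add: m_ac)
    also have "\<dots> = d \<otimes> (x \<otimes> b)" by (simp only: z(4))
    also have "\<dots> = b \<otimes> (x \<otimes> d)" using z(2,3) abcd by (simp add: m_ac)
    finally have "c \<otimes> y = x \<otimes> d" using z abcd by (subst (asm) m_lcancel) auto
    with z show "z \<in> fraction R c d" by (simp add: fraction_mem_iff)
  qed
  assume "a \<otimes> d = c \<otimes> b"
  with *[of a d c b] *[of c b a d] assms show "fraction R a b = fraction R c d" by auto
qed

lemma fraction_field_mult:
  assumes ab: "a \<in> carrier R" "b \<in> carrier R - {\<zero>}" and cd: "c \<in> carrier R" "d \<in> carrier R - {\<zero>}"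
  shows "fraction R a b \<otimes>\<^bsub>fraction_field R\<^esub> fraction R c d = fraction R (a \<otimes> c) (b \<otimes> d)"
proof -
  have "fraction R (x \<otimes> u) (y \<otimes> v) = fraction R (a \<otimes> c) (b \<otimes> d)"
    if "(x, y) \<in> fraction R a b" "(u, v) \<in> fraction R c d" for x y u v
  proof (subst fraction_eq_iff)
    have xy: "x \<in> carrier R" "y \<in> carrier R - {\<zero>}" "a \<otimes> y = x \<otimes> b"
      and uv: "u \<in> carrier R" "v \<in> carrier R - {\<zero>}" "c \<otimes> v = u \<otimes> d"
      using that by (auto simp: fraction_mem_iff)
    show "x \<otimes> u \<in> carrier R" "a \<otimes> c \<in> carrier R" "y \<otimes> v \<in> carrier R - {\<zero>}"
      "b \<otimes> d \<in> carrier R - {\<zero>}"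
      using xy uv ab cd by (auto simp: integral_iff)
    have "x \<otimes> u \<otimes> (b \<otimes> d) = (x \<otimes> b) \<otimes> (u \<otimes> d)" using xy uv ab cd by (simp add: m_ac)
    also have "\<dots> = (a \<otimes> y) \<otimes> (c \<otimes> v)" using xy uv by simp
    also have "\<dots> = a \<otimes> c \<otimes> (y \<otimes> v)" using xy(1,2) uv(1,2) ab cd by (simp add: m_ac)
    finally show "x \<otimes> u \<otimes> (b \<otimes> d) = a \<otimes> c \<otimes> (y \<otimes> v)" .
  qed
  moreover have "(a, b) \<in> fraction R a b" "(c, d) \<in> fraction R c d"
    using ab cd by (auto simp: fraction_mem_iff)
  ultimately show ?thesis
    unfolding fraction_field_def monoid.simps ring.simps by (rule UN2_const)
qed

lemma fraction_field_add:
  assumes ab: "a \<in> carrier R" "b \<in> carrier R - {\<zero>}" and cd: "c \<in> carrier R" "d \<in> carrier R - {\<zero>}"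
  shows "fraction R a b \<oplus>\<^bsub>fraction_field R\<^esub> fraction R c d = fraction R (a \<otimes> d \<oplus> c \<otimes> b) (b \<otimes> d)"
proof -
  have "fraction R (x \<otimes> v \<oplus> u \<otimes> y) (y \<otimes> v) = fraction R (a \<otimes> d \<oplus> c \<otimes> b) (b \<otimes> d)"
    if "(x, y) \<in> fraction R a b" "(u, v) \<in> fraction R c d" for x y u v
  proof (subst fraction_eq_iff)
    have xy: "x \<in> carrier R" "y \<in> carrier R - {\<zero>}" "a \<otimes> y = x \<otimes> b"
      and uv: "u \<in> carrier R" "v \<in> carrier R - {\<zero>}" "c \<otimes> v = u \<otimes> d"
      using that by (auto simp: fraction_mem_iff)
    show "x \<otimes> v \<oplus> u \<otimes> y \<in> carrier R" "a \<otimes> d \<oplus> c \<otimes> b \<in> carrier R"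
      "y \<otimes> v \<in> carrier R - {\<zero>}" "b \<otimes> d \<in> carrier R - {\<zero>}"
      using xy uv ab cd by (auto simp: integral_iff)
    have "(x \<otimes> v \<oplus> u \<otimes> y) \<otimes> (b \<otimes> d) = (x \<otimes> b) \<otimes> (v \<otimes> d) \<oplus> (u \<otimes> d) \<otimes> (b \<otimes> y)"
      using xy(1,2) uv(1,2) ab cd by (simp add: l_distr r_distr m_ac)
    also have "\<dots> = (a \<otimes> y) \<otimes> (v \<otimes> d) \<oplus> (c \<otimes> v) \<otimes> (b \<otimes> y)" using xy uv by simp
    also have "\<dots> = (a \<otimes> d \<oplus> c \<otimes> b) \<otimes> (y \<otimes> v)"
      using xy(1,2) uv(1,2) ab cd by (simp add: l_distr r_distr m_ac)
    finally show "(x \<otimes> v \<oplus> u \<otimes> y) \<otimes> (b \<otimes> d) = (a \<otimes> d \<oplus> c \<otimes> b) \<otimes> (y \<otimes> v)" .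
  qed
  moreover have "(a, b) \<in> fraction R a b" "(c, d) \<in> fraction R c d"
    using ab cd by (auto simp: fraction_mem_iff)
  ultimately show ?thesis
    unfolding fraction_field_def monoid.simps ring.simps by (rule UN2_const)
qed

lemma fraction_in_carrier:
  "a \<in> carrier R \<Longrightarrow> b \<in> carrier R - {\<zero>} \<Longrightarrow> fraction R a b \<in> carrier (fraction_field R)"
  by (auto simp: fraction_field_def)

lemma fraction_cases:
  assumes "z \<in> carrier (fraction_field R)"
  obtains a b where "a \<in> carrier R" "b \<in> carrier R - {\<zero>}" "z = fraction R a b"
  using assms by (auto simp: fraction_field_def)

lemma fraction_field_is_field: "field (fraction_field R)"
proof -
  let ?K = "fraction_field R"
  have one: "\<one>\<^bsub>?K\<^esub> = fraction R \<one> \<one>" and zero: "\<zero>\<^bsub>?K\<^esub> = fraction R \<zero> \<one>"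
    by (simp_all add: fraction_field_def)
  note calc = fraction_field_mult fraction_field_add fraction_eq_iff integral_iff one zero
  have "cring ?K"
  proof (intro cringI abelian_groupI comm_monoidI)
    fix x y z assume "x \<in> carrier ?K" "y \<in> carrier ?K" "z \<in> carrier ?K"
    then obtain a b c d e f where [simp]: "a \<in> carrier R" "b \<in> carrier R" "b \<noteq> \<zero>"
        "c \<in> carrier R" "d \<in> carrier R" "d \<noteq> \<zero>" "e \<in> carrier R" "f \<in> carrier R" "f \<noteq> \<zero>"
      and [simp]: "x = fraction R a b" "y = fraction R c d" "z = fraction R e f"
      by (elim fraction_cases) auto
    show "x \<oplus>\<^bsub>?K\<^esub> y \<oplus>\<^bsub>?K\<^esub> z = x \<oplus>\<^bsub>?K\<^esub> (y \<oplus>\<^bsub>?K\<^esub> z)" "x \<otimes>\<^bsub>?K\<^esub> y \<otimes>\<^bsub>?K\<^esub> z = x \<otimes>\<^bsub>?K\<^esub> (y \<otimes>\<^bsub>?K\<^esub> z)"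
      "(x \<oplus>\<^bsub>?K\<^esub> y) \<otimes>\<^bsub>?K\<^esub> z = x \<otimes>\<^bsub>?K\<^esub> z \<oplus>\<^bsub>?K\<^esub> y \<otimes>\<^bsub>?K\<^esub> z"
      by (simp_all add: calc l_distr r_distr m_ac a_ac)
  next
    fix x y assume "x \<in> carrier ?K" "y \<in> carrier ?K"
    then obtain a b c d where [simp]: "a \<in> carrier R" "b \<in> carrier R" "b \<noteq> \<zero>"
        "c \<in> carrier R" "d \<in> carrier R" "d \<noteq> \<zero>"
      and [simp]: "x = fraction R a b" "y = fraction R c d"
      by (elim fraction_cases) auto
    show "x \<oplus>\<^bsub>?K\<^esub> y = y \<oplus>\<^bsub>?K\<^esub> x" "x \<otimes>\<^bsub>?K\<^esub> y = y \<otimes>\<^bsub>?K\<^esub> x"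
      by (simp_all add: calc m_ac a_ac)
    show "x \<oplus>\<^bsub>?K\<^esub> y \<in> carrier ?K" "x \<otimes>\<^bsub>?K\<^esub> y \<in> carrier ?K"
      by (auto simp: calc intro!: fraction_in_carrier)
  next
    fix x assume "x \<in> carrier ?K"
    then obtain a b where [simp]: "a \<in> carrier R" "b \<in> carrier R" "b \<noteq> \<zero>"
      and [simp]: "x = fraction R a b"
      by (elim fraction_cases) auto
    show "\<zero>\<^bsub>?K\<^esub> \<oplus>\<^bsub>?K\<^esub> x = x" "\<one>\<^bsub>?K\<^esub> \<otimes>\<^bsub>?K\<^esub> x = x"
      by (simp_all add: calc)
    show "\<exists>y\<in>carrier ?K. y \<oplus>\<^bsub>?K\<^esub> x = \<zero>\<^bsub>?K\<^esub>"
      by (rule bexI[of _ "fraction R (\<ominus> a) b"]) (auto simp: calc l_minus l_neg intro!: fraction_in_carrier)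
  next
    show "\<zero>\<^bsub>?K\<^esub> \<in> carrier ?K" "\<one>\<^bsub>?K\<^esub> \<in> carrier ?K"
      by (auto simp: one zero intro!: fraction_in_carrier)
  qed
  then interpret K: cring ?K .
  show ?thesis
  proof (rule K.cring_fieldI2)
    show "\<zero>\<^bsub>?K\<^esub> \<noteq> \<one>\<^bsub>?K\<^esub>" by (simp add: calc)
    fix x assume "x \<in> carrier ?K" "x \<noteq> \<zero>\<^bsub>?K\<^esub>"
    then obtain a b where [simp]: "a \<in> carrier R" "b \<in> carrier R" "b \<noteq> \<zero>"
      and x: "x = fraction R a b" "x \<noteq> \<zero>\<^bsub>?K\<^esub>"
      by (elim fraction_cases) auto
    from x have "a \<noteq> \<zero>" by (auto simp: calc)
    with x show "\<exists>y\<in>carrier ?K. x \<otimes>\<^bsub>?K\<^esub> y = \<one>\<^bsub>?K\<^esub>"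
      by (intro bexI[of _ "fraction R b a"]) (auto simp: calc m_comm intro!: fraction_in_carrier)
  qed
qed

end

text \<open>The proper valuation rings of a field \<open>K\<close>. If \<open>K\<close> is a function field in one variable over a
  finite field \<open>k\<close>, each of them contains \<open>k\<close> (the nonzero elements of \<open>k\<close> are roots of unity) and is
  discrete, and they are the local rings at the closed points of the smooth projective curve over
  \<open>k\<close> with function field \<open>K\<close>.\<close>

definition valuation_rings :: "('a, 'm) ring_scheme \<Rightarrow> 'a set set" where
  "valuation_rings K =
    {V. subring V K \<and> V \<noteq> carrier K \<and> (\<forall>z \<in> carrier K - {\<zero>\<^bsub>K\<^esub>}. z \<in> V \<or> inv\<^bsub>K\<^esub> z \<in> V)}"

text \<open>The \<open>L\<close>-valued points \<open>Spec L \<rightarrow> X\<close> of the smooth projective curve \<open>X\<close> over a prime field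
  \<open>\<bbbF>\<^sub>p\<close> with function field \<open>K\<close>, for a finite field \<open>L\<close>: a closed point of \<open>X\<close> together with a
  local homomorphism from its local ring to \<open>L\<close>. The generic point contributes nothing, as \<open>K\<close> is
  infinite, and \<open>\<bbbF>\<^sub>p\<close>-linearity is automatic over a prime field.\<close>

definition curve_points ::
    "('a, 'm) ring_scheme \<Rightarrow> ('b, 'n) ring_scheme \<Rightarrow> ('a set \<times> ('a \<Rightarrow> 'b)) set" where
  "curve_points K L =
    {(V, \<phi>). V \<in> valuation_rings K \<and>
       \<phi> \<in> ring_hom (K\<lparr>carrier := V\<rparr>) L \<and> \<phi> \<in> extensional V \<and>
       (\<forall>z \<in> V - Units (K\<lparr>carrier := V\<rparr>). \<phi> z = \<zero>\<^bsub>L\<^esub>)}"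

section \<open>Artin-Schreier curves\<close>

definition p_integral :: "nat \<Rightarrow> rat \<Rightarrow> bool" where
  "p_integral p a \<longleftrightarrow> \<not> int p dvd snd (quotient_of a)"

definition rat_mod :: "nat \<Rightarrow> rat \<Rightarrow> int" where
  "rat_mod p a = (let k = residue_ring (int p) in
     (fst (quotient_of a) mod int p) \<otimes>\<^bsub>k\<^esub> inv\<^bsub>k\<^esub> (snd (quotient_of a) mod int p))"

definition poly_mod :: "nat \<Rightarrow> rat Polynomial.poly \<Rightarrow> nat \<Rightarrow> int" where
  "poly_mod p f = (\<lambda>i. rat_mod p (Polynomial.coeff f i))"

text \<open>In the ring \<open>S = k[x][y]\<close> below, \<open>h \<in> k[x]\<close>.\<close>

definition AS_coordinate_ring :: "nat \<Rightarrow> (nat \<Rightarrow> int) \<Rightarrow> (nat \<Rightarrow> nat \<Rightarrow> int) set ring" where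
  "AS_coordinate_ring p h =
    (let A = UP (residue_ring (int p)); S = UP A; y = up_ring.monom S \<one>\<^bsub>A\<^esub> 1
     in S Quot (PIdl\<^bsub>S\<^esub> (y [^]\<^bsub>S\<^esub> p \<ominus>\<^bsub>S\<^esub> y \<ominus>\<^bsub>S\<^esub> up_ring.monom S h 0)))"

definition AS_function_field ::
    "nat \<Rightarrow> (nat \<Rightarrow> int) \<Rightarrow> ((nat \<Rightarrow> nat \<Rightarrow> int) set \<times> (nat \<Rightarrow> nat \<Rightarrow> int) set) set ring" where
  "AS_function_field p h = fraction_field (AS_coordinate_ring p h)"

text \<open>The field with \<open>p ^ n\<close> elements, inside an algebraic closure of \<open>\<bbbF>\<^sub>p\<close>.\<close>

definition GF :: "nat \<Rightarrow> nat \<Rightarrow> ((int list \<times> nat) multiset \<Rightarrow> int) ring" where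
  "GF p n = (let C = field.alg_closure (residue_ring (int p)) in
     C\<lparr>carrier := {x \<in> carrier C. x [^]\<^bsub>C\<^esub> (p ^ n) = x}\<rparr>)"

definition AS_point_count :: "nat \<Rightarrow> (nat \<Rightarrow> int) \<Rightarrow> nat \<Rightarrow> nat" where
  "AS_point_count p h n = card (curve_points (AS_function_field p h) (GF p n))"

section \<open>Newton polygons\<close>

definition ord_rat :: "nat \<Rightarrow> rat \<Rightarrow> int" where
  "ord_rat p r = int (multiplicity (int p) (fst (quotient_of r)))
               - int (multiplicity (int p) (snd (quotient_of r)))"

text \<open>The series \<open>P(T)\<close> of a curve over the field with \<open>q\<close> elements that has \<open>N n\<close> points over the
  extension of degree \<open>n\<close>.\<close>

definition zeta_numerator :: "nat \<Rightarrow> (nat \<Rightarrow> nat) \<Rightarrow> rat fps" where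
  "zeta_numerator q N = inverse (fps_exp 1 oo
     Abs_fps (\<lambda>n. if n = 0 then 0 else (of_nat q ^ n + 1 - of_nat (N n)) / of_nat n))"

text \<open>Coefficients equal to 0 have infinite order and so contribute no point.\<close>

definition newton_points :: "nat \<Rightarrow> nat \<Rightarrow> nat \<Rightarrow> rat fps \<Rightarrow> (real \<times> real) set" where
  "newton_points p \<nu> g P =
    insert (0, 0) {(real l, real_of_int (ord_rat p (fps_nth P l)) / real \<nu>) | l.
                     1 \<le> l \<and> l \<le> 2 * g \<and> fps_nth P l \<noteq> 0}"

definition lower_convex_hull :: "(real \<times> real) set \<Rightarrow> (real \<times> real) set" where
  "lower_convex_hull S =
    {(x, y). (x, y) \<in> convex hull S \<and> (\<forall>y'. (x, y') \<in> convex hull S \<longrightarrow> y \<le> y')}"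

definition slopes :: "(real \<times> real) set \<Rightarrow> real set" where
  "slopes C = {(v - u) / (b - a) | a u b v. a < b \<and> closed_segment (a, u) (b, v) \<subseteq> C}"

definition first_slope :: "(real \<times> real) set \<Rightarrow> real" where
  "first_slope C = (LEAST s. s \<in> slopes C)"

definition NP :: "nat \<Rightarrow> nat \<Rightarrow> nat \<Rightarrow> (nat \<Rightarrow> nat) \<Rightarrow> (real \<times> real) set" where
  "NP p \<nu> g N = lower_convex_hull (newton_points p \<nu> g (zeta_numerator (p ^ \<nu>) N))"

text \<open>The Artin-Schreier curve over \<open>\<bbbF>\<^sub>p\<close> given by \<open>f mod p\<close>, of genus \<open>(p - 1) (d - 1) / 2\<close>.\<close>

definition AS_NP1 :: "nat \<Rightarrow> rat Polynomial.poly \<Rightarrow> real" where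
  "AS_NP1 p f = first_slope
     (NP p 1 ((p - 1) * (Polynomial.degree f - 1) div 2) (AS_point_count p (poly_mod p f)))"

end

theory Submission
  imports Defs
begin

text \<open>The count of places of \<open>y ^ p - y = h(x)\<close> shows that \<open>P(T)\<close> is the product, over the nontrivial
  additive characters of \<open>\<bbbF>\<^sub>p\<close>, of the L-functions \<open>L(T) = \<Sum>n<d. A n * T ^ n\<close>, where \<open>A n\<close> is the
  character sum of \<open>\<Sum>h(\<alpha>)\<close> (\<open>\<alpha>\<close> running over the roots of \<open>g\<close>) over all monic \<open>g\<close> of degree \<open>n\<close>.
  Expand the character in powers of \<open>\<pi> = \<zeta>\<^sub>p - 1\<close>. A coefficient of order \<open>k\<close> is a sum over a finite
  vector space of a polynomial of small weight, and vanishes modulo \<open>p\<close> unless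
  \<open>2 * k * d \<ge> (p - 1) * n * (n + 1)\<close>; so \<open>\<pi> ^ k\<close> divides \<open>A n\<close> for some \<open>k \<ge> n * (p - 1) / d\<close>,
  and all slopes of \<open>P\<close> are at least \<open>1 / d\<close>. Conversely \<open>A 1\<close> has valuation exactly
  \<open>k = \<lceil>(p - 1) / d\<rceil>\<close> as soon as \<open>p\<close> does not divide the coefficient of \<open>x ^ (p - 1)\<close> in \<open>h ^ k\<close>, which
  gives a slope of at most \<open>k / (p - 1)\<close>. With \<open>k * d = p - 1 + r\<close> this coefficient is, up to a unit, the
  reduction of a polynomial in the coefficients of \<open>f\<close> that depends on \<open>d\<close> and \<open>r\<close> only. Here
  \<open>r \<noteq> 1\<close>, and for these \<open>r\<close> the polynomial does not vanish at \<open>x ^ d + x ^ (d - 1)\<close>. The set \<open>U\<close> is the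
  complement of the zeros of these finitely many polynomials.\<close>

hide_const (open) up_ring.coeff up_ring.monom Polynomials.degree Polynomials.lead_coeff Coset.order Divisibility.irreducible

section \<open>Evaluating polynomials along a homomorphism\<close>

text \<open>Orders at \<pi> are read off from membership in the ideals of \<int>[\<zeta>] generated
  by the powers of \<pi>. The coefficients in the expansion by powers of \<zeta> ^ a - 1 are
  integers that do not depend on the character a, but only their residues modulo p are controlled;
  so exact orders are visible below p - 1 only. This forces p > d ^ 2: the order at the deciding
  vertex, at most k * (d - 1), has to stay below p - 1. The vertex sits at the same n for all p - 1
  characters, so their product has an initial segment of the same slope, ending at (p - 1) * n \<le>
  2 * g.

  Points of the smooth model are valuation rings with a residue map. The count therefore needs one
  place for every affine solution and a single one at infinity. Both arise from a local ring shown
  to be a valuation ring already: at an affine point by the uniformizer x ^ (p ^ N) - x, at infinity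
  by weights, where coprimality of d and p makes leading terms unambiguous.

  From k * d = p - 1 + r follows k = (r - 1) / d modulo p; this is how p disappears from the
  deciding coefficient.\<close>

definition pev :: "('a::comm_ring_1 \<Rightarrow> 'b::comm_ring_1) \<Rightarrow> 'b \<Rightarrow> 'a poly \<Rightarrow> 'b" where
  "pev \<phi> y U = poly (map_poly \<phi> U) y"

locale ring_morphism =
  fixes \<phi> :: "'a::comm_ring_1 \<Rightarrow> 'b::comm_ring_1"
  assumes hom_add: "\<phi> (a + b) = \<phi> a + \<phi> b"
    and hom_mult: "\<phi> (a * b) = \<phi> a * \<phi> b"
    and hom_one: "\<phi> 1 = 1"
begin

lemma hom_zero: "\<phi> 0 = 0"
  using hom_add[of 0 0] by simp

lemma hom_uminus: "\<phi> (- a) = - \<phi> a"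
  using hom_add[of a "- a"] by (simp add: hom_zero eq_neg_iff_add_eq_0 add.commute)

lemma hom_diff: "\<phi> (a - b) = \<phi> a - \<phi> b"
  using hom_add[of a "- b"] by (simp add: hom_uminus)

lemma hom_power: "\<phi> (a ^ n) = \<phi> a ^ n"
  by (induction n) (simp_all add: hom_one hom_mult)

lemma hom_sum: "\<phi> (sum f A) = (\<Sum>x\<in>A. \<phi> (f x))"
  by (induction A rule: infinite_finite_induct) (simp_all add: hom_zero hom_add)

lemma hom_prod: "\<phi> (prod f A) = (\<Prod>x\<in>A. \<phi> (f x))"
  by (induction A rule: infinite_finite_induct) (simp_all add: hom_one hom_mult)

lemma hom_of_nat: "\<phi> (of_nat n) = of_nat n"
  by (induction n) (simp_all add: hom_zero hom_one hom_add)

lemma hom_of_int: "\<phi> (of_int n) = of_int n"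
  by (cases n) (simp_all add: hom_of_nat hom_uminus hom_diff hom_one)

lemma pev_0 [simp]: "pev \<phi> y 0 = 0"
  by (simp add: pev_def)

lemma pev_pCons [simp]: "pev \<phi> y (pCons a U) = \<phi> a + y * pev \<phi> y U"
  by (cases "a = 0 \<and> U = 0") (auto simp: pev_def map_poly_pCons hom_zero)

lemma pev_add: "pev \<phi> y (U + V) = pev \<phi> y U + pev \<phi> y V"
  by (induction U V rule: poly_induct2) (simp_all add: hom_add hom_zero algebra_simps)

lemma pev_smult: "pev \<phi> y (Polynomial.smult a U) = \<phi> a * pev \<phi> y U"
  by (induction U) (simp_all add: hom_mult hom_zero algebra_simps)

lemma pev_mult: "pev \<phi> y (U * V) = pev \<phi> y U * pev \<phi> y V"
  by (induction U) (simp_all add: pev_add pev_smult hom_zero algebra_simps)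

lemma pev_1: "pev \<phi> y 1 = 1"
  by (simp add: one_pCons hom_one)

lemma pev_monom: "pev \<phi> y (Polynomial.monom a n) = \<phi> a * y ^ n"
  by (induction n) (simp_all add: monom_0 monom_Suc hom_zero algebra_simps)

lemma pev_morphism: "ring_morphism (pev \<phi> y)"
  by standard (simp_all add: pev_add pev_mult pev_1)

lemma pev_altdef: "pev \<phi> y U = (\<Sum>i\<le>degree U. \<phi> (coeff U i) * y ^ i)"
proof -
  have "pev \<phi> y U = pev \<phi> y (\<Sum>i\<le>degree U. Polynomial.monom (coeff U i) i)"
    by (simp add: poly_as_sum_of_monoms)
  also have "\<dots> = (\<Sum>i\<le>degree U. \<phi> (coeff U i) * y ^ i)"
    by (simp add: ring_morphism.hom_sum[OF pev_morphism] pev_monom)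
  finally show ?thesis .
qed

end

lemma of_int_morphism: "ring_morphism (of_int :: int \<Rightarrow> 'a::comm_ring_1)"
  by standard simp_all

text \<open>Polynomials keep integer coefficients throughout; reduction modulo p happens only by
  evaluation in a ring with p = 0. The same polynomial can thus be evaluated at \<zeta>, at a
  generator of the function field and at a point of the curve.\<close>

definition ipe :: "'a::comm_ring_1 \<Rightarrow> int poly \<Rightarrow> 'a" where
  "ipe x = pev of_int x"

definition bev :: "'a::comm_ring_1 \<Rightarrow> 'a \<Rightarrow> int poly poly \<Rightarrow> 'a" where
  "bev x y = pev (ipe x) y"

lemma ipe_morphism: "ring_morphism (ipe x)"
  unfolding ipe_def by (rule ring_morphism.pev_morphism[OF of_int_morphism])

lemma bev_morphism: "ring_morphism (bev x y)"
  unfolding bev_def by (rule ring_morphism.pev_morphism[OF ipe_morphism])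

lemmas ipe_simps [simp] =
  ring_morphism.hom_add[OF ipe_morphism] ring_morphism.hom_mult[OF ipe_morphism]
  ring_morphism.hom_one[OF ipe_morphism] ring_morphism.hom_zero[OF ipe_morphism]
  ring_morphism.hom_uminus[OF ipe_morphism] ring_morphism.hom_diff[OF ipe_morphism]
  ring_morphism.hom_power[OF ipe_morphism] ring_morphism.hom_sum[OF ipe_morphism]
  ring_morphism.hom_prod[OF ipe_morphism]
  ring_morphism.hom_of_nat[OF ipe_morphism] ring_morphism.hom_of_int[OF ipe_morphism]

lemmas bev_simps [simp] =
  ring_morphism.hom_add[OF bev_morphism] ring_morphism.hom_mult[OF bev_morphism]
  ring_morphism.hom_one[OF bev_morphism] ring_morphism.hom_zero[OF bev_morphism]
  ring_morphism.hom_uminus[OF bev_morphism] ring_morphism.hom_diff[OF bev_morphism]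
  ring_morphism.hom_power[OF bev_morphism] ring_morphism.hom_sum[OF bev_morphism]
  ring_morphism.hom_prod[OF bev_morphism]
  ring_morphism.hom_of_nat[OF bev_morphism] ring_morphism.hom_of_int[OF bev_morphism]

lemma ipe_pCons [simp]: "ipe x (pCons a q) = of_int a + x * ipe x q"
  unfolding ipe_def by (rule ring_morphism.pev_pCons[OF of_int_morphism])

lemma ipe_monom [simp]: "ipe x (Polynomial.monom a n) = of_int a * x ^ n"
  unfolding ipe_def by (rule ring_morphism.pev_monom[OF of_int_morphism])

lemma ipe_altdef: "ipe x q = (\<Sum>i\<le>degree q. of_int (coeff q i) * x ^ i)"
  unfolding ipe_def by (rule ring_morphism.pev_altdef[OF of_int_morphism])

lemma bev_pCons [simp]: "bev x y (pCons a q) = ipe x a + y * bev x y q"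
  unfolding bev_def by (rule ring_morphism.pev_pCons[OF ipe_morphism])

lemma bev_monom [simp]: "bev x y (Polynomial.monom a n) = ipe x a * y ^ n"
  unfolding bev_def by (rule ring_morphism.pev_monom[OF ipe_morphism])

lemma bev_smult [simp]: "bev x y (Polynomial.smult a q) = ipe x a * bev x y q"
  unfolding bev_def by (rule ring_morphism.pev_smult[OF ipe_morphism])

lemma bev_altdef: "bev x y U = (\<Sum>i\<le>degree U. ipe x (coeff U i) * y ^ i)"
  unfolding bev_def by (rule ring_morphism.pev_altdef[OF ipe_morphism])

section \<open>The ring of integers of a cyclotomic field of prime conductor\<close>

definition ee :: "nat \<Rightarrow> int \<Rightarrow> complex" where
  "ee p a = cis (2 * pi * of_int a / of_nat p)"

lemma ee_0 [simp]: "ee p 0 = 1"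
  by (simp add: ee_def)

lemma ee_add: "ee p (a + b) = ee p a * ee p b"
  by (simp add: ee_def cis_mult add_divide_distrib ring_distribs)

lemma ee_power: "ee p a ^ n = ee p (a * int n)"
  by (simp add: ee_def Complex.DeMoivre mult_ac)

lemma ee_multiple: "p > 0 \<Longrightarrow> ee p (int p * k) = 1"
proof -
  assume "p > 0"
  then have "2 * pi * of_int (int p * k) / of_nat p = 2 * pi * of_int k" by simp
  then show ?thesis unfolding ee_def by (simp only:) (simp add: cis_multiple_2pi)
qed

lemma ee_mod: "p > 0 \<Longrightarrow> ee p (a mod int p) = ee p a"
proof -
  assume p: "p > 0"
  have "ee p a = ee p (int p * (a div int p) + a mod int p)" by simp
  also have "\<dots> = ee p (a mod int p)" using p by (simp only: ee_add ee_multiple) simp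
  finally show ?thesis by simp
qed

lemma ee_cong: "p > 0 \<Longrightarrow> a mod int p = b mod int p \<Longrightarrow> ee p a = ee p b"
  by (metis ee_mod)

lemma ee_nonzero [simp]: "ee p a \<noteq> 0"
  by (simp add: ee_def)

lemma ee_eq_1_iff: assumes "p > 0" shows "ee p a = 1 \<longleftrightarrow> int p dvd a"
proof
  assume "ee p a = 1"
  then have "cos (2 * pi * of_int a / of_nat p) = 1" unfolding ee_def by (metis cis.sel(1) one_complex.sel(1))
  then obtain x :: int where "2 * pi * of_int a / of_nat p = of_int x * 2 * pi"
    by (auto simp: cos_one_2pi_int)
  then have "real_of_int a = real_of_int (x * int p)" using assms by (simp add: field_simps)
  then have "a = x * int p" by (simp only: of_int_eq_iff)
  then show "int p dvd a" by simp
next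
  assume "int p dvd a"
  then show "ee p a = 1" using assms by (auto simp: ee_multiple elim!: dvdE)
qed

lemma sum_ee: assumes "p > 0"
  shows "(\<Sum>x<p. ee p (a * int x)) = (if int p dvd a then of_nat p else 0)"
proof (cases "int p dvd a")
  case True
  then have "ee p (a * int x) = 1" for x using assms by (simp add: ee_eq_1_iff)
  then show ?thesis using True by simp
next
  case False
  have "(\<Sum>x<p. ee p (a * int x)) = (\<Sum>x<p. ee p a ^ x)" by (simp add: ee_power)
  also have "\<dots> = (ee p a ^ p - 1) / (ee p a - 1)"
    by (rule geometric_sum) (use False assms in \<open>simp add: ee_eq_1_iff\<close>)
  also have "ee p a ^ p = 1" using assms by (simp add: ee_power ee_eq_1_iff)
  finally show ?thesis using False by simp
qed

definition zz :: "nat \<Rightarrow> complex set" where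
  "zz p = range (ipe (ee p 1))"

lemma zz_ipe [intro, simp]: "ipe (ee p 1) q \<in> zz p"
  by (simp add: zz_def)

lemma zzE: assumes "z \<in> zz p" obtains q where "z = ipe (ee p 1) q"
  using assms by (auto simp: zz_def)

lemma zz_add [intro]: "x \<in> zz p \<Longrightarrow> y \<in> zz p \<Longrightarrow> x + y \<in> zz p"
  by (metis zzE zz_ipe ipe_simps(1))

lemma zz_mult [intro]: "x \<in> zz p \<Longrightarrow> y \<in> zz p \<Longrightarrow> x * y \<in> zz p"
  by (metis zzE zz_ipe ipe_simps(2))

lemma zz_uminus [intro]: "x \<in> zz p \<Longrightarrow> - x \<in> zz p"
  by (metis zzE zz_ipe ipe_simps(5))

lemma zz_diff [intro]: "x \<in> zz p \<Longrightarrow> y \<in> zz p \<Longrightarrow> x - y \<in> zz p"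
  by (metis zzE zz_ipe ipe_simps(6))

lemma zz_of_int [intro, simp]: "of_int a \<in> zz p"
  using zz_ipe[of p "[:a:]"] by simp

lemma zz_of_nat [intro, simp]: "of_nat a \<in> zz p"
  using zz_of_int[of "int a"] by simp

lemma zz_0 [intro, simp]: "0 \<in> zz p" and zz_1 [intro, simp]: "1 \<in> zz p"
  using zz_of_int[of 0] zz_of_int[of 1] by simp_all

lemma zz_power [intro]: "x \<in> zz p \<Longrightarrow> x ^ n \<in> zz p"
  by (induction n) auto

lemma zz_sum [intro]: "(\<And>x. x \<in> A \<Longrightarrow> f x \<in> zz p) \<Longrightarrow> sum f A \<in> zz p"
  by (induction A rule: infinite_finite_induct) auto

lemma zz_ee [intro, simp]: assumes "p > 0" shows "ee p a \<in> zz p"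
proof -
  have "ee p a = ee p (a mod int p)" using assms by (simp add: ee_mod)
  also have "\<dots> = ee p 1 ^ nat (a mod int p)" using assms by (simp add: ee_power)
  also have "\<dots> = ipe (ee p 1) (Polynomial.monom 1 (nat (a mod int p)))" by simp
  finally show ?thesis by (metis zz_ipe)
qed

lemma zz_expansion:
  assumes "z \<in> zz p" "p > 0"
  shows "\<exists>c::nat \<Rightarrow> int. z = (\<Sum>j<p. of_int (c j) * ee p 1 ^ j)"
proof -
  have "\<exists>c::nat \<Rightarrow> int. ipe (ee p 1) q = (\<Sum>j<p. of_int (c j) * ee p 1 ^ j)" for q
  proof (induction q)
    case 0
    show ?case by (rule exI[of _ "\<lambda>_. 0"]) simp
  next
    case (pCons a q)
    then obtain c :: "nat \<Rightarrow> int" where c: "ipe (ee p 1) q = (\<Sum>j<p. of_int (c j) * ee p 1 ^ j)" by blast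
    obtain m where m: "p = Suc m" using assms(2) by (cases p) auto
    \<comment> \<open>Multiplication by \<zeta> shifts the coefficients cyclically, as \<zeta> ^ p =
      1: the top coefficient \<open>c m\<close> returns to position 0, where a is added.\<close>
    define c' where "c' = (\<lambda>j. if j = 0 then a + c m else c (j - 1))"
    have "ee p 1 ^ p = 1" using assms(2) by (simp add: ee_power ee_eq_1_iff)
    then have e: "ee p 1 * ee p 1 ^ m = 1" by (simp add: m)
    have "(\<Sum>j<p. of_int (c' j) * ee p 1 ^ j) = of_int (a + c m) + (\<Sum>j<m. of_int (c j) * ee p 1 ^ Suc j)"
      unfolding m by (subst sum.lessThan_Suc_shift) (simp add: c'_def)
    also have "\<dots> = of_int a + ee p 1 * (\<Sum>j<p. of_int (c j) * ee p 1 ^ j)"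
      unfolding m sum.lessThan_Suc
      using e by (simp add: m sum_distrib_left algebra_simps)
    finally show ?case by (intro exI[of _ c']) (simp add: c)
  qed
  with assms(1) show ?thesis by (metis zzE)
qed

text \<open>Nakayama's lemma for a finitely generated submodule of \<open>\<complex>\<close>, localised at \<open>p\<close>: one generator
  after the other is eliminated, the factors \<open>s\<close> playing the role of the denominators.\<close>

lemma nakayama:
  fixes w :: "nat \<Rightarrow> complex"
  assumes p: "prime p"
    and "\<And>i. i < m \<Longrightarrow> \<exists>s c. \<not> int p dvd s \<and> of_int s * w i = of_nat p * (\<Sum>j<m. of_int (c j) * w j)"
    and "i < m"
  shows "w i = 0"
  using assms(2,3)
proof (induction m arbitrary: i)
  case 0
  then show ?case by simp
next
  case (Suc m)
  have pp: "prime (int p)" using p by simp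
  obtain s c where s: "\<not> int p dvd s"
    and e: "of_int s * w m = of_nat p * (\<Sum>j<Suc m. of_int (c j) * w j)"
    using Suc.prems(1)[of m] by auto
  \<comment> \<open>Moving the m-th term to the left changes s by a multiple of p only;
    \<open>w m\<close> is then expressed by the earlier generators.\<close>
  define s' where "s' = s - int p * c m"
  have "int p dvd s" if "int p dvd s'"
    using dvd_add[OF that dvd_triv_left[of "int p" "c m"]] by (simp add: s'_def)
  then have s': "\<not> int p dvd s'" using s by blast
  have e': "of_int s' * w m = of_nat p * (\<Sum>j<m. of_int (c j) * w j)"
    using e by (simp add: s'_def algebra_simps)
  have IH: "w j = 0" if "j < m" for j
  proof (rule Suc.IH[OF _ that])
    fix i assume "i < m"
    then obtain t b where t: "\<not> int p dvd t"
      and f: "of_int t * w i = of_nat p * (\<Sum>j<Suc m. of_int (b j) * w j)"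
      using Suc.prems(1)[of i] by auto
    have "of_int (s' * t) * w i = of_nat p * (of_int s' * (\<Sum>j<m. of_int (b j) * w j) + of_int (b m) * (of_int s' * w m))"
      using arg_cong[OF f, of "\<lambda>x. of_int s' * x"] by (simp add: algebra_simps)
    also have "\<dots> = of_nat p * (\<Sum>j<m. of_int (s' * b j + b m * int p * c j) * w j)"
      unfolding e' by (simp add: sum_distrib_left sum.distrib algebra_simps)
    finally show "\<exists>s c. \<not> int p dvd s \<and> of_int s * w i = of_nat p * (\<Sum>j<m. of_int (c j) * w j)"
      using s' t pp by (intro exI[of _ "s' * t"] exI[of _ "\<lambda>j. s' * b j + b m * int p * c j"])
        (simp add: prime_dvd_mult_iff)
  qed
  then have "of_int s' * w m = 0" using e' by simp
  moreover have "s' \<noteq> 0" using s' by auto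
  ultimately have "w m = 0" by simp
  with IH Suc.prems(2) show ?case by (cases "i = m") auto
qed

text \<open>If p had an inverse r, each power of \<zeta> would be p times an element of
  \<int>[\<zeta>], so this module would equal p times itself; \<open>nakayama\<close> then makes the
  generator \<zeta> ^ 0 = 1 vanish.\<close>

lemma one_not_p_multiple:
  assumes p: "prime p" and r: "r \<in> zz p"
  shows "of_nat p * r \<noteq> 1"
proof
  assume 1: "of_nat p * r = 1"
  have p0: "p > 0" using p prime_gt_0_nat by blast
  have "ee p 1 ^ 0 = 0"
  proof (rule nakayama[OF p, where w = "\<lambda>i. ee p 1 ^ i" and m = p])
    fix i assume "i < p"
    have "ee p 1 ^ i * r \<in> zz p" using r p0 by auto
    then obtain c :: "nat \<Rightarrow> int" where c: "ee p 1 ^ i * r = (\<Sum>j<p. of_int (c j) * ee p 1 ^ j)"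
      using zz_expansion p0 by blast
    have "ee p 1 ^ i = of_nat p * (ee p 1 ^ i * r)" using 1 by (simp add: mult_ac)
    then show "\<exists>s c. \<not> int p dvd s \<and> of_int s * ee p 1 ^ i = of_nat p * (\<Sum>j<p. of_int (c j) * ee p 1 ^ j)"
      using c p by (intro exI[of _ 1] exI[of _ c]) auto
  qed (use p0 in auto)
  then show False by simp
qed

lemma frobenius_zz:
  assumes "prime p" "x \<in> zz p" "y \<in> zz p"
  shows "\<exists>r\<in>zz p. (x + y) ^ p = x ^ p + y ^ p + of_nat p * r"
proof -
  have p0: "p > 0" using assms prime_gt_0_nat by blast
  define c where "c = (\<lambda>k. (p choose k) div p)"
  have c: "p choose k = p * c k" if "k \<in> {1..<p}" for k
    using that assms(1) by (simp add: c_def dvd_choose_prime)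
  define r where "r = (\<Sum>k\<in>{1..<p}. of_nat (c k) * x ^ k * y ^ (p - k))"
  have "(x + y) ^ p = (\<Sum>k\<le>p. of_nat (p choose k) * x ^ k * y ^ (p - k))" by (rule binomial_ring)
  also have "{..p} = insert 0 (insert p {1..<p})" using p0 by auto
  also have "(\<Sum>k\<in>\<dots>. of_nat (p choose k) * x ^ k * y ^ (p - k)) =
      y ^ p + (x ^ p + (\<Sum>k\<in>{1..<p}. of_nat (p choose k) * x ^ k * y ^ (p - k)))"
    using p0 by simp
  also have "(\<Sum>k\<in>{1..<p}. of_nat (p choose k) * x ^ k * y ^ (p - k)) = of_nat p * r"
    by (simp add: r_def sum_distrib_left c mult_ac)
  finally show ?thesis using assms by (intro bexI[of _ r]) (auto simp: r_def)
qed

lemma fermat_int: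
  assumes p: "prime p"
  shows "[a ^ p = a] (mod int p)"
proof (cases "int p dvd a")
  case True
  moreover have "a dvd a ^ p" using prime_gt_0_nat[OF p] by (simp add: dvd_power)
  ultimately show ?thesis by (meson cong_0_iff cong_sym cong_trans dvd_trans)
next
  case False
  define b where "b = nat (a mod int p)"
  have ab: "[int b = a] (mod int p)" using prime_gt_0_nat[OF p] by (simp add: b_def)
  then have "\<not> int p dvd int b" using False cong_dvd_iff[OF ab] by blast
  then have "\<not> p dvd b" by simp
  then have "[b ^ (p - 1) = 1] (mod p)" using p by (intro fermat_theorem)
  then have "[int b ^ (p - 1) = 1] (mod int p)" by (metis cong_int_iff of_nat_1 of_nat_power)
  then have "[int b ^ (p - 1) * int b = 1 * int b] (mod int p)" by (intro cong_mult cong_refl)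
  then have "[int b ^ p = int b] (mod int p)" using prime_gt_0_nat[OF p] by (simp add: power_eq_if mult.commute)
  then show ?thesis using ab by (meson cong_pow cong_sym cong_trans)
qed

text \<open>Modulo p the p-th power map is additive, fixes the integers and sends \<zeta> to 1, so
  it turns g(\<zeta>) into g(1).\<close>

lemma ipe_power_p:
  assumes p: "prime p"
  shows "\<exists>r\<in>zz p. ipe (ee p 1) g ^ p = of_int (poly g 1) + of_nat p * r"
proof (induction g)
  case 0
  show ?case using p prime_gt_0_nat[OF p] by (intro bexI[of _ 0]) auto
next
  case (pCons a q)
  have p0: "p > 0" using p prime_gt_0_nat by blast
  obtain r where r: "r \<in> zz p" "ipe (ee p 1) q ^ p = of_int (poly q 1) + of_nat p * r" using pCons by blast
  obtain s where s: "s \<in> zz p" "(of_int a + ee p 1 * ipe (ee p 1) q) ^ p =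
     of_int a ^ p + (ee p 1 * ipe (ee p 1) q) ^ p + of_nat p * s"
    using frobenius_zz[OF p, of "of_int a" "ee p 1 * ipe (ee p 1) q"] p0 by auto
  have "[a ^ p = a] (mod int p)" by (rule fermat_int[OF p])
  then obtain t where t: "a ^ p = a + int p * t" using cong_iff_lin cong_sym by blast
  have "ee p 1 ^ p = 1" using p0 by (simp add: ee_power ee_eq_1_iff)
  then have "ipe (ee p 1) (pCons a q) ^ p = of_int (poly (pCons a q) 1) + of_nat p * (r + s + of_int t)"
    using s(2) r(2) arg_cong[OF t, of "of_int :: int \<Rightarrow> complex"] by (simp add: power_mult_distrib algebra_simps)
  then show ?case using r(1) s(1) by auto
qed

text \<open>This makes g(\<zeta>) \<mapsto> g(1) mod p a well-defined map onto F_p. If g(\<zeta>) =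
  0 then p divides g(1) within \<int>[\<zeta>]; were g(1) prime to p, a Bezout relation would make p
  a unit there.\<close>

lemma ipe_eq_0_imp_dvd:
  assumes p: "prime p" and g: "ipe (ee p 1) g = 0"
  shows "int p dvd poly g 1"
proof (rule ccontr)
  assume "\<not> int p dvd poly g 1"
  then have "coprime (poly g 1) (int p)" using p by (simp add: prime_imp_coprime coprime_commute)
  then obtain u where u: "[poly g 1 * u = 1] (mod int p)" using cong_solve_coprime_int by blast
  then obtain v where v: "1 = poly g 1 * u + int p * v" using cong_iff_lin by blast
  obtain r where r: "r \<in> zz p" "0 = of_int (poly g 1) + of_nat p * r"
    using ipe_power_p[OF p, of g] g prime_gt_0_nat[OF p] by (auto simp: power_0_left)
  have "of_int (poly g 1) = - of_nat p * r" using r(2) by (simp add: eq_neg_iff_add_eq_0)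
  then have "1 = - of_nat p * r * of_int u + of_nat p * of_int v"
    using arg_cong[OF v, of "of_int :: int \<Rightarrow> complex"] by simp
  then have "of_nat p * (of_int v - r * of_int u) = (1::complex)" by (simp add: algebra_simps)
  moreover have "of_int v - r * of_int u \<in> zz p" using r(1) by auto
  ultimately show False using one_not_p_multiple[OF p] by blast
qed

section \<open>The powers of the prime ideal generated by \<pi> = \<zeta> - 1\<close>

definition pip :: "nat \<Rightarrow> nat \<Rightarrow> complex set" where
  "pip p k = {(ee p 1 - 1) ^ k * r | r. r \<in> zz p}"

lemma pip_0 [simp]: "pip p 0 = zz p"
  by (auto simp: pip_def)

lemma zero_in_pip [simp]: "0 \<in> pip p k"
  unfolding pip_def by (auto intro: exI[of _ 0])

lemma pip_add: "x \<in> pip p k \<Longrightarrow> y \<in> pip p k \<Longrightarrow> x + y \<in> pip p k"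
  unfolding pip_def by (auto simp flip: distrib_left)

lemma pip_mult: "x \<in> pip p k \<Longrightarrow> y \<in> pip p l \<Longrightarrow> x * y \<in> pip p (k + l)"
proof -
  assume "x \<in> pip p k" "y \<in> pip p l"
  then obtain r s where "r \<in> zz p" "s \<in> zz p" "x = (ee p 1 - 1) ^ k * r" "y = (ee p 1 - 1) ^ l * s"
    by (auto simp: pip_def)
  then show ?thesis unfolding pip_def by (intro CollectI exI[of _ "r * s"]) (auto simp: power_add)
qed

lemma pip_mult_zz: "x \<in> pip p k \<Longrightarrow> y \<in> zz p \<Longrightarrow> x * y \<in> pip p k"
  using pip_mult[of x p k y 0] by simp

lemma pip_uminus: "x \<in> pip p k \<Longrightarrow> - x \<in> pip p k"
  using pip_mult_zz[of x p k "- 1"] by auto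

lemma pip_diff: "x \<in> pip p k \<Longrightarrow> y \<in> pip p k \<Longrightarrow> x - y \<in> pip p k"
  using pip_add[of x p k "- y"] pip_uminus by auto

lemma pip_sum: "(\<And>x. x \<in> A \<Longrightarrow> f x \<in> pip p k) \<Longrightarrow> sum f A \<in> pip p k"
  by (induction A rule: infinite_finite_induct) (auto intro: pip_add)

lemma pip_mono: assumes "l \<le> k" "p > 0" "x \<in> pip p k" shows "x \<in> pip p l"
proof -
  obtain r where r: "r \<in> zz p" "x = (ee p 1 - 1) ^ k * r" using assms(3) by (auto simp: pip_def)
  have "x = (ee p 1 - 1) ^ l * ((ee p 1 - 1) ^ (k - l) * r)"
    using assms(1) by (simp add: r flip: mult.assoc power_add)
  moreover have "(ee p 1 - 1) ^ (k - l) * r \<in> zz p" using r assms by auto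
  ultimately show ?thesis by (auto simp: pip_def)
qed

lemma ee_1_neq_1: "prime p \<Longrightarrow> ee p 1 \<noteq> 1"
  using prime_gt_1_nat[of p] by (auto simp: ee_eq_1_iff)

lemma pi_in_pip: "(ee p 1 - 1) ^ k \<in> pip p k"
  unfolding pip_def by (auto intro: exI[of _ 1])

lemma pip_Suc_iff: assumes "prime p" shows "(ee p 1 - 1) ^ k * z \<in> pip p (k + l) \<longleftrightarrow> z \<in> pip p l"
proof
  assume "(ee p 1 - 1) ^ k * z \<in> pip p (k + l)"
  then obtain r where "r \<in> zz p" "(ee p 1 - 1) ^ k * z = (ee p 1 - 1) ^ (k + l) * r" by (auto simp: pip_def)
  then show "z \<in> pip p l" using ee_1_neq_1[OF assms] by (auto simp: pip_def power_add mult.assoc)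
next
  assume "z \<in> pip p l"
  then show "(ee p 1 - 1) ^ k * z \<in> pip p (k + l)" by (intro pip_mult pi_in_pip)
qed

text \<open>Expand 1 = (1 + \<pi>) ^ p and divide by \<pi>: the inner binomial coefficients are
  multiples of p, and s collects those with index at least 2.\<close>

lemma p_pi_relation:
  assumes p: "prime p"
  shows "\<exists>s\<in>zz p. of_nat p * (1 + (ee p 1 - 1) * s) = - ((ee p 1 - 1) ^ (p - 1))"
proof -
  have p0: "p > 0" using p prime_gt_0_nat by blast
  define \<pi> where "\<pi> = ee p 1 - 1"
  have pz: "\<pi> \<noteq> 0" using ee_1_neq_1[OF p] by (simp add: \<pi>_def)
  have \<pi>zz: "\<pi> \<in> zz p" using p0 by (auto simp: \<pi>_def)
  define c where "c = (\<lambda>k. (p choose k) div p)"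
  have c: "p choose k = p * c k" if "k \<in> {1..<p}" for k
    using that p by (simp add: c_def dvd_choose_prime)
  have p2: "p \<ge> 2" using p prime_ge_2_nat by blast
  have c1: "c 1 = 1" using p0 by (simp add: c_def)
  define s where "s = (\<Sum>k\<in>{2..<p}. of_nat (c k) * \<pi> ^ (k - 2))"
  have szz: "s \<in> zz p" unfolding s_def using \<pi>zz by auto
  have "1 = (\<pi> + 1) ^ p" using p0 by (simp add: \<pi>_def ee_power ee_eq_1_iff)
  also have "\<dots> = (\<Sum>k\<le>p. of_nat (p choose k) * \<pi> ^ k)" by (simp add: binomial_ring)
  also have "{..p} = insert 0 (insert 1 (insert p {2..<p}))" using p2 by auto
  also have "(\<Sum>k\<in>\<dots>. of_nat (p choose k) * \<pi> ^ k) =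
      1 + (of_nat p * \<pi> + (\<pi> ^ p + (\<Sum>k\<in>{2..<p}. of_nat (p choose k) * \<pi> ^ k)))"
    using p2 by simp
  also have "(\<Sum>k\<in>{2..<p}. of_nat (p choose k) * \<pi> ^ k) = \<pi> * (of_nat p * \<pi> * s)"
    unfolding s_def sum_distrib_left
  proof (rule sum.cong)
    fix k assume k: "k \<in> {2..<p}"
    then have "\<pi> ^ k = \<pi> * \<pi> * \<pi> ^ (k - 2)" by (simp flip: power_Suc add: Suc_diff_Suc numeral_2_eq_2 mult.assoc)
    then show "of_nat (p choose k) * \<pi> ^ k = \<pi> * (of_nat p * \<pi> * (of_nat (c k) * \<pi> ^ (k - 2)))"
      using k by (simp add: c)
  qed simp
  also have "\<pi> ^ p = \<pi> * \<pi> ^ (p - 1)" using p0 by (simp flip: power_Suc)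
  finally have "\<pi> * (of_nat p + \<pi> ^ (p - 1) + of_nat p * \<pi> * s) = 0" by (simp add: algebra_simps)
  then have "of_nat p + \<pi> ^ (p - 1) + of_nat p * \<pi> * s = 0" using pz by simp
  then have e: "of_nat p * (1 + \<pi> * s) = - (\<pi> ^ (p - 1))" by (simp add: algebra_simps eq_neg_iff_add_eq_0)
  with szz show ?thesis unfolding \<pi>_def by blast
qed

lemma p_in_pip: assumes p: "prime p" shows "of_nat p \<in> pip p (p - 1)"
proof -
  have p0: "p > 0" using p prime_gt_0_nat by blast
  define \<pi> where "\<pi> = ee p 1 - 1"
  have \<pi>zz: "\<pi> \<in> zz p" using p0 by (auto simp: \<pi>_def)
  obtain s where szz: "s \<in> zz p" and e: "of_nat p * (1 + \<pi> * s) = - (\<pi> ^ (p - 1))"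
    using p_pi_relation[OF p] unfolding \<pi>_def by blast
  \<comment> \<open>A truncated geometric series inverts 1 + \<pi> s up to (\<pi> s) ^ (p - 1), and
    this error already lies in the ideal of \<pi> ^ (p - 1).\<close>
  define q where "q = (\<Sum>i<p - 1. (- (\<pi> * s)) ^ i)"
  have qzz: "q \<in> zz p" unfolding q_def using \<pi>zz szz by auto
  have "(1 - (- (\<pi> * s))) * q = 1 - (- (\<pi> * s)) ^ (p - 1)"
    unfolding q_def by (rule one_diff_power_eq[symmetric])
  then have "of_nat p * (1 - (- (\<pi> * s)) ^ (p - 1)) = of_nat p * (1 + \<pi> * s) * q" by (simp add: mult.assoc)
  then have "of_nat p = \<pi> ^ (p - 1) * (of_nat p * (- s) ^ (p - 1) - q)"
    by (simp only: e minus_mult_right power_mult_distrib) (simp add: algebra_simps)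
  moreover have "of_nat p * (- s) ^ (p - 1) - q \<in> zz p" using szz qzz by auto
  ultimately show ?thesis unfolding pip_def \<pi>_def by blast
qed

lemma ipe_diff_value_pip: assumes "p > 0"
  shows "ipe (ee p 1) g - of_int (poly g 1) \<in> pip p 1"
proof (induction g)
  case (pCons a q)
  have "ipe (ee p 1) (pCons a q) - of_int (poly (pCons a q) 1) =
      (ee p 1 - 1) * ipe (ee p 1) q + (ipe (ee p 1) q - of_int (poly q 1))"
    by (simp add: algebra_simps)
  moreover have "(ee p 1 - 1) * ipe (ee p 1) q \<in> pip p 1" by (auto simp: pip_def)
  ultimately show ?case using pCons pip_add by metis
qed simp

text \<open>The ideal of \<pi> is the kernel of g(\<zeta>) \<mapsto> g(1) mod p, hence prime with
  residue field F_p. A relation g(\<zeta>) = (\<zeta> - 1) q(\<zeta>) says that g - (X - 1) q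
  vanishes at \<zeta>, and this polynomial has the same value as g at 1.\<close>

lemma ipe_in_pip_1_iff:
  assumes p: "prime p" shows "ipe (ee p 1) g \<in> pip p 1 \<longleftrightarrow> int p dvd poly g 1"
proof
  assume "ipe (ee p 1) g \<in> pip p 1"
  then obtain q where "ipe (ee p 1) g = (ee p 1 - 1) * ipe (ee p 1) q"
    by (auto simp: pip_def elim: zzE)
  then have "ipe (ee p 1) (g - [:-1, 1:] * q) = 0" by (simp add: algebra_simps)
  from ipe_eq_0_imp_dvd[OF p this] show "int p dvd poly g 1" by simp
next
  assume d: "int p dvd poly g 1"
  have p0: "p > 0" using p prime_gt_0_nat by blast
  have "of_int (poly g 1) \<in> pip p (p - 1)"
    using d p_in_pip[OF p] by (auto elim!: dvdE intro!: pip_mult_zz)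
  then have "of_int (poly g 1) \<in> pip p 1" using p0 prime_ge_2_nat[OF p] pip_mono[of 1 "p - 1"] by auto
  from pip_add[OF ipe_diff_value_pip[OF p0, of g] this] show "ipe (ee p 1) g \<in> pip p 1" by simp
qed

lemma pip_1_prime:
  assumes "prime p" "x \<in> zz p" "y \<in> zz p" "x * y \<in> pip p 1"
  shows "x \<in> pip p 1 \<or> y \<in> pip p 1"
proof -
  obtain f g where fg: "x = ipe (ee p 1) f" "y = ipe (ee p 1) g" using assms by (metis zzE)
  then have "ipe (ee p 1) (f * g) \<in> pip p 1" using assms by simp
  then have "int p dvd poly f 1 * poly g 1" using assms(1) by (subst (asm) ipe_in_pip_1_iff) auto
  then show ?thesis using assms(1) by (simp add: fg ipe_in_pip_1_iff prime_dvd_mult_iff del: One_nat_def)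
qed

text \<open>The exact \<pi>-adic order. Zero lies in every \<open>pip p k\<close> and so has no
  exact order.\<close>

definition vex :: "nat \<Rightarrow> nat \<Rightarrow> complex \<Rightarrow> bool" where
  "vex p k z \<longleftrightarrow> z \<in> pip p k \<and> z \<notin> pip p (Suc k)"

lemma vexE:
  assumes "prime p" "vex p k z" obtains r where "r \<in> zz p" "r \<notin> pip p 1" "z = (ee p 1 - 1) ^ k * r"
proof -
  obtain r where r: "r \<in> zz p" "z = (ee p 1 - 1) ^ k * r" using assms by (auto simp: vex_def pip_def)
  with assms pip_Suc_iff[of p k r 1] have "r \<notin> pip p 1" by (auto simp: vex_def)
  with r that show ?thesis by blast
qed

lemma vex_mult: assumes p: "prime p" and "vex p k x" "vex p l y" shows "vex p (k + l) (x * y)"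
proof -
  obtain r where r: "r \<in> zz p" "r \<notin> pip p 1" "x = (ee p 1 - 1) ^ k * r" using assms vexE by blast
  obtain s where s: "s \<in> zz p" "s \<notin> pip p 1" "y = (ee p 1 - 1) ^ l * s" using assms vexE by blast
  have "r * s \<notin> pip p 1" using pip_1_prime r s p by blast
  moreover have "x * y = (ee p 1 - 1) ^ (k + l) * (r * s)" by (simp add: r s power_add)
  moreover have "r * s \<in> zz p" using r s by auto
  ultimately show ?thesis using pip_Suc_iff[OF p, of "k + l" "r * s" 1]
    unfolding vex_def by (auto simp: pip_def)
qed

lemma vex_power: "prime p \<Longrightarrow> vex p k x \<Longrightarrow> vex p (n * k) (x ^ n)"
proof (induction n)
  case 0
  have "ipe (ee p 1) 1 \<notin> pip p 1" using 0 by (subst ipe_in_pip_1_iff) auto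
  then show ?case by (simp add: vex_def)
next
  case (Suc n)
  then show ?case using vex_mult[of p k x "n * k" "x ^ n"] by simp
qed

lemma vex_add: "vex p k x \<Longrightarrow> y \<in> pip p (Suc k) \<Longrightarrow> p > 0 \<Longrightarrow> vex p k (x + y)"
  unfolding vex_def using pip_mono[of k "Suc k" p y] pip_add[of x p k y] pip_diff[of "x + y" p "Suc k" y]
  by auto

lemma vex_pip_le: "vex p k z \<Longrightarrow> z \<in> pip p l \<Longrightarrow> p > 0 \<Longrightarrow> l \<le> k"
  unfolding vex_def using pip_mono[of "Suc k" l p z] not_less_eq_eq by blast

lemma vex_unique: "vex p k z \<Longrightarrow> vex p l z \<Longrightarrow> p > 0 \<Longrightarrow> k = l"
  using vex_pip_le[of p k z l] vex_pip_le[of p l z k] by (auto simp: vex_def)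

lemma vex_0_ipe: "prime p \<Longrightarrow> vex p 0 (ipe (ee p 1) g) \<longleftrightarrow> \<not> int p dvd poly g 1"
  using ipe_in_pip_1_iff[of p g] by (simp add: vex_def)

lemma vex_0_of_int: "prime p \<Longrightarrow> \<not> int p dvd a \<Longrightarrow> vex p 0 (of_int a)"
  using vex_0_ipe[of p "[:a:]"] by simp

text \<open>By the relation p (1 + \<pi> s) = - \<pi> ^ (p - 1), an order of p or more would put 1
  into the ideal of \<pi>.\<close>

lemma vex_p: assumes p: "prime p" shows "vex p (p - 1) (of_nat p)"
proof -
  have p0: "p > 0" using p prime_gt_0_nat by blast
  have "of_nat p \<notin> pip p (p - 1 + 1)"
  proof
    assume P: "of_nat p \<in> pip p (p - 1 + 1)"
    obtain s where s: "s \<in> zz p" and e: "of_nat p * (1 + (ee p 1 - 1) * s) = - ((ee p 1 - 1) ^ (p - 1))"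
      using p_pi_relation[OF p] by blast
    have "1 + (ee p 1 - 1) * s \<in> zz p" using s p0 by auto
    from pip_uminus[OF pip_mult_zz[OF P this]] have "(ee p 1 - 1) ^ (p - 1) * 1 \<in> pip p (p - 1 + 1)"
      by (simp add: e)
    then have "1 \<in> pip p 1" by (simp only: pip_Suc_iff[OF p])
    then show False using vex_0_of_int[OF p, of 1] prime_gt_1_nat[OF p] by (auto simp: vex_def)
  qed
  then show ?thesis using p_in_pip[OF p] p0 by (simp add: vex_def)
qed

text \<open>The cofactor of \<pi> is 1 + \<zeta> + ... + \<zeta> ^ (a - 1), which is a modulo \<pi>.
  So \<zeta> ^ a - 1 is as good a uniformizer as \<pi>, and all nontrivial characters behave
  alike.\<close>

lemma ee_minus_1: assumes p: "prime p" and a: "0 < a" "a < p"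
  shows "vex p 1 (ee p (int a) - 1)"
proof -
  have p0: "p > 0" using p prime_gt_0_nat by blast
  define g where "g = (\<Sum>i<a. Polynomial.monom (1::int) i)"
  have "ee p (int a) = ee p 1 ^ a" by (simp add: ee_power)
  also have "\<dots> - 1 = (ee p 1 - 1) * (\<Sum>i<a. ee p 1 ^ i)" by (rule power_diff_1_eq)
  also have "(\<Sum>i<a. ee p 1 ^ i) = ipe (ee p 1) g" by (simp add: g_def)
  finally have e: "ee p (int a) - 1 = (ee p 1 - 1) ^ 1 * ipe (ee p 1) g" by simp
  have "poly g 1 = int a" by (simp add: g_def poly_sum poly_monom)
  then have "vex p 0 (ipe (ee p 1) g)" using a p by (subst vex_0_ipe) (auto dest: zdvd_imp_le)
  then show ?thesis unfolding e vex_def using pip_Suc_iff[OF p, of 1 "ipe (ee p 1) g" 0]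
     pip_Suc_iff[OF p, of 1 "ipe (ee p 1) g" 1] by auto
qed

lemma vex_of_int: assumes p: "prime p" and "a \<noteq> 0"
  shows "vex p ((p - 1) * multiplicity (int p) a) (of_int a)"
proof -
  have nu: "\<not> is_unit (int p)" using p prime_gt_1_nat by fastforce
  obtain b where b: "a = int p ^ multiplicity (int p) a * b" "\<not> int p dvd b"
    using multiplicity_decompose'[OF assms(2) nu] by metis
  have "vex p (multiplicity (int p) a * (p - 1) + 0) (of_nat p ^ multiplicity (int p) a * of_int b)"
    by (intro vex_mult[OF p] vex_power[OF p] vex_p[OF p] vex_0_of_int[OF p] b)
  also have "of_nat p ^ multiplicity (int p) a * of_int b = (of_int a :: complex)"
    using arg_cong[OF b(1), of "of_int :: int \<Rightarrow> complex"] by simp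
  finally show ?thesis by (simp add: mult.commute)
qed

text \<open>The ramification index p - 1 converts orders at \<pi> into \<open>ord_rat\<close>.
  Multiplying by the denominator reduces both statements to integers, whose exact order is
  known.\<close>

lemma vex_of_rat:
  assumes p: "prime p" and r: "r \<noteq> 0"
  shows "of_rat r \<in> pip p k \<Longrightarrow> int k \<le> int (p - 1) * ord_rat p r"
    and "vex p k (of_rat r) \<Longrightarrow> int k = int (p - 1) * ord_rat p r"
proof -
  have p0: "p > 0" using p prime_gt_0_nat by blast
  obtain a b where ab: "quotient_of r = (a, b)" by force
  then have b: "b > 0" and rab: "r = of_int a / of_int b"
    using quotient_of_denom_pos quotient_of_div by blast+
  with r have a: "a \<noteq> 0" by auto
  define m n where "m = multiplicity (int p) a" and "n = multiplicity (int p) b"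
  have ord: "ord_rat p r = int m - int n" by (simp add: ord_rat_def ab m_def n_def)
  have eq: "of_rat r * of_int b = (of_int a :: complex)" using b by (simp add: rab of_rat_divide)
  have va: "vex p ((p - 1) * m) (of_int a)" and vb: "vex p ((p - 1) * n) (of_int b)"
    using vex_of_int[OF p] a b by (auto simp: m_def n_def)
  {
    assume "of_rat r \<in> pip p k"
    then have "of_int a \<in> pip p (k + (p - 1) * n)"
      using pip_mult[of "of_rat r" p k "of_int b"] vb eq by (auto simp: vex_def)
    then have "k + (p - 1) * n \<le> (p - 1) * m" using vex_pip_le[OF va] p0 by blast
    then have "int (k + (p - 1) * n) \<le> int ((p - 1) * m)" by (simp only: of_nat_le_iff)
    then show "int k \<le> int (p - 1) * ord_rat p r"
      unfolding ord right_diff_distrib of_nat_add of_nat_mult by linarith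
  }
  {
    assume "vex p k (of_rat r)"
    then have "vex p (k + (p - 1) * n) (of_int a)" using vex_mult[OF p _ vb] eq by metis
    then have "k + (p - 1) * n = (p - 1) * m" using vex_unique va p0 by blast
    then have "int (k + (p - 1) * n) = int ((p - 1) * m)" by (simp only: )
    then show "int k = int (p - 1) * ord_rat p r"
      unfolding ord right_diff_distrib of_nat_add of_nat_mult by linarith
  }
qed

text \<open>A coefficient divisible by p contributes order at least p - 1, which is why K is capped
  there; the terms from K on have order at least K by their power of \<zeta> ^ a - 1.\<close>

lemma pip_expansion:
  assumes p: "prime p" and a: "0 < a" "a < p" and K: "K \<le> p - 1"
    and c: "\<And>k. k < K \<Longrightarrow> int p dvd c k"
  shows "(\<Sum>k<n. of_int (c k) * (ee p (int a) - 1) ^ k) \<in> pip p K"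
proof (rule pip_sum)
  fix k
  have p0: "p > 0" using p prime_gt_0_nat by blast
  have v: "vex p (k * 1) ((ee p (int a) - 1) ^ k)" by (intro vex_power[OF p] ee_minus_1 p a)
  show "of_int (c k) * (ee p (int a) - 1) ^ k \<in> pip p K"
  proof (cases "k < K")
    case True
    then obtain b where b: "c k = int p * b" using c by blast
    have "of_nat p * (of_int b * (ee p (int a) - 1) ^ k) \<in> pip p (p - 1)"
      using p0 by (intro pip_mult_zz p_in_pip[OF p]) auto
    then show ?thesis using pip_mono[OF K p0] by (simp add: b mult.assoc)
  next
    case False
    then have "(ee p (int a) - 1) ^ k \<in> pip p K" using v pip_mono[of K k p] p0 by (auto simp: vex_def)
    then show ?thesis using pip_mult_zz[of _ p K "of_int (c k)"] by (subst mult.commute) auto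
  qed
qed

lemma vex_expansion:
  assumes p: "prime p" and a: "0 < a" "a < p" and K: "K < p - 1" "K < n"
    and c: "\<And>k. k < K \<Longrightarrow> int p dvd c k" and cK: "\<not> int p dvd c K"
  shows "vex p K (\<Sum>k<n. of_int (c k) * (ee p (int a) - 1) ^ k)"
proof -
  have p0: "p > 0" using p prime_gt_0_nat by blast
  \<comment> \<open>With the K-th coefficient removed, the sum has order at least K + 1; this is
    where K < p - 1 has to be strict.\<close>
  define c' where "c' = c(K := 0)"
  have *: "(\<Sum>k<n. of_int (c' k) * (ee p (int a) - 1) ^ k) \<in> pip p (Suc K)"
    using K by (intro pip_expansion p a) (auto simp: c'_def c less_Suc_eq)
  have "vex p (0 + K * 1) (of_int (c K) * (ee p (int a) - 1) ^ K)"
    by (intro vex_mult[OF p] vex_power[OF p] vex_0_of_int[OF p] cK ee_minus_1 p a)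
  from vex_add[OF this[simplified] * p0]
  have "vex p K (of_int (c K) * (ee p (int a) - 1) ^ K + (\<Sum>k<n. of_int (c' k) * (ee p (int a) - 1) ^ k))" .
  also have "(\<Sum>k<n. of_int (c' k) * (ee p (int a) - 1) ^ k) = (\<Sum>k\<in>{..<n} - {K}. of_int (c k) * (ee p (int a) - 1) ^ k)"
    by (rule sum.mono_neutral_cong_right) (auto simp: c'_def)
  also have "of_int (c K) * (ee p (int a) - 1) ^ K + \<dots> = (\<Sum>k<n. of_int (c k) * (ee p (int a) - 1) ^ k)"
    using K by (subst (2) sum.remove[of _ K]) auto
  finally show ?thesis .
qed

section \<open>Exponential sums over the coefficients of monic polynomials\<close>

text \<open>A vector \<open>c\<close> in \<open>cvecs p n\<close> stands for the polynomial \<open>X ^ n + c 1 X ^ (n - 1) + \<dots> + c n\<close> modulo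
  \<open>p\<close>; \<open>psum n c k\<close> is the sum of the \<open>k\<close>-th powers of its roots, given by Newton's identities, and
  \<open>hsum h n c\<close> is the sum of the values of \<open>h\<close> at its roots.\<close>

definition cvecs :: "nat \<Rightarrow> nat \<Rightarrow> (nat \<Rightarrow> int) set" where
  "cvecs p n = PiE {1..n} (\<lambda>_. {0..<int p})"

definition cf :: "nat \<Rightarrow> (nat \<Rightarrow> int) \<Rightarrow> nat \<Rightarrow> int" where
  "cf n c i = (if i \<in> {1..n} then c i else 0)"

function psum :: "nat \<Rightarrow> (nat \<Rightarrow> int) \<Rightarrow> nat \<Rightarrow> int" where
  "psum n c k = (if k = 0 then int n
     else - (\<Sum>i\<in>{1..<k}. cf n c i * psum n c (k - i)) - int k * cf n c k)"
  by auto
termination by (relation "Wellfounded.measure (\<lambda>(n, c, k). k)") auto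

declare psum.simps [simp del]

definition hsum :: "int poly \<Rightarrow> nat \<Rightarrow> (nat \<Rightarrow> int) \<Rightarrow> int" where
  "hsum h n c = (\<Sum>k\<le>degree h. coeff h k * psum n c k)"

definition expsum :: "nat \<Rightarrow> int poly \<Rightarrow> int \<Rightarrow> nat \<Rightarrow> complex" where
  "expsum p h a n = (\<Sum>c\<in>cvecs p n. ee p (a * hsum h n c))"

lemma finite_cvecs [simp]: "finite (cvecs p n)"
  by (auto simp: cvecs_def intro!: finite_PiE)

section \<open>Polynomials of bounded weight in the coefficients\<close>

inductive wpoly :: "nat \<Rightarrow> nat \<Rightarrow> ((nat \<Rightarrow> int) \<Rightarrow> int) \<Rightarrow> bool" for n m where
  monom: "(\<Sum>i\<in>{1..n}. i * e i) \<le> m \<Longrightarrow> wpoly n m (\<lambda>c. k * (\<Prod>i\<in>{1..n}. c i ^ e i))"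
| add: "wpoly n m f \<Longrightarrow> wpoly n m g \<Longrightarrow> wpoly n m (\<lambda>c. f c + g c)"

lemma wpoly_const: "wpoly n m (\<lambda>_. k)"
  using wpoly.monom[where e = "\<lambda>_. 0" and n = n and m = m and k = k] by simp

lemma wpoly_mono: "wpoly n m f \<Longrightarrow> m \<le> m' \<Longrightarrow> wpoly n m' f"
  by (induction rule: wpoly.induct) (auto intro: wpoly.add intro!: wpoly.monom simp del: One_nat_def)

lemma wpoly_mult_monom:
  assumes "wpoly n m f" "(\<Sum>i\<in>{1..n}. i * e i) \<le> m'"
  shows "wpoly n (m + m') (\<lambda>c. f c * (k * (\<Prod>i\<in>{1..n}. c i ^ e i)))"
  using assms(1)
proof induction
  case (monom e' k')
  have "(\<Sum>i\<in>{1..n}. i * (e' i + e i)) \<le> m + m'"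
    using monom assms(2) by (simp add: algebra_simps sum.distrib)
  from wpoly.monom[OF this, of "k' * k"] show ?case
    by (simp add: power_add prod.distrib mult_ac)
next
  case (add f g)
  from wpoly.add[OF add.IH] show ?case by (simp add: algebra_simps)
qed

lemma wpoly_mult:
  assumes f: "wpoly n m f" and "wpoly n m' g"
  shows "wpoly n (m + m') (\<lambda>c. f c * g c)"
  using assms(2)
proof induction
  case (monom e k)
  then show ?case using wpoly_mult_monom[OF f] by blast
next
  case (add g h)
  from wpoly.add[OF add.IH] show ?case by (simp add: algebra_simps)
qed

lemma wpoly_sum:
  "(\<And>i. i \<in> A \<Longrightarrow> wpoly n m (f i)) \<Longrightarrow> wpoly n m (\<lambda>c. \<Sum>i\<in>A. f i c)"
  by (induction A rule: infinite_finite_induct) (auto intro: wpoly_const wpoly.add)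

lemma wpoly_cf: "wpoly n i (\<lambda>c. cf n c i)"
proof (cases "i \<in> {1..n}")
  case True
  have "(\<Sum>j\<in>{1..n}. j * (if j = i then 1 else 0)) \<le> i" using True by (simp add: if_distrib cong: if_cong)
  from wpoly.monom[OF this, of 1] show ?thesis
    using True by (simp add: cf_def if_distrib[of "\<lambda>e. _ ^ e"] cong: if_cong)
qed (auto simp: cf_def wpoly_const)

text \<open>Giving \<open>c i\<close> weight i makes Newton's identities homogeneous, so the k-th
  power sum has weight k.\<close>

lemma wpoly_psum: "wpoly n k (\<lambda>c. psum n c k)"
proof (induction k rule: less_induct)
  case (less k)
  show ?case
  proof (cases "k = 0")
    case True
    then show ?thesis by (simp add: psum.simps wpoly_const)
  next
    case False
    have "wpoly n k (\<lambda>c. (\<Sum>i\<in>{1..<k}. (-1) * (cf n c i * psum n c (k - i))) + (- int k) * cf n c k)"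
    proof (intro wpoly.add wpoly_sum)
      fix i assume i: "i \<in> {1..<k}"
      then have "wpoly n (0 + (i + (k - i))) (\<lambda>c. (-1) * (cf n c i * psum n c (k - i)))"
        by (intro wpoly_mult wpoly_cf wpoly_const less) auto
      then show "wpoly n k (\<lambda>c. (-1) * (cf n c i * psum n c (k - i)))" using i by simp
    next
      show "wpoly n k (\<lambda>c. (- int k) * cf n c k)"
        using wpoly_mult[OF wpoly_const[of n 0 "- int k"] wpoly_cf[of n k]] by simp
    qed
    also have "(\<lambda>c. (\<Sum>i\<in>{1..<k}. (-1) * (cf n c i * psum n c (k - i))) + (- int k) * cf n c k) = (\<lambda>c. psum n c k)"
      using False by (subst psum.simps) (simp add: sum_negf)
    finally show ?thesis .
  qed
qed

lemma wpoly_hsum: assumes "degree h \<le> d" shows "wpoly n d (hsum h n)"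
proof -
  have "wpoly n d (\<lambda>c. \<Sum>k\<le>degree h. coeff h k * psum n c k)"
  proof (intro wpoly_sum)
    fix k assume "k \<in> {..degree h}"
    have "wpoly n (0 + k) (\<lambda>c. coeff h k * psum n c k)"
      by (intro wpoly_mult wpoly_const wpoly_psum)
    moreover have "0 + k \<le> d" using \<open>k \<in> {..degree h}\<close> assms by simp
    ultimately show "wpoly n d (\<lambda>c. coeff h k * psum n c k)" by (rule wpoly_mono)
  qed
  then show ?thesis by (simp add: hsum_def[abs_def])
qed

lemma wpoly_falling: assumes "wpoly n d f" shows "wpoly n (k * d) (\<lambda>c. \<Prod>j<k. (f c - int j))"
proof (induction k)
  case (Suc k)
  have "wpoly n (k * d + d) (\<lambda>c. (\<Prod>j<k. (f c - int j)) * (f c + (- int k)))"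
    by (intro wpoly_mult Suc wpoly.add assms wpoly_const)
  then show ?case by (simp add: add.commute)
qed (simp add: wpoly_const)

lemma sum_int_interval: "(\<Sum>x\<in>{0..<int p}. f x) = (\<Sum>x<p. f (int x))"
  by (rule sum.reindex_bij_witness[of _ int nat]) auto

text \<open>Summing (x + 1) ^ (e + 1) - x ^ (e + 1) over x < p telescopes to p ^ (e + 1). By
  induction the lower power sums are 0 modulo p, and the factor e + 1 < p of the e-th one can be
  cancelled.\<close>

lemma power_sum_dvd:
  assumes p: "prime p" and "e < p - 1"
  shows "int p dvd (\<Sum>x<p. int x ^ e)"
  using assms(2)
proof (induction e rule: less_induct)
  case (less e)
  define S where "S = (\<lambda>e. \<Sum>x<p. int x ^ e)"
  have "(\<Sum>x<p. int (Suc x) ^ Suc e - int x ^ Suc e) = int p ^ Suc e"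
    by (subst sum_lessThan_telescope) simp
  moreover have "(\<Sum>x<p. int (Suc x) ^ Suc e - int x ^ Suc e) = (\<Sum>j\<le>e. int (Suc e choose j) * S j)"
  proof -
    have "int (Suc x) ^ Suc e - int x ^ Suc e = (\<Sum>j\<le>e. int (Suc e choose j) * int x ^ j)" for x
    proof -
      have "int (Suc x) ^ Suc e = (\<Sum>j\<le>Suc e. int (Suc e choose j) * int x ^ j)"
        using binomial_ring[of "int x" 1 "Suc e"] by (simp add: add.commute)
      then show ?thesis by simp
    qed
    then have "(\<Sum>x<p. int (Suc x) ^ Suc e - int x ^ Suc e) = (\<Sum>x<p. \<Sum>j\<le>e. int (Suc e choose j) * int x ^ j)"
      by simp
    also have "\<dots> = (\<Sum>j\<le>e. int (Suc e choose j) * S j)"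
      by (subst sum.swap) (simp add: S_def sum_distrib_left)
    finally show ?thesis .
  qed
  ultimately have "int p ^ Suc e = (\<Sum>j<e. int (Suc e choose j) * S j) + int (Suc e) * S e"
    by (simp add: lessThan_Suc_atMost[symmetric])
  moreover have "int p dvd (\<Sum>j<e. int (Suc e choose j) * S j)"
    using less by (intro dvd_sum dvd_mult) (auto simp: S_def)
  moreover have "int p dvd int p ^ Suc e" by simp
  ultimately have "int p dvd int (Suc e) * S e" by (metis dvd_add_right_iff)
  moreover have "\<not> int p dvd int (Suc e)" using less.prems by (auto dest: zdvd_imp_le)
  ultimately have "int p dvd S e" using p prime_dvd_mult_iff[of "int p"] by auto
  then show ?case by (simp add: S_def)
qed

text \<open>The sum of a monomial over the whole space is a product of power sums. If all exponents
  are at least p - 1, the weight is at least (p - 1) n (n + 1) / 2; otherwise one factor is 0 modulo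
  p.\<close>

lemma sum_wpoly_dvd:
  assumes p: "prime p" and "wpoly n m f" and m: "2 * m < (p - 1) * n * (n + 1)"
  shows "int p dvd (\<Sum>c\<in>cvecs p n. f c)"
  using assms(2)
proof induction
  case (monom e k)
  have "\<exists>i\<in>{1..n}. e i < p - 1"
  proof (rule ccontr)
    assume "\<not> ?thesis"
    then have "\<forall>i\<in>{1..n}. p - 1 \<le> e i" by (simp add: not_less)
    then have "(\<Sum>i\<in>{1..n}. i * (p - 1)) \<le> (\<Sum>i\<in>{1..n}. i * e i)"
      by (intro sum_mono mult_left_mono) auto
    also have "(\<Sum>i\<in>{1..n}. i * (p - 1)) = (p - 1) * (\<Sum>i\<in>{1..n}. i)" by (simp add: sum_distrib_left mult.commute)
    finally have "2 * ((p - 1) * (\<Sum>i\<in>{1..n}. i)) \<le> 2 * m" using monom by linarith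
    moreover have "2 * (\<Sum>i\<in>{1..n}. i) = n * (n + 1)" by (induction n) auto
    ultimately show False using m by (metis mult.assoc mult.left_commute not_le)
  qed
  then obtain i where i: "i \<in> {1..n}" "e i < p - 1" by blast
  have "(\<Sum>c\<in>cvecs p n. \<Prod>i\<in>{1..n}. c i ^ e i) = (\<Prod>i\<in>{1..n}. \<Sum>x\<in>{0..<int p}. x ^ e i)"
    unfolding cvecs_def by (rule prod_sum_PiE[symmetric]) auto
  moreover have "int p dvd (\<Prod>i\<in>{1..n}. \<Sum>x\<in>{0..<int p}. x ^ e i)"
    using power_sum_dvd[OF p i(2)] i(1) unfolding sum_int_interval by (intro dvd_prodI[THEN dvd_trans[rotated]]) auto
  ultimately show ?case by (simp flip: sum_distrib_left)
next
  case (add f g)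
  then show ?case by (simp add: sum.distrib)
qed

text \<open>The coefficient of (\<zeta> ^ a - 1) ^ k in \<open>expsum p h a n\<close>. It does not
  involve a, so one integer governs all characters. Reducing \<open>hsum\<close> to the range 0..p-1
  first makes the binomial coefficients with k \<ge> p vanish.\<close>

definition csum :: "nat \<Rightarrow> int poly \<Rightarrow> nat \<Rightarrow> nat \<Rightarrow> int" where
  "csum p h n k = (\<Sum>c\<in>cvecs p n. int (nat (hsum h n c mod int p) choose k))"

lemma fact_binomial: "int (fact k * (n choose k)) = (\<Prod>j<k. (int n - int j))"
proof -
  have "of_int (int (fact k * (n choose k))) = (fact k * (of_nat n gchoose k) :: rat)"
    by (simp add: binomial_gbinomial)
  also have "\<dots> = (\<Prod>j<k. (of_nat n - of_nat j))"
    by (simp add: gbinomial_prod_rev atLeast0LessThan)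
  also have "\<dots> = of_int (\<Prod>j<k. (int n - int j))" by simp
  finally show ?thesis by (simp only: of_int_eq_iff)
qed

lemma fact_csum_cong:
  assumes p: "prime p"
  shows "[fact k * csum p h n k = (\<Sum>c\<in>cvecs p n. \<Prod>j<k. (hsum h n c - int j))] (mod int p)"
proof -
  have p0: "p > 0" using p prime_gt_0_nat by blast
  have "fact k * csum p h n k = (\<Sum>c\<in>cvecs p n. int (fact k * (nat (hsum h n c mod int p) choose k)))"
    by (simp add: csum_def sum_distrib_left)
  also have "\<dots> = (\<Sum>c\<in>cvecs p n. \<Prod>j<k. (hsum h n c mod int p - int j))"
    using p0 by (simp only: fact_binomial) simp
  also have "[\<dots> = (\<Sum>c\<in>cvecs p n. \<Prod>j<k. (hsum h n c - int j))] (mod int p)"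
    by (intro cong_sum cong_prod cong_diff cong_refl) (simp add: cong_def)
  finally show ?thesis .
qed

lemma csum_dvd:
  assumes p: "prime p" and h: "degree h \<le> d" and k: "k < p" "2 * (k * d) < (p - 1) * n * (n + 1)"
  shows "int p dvd csum p h n k"
proof -
  have "int p dvd (\<Sum>c\<in>cvecs p n. \<Prod>j<k. (hsum h n c - int j))"
    using h k by (intro sum_wpoly_dvd[OF p, of n "k * d"] wpoly_falling wpoly_hsum)
  then have "int p dvd fact k * csum p h n k" using cong_dvd_iff[OF fact_csum_cong[OF p]] by blast
  moreover have "\<not> int p dvd fact k" using p k(1) prime_dvd_fact_iff[of p k]
    by (metis int_dvd_int_iff of_nat_fact not_le)
  ultimately show ?thesis using p prime_dvd_mult_iff[of "int p"] by auto
qed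

text \<open>Write \<zeta> ^ (a m) = (1 + (\<zeta> ^ a - 1)) ^ m for the residue m of
  \<open>hsum\<close> and use the binomial theorem.\<close>

lemma expsum_expansion:
  assumes p0: "p > 0"
  shows "expsum p h a n = (\<Sum>k<p. of_int (csum p h n k) * (ee p a - 1) ^ k)"
proof -
  have "ee p (a * hsum h n c) = (\<Sum>k<p. of_int (int (nat (hsum h n c mod int p) choose k)) * (ee p a - 1) ^ k)" for c
  proof -
    define m where "m = nat (hsum h n c mod int p)"
    have m: "m < p" using p0 by (simp add: m_def nat_less_iff)
    have "ee p (a * hsum h n c) = ee p (a * int m)"
      using p0 by (intro ee_cong) (auto simp: m_def mod_mult_right_eq)
    also have "\<dots> = ((ee p a - 1) + 1) ^ m" by (simp add: ee_power)
    also have "\<dots> = (\<Sum>k\<le>m. of_nat (m choose k) * (ee p a - 1) ^ k)" by (subst binomial_ring) simp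
    also have "\<dots> = (\<Sum>k<p. of_nat (m choose k) * (ee p a - 1) ^ k)"
      using m by (intro sum.mono_neutral_left) auto
    finally show ?thesis by (simp add: m_def)
  qed
  then have "expsum p h a n = (\<Sum>c\<in>cvecs p n. \<Sum>k<p. of_int (int (nat (hsum h n c mod int p) choose k)) * (ee p a - 1) ^ k)"
    by (simp add: expsum_def)
  also have "\<dots> = (\<Sum>k<p. of_int (csum p h n k) * (ee p a - 1) ^ k)"
    by (subst sum.swap) (simp add: csum_def sum_distrib_right)
  finally show ?thesis .
qed

lemma psum_0: "psum 0 c k = 0"
  by (induction k rule: less_induct) (subst psum.simps, simp add: cf_def)

lemma expsum_0: "expsum p h a 0 = 1"
  by (simp add: expsum_def cvecs_def hsum_def psum_0)

text \<open>For \<open>n \<ge> d\<close>, \<open>c d\<close> enters \<open>hsum h n c\<close> only through the term \<open>- d * c d\<close>.\<close>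

lemma psum_upd_less: "k < m \<Longrightarrow> psum n (c(m := x)) k = psum n c k"
proof (induction k rule: less_induct)
  case (less k)
  have cf: "cf n (c(m := x)) i = cf n c i" if "i \<le> k" for i using that less.prems by (simp add: cf_def)
  have "psum n (c(m := x)) (k - i) = psum n c (k - i)" if "i \<in> {1..<k}" for i
    using that less.prems by (intro less.IH) auto
  then show ?case using cf by (subst (1 2) psum.simps) (auto intro!: sum.cong)
qed

lemma psum_upd_eq:
  assumes "m \<in> {1..n}"
  shows "psum n (c(m := x)) m = psum n c m + int m * c m - int m * x"
proof -
  have cf: "cf n (c(m := x)) i = cf n c i" if "i < m" for i using that by (simp add: cf_def)
  have "(\<Sum>i\<in>{1..<m}. cf n (c(m := x)) i * psum n (c(m := x)) (m - i)) = (\<Sum>i\<in>{1..<m}. cf n c i * psum n c (m - i))"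
    using cf psum_upd_less by (intro sum.cong) auto
  moreover have "cf n c m = c m" "cf n (c(m := x)) m = x" using assms by (auto simp: cf_def)
  ultimately show ?thesis using assms by (subst (1 2) psum.simps) simp
qed

lemma expsum_eq_0:
  assumes p: "prime p" and h: "degree h = d" "lead_coeff h = 1" and d: "1 \<le> d" "d \<le> n"
    and a: "\<not> int p dvd a" "\<not> p dvd d"
  shows "expsum p h a n = 0"
proof -
  have p0: "p > 0" using p prime_gt_0_nat by blast
  \<comment> \<open>Translating the coordinate \<open>c d\<close> by 1 permutes the vectors and
    multiplies every term by the same root of unity \<zeta> ^ (- a d), which differs from 1; so the
    sum is 0.\<close>
  define g where "g = (\<lambda>c::nat \<Rightarrow> int. c(d := (c d + 1) mod int p))"
  have hs: "hsum h n (c(d := x)) = hsum h n c + int d * c d - int d * x" for c x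
  proof -
    have "hsum h n c' = (\<Sum>k<d. coeff h k * psum n c' k) + psum n c' d" for c'
      using h by (simp add: hsum_def lessThan_Suc_atMost[symmetric])
    then show ?thesis using d by (simp add: psum_upd_less psum_upd_eq)
  qed
  have e: "ee p (a * hsum h n (g c)) = ee p (- a * int d) * ee p (a * hsum h n c)" for c
  proof -
    have "ee p (a * hsum h n (g c)) = ee p (- a * int d + a * hsum h n c)"
    proof (rule ee_cong[OF p0], fold cong_def)
      have "a * hsum h n (g c) = a * (hsum h n c + int d * c d - int d * ((c d + 1) mod int p))"
        by (simp add: g_def hs)
      also have "[\<dots> = a * (hsum h n c + int d * c d - int d * (c d + 1))] (mod int p)"
        by (intro cong_mult cong_diff cong_refl) (simp add: cong_def)
      finally show "[a * hsum h n (g c) = - a * int d + a * hsum h n c] (mod int p)"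
        by (simp add: algebra_simps)
    qed
    then show ?thesis by (simp only: ee_add)
  qed
  have "bij_betw g (cvecs p n) (cvecs p n)"
  proof (rule bij_betwI[where g = "\<lambda>c. c(d := (c d - 1) mod int p)"])
    show "g \<in> cvecs p n \<rightarrow> cvecs p n" "(\<lambda>c. c(d := (c d - 1) mod int p)) \<in> cvecs p n \<rightarrow> cvecs p n"
      using d p0 by (auto simp: g_def cvecs_def PiE_iff extensional_def)
    fix c assume c: "c \<in> cvecs p n"
    have "((c d + 1) mod int p - 1) mod int p = c d mod int p" "((c d - 1) mod int p + 1) mod int p = c d mod int p"
      by (simp_all add: mod_simps)
    moreover have "c d mod int p = c d" using c d by (auto simp: cvecs_def PiE_iff)
    ultimately show "(g c)(d := (g c d - 1) mod int p) = c" "g (c(d := (c d - 1) mod int p)) = c"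
      by (auto simp: g_def)
  qed
  then have "expsum p h a n = (\<Sum>c\<in>cvecs p n. ee p (a * hsum h n (g c)))"
    unfolding expsum_def by (rule sum.reindex_bij_betw[symmetric])
  also have "\<dots> = ee p (- a * int d) * expsum p h a n"
    by (simp only: e expsum_def sum_distrib_left)
  finally have "(ee p (- a * int d) - 1) * expsum p h a n = 0" by (simp add: algebra_simps)
  moreover have "ee p (- a * int d) \<noteq> 1"
    using a p p0 prime_dvd_mult_iff[of "int p" a "int d"] by (subst ee_eq_1_iff) auto
  ultimately show ?thesis by simp
qed

section \<open>The linear case n = 1\<close>

lemma psum_1: "psum 1 c k = (- c 1) ^ k"
proof (induction k rule: less_induct)
  case (less k)
  consider "k = 0" | "k = 1" | "k \<ge> 2" by linarith
  then show ?case
  proof cases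
    case 3
    have "(\<Sum>i\<in>{1..<k}. cf 1 c i * psum 1 c (k - i)) = (\<Sum>i\<in>{1}. cf 1 c i * psum 1 c (k - i))"
      using 3 by (intro sum.mono_neutral_right) (auto simp: cf_def)
    then have "psum 1 c k = - (c 1 * (- c 1) ^ (k - 1))"
      using 3 less[of "k - 1"] by (subst psum.simps) (simp add: cf_def)
    also have "\<dots> = (- c 1) ^ k" using 3 by (simp add: power_eq_if)
    finally show ?thesis .
  qed (auto simp: psum.simps cf_def)
qed

lemma sum_cvecs_1: "(\<Sum>c\<in>cvecs p 1. f (c 1)) = (\<Sum>x<p. f (int x))"
proof -
  have "(\<Sum>c\<in>cvecs p 1. f (c 1)) = (\<Sum>x\<in>{0..<int p}. f x)"
    by (rule sum.reindex_bij_witness[of _ "\<lambda>x. (\<lambda>i. if i = 1 then x else undefined)" "\<lambda>c. c 1"])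
      (auto simp: cvecs_def PiE_iff extensional_def)
  then show ?thesis by (simp add: sum_int_interval)
qed

lemma power_sum_p_minus_1:
  assumes p: "prime p" shows "[(\<Sum>x<p. int x ^ (p - 1)) = -1] (mod int p)"
proof -
  have p2: "p \<ge> 2" using p prime_ge_2_nat by blast
  have "[int x ^ (p - 1) = (if x = 0 then 0 else 1)] (mod int p)" if "x < p" for x
  proof (cases "x = 0")
    case False
    then have "\<not> p dvd x" using that by (auto dest: dvd_imp_le)
    then have "[x ^ (p - 1) = 1] (mod p)" using p by (intro fermat_theorem)
    then have "[int (x ^ (p - 1)) = int 1] (mod int p)" by (simp only: cong_int_iff)
    then show ?thesis using False by simp
  qed (use p2 in \<open>simp add: power_0_left\<close>)
  then have "[(\<Sum>x<p. int x ^ (p - 1)) = (\<Sum>x<p. if x = 0 then 0 else 1)] (mod int p)"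
    by (intro cong_sum) auto
  also have "(\<Sum>x<p. if x = 0 then 0 else 1 :: int) = (\<Sum>x\<in>{..<p} - {0}. 1)"
    by (intro sum.mono_neutral_cong_right) auto
  also have "\<dots> = int p - 1" using p2 by simp
  also have "[int p - 1 = -1] (mod int p)" by (simp add: cong_iff_dvd_diff)
  finally show ?thesis .
qed

text \<open>Replacing x ^ p by x lowers the exponent by p - 1, into the range where power sums
  vanish modulo p.\<close>

lemma power_sum_gt:
  assumes p: "prime p" and e: "p - 1 < e" "e < 2 * (p - 1)"
  shows "int p dvd (\<Sum>x<p. int x ^ e)"
proof -
  have "[int x ^ e = int x ^ (e - (p - 1))] (mod int p)" for x
  proof -
    have "[int x ^ p = int x] (mod int p)" by (rule fermat_int[OF p])
    then have "[int x ^ p * int x ^ (e - p) = int x * int x ^ (e - p)] (mod int p)"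
      by (intro cong_mult cong_refl)
    moreover have "e = p + (e - p)" "e - (p - 1) = Suc (e - p)" using e by linarith+
    ultimately show ?thesis by (metis power_Suc power_add)
  qed
  then have "[(\<Sum>x<p. int x ^ e) = (\<Sum>x<p. int x ^ (e - (p - 1)))] (mod int p)"
    by (intro cong_sum)
  moreover have "int p dvd (\<Sum>x<p. int x ^ (e - (p - 1)))" using e by (intro power_sum_dvd[OF p]) linarith
  ultimately show ?thesis using cong_dvd_iff by blast
qed

text \<open>Below degree 2 (p - 1) only the exponent p - 1 has a power sum that is nonzero modulo p,
  namely -1. The sign of x is harmless there because p - 1 is even.\<close>

lemma sum_poly_cong:
  assumes p: "prime p" and "odd p" and G: "degree G < 2 * (p - 1)"
  shows "[(\<Sum>x<p. poly G (- int x)) = - coeff G (p - 1)] (mod int p)"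
proof -
  define D where "D = 2 * (p - 1)"
  have p2: "p \<ge> 2" using p prime_ge_2_nat by blast
  have "poly G y = (\<Sum>e<D. coeff G e * y ^ e)" for y
    unfolding poly_altdef using G by (intro sum.mono_neutral_left) (auto simp: D_def coeff_eq_0)
  then have "(\<Sum>x<p. poly G (- int x)) = (\<Sum>e<D. coeff G e * (-1) ^ e * (\<Sum>x<p. int x ^ e))"
    by (simp add: sum_distrib_left sum.swap[of _ "{..<p}"] power_minus[of "int _"] mult_ac)
  also have "[\<dots> = (\<Sum>e<D. if e = p - 1 then - coeff G (p - 1) else 0)] (mod int p)"
  proof (intro cong_sum)
    fix e assume e: "e \<in> {..<D}"
    show "[coeff G e * (-1) ^ e * (\<Sum>x<p. int x ^ e) = (if e = p - 1 then - coeff G (p - 1) else 0)] (mod int p)"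
    proof (cases "e = p - 1")
      case True
      have "[coeff G e * (-1) ^ e * (\<Sum>x<p. int x ^ e) = coeff G e * (-1) ^ e * (-1)] (mod int p)"
        unfolding True by (intro cong_mult power_sum_p_minus_1[OF p] cong_refl)
      then show ?thesis using True \<open>odd p\<close> by simp
    next
      case False
      then have "int p dvd (\<Sum>x<p. int x ^ e)"
        using power_sum_dvd[OF p, of e] power_sum_gt[OF p, of e] e by (cases "e < p - 1") (auto simp: D_def)
      then show ?thesis using False by (simp add: cong_0_iff)
    qed
  qed
  also have "(\<Sum>e<D. if e = p - 1 then - coeff G (p - 1) else 0) = - coeff G (p - 1)"
    using p2 by (simp add: D_def)
  finally show ?thesis .
qed

text \<open>For n = 1 the only root is \<open>- c 1\<close>, so k! times \<open>csum\<close> is,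
  modulo p, the sum over F_p of the falling factorial of h. This differs from h ^ k in degree at
  most (k - 1) d < p - 1, so both have the same coefficient at x ^ (p - 1).\<close>

lemma csum_1_not_dvd:
  assumes p: "prime p" "odd p" and h: "degree h \<le> d" and k: "k < p" "k * d < 2 * (p - 1)" "(k - 1) * d < p - 1"
    and c: "\<not> int p dvd coeff (h ^ k) (p - 1)"
  shows "\<not> int p dvd csum p h 1 k"
proof
  assume "int p dvd csum p h 1 k"
  then have *: "int p dvd (\<Sum>c\<in>cvecs p 1. \<Prod>j<k. (hsum h 1 c - int j))"
    using cong_dvd_iff[OF fact_csum_cong[OF p(1)], of k h 1] by simp
  define G where "G = (\<lambda>k. \<Prod>j<k. (h - [:int j:]))"
  have "hsum h 1 c = poly h (- c 1)" for c by (simp add: hsum_def psum_1 poly_altdef del: One_nat_def)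
  then have "(\<Sum>c\<in>cvecs p 1. \<Prod>j<k. (hsum h 1 c - int j)) = (\<Sum>c\<in>cvecs p 1. poly (G k) (- c 1))"
    by (simp add: poly_prod G_def)
  also have "\<dots> = (\<Sum>x<p. poly (G k) (- int x))" by (rule sum_cvecs_1)
  finally have **: "int p dvd (\<Sum>x<p. poly (G k) (- int x))" using * by simp
  have deg: "degree (h - [:int j:]) \<le> d" for j
    using h by (intro degree_diff_le) auto
  have dG: "degree (G k) \<le> k * d" for k
  proof (induction k)
    case (Suc k)
    have "degree (G (Suc k)) \<le> degree (G k) + degree (h - [:int k:])"
      by (simp add: G_def degree_mult_le)
    then show ?case using Suc deg[of k] by simp
  qed (simp add: G_def)
  have dH: "degree (h ^ k) \<le> k * d" for k
    using degree_power_le[of h k] h by (metis le_trans mult.commute mult_le_mono1)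
  have diff: "degree (G k - h ^ k) \<le> (k - 1) * d" for k
  proof (induction k)
    case (Suc k)
    have "G (Suc k) - h ^ Suc k = h * (G k - h ^ k) - [:int k:] * G k"
      by (simp add: G_def algebra_simps)
    moreover have "degree (h * (G k - h ^ k)) \<le> k * d"
    proof (cases k)
      case (Suc l)
      have "degree (h * (G k - h ^ k)) \<le> degree h + degree (G k - h ^ k)" by (rule degree_mult_le)
      also have "\<dots> \<le> d + l * d" using Suc.IH h Suc by (intro add_mono) auto
      finally show ?thesis using Suc by simp
    qed (simp add: G_def)
    moreover have "degree ([:int k:] * G k) \<le> k * d"
      using dG[of k] degree_smult_le[of "int k" "G k"] by simp
    ultimately have "degree (G (Suc k) - h ^ Suc k) \<le> k * d"
      by (simp only: degree_diff_le)
    then show ?case by simp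
  qed (simp add: G_def)
  have "degree (G k - h ^ k) < p - 1" using diff[of k] k(3) by linarith
  then have "coeff (G k - h ^ k) (p - 1) = 0" by (rule coeff_eq_0)
  then have "coeff (G k) (p - 1) = coeff (h ^ k) (p - 1)" by simp
  moreover have "[(\<Sum>x<p. poly (G k) (- int x)) = - coeff (G k) (p - 1)] (mod int p)"
    using dG[of k] k(2) by (intro sum_poly_cong p) linarith
  ultimately show False using ** c cong_dvd_iff by fastforce
qed

declare One_nat_def [simp del]

section \<open>Frobenius-stable multisets in an algebraically closed field\<close>

lemma (in ring_morphism) map_poly_mult: "map_poly \<phi> (p * q) = map_poly \<phi> p * map_poly \<phi> q"
  by (rule poly_eqI) (simp add: coeff_map_poly hom_zero coeff_mult hom_sum hom_mult)

lemma (in ring_morphism) map_poly_prod_mset: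
  "map_poly \<phi> (\<Prod>x\<in>#M. f x) = (\<Prod>x\<in>#M. map_poly \<phi> (f x))"
  by (induction M) (simp_all add: map_poly_mult hom_one map_poly_1')

lemma proots_linear_prod: "proots (\<Prod>x\<in>#M. [:- x, 1:]) = (M :: 'a::idom multiset)"
proof (induction M)
  case (add x M)
  have "(\<Prod>x\<in>#M. [:- x, 1:]) \<noteq> 0" by (auto simp: prod_mset_zero_iff)
  then show ?case using add by (simp add: proots_mult del: mult_pCons_left)
qed simp

lemma monic_factorization:
  fixes Q :: "'a::alg_closed_field poly"
  assumes "lead_coeff Q = 1"
  shows "(\<Prod>x\<in>#proots Q. [:- x, 1:]) = Q"
proof -
  have "Q \<noteq> 0" using assms by auto
  then obtain A where A: "Q = Polynomial.smult (lead_coeff Q) (\<Prod>x\<in>#A. [:- x, 1:])"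
    using alg_closed_imp_factorization by blast
  then have Q: "Q = (\<Prod>x\<in>#A. [:- x, 1:])" using assms by simp
  then have "proots Q = A" using proots_linear_prod by metis
  with Q show ?thesis by metis
qed

lemma degree_linear_prod: "degree (\<Prod>x\<in>#M. [:- x, 1:]) = size (M :: 'a::idom multiset)"
proof (induction M)
  case (add x M)
  have "(\<Prod>x\<in>#M. [:- x, 1:]) \<noteq> 0" by (auto simp: prod_mset_zero_iff)
  then have "degree ([:- x, 1:] * (\<Prod>x\<in>#M. [:- x, 1:])) = 1 + size M"
    using add by (subst degree_mult_eq) auto
  then show ?case by (simp del: mult_pCons_left)
qed simp

lemma lead_coeff_linear_prod: "lead_coeff (\<Prod>x\<in>#M. [:- x, 1:]) = (1 :: 'a::idom)"
proof (induction M)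
  case (add x M)
  have "lead_coeff ([:- x, 1:] * (\<Prod>x\<in>#M. [:- x, 1:])) = 1"
    using add by (subst lead_coeff_mult) auto
  then show ?case by (simp del: mult_pCons_left)
qed simp

lemma card_separable_roots:
  fixes Q :: "'a::alg_closed_field poly"
  assumes Q: "Q \<noteq> 0" and sep: "\<And>x. poly Q x = 0 \<Longrightarrow> poly (pderiv Q) x \<noteq> 0"
  shows "card {x. poly Q x = 0} = degree Q"
proof -
  obtain A where A: "size A = degree Q" "Q = Polynomial.smult (lead_coeff Q) (\<Prod>x\<in>#A. [:- x, 1:])"
    using alg_closed_imp_factorization[OF Q] by blast
  have le: "count A x \<le> 1" for x
  proof (rule ccontr)
    assume "\<not> count A x \<le> 1"
    then have "{#x, x#} \<subseteq># A" by (auto simp: subseteq_mset_def)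
    then obtain B where B: "A = {#x, x#} + B" by (metis subset_mset.add_diff_inverse)
    define R where "R = Polynomial.smult (lead_coeff Q) (\<Prod>x\<in>#B. [:- x, 1:])"
    have "Q = [:- x, 1:] * ([:- x, 1:] * R)" by (subst A(2)) (simp add: R_def B)
    then have "poly Q x = 0 \<and> poly (pderiv Q) x = 0" by (simp add: pderiv_mult del: mult_pCons_left)
    then show False using sep by blast
  qed
  have "set_mset A = {x. poly Q x = 0}"
    by (subst A(2)) (use Q in \<open>auto simp: poly_prod_mset prod_mset_zero_iff\<close>)
  moreover have "A = mset_set (set_mset A)"
  proof (rule multiset_eqI)
    fix x show "count A x = count (mset_set (set_mset A)) x"
      using le[of x] by (cases "x \<in># A") (auto simp: count_mset_set' not_in_iff dest: count_greater_zero_iff[THEN iffD2] intro: le_antisym)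
  qed
  ultimately show ?thesis using A(1) by (metis size_mset_set)
qed

text \<open>Newton's identities, read off from the logarithmic derivative of \<open>\<Prod>(1 - x t)\<close>.\<close>

lemma newton_fps:
  fixes M :: "'a::field multiset"
  shows "fps_X * fps_deriv (fps_of_poly (\<Prod>x\<in>#M. [:1, - x:])) +
    fps_of_poly (\<Prod>x\<in>#M. [:1, - x:]) * Abs_fps (\<lambda>k. if k = 0 then 0 else \<Sum>x\<in>#M. x ^ k) = 0"
proof (induction M)
  case empty
  have "Abs_fps (\<lambda>k. if k = 0 then 0 else \<Sum>x\<in>#{#}. x ^ k) = (0 :: 'a fps)" by (rule fps_ext) simp
  then show ?case by simp
next
  case (add x M)
  define R where "R = fps_of_poly (\<Prod>x\<in>#M. [:1, - x:])"
  define F where "F = Abs_fps (\<lambda>k. if k = 0 then 0 else \<Sum>x\<in>#M. x ^ k)"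
  define G where "G = Abs_fps (\<lambda>k. if k = 0 then 0 else x ^ k)"
  define L where "L = 1 - fps_const x * fps_X"
  have L: "fps_of_poly [:1, - x:] = L" by (simp add: fps_of_poly_pCons L_def)
  have LG: "L * G = fps_const x * fps_X"
  proof (rule fps_ext)
    fix k show "fps_nth (L * G) k = fps_nth (fps_const x * fps_X) k"
      by (cases k) (auto simp: L_def G_def algebra_simps fps_mult_fps_X_plus_1_nth mult.assoc)
  qed
  have dL: "fps_deriv L = - fps_const x" by (simp add: L_def)
  have FG: "Abs_fps (\<lambda>k. if k = 0 then 0 else \<Sum>x\<in>#add_mset x M. x ^ k) = F + G"
    by (simp add: fps_eq_iff F_def G_def)
  have R': "fps_of_poly (\<Prod>x\<in>#add_mset x M. [:1, - x:]) = L * R"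
    by (simp add: R_def fps_of_poly_mult L del: mult_pCons_left)
  have IH: "fps_X * fps_deriv R + R * F = 0" using add by (simp add: R_def F_def)
  have "fps_X * fps_deriv (L * R) + (L * R) * (F + G) = L * (fps_X * fps_deriv R + R * F) + R * (fps_X * fps_deriv L + L * G)"
    by (simp add: algebra_simps)
  also have "\<dots> = 0" unfolding IH dL LG by (simp add: algebra_simps del: fps_const_neg)
  finally show ?case unfolding R' FG .
qed

lemma newton_identity:
  fixes M :: "'a::field multiset"
  assumes "k > 0"
  defines "C \<equiv> \<lambda>i. if i \<le> size M then coeff (\<Prod>x\<in>#M. [:- x, 1:]) (size M - i) else 0"
  shows "(\<Sum>x\<in>#M. x ^ k) = - (\<Sum>i\<in>{1..<k}. C i * (\<Sum>x\<in>#M. x ^ (k - i))) - of_nat k * C k"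
proof -
  define R where "R = (\<Prod>x\<in>#M. [:1, - x:])"
  have lin: "reflect_poly [:- x, 1:] = [:1, - x:]" for x :: 'a by (simp add: reflect_poly_def)
  \<comment> \<open>Reversing the coefficients turns \<Prod>(t - x) into \<Prod>(1 - x t), so
    \<open>C i\<close> is the coefficient of t ^ i there.\<close>
  have "R = reflect_poly (\<Prod>x\<in>#M. [:- x, 1:])"
    unfolding R_def by (induction M) (simp_all add: reflect_poly_mult lin del: mult_pCons_left)
  then have R: "coeff R i = C i" for i by (simp add: coeff_reflect_poly degree_linear_prod C_def)
  have C0: "C 0 = 1" using lead_coeff_linear_prod[of M] by (simp add: C_def degree_linear_prod)
  define F where "F = Abs_fps (\<lambda>k. if k = 0 then 0 else \<Sum>x\<in>#M. x ^ k)"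
  have "fps_nth (fps_X * fps_deriv (fps_of_poly R) + fps_of_poly R * F) k = 0"
    using newton_fps[of M] by (simp add: R_def F_def)
  moreover have "fps_nth (fps_X * fps_deriv (fps_of_poly R)) k = of_nat k * C k"
    using assms(1) by (cases k) (simp_all add: R Suc_eq_plus1 add.commute)
  moreover have "fps_nth (fps_of_poly R * F) k = (\<Sum>i\<in>{1..<k}. C i * (\<Sum>x\<in>#M. x ^ (k - i))) + (\<Sum>x\<in>#M. x ^ k)"
  proof -
    have "fps_nth (fps_of_poly R * F) k = (\<Sum>i\<in>{0..k}. C i * (if k - i = 0 then 0 else \<Sum>x\<in>#M. x ^ (k - i)))"
      by (simp add: fps_mult_nth R F_def)
    also have "{0..k} = insert 0 (insert k {1..<k})" using assms(1) by auto
    finally show ?thesis using assms(1) by (simp add: C0)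
  qed
  ultimately show ?thesis by (simp add: algebra_simps eq_neg_iff_add_eq_0)
qed

section \<open>Finite subfields, additive characters and traces in characteristic p\<close>

locale alg_closed_char =
  fixes p :: nat and T :: "'f::alg_closed_field itself"
  assumes p: "prime p" and char: "CHAR('f) = p"
begin

lemma p_pos: "p > 0" and p_gt_1: "p > 1"
  using p prime_gt_0_nat prime_gt_1_nat by auto

lemma of_nat_p: "of_nat p = (0::'f)"
  using of_nat_CHAR[where ?'a = 'f] by (simp add: char)

lemma frob_add: "(x + y :: 'f) ^ (p ^ n) = x ^ (p ^ n) + y ^ (p ^ n)"
  by (rule freshmans_dream') (simp_all add: char p)

lemma frob_morphism: "ring_morphism (\<lambda>x::'f. x ^ (p ^ n))"
  by standard (simp_all add: frob_add power_mult_distrib)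

lemma frob1_morphism: "ring_morphism (\<lambda>x::'f. x ^ p)"
  using frob_morphism[of 1] by simp

lemma frob_inj: "x ^ (p ^ n) = y ^ (p ^ n) \<Longrightarrow> x = (y::'f)"
  using ring_morphism.hom_diff[OF frob_morphism[of n], of x y] p_pos by (simp add: power_0_left)

text \<open>For n > 0 the subfield with p ^ n elements. For n = 0 the condition is empty and
  \<open>gf 0\<close> is the whole field.\<close>

definition gf :: "nat \<Rightarrow> 'f set" where
  "gf n = {x. x ^ (p ^ n) = x}"

lemma gfD: "x \<in> gf n \<Longrightarrow> x ^ (p ^ n) = x"
  by (simp_all add: gf_def)

lemma gf_add: "x \<in> gf n \<Longrightarrow> y \<in> gf n \<Longrightarrow> x + y \<in> gf n"
  and gf_diff: "x \<in> gf n \<Longrightarrow> y \<in> gf n \<Longrightarrow> x - y \<in> gf n"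
  and gf_mult: "x \<in> gf n \<Longrightarrow> y \<in> gf n \<Longrightarrow> x * y \<in> gf n"
  and gf_0: "0 \<in> gf n" and gf_1: "1 \<in> gf n"
  using p_pos by (simp_all add: gf_def frob_add power_mult_distrib power_0_left
      ring_morphism.hom_diff[OF frob_morphism])

lemma gf_divide: "x \<in> gf n \<Longrightarrow> y \<in> gf n \<Longrightarrow> x / y \<in> gf n"
  by (simp add: gf_def power_divide)

lemma gf_power: "x \<in> gf n \<Longrightarrow> x ^ k \<in> gf n"
  by (simp add: gf_def flip: power_mult) (metis mult.commute power_mult)

lemma gf_of_int: "of_int m \<in> gf n"
  using ring_morphism.hom_of_int[OF frob_morphism[of n], of m] by (simp add: gf_def)

lemma frob_ipe: "ipe x h ^ (p ^ n) = ipe (x ^ (p ^ n)) h" for x :: 'f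
proof (induction h)
  case (pCons a h)
  have "(of_int a :: 'f) ^ (p ^ n) = of_int a" using gf_of_int gfD by blast
  then show ?case using pCons by (simp add: frob_add power_mult_distrib)
qed (use p_pos in \<open>simp add: power_0_left\<close>)

lemma gf_ipe: "x \<in> gf n \<Longrightarrow> ipe x h \<in> gf n"
  by (simp add: gf_def frob_ipe)

lemma gf_sum: "(\<And>x. x \<in> A \<Longrightarrow> f x \<in> gf n) \<Longrightarrow> sum f A \<in> gf n"
  by (induction A rule: infinite_finite_induct) (auto intro: gf_0 gf_add)

lemma gf_bev: "x \<in> gf n \<Longrightarrow> y \<in> gf n \<Longrightarrow> bev x y U \<in> gf n"
  by (simp add: bev_altdef gf_sum gf_mult gf_power gf_ipe)

lemma card_gf: "n > 0 \<Longrightarrow> card (gf n) = p ^ n"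
proof -
  assume n: "n > 0"
  define Q where "Q = Polynomial.monom (1::'f) (p ^ n) + [:0, -1:]"
  have 1: "1 < p ^ n" using p_gt_1 n by (simp add: one_less_power)
  have dQ: "degree Q = p ^ n"
    unfolding Q_def using 1 by (subst degree_add_eq_left) (auto simp: degree_monom_eq)
  have "poly (pderiv Q) x = -1" for x
    using n by (simp add: Q_def pderiv_add pderiv_monom poly_monom of_nat_p pderiv_pCons)
  then have "card {x. poly Q x = 0} = degree Q"
    using dQ 1 by (intro card_separable_roots) auto
  moreover have "{x. poly Q x = 0} = gf n" by (auto simp: Q_def poly_monom gf_def)
  ultimately show ?thesis using dQ by simp
qed

lemma finite_gf: "n > 0 \<Longrightarrow> finite (gf n)"
  using card_gf[of n] p_pos by (metis card.infinite power_eq_0_iff neq0_conv)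

lemma gf_1_eq: "gf 1 = of_nat ` {..<p}"
proof -
  have inj: "inj_on (of_nat :: nat \<Rightarrow> 'f) {..<p}"
    by (rule inj_onI) (simp add: of_nat_eq_iff_cong_CHAR char cong_def)
  have sub: "of_nat ` {..<p} \<subseteq> gf 1" using gf_of_int[of "int _" 1] by auto
  show ?thesis
    using card_subset_eq[OF finite_gf[of 1] sub] card_gf[of 1] card_image[OF inj] by simp
qed

definition ind :: "'f \<Rightarrow> nat" where
  "ind z = (SOME m. m < p \<and> of_nat m = z)"

lemma ind: assumes "z \<in> gf 1" shows "ind z < p" "of_nat (ind z) = z"
proof -
  have "\<exists>m. m < p \<and> of_nat m = z" using assms unfolding gf_1_eq by auto
  then have "ind z < p \<and> of_nat (ind z) = z" unfolding ind_def by (rule someI_ex)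
  then show "ind z < p" "of_nat (ind z) = z" by auto
qed

definition psi :: "int \<Rightarrow> 'f \<Rightarrow> complex" where
  "psi a z = ee p (a * int (ind z))"

lemma psi_of_int: "psi a (of_int m) = ee p (a * m)"
proof -
  have "of_int m \<in> gf 1" by (rule gf_of_int)
  then have "of_int (int (ind (of_int m))) = (of_int m :: 'f)" using ind(2) by simp
  then have "[int (ind (of_int m)) = m] (mod int p)" by (simp only: of_int_eq_iff_cong_CHAR char)
  then have "[a * int (ind (of_int m)) = a * m] (mod int p)" by (intro cong_mult cong_refl)
  then show ?thesis unfolding psi_def using p_pos by (intro ee_cong) (auto simp: cong_def)
qed

lemma gf_1_of_int: "z \<in> gf 1 \<Longrightarrow> \<exists>m. z = of_int m"
  using ind(2)[of z] by (metis of_int_of_nat_eq)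

lemma psi_add: assumes "z \<in> gf 1" "w \<in> gf 1" shows "psi a (z + w) = psi a z * psi a w"
proof -
  obtain m n where mn: "z = of_int m" "w = of_int n" using assms gf_1_of_int by blast
  have "psi a (z + w) = psi a (of_int (m + n))" by (simp add: mn)
  then show ?thesis unfolding psi_of_int mn by (simp add: distrib_left ee_add)
qed

lemma sum_psi: assumes "z \<in> gf 1" shows "(\<Sum>a<p. psi (int a) z) = (if z = 0 then of_nat p else 0)"
proof -
  obtain m where m: "z = of_int m" using assms gf_1_of_int by blast
  have "(\<Sum>a<p. psi (int a) z) = (\<Sum>a<p. ee p (m * int a))" by (simp add: m psi_of_int mult.commute)
  also have "\<dots> = (if int p dvd m then of_nat p else 0)" using p_pos by (rule sum_ee)
  also have "int p dvd m \<longleftrightarrow> z = 0" by (simp add: m of_int_eq_0_iff_char_dvd char)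
  finally show ?thesis .
qed

definition trace :: "nat \<Rightarrow> 'f \<Rightarrow> 'f" where
  "trace n z = (\<Sum>i<n. z ^ (p ^ i))"

lemma trace_frob_diff: "trace n z ^ p = trace n z + z ^ (p ^ n) - z"
proof -
  have "trace n z ^ p = (\<Sum>i<n. z ^ (p ^ Suc i))"
    unfolding trace_def by (subst ring_morphism.hom_sum[OF frob1_morphism]) (simp add: mult.commute flip: power_mult)
  also have "\<dots> = (\<Sum>i<Suc n. z ^ (p ^ i)) - z" by (subst sum.lessThan_Suc_shift) simp
  finally show ?thesis by (simp add: trace_def)
qed

lemma trace_gf: "z \<in> gf n \<Longrightarrow> trace n z \<in> gf 1"
  using trace_frob_diff[of n z] by (simp add: gf_def)

text \<open>Iterate y ^ p = y + z. For z in \<open>gf n\<close>, the solutions y all lie in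
  \<open>gf n\<close> or none does, according to whether the trace of z is 0.\<close>

lemma AS_power: assumes "y ^ p - y = z" shows "y ^ (p ^ n) = y + trace n (z :: 'f)"
proof (induction n)
  case (Suc n)
  have "y ^ (p ^ Suc n) = (y ^ p) ^ (p ^ n)" by (simp add: power_mult)
  also have "y ^ p = y + z" using assms by (simp add: algebra_simps)
  finally show ?case using Suc by (simp add: frob_add trace_def)
qed (simp add: trace_def)

lemma card_AS_roots: "card {y. y ^ p - y = (z::'f)} = p"
proof -
  define Q where "Q = Polynomial.monom (1::'f) p + [:- z, -1:]"
  have dQ: "degree Q = p"
    unfolding Q_def using p_gt_1 by (subst degree_add_eq_left) (auto simp: degree_monom_eq)
  have "poly (pderiv Q) x = -1" for x
    by (simp add: Q_def pderiv_add pderiv_monom poly_monom of_nat_p pderiv_pCons)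
  then have "card {x. poly Q x = 0} = degree Q"
    using dQ p_pos by (intro card_separable_roots) auto
  moreover have "{x. poly Q x = 0} = {y. y ^ p - y = z}" by (auto simp: Q_def poly_monom algebra_simps)
  ultimately show ?thesis using dQ by simp
qed

definition S :: "int poly \<Rightarrow> int \<Rightarrow> nat \<Rightarrow> complex" where
  "S h a n = (\<Sum>x\<in>gf n. psi a (trace n (ipe x h)))"

text \<open>The fibre over x has p points if the trace of h(x) is 0 and none otherwise, which the
  sum of all p characters at this trace detects. The trivial character contributes the p ^ n points
  of the line.\<close>

lemma affine_count:
  assumes n: "n > 0"
  shows "of_nat (card {(x, y). x \<in> gf n \<and> y \<in> gf n \<and> y ^ p - y = ipe x h}) =
    of_nat p ^ n + (\<Sum>a\<in>{1..<p}. S h (int a) n)"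
proof -
  have *: "of_nat (card {y \<in> gf n. y ^ p - y = ipe x h}) = (\<Sum>a<p. psi (int a) (trace n (ipe x h)))"
    if x: "x \<in> gf n" for x
  proof -
    have "{y \<in> gf n. y ^ p - y = ipe x h} = (if trace n (ipe x h) = 0 then {y. y ^ p - y = ipe x h} else {})"
      using AS_power[of _ "ipe x h" n] by (auto simp: gf_def)
    then show ?thesis using sum_psi[OF trace_gf[OF gf_ipe[OF x]]] by (simp add: card_AS_roots)
  qed
  have "{(x, y). x \<in> gf n \<and> y \<in> gf n \<and> y ^ p - y = ipe x h} = (SIGMA x:gf n. {y \<in> gf n. y ^ p - y = ipe x h})"
    by auto
  then have "of_nat (card {(x, y). x \<in> gf n \<and> y \<in> gf n \<and> y ^ p - y = ipe x h}) =
      (\<Sum>x\<in>gf n. of_nat (card {y \<in> gf n. y ^ p - y = ipe x h}) :: complex)"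
    using finite_gf[OF n] by (simp add: card_SigmaI)
  also have "\<dots> = (\<Sum>x\<in>gf n. \<Sum>a<p. psi (int a) (trace n (ipe x h)))" by (simp add: *)
  also have "\<dots> = (\<Sum>a<p. S h (int a) n)" unfolding S_def by (rule sum.swap)
  also have "{..<p} = insert 0 {1..<p}" using p_pos by auto
  also have "(\<Sum>a\<in>\<dots>. S h (int a) n) = S h 0 n + (\<Sum>a\<in>{1..<p}. S h (int a) n)" by simp
  also have "S h 0 n = of_nat p ^ n" using card_gf[OF n] by (simp add: S_def psi_def)
  finally show ?thesis .
qed

section \<open>Frobenius-stable multisets as effective divisors on the line\<close>

definition frobm :: "'f multiset \<Rightarrow> 'f multiset" where
  "frobm M = image_mset (\<lambda>x. x ^ p) M"

text \<open>These are the root multisets of the monic polynomials of degree n over F_p, that is, the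
  effective divisors of degree n on the affine line over F_p.\<close>

definition stab :: "nat \<Rightarrow> 'f multiset set" where
  "stab n = {M. size M = n \<and> frobm M = M}"

definition orb :: "nat \<Rightarrow> 'f \<Rightarrow> 'f multiset" where
  "orb j x = image_mset (\<lambda>i. x ^ (p ^ i)) (mset_set {..<j})"

lemma orb_0 [simp]: "orb 0 x = {#}"
  by (simp add: orb_def)

lemma orb_Suc: "orb (Suc j) x = add_mset (x ^ (p ^ j)) (orb j x)"
  by (simp add: orb_def lessThan_Suc)

lemma size_orb [simp]: "size (orb j x) = j"
  by (simp add: orb_def)

lemma orb_add: "orb (i + j) x = orb i x + orb j (x ^ (p ^ i))"
  by (induction j) (simp_all add: orb_Suc power_add power_mult)

lemma frobm_orb: "frobm (orb j x) = orb j (x ^ p)"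
  by (induction j) (simp_all add: orb_Suc frobm_def mult.commute flip: power_mult)

lemma frobm_orb_gf: "x \<in> gf j \<Longrightarrow> frobm (orb j x) = orb j x"
proof -
  assume x: "x \<in> gf j"
  have "orb (Suc 0 + j) x = add_mset x (orb j (x ^ p))" unfolding orb_add by (simp add: orb_Suc)
  moreover have "orb (Suc 0 + j) x = add_mset x (orb j x)" using x by (simp add: orb_Suc gf_def)
  ultimately show ?thesis by (simp add: frobm_orb)
qed

lemma count_frobm: "count (frobm M) (x ^ p) = count M x"
proof -
  have "inj (\<lambda>x::'f. x ^ p)" using frob_inj[of _ 1] by (auto intro: injI)
  then show ?thesis unfolding frobm_def
    by (induction M) (auto dest: injD)
qed

lemma count_stab: "M \<in> stab n \<Longrightarrow> count M (x ^ (p ^ i)) = count M x"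
proof (induction i)
  case (Suc i)
  have "count M ((x ^ (p ^ i)) ^ p) = count (frobm M) ((x ^ (p ^ i)) ^ p)" using Suc.prems by (simp add: stab_def)
  also have "\<dots> = count M x" using Suc by (simp only: count_frobm)
  finally show ?case by (simp add: mult.commute flip: power_mult)
qed simp

text \<open>If the Frobenius orbit of \<open>x\<close> has length \<open>e\<close>, then \<open>orb j x\<close> is defined over the prime field for
  \<open>j = e * t\<close> only, and it is then contained in \<open>M\<close> iff \<open>t \<le> count M x\<close>.\<close>

lemma card_orb_subset:
  assumes M: "M \<in> stab n"
  shows "card {j \<in> {1..n}. x \<in> gf j \<and> orb j x \<subseteq># M} = count M x"
proof (cases "x \<in># M")
  case False
  have "\<not> orb j x \<subseteq># M" if "j \<ge> 1" for j
  proof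
    assume "orb j x \<subseteq># M"
    moreover have "x \<in># orb j x" using that by (auto simp: orb_def intro!: image_eqI[of _ _ 0])
    ultimately show False using False mset_subset_eqD by metis
  qed
  then show ?thesis using False by (auto simp: not_in_iff)
next
  case True
  \<comment> \<open>The support of M is finite and closed under Frobenius, so two iterates of x
    coincide and x lies in a finite subfield.\<close>
  have "x ^ (p ^ i) \<in># M" for i using count_stab[OF M, of x i] True by (metis count_inI count_eq_zero_iff)
  then have "range (\<lambda>i. x ^ (p ^ i)) \<subseteq> set_mset M" by auto
  then have "\<not> inj (\<lambda>i. x ^ (p ^ i))" using finite_imageD finite_subset[OF _ finite_set_mset] infinite_UNIV_nat by blast
  then obtain i j where ij: "i < j" "x ^ (p ^ i) = x ^ (p ^ j)" unfolding inj_def by (metis linorder_neqE_nat)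
  have diff: "x \<in> gf (j - i)" if "i < j" "x ^ (p ^ i) = x ^ (p ^ j)" for i j
  proof -
    have "x ^ (p ^ j) = (x ^ (p ^ (j - i))) ^ (p ^ i)" using that by (simp flip: power_mult power_add)
    then have "(x ^ (p ^ (j - i))) ^ (p ^ i) = x ^ (p ^ i)" using that by simp
    then show ?thesis using frob_inj by (simp add: gf_def)
  qed
  define e where "e = (LEAST e. e > 0 \<and> x \<in> gf e)"
  have "\<exists>e. e > 0 \<and> x \<in> gf e" using diff[OF ij] ij by (intro exI[of _ "j - i"]) auto
  then have e: "e > 0" "x \<in> gf e" unfolding e_def by (metis (mono_tags, lifting) LeastI_ex)+
  have min: "x \<notin> gf k" if "0 < k" "k < e" for k using that not_less_Least[of k "\<lambda>e. e > 0 \<and> x \<in> gf e"] by (auto simp: e_def)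
  have gfe: "x \<in> gf (e * t)" for t
    by (induction t) (use e in \<open>simp_all add: gf_def power_add power_mult\<close>)
  have gf_iff: "x \<in> gf j \<longleftrightarrow> e dvd j" for j
  proof
    assume j: "x \<in> gf j"
    have "x ^ (p ^ j) = (x ^ (p ^ (e * (j div e)))) ^ (p ^ (j mod e))" by (simp flip: power_mult power_add)
    also have "\<dots> = x ^ (p ^ (j mod e))" using gfe by (simp add: gf_def)
    finally have "x \<in> gf (j mod e)" using j by (simp add: gf_def)
    then show "e dvd j" using min[of "j mod e"] e by (auto simp: dvd_eq_mod_eq_0)
  qed (use gfe in auto)
  have cnt: "count (orb (e * t) x) y = t * count (orb e x) y" for t y
  proof (induction t)
    case (Suc t)
    have "orb (e * Suc t) x = orb (e * t) x + orb e x"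
      using gfe[of t] orb_add[of "e * t" e x] by (simp add: gf_def add.commute)
    then show ?case using Suc by simp
  qed simp
  have "inj_on (\<lambda>i. x ^ (p ^ i)) {..<e}"
  proof (rule inj_onI)
    have *: False if "i < j" "j < e" "x ^ (p ^ i) = x ^ (p ^ j)" for i j
      using diff[OF that(1,3)] min[of "j - i"] that by auto
    fix i j assume "i \<in> {..<e}" "j \<in> {..<e}" "x ^ (p ^ i) = x ^ (p ^ j)"
    then show "i = j" using *[of i j] *[of j i] by (metis lessThan_iff linorder_neqE_nat)
  qed
  then have orbe: "orb e x = mset_set ((\<lambda>i. x ^ (p ^ i)) ` {..<e})" by (simp add: orb_def image_mset_mset_set)
  have x1: "count (orb e x) x = 1" using e by (auto simp: orbe count_mset_set' intro!: image_eqI[of _ _ 0])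
  have sub_iff: "orb (e * t) x \<subseteq># M \<longleftrightarrow> t \<le> count M x" for t
  proof
    assume "orb (e * t) x \<subseteq># M"
    then have "count (orb (e * t) x) x \<le> count M x" by (simp add: mset_subset_eq_count)
    then show "t \<le> count M x" by (simp add: cnt x1)
  next
    assume t: "t \<le> count M x"
    show "orb (e * t) x \<subseteq># M"
    proof (rule mset_subset_eqI)
      fix y show "count (orb (e * t) x) y \<le> count M y"
      proof (cases "y \<in> (\<lambda>i. x ^ (p ^ i)) ` {..<e}")
        case True
        then have "count M y = count M x" using count_stab[OF M] by auto
        moreover have "count (orb e x) y \<le> 1" by (simp add: orbe count_mset_set')
        ultimately show ?thesis using t by (metis cnt le_trans mult.right_neutral mult_le_mono2)
      qed (simp add: cnt orbe count_mset_set')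
    qed
  qed
  have "{j \<in> {1..n}. x \<in> gf j \<and> orb j x \<subseteq># M} = (\<lambda>t. e * t) ` {1..count M x}"
  proof (intro equalityI subsetI)
    fix j assume j: "j \<in> {j \<in> {1..n}. x \<in> gf j \<and> orb j x \<subseteq># M}"
    then obtain t where "j = e * t" using gf_iff by auto
    moreover from this j have "t \<ge> 1" "t \<le> count M x" using sub_iff[of t] by (cases t; simp)+
    ultimately show "j \<in> (\<lambda>t. e * t) ` {1..count M x}" by auto
  next
    fix j assume "j \<in> (\<lambda>t. e * t) ` {1..count M x}"
    then obtain t where t: "j = e * t" "t \<in> {1..count M x}" by (rule imageE)
    then have "t \<le> count M x" by simp
    then have "orb j x \<subseteq># M" by (simp add: sub_iff t)
    moreover from size_mset_mono[OF this] have "j \<le> n" using M by (simp add: stab_def)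
    ultimately show "j \<in> {j \<in> {1..n}. x \<in> gf j \<and> orb j x \<subseteq># M}" using t e gfe by (simp add: Suc_le_eq One_nat_def)
  qed
  moreover have "inj_on (\<lambda>t. e * t) {1..count M x}" using e by (auto intro: inj_onI)
  ultimately show ?thesis by (simp add: card_image)
qed

definition hm :: "int poly \<Rightarrow> 'f multiset \<Rightarrow> 'f" where
  "hm h M = (\<Sum>x\<in>#M. ipe x h)"

lemma hm_add: "hm h (M + N) = hm h M + hm h N"
  by (simp add: hm_def)

lemma hm_frobm: "hm h (frobm M) = hm h M ^ p"
proof -
  have "hm h M ^ p = (\<Sum>x\<in>#M. ipe x h ^ p)"
    unfolding hm_def by (induction M) (use p_pos frob_add[of _ _ 1] in \<open>simp_all add: power_0_left\<close>)
  then show ?thesis using frob_ipe[of _ h 1] by (simp add: hm_def frobm_def multiset.map_comp o_def)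
qed

lemma hm_gf: "frobm M = M \<Longrightarrow> hm h M \<in> gf 1"
  using hm_frobm[of h M] by (simp add: gf_def)

lemma hm_orb: "hm h (orb j x) = trace j (ipe x h)"
  by (simp add: hm_def orb_def trace_def frob_ipe multiset.map_comp o_def sum_unfold_sum_mset)

definition mpoly :: "nat \<Rightarrow> (nat \<Rightarrow> int) \<Rightarrow> 'f poly" where
  "mpoly n c = Polynomial.monom 1 n + (\<Sum>i\<in>{1..n}. Polynomial.monom (of_int (c i)) (n - i))"

lemma coeff_mpoly:
  "coeff (mpoly n c) k = (if k = n then 1 else if k < n then of_int (c (n - k)) else 0)"
proof -
  have "coeff (\<Sum>i\<in>{1..n}. Polynomial.monom (of_int (c i) :: 'f) (n - i)) k =
      (\<Sum>i\<in>{1..n}. if n - i = k then of_int (c i) else 0)"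
    by (simp add: coeff_sum)
  also have "\<dots> = (\<Sum>i\<in>{1..n}. if i = n - k \<and> k < n then of_int (c i) else 0)"
    by (intro sum.cong) auto
  also have "\<dots> = (if k < n then of_int (c (n - k)) else 0)"
    by (cases "k < n") (auto simp: sum.delta)
  finally show ?thesis by (auto simp: mpoly_def)
qed

lemma degree_mpoly: "degree (mpoly n c) = n"
  by (intro antisym degree_le le_degree) (simp_all add: coeff_mpoly)

lemma proots_mpoly_stab: "proots (mpoly n c) \<in> stab n"
proof -
  define M where "M = proots (mpoly n c)"
  have M: "(\<Prod>x\<in>#M. [:- x, 1:]) = mpoly n c"
    unfolding M_def by (rule monic_factorization) (simp add: degree_mpoly coeff_mpoly)
  have "size M = n" using M degree_linear_prod[of M] degree_mpoly by metis
  moreover have "frobm M = M"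
  proof -
    interpret fr: ring_morphism "\<lambda>x::'f. x ^ p" by (rule frob1_morphism)
    have "map_poly (\<lambda>x. x ^ p) [:- x, 1:] = [:- (x ^ p), 1:]" for x :: 'f
      using p_pos fr.hom_uminus[of x] by (simp add: map_poly_pCons power_0_left)
    then have "(\<Prod>x\<in>#frobm M. [:- x, 1:]) = map_poly (\<lambda>x. x ^ p) (\<Prod>x\<in>#M. [:- x, 1:])"
      by (simp add: fr.map_poly_prod_mset frobm_def multiset.map_comp o_def)
    also have "\<dots> = mpoly n c"
      unfolding M using p_pos gfD[OF gf_of_int, of _ 1]
      by (intro poly_eqI) (simp add: coeff_map_poly power_0_left coeff_mpoly)
    finally have "(\<Prod>x\<in>#frobm M. [:- x, 1:]) = (\<Prod>x\<in>#M. [:- x, 1:])" by (simp add: M)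
    then show ?thesis by (metis proots_linear_prod)
  qed
  ultimately show ?thesis by (simp add: stab_def M_def)
qed

text \<open>The monic polynomial of a stable multiset is fixed by Frobenius on its coefficients, so
  these lie in F_p; \<open>ind\<close> picks their representatives in 0..p-1.\<close>

lemma bij_stab: "bij_betw (\<lambda>c. proots (mpoly n c)) (cvecs p n) (stab n)"
proof (rule bij_betwI')
  fix c c' assume c: "c \<in> cvecs p n" and c': "c' \<in> cvecs p n"
  show "proots (mpoly n c) = proots (mpoly n c') \<longleftrightarrow> c = c'"
  proof
    assume "proots (mpoly n c) = proots (mpoly n c')"
    moreover have "(\<Prod>x\<in>#proots (mpoly n c). [:- x, 1:]) = mpoly n c" for c
      by (rule monic_factorization) (simp add: degree_mpoly coeff_mpoly)
    ultimately have eq: "mpoly n c = mpoly n c'" by metis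
    show "c = c'"
    proof
      fix i show "c i = c' i"
      proof (cases "i \<in> {1..n}")
        case True
        then have "n - i < n" "n - i \<noteq> n" "n - (n - i) = i" by auto
        then have "(of_int (c i) :: 'f) = of_int (c' i)"
          using arg_cong[OF eq, of "\<lambda>q. coeff q (n - i)"] by (simp add: coeff_mpoly)
        then have "[c i = c' i] (mod int p)" by (simp add: of_int_eq_iff_cong_CHAR char)
        moreover have "c i \<in> {0..<int p}" "c' i \<in> {0..<int p}" using c c' True by (auto simp: cvecs_def)
        ultimately show ?thesis by (simp add: cong_def)
      next
        case False
        then show ?thesis using c c' by (metis PiE_arb cvecs_def)
      qed
    qed
  qed simp
next
  fix c assume "c \<in> cvecs p n"
  show "proots (mpoly n c) \<in> stab n" by (rule proots_mpoly_stab)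
next
  fix M assume M: "M \<in> stab n"
  define Q where "Q = (\<Prod>x\<in>#M. [:- x, 1:])"
  have Q: "degree Q = n" "coeff Q n = 1" "proots Q = M"
    using M degree_linear_prod[of M] lead_coeff_linear_prod[of M] proots_linear_prod[of M]
    by (auto simp: Q_def stab_def)
  have gf: "coeff Q i \<in> gf 1" for i
  proof -
    interpret fr: ring_morphism "\<lambda>x::'f. x ^ p" by (rule frob1_morphism)
    have "map_poly (\<lambda>x. x ^ p) [:- x, 1:] = [:- (x ^ p), 1:]" for x :: 'f
      using p_pos fr.hom_uminus[of x] by (simp add: map_poly_pCons power_0_left)
    then have "(\<Prod>x\<in>#frobm M. [:- x, 1:]) = map_poly (\<lambda>x. x ^ p) Q"
      by (simp add: fr.map_poly_prod_mset frobm_def multiset.map_comp o_def Q_def)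
    then have "Q = map_poly (\<lambda>x. x ^ p) Q" using M by (simp add: stab_def Q_def)
    then have "coeff Q i = coeff Q i ^ p"
      using p_pos by (metis coeff_map_poly power_0_left neq0_conv)
    then show ?thesis by (simp add: gf_def)
  qed
  define c where "c = (\<lambda>i\<in>{1..n}. int (ind (coeff Q (n - i))))"
  have "c \<in> cvecs p n" using ind(1)[OF gf] by (auto simp: c_def cvecs_def)
  moreover have "mpoly n c = Q"
  proof (rule poly_eqI)
    fix k show "coeff (mpoly n c) k = coeff Q k"
      using Q ind(2)[OF gf] by (auto simp: coeff_mpoly c_def coeff_eq_0)
  qed
  ultimately show "\<exists>c\<in>cvecs p n. M = proots (mpoly n c)" using Q by auto
qed

lemma finite_stab: "finite (stab n)"
  using bij_betw_finite[OF bij_stab] by simp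

text \<open>Both sides satisfy the same recursion: the one defining \<open>psum\<close> is Newton's
  identity for the integer lifts \<open>cf\<close> of the coefficients, which are 0 beyond
  n.\<close>

lemma power_sum_mpoly: "(\<Sum>x\<in>#proots (mpoly n c). x ^ k) = of_int (psum n c k)"
proof (induction k rule: less_induct)
  case (less k)
  define M where "M = proots (mpoly n c)"
  have M: "(\<Prod>x\<in>#M. [:- x, 1:]) = mpoly n c"
    unfolding M_def by (rule monic_factorization) (simp add: degree_mpoly coeff_mpoly)
  have sM: "size M = n" using proots_mpoly_stab by (simp add: stab_def M_def)
  show ?case
  proof (cases "k = 0")
    case True
    then show ?thesis using sM by (simp add: psum.simps flip: M_def)
  next
    case False
    have C: "(if i \<le> size M then coeff (\<Prod>x\<in>#M. [:- x, 1:]) (size M - i) else 0) = of_int (cf n c i)"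
      if "i > 0" for i
      using that unfolding M sM by (auto simp: coeff_mpoly cf_def)
    have "(\<Sum>i\<in>{1..<k}. (if i \<le> size M then coeff (\<Prod>x\<in>#M. [:- x, 1:]) (size M - i) else 0) * (\<Sum>x\<in>#M. x ^ (k - i))) =
        (\<Sum>i\<in>{1..<k}. of_int (cf n c i) * of_int (psum n c (k - i)))"
      using less by (intro sum.cong refl) (simp add: C flip: M_def)
    then have "(\<Sum>x\<in>#M. x ^ k) = - (\<Sum>i\<in>{1..<k}. of_int (cf n c i) * of_int (psum n c (k - i))) - of_nat k * of_int (cf n c k)"
      using newton_identity[of k M] False by (simp add: C)
    also have "\<dots> = of_int (psum n c k)" using False by (subst (2) psum.simps) simp
    finally show ?thesis by (simp add: M_def)
  qed
qed

lemma sum_mset_sum_swap: "(\<Sum>x\<in>#M. \<Sum>i\<in>A. g i x) = (\<Sum>i\<in>A. \<Sum>x\<in>#M. g i x)"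
  by (induction M) (simp_all add: sum.distrib)

lemma hm_mpoly: "hm h (proots (mpoly n c)) = of_int (hsum h n c)"
proof -
  have "hm h (proots (mpoly n c)) = (\<Sum>x\<in>#proots (mpoly n c). \<Sum>i\<le>degree h. of_int (coeff h i) * x ^ i)"
    by (simp add: hm_def ipe_altdef)
  also have "\<dots> = (\<Sum>i\<le>degree h. of_int (coeff h i) * (\<Sum>x\<in>#proots (mpoly n c). x ^ i))"
    by (simp add: sum_mset_sum_swap sum_mset_distrib_left)
  finally show ?thesis by (simp add: power_sum_mpoly hsum_def)
qed

lemma expsum_stab: "expsum p h a n = (\<Sum>M\<in>stab n. psi a (hm h M))"
  unfolding expsum_def sum.reindex_bij_betw[OF bij_stab, symmetric] by (simp add: hm_mpoly psi_of_int)

text \<open>Removing \<open>orb j x\<close>, which is itself stable, is a bijection onto the stable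
  multisets of size n - j, and the character turns the additive \<open>hm\<close> into a
  product.\<close>

lemma sum_stab_orb:
  assumes j: "j \<le> n" and x: "x \<in> gf j"
  shows "(\<Sum>M | M \<in> stab n \<and> orb j x \<subseteq># M. psi a (hm h M)) = psi a (trace j (ipe x h)) * expsum p h a (n - j)"
proof -
  have fo: "frobm (orb j x) = orb j x" by (rule frobm_orb_gf[OF x])
  have "(\<Sum>M | M \<in> stab n \<and> orb j x \<subseteq># M. psi a (hm h M)) = (\<Sum>M\<in>stab (n - j). psi a (hm h (orb j x + M)))"
  proof (rule sum.reindex_bij_witness[of _ "\<lambda>M. orb j x + M" "\<lambda>M. M - orb j x"])
    fix M assume M: "M \<in> {M \<in> stab n. orb j x \<subseteq># M}"
    then show "orb j x + (M - orb j x) = M" by simp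
    have "frobm (M - orb j x) = M - orb j x"
      using M fo by (simp add: frobm_def image_mset_Diff stab_def)
    then show "M - orb j x \<in> stab (n - j)" using M by (simp add: stab_def size_Diff_submset)
    show "psi a (hm h (orb j x + (M - orb j x))) = psi a (hm h M)" using M by simp
  next
    fix M assume M: "M \<in> stab (n - j)"
    then show "orb j x + M \<in> {M \<in> stab n. orb j x \<subseteq># M}" using fo j by (simp add: stab_def frobm_def)
  qed simp
  also have "\<dots> = (\<Sum>M\<in>stab (n - j). psi a (trace j (ipe x h)) * psi a (hm h M))"
    using psi_add[OF trace_gf[OF gf_ipe[OF x]] hm_gf] by (intro sum.cong) (simp_all add: hm_add hm_orb stab_def)
  finally show ?thesis by (simp add: expsum_stab sum_distrib_left)
qed

text \<open>This is T L' / L = \<Sum> S j T ^ j, written coefficientwise. It follows by double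
  counting: a stable M of size n has exactly n pairs (j, x) with x in \<open>gf j\<close> and
  \<open>orb j x\<close> contained in M, because by \<open>card_orb_subset\<close> each x accounts
  for \<open>count M x\<close> of them.\<close>

theorem expsum_recurrence:
  "of_nat n * expsum p h a n = (\<Sum>j\<in>{1..n}. S h a j * expsum p h a (n - j))"
proof -
  have n: "of_nat n = (\<Sum>j\<in>{1..n}. of_nat (card {x \<in> gf j. orb j x \<subseteq># M}) :: complex)" if M: "M \<in> stab n" for M
  proof -
    have sub: "{x \<in> gf j. orb j x \<subseteq># M} = {x. x \<in> set_mset M \<and> x \<in> gf j \<and> orb j x \<subseteq># M}" if "j \<in> {1..n}" for j
    proof -
      have "x \<in># M" if "orb j x \<subseteq># M" for x
      proof -
        have "x \<in># orb j x" using \<open>j \<in> {1..n}\<close> by (auto simp: orb_def intro!: image_eqI[of _ _ 0])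
        then show ?thesis using that mset_subset_eqD by metis
      qed
      then show ?thesis by auto
    qed
    have "n = (\<Sum>x\<in>set_mset M. count M x)" using M by (simp add: stab_def size_multiset_overloaded_eq)
    also have "\<dots> = (\<Sum>x\<in>set_mset M. \<Sum>j | j \<in> {1..n} \<and> x \<in> gf j \<and> orb j x \<subseteq># M. 1)"
      by (subst card_orb_subset[OF M, symmetric]) simp
    also have "\<dots> = (\<Sum>j\<in>{1..n}. \<Sum>x | x \<in> set_mset M \<and> x \<in> gf j \<and> orb j x \<subseteq># M. 1)"
      by (rule sum.swap_restrict) auto
    also have "\<dots> = (\<Sum>j\<in>{1..n}. card {x \<in> gf j. orb j x \<subseteq># M})"
      using sub by (intro sum.cong) auto
    finally have "(of_nat n :: complex) = of_nat (\<Sum>j\<in>{1..n}. card {x \<in> gf j. orb j x \<subseteq># M})"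
      by (rule arg_cong)
    then show ?thesis by simp
  qed
  have "of_nat n * expsum p h a n = (\<Sum>M\<in>stab n. \<Sum>j\<in>{1..n}. of_nat (card {x \<in> gf j. orb j x \<subseteq># M}) * psi a (hm h M))"
    unfolding expsum_stab sum_distrib_left
  proof (intro sum.cong refl)
    fix M assume M: "M \<in> stab n"
    show "of_nat n * psi a (hm h M) = (\<Sum>j\<in>{1..n}. of_nat (card {x \<in> gf j. orb j x \<subseteq># M}) * psi a (hm h M))"
      by (simp only: n[OF M] sum_distrib_right)
  qed
  also have "\<dots> = (\<Sum>j\<in>{1..n}. \<Sum>M\<in>stab n. \<Sum>x | x \<in> gf j \<and> orb j x \<subseteq># M. psi a (hm h M))"
    by (simp only: sum_constant) (rule sum.swap)
  also have "\<dots> = (\<Sum>j\<in>{1..n}. \<Sum>x\<in>gf j. \<Sum>M | M \<in> stab n \<and> orb j x \<subseteq># M. psi a (hm h M))"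
    using finite_gf finite_stab by (intro sum.cong refl sum.swap_restrict) auto
  also have "\<dots> = (\<Sum>j\<in>{1..n}. S h a j * expsum p h a (n - j))"
    by (intro sum.cong refl) (simp add: sum_stab_orb S_def sum_distrib_right)
  finally show ?thesis .
qed

end

section \<open>Places of a function field\<close>

text \<open>A point in the sense of \<open>curve_points\<close>, for fields that are types, up to
  the values of \<phi> outside V. The elements of V that are 0 or have their inverse outside V are
  its nonunits.\<close>

definition is_place :: "'k::field set \<Rightarrow> ('k \<Rightarrow> 'f::field) \<Rightarrow> bool" where
  "is_place V \<phi> \<longleftrightarrow> V \<noteq> UNIV \<and> 1 \<in> V \<and> - 1 \<in> V \<and>
     (\<forall>a\<in>V. \<forall>b\<in>V. a + b \<in> V \<and> a * b \<in> V \<and> \<phi> (a + b) = \<phi> a + \<phi> b \<and> \<phi> (a * b) = \<phi> a * \<phi> b) \<and>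
     \<phi> 1 = 1 \<and> (\<forall>z. z \<noteq> 0 \<longrightarrow> z \<in> V \<or> inverse z \<in> V) \<and>
     (\<forall>z\<in>V. z = 0 \<or> inverse z \<notin> V \<longrightarrow> \<phi> z = 0)"

locale place =
  fixes V :: "'k::field set" and \<phi> :: "'k \<Rightarrow> 'f::field"
  assumes place: "is_place V \<phi>"
begin

lemma
  shows neq_UNIV: "V \<noteq> UNIV" and one: "1 \<in> V" "\<phi> 1 = 1"
    and add: "a \<in> V \<Longrightarrow> b \<in> V \<Longrightarrow> a + b \<in> V" "a \<in> V \<Longrightarrow> b \<in> V \<Longrightarrow> \<phi> (a + b) = \<phi> a + \<phi> b"
    and mult: "a \<in> V \<Longrightarrow> b \<in> V \<Longrightarrow> a * b \<in> V" "a \<in> V \<Longrightarrow> b \<in> V \<Longrightarrow> \<phi> (a * b) = \<phi> a * \<phi> b"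
    and nonunit: "z \<in> V \<Longrightarrow> z = 0 \<or> inverse z \<notin> V \<Longrightarrow> \<phi> z = 0"
  using place by (simp_all add: is_place_def) auto

lemma zero: "0 \<in> V" "\<phi> 0 = 0"
proof -
  have "- 1 \<in> V" using place by (simp add: is_place_def)
  then show "0 \<in> V" using add(1)[OF one(1), of "- 1"] by simp
  then show "\<phi> 0 = 0" using nonunit by blast
qed

lemma total: "z \<notin> V \<Longrightarrow> inverse z \<in> V"
  using place zero(1) unfolding is_place_def by (cases "z = 0") auto

lemma uminus: assumes "a \<in> V" shows "- a \<in> V" "\<phi> (- a) = - \<phi> a"
proof -
  have "- 1 \<in> V" using place by (simp add: is_place_def)
  then show *: "- a \<in> V" using mult(1)[OF assms, of "- 1"] by simp
  show "\<phi> (- a) = - \<phi> a" using add(2)[OF assms *] zero by (simp add: eq_neg_iff_add_eq_0 add.commute)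
qed

lemma diff: assumes "a \<in> V" "b \<in> V" shows "a - b \<in> V" "\<phi> (a - b) = \<phi> a - \<phi> b"
  using add[OF assms(1) uminus(1)[OF assms(2)]] uminus(2)[OF assms(2)] by simp_all

lemma power: assumes "a \<in> V" shows "a ^ n \<in> V" "\<phi> (a ^ n) = \<phi> a ^ n"
  by (induction n) (use assms in \<open>simp_all add: one mult\<close>)

lemma sum: assumes "\<And>x. x \<in> A \<Longrightarrow> f x \<in> V"
  shows "sum f A \<in> V" "\<phi> (sum f A) = (\<Sum>x\<in>A. \<phi> (f x))"
  using assms by (induction A rule: infinite_finite_induct) (simp_all add: zero add)

lemma of_nat: "of_nat n \<in> V" "\<phi> (of_nat n) = of_nat n"
  by (induction n) (simp_all add: zero one add)

lemma of_int: "of_int n \<in> V" "\<phi> (of_int n) = of_int n"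
  by (cases n; simp add: of_nat uminus diff one)+

lemma ipe: assumes "x \<in> V" shows "ipe x q \<in> V" "\<phi> (ipe x q) = ipe (\<phi> x) q"
  by (induction q) (use assms in \<open>simp_all add: zero add mult of_int\<close>)

lemma bev: assumes "x \<in> V" "y \<in> V" shows "bev x y q \<in> V" "\<phi> (bev x y q) = bev (\<phi> x) (\<phi> y) q"
  by (induction q) (use assms in \<open>simp_all add: zero add mult ipe\<close>)

lemma inv: assumes "z \<in> V" "\<phi> z \<noteq> 0"
  shows "z \<noteq> 0" "inverse z \<in> V" "\<phi> (inverse z) = inverse (\<phi> z)"
proof -
  show z: "z \<noteq> 0" and i: "inverse z \<in> V" using nonunit[OF assms(1)] assms(2) by auto
  have "\<phi> z * \<phi> (inverse z) = 1" using mult(2)[OF assms(1) i] z one by simp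
  then show "\<phi> (inverse z) = inverse (\<phi> z)" using assms(2) by (simp add: field_simps)
qed

lemma not_in: assumes "z \<notin> V" shows "z \<noteq> 0" "inverse z \<in> V" "\<phi> (inverse z) = 0"
  using assms zero total[OF assms] nonunit[of "inverse z"] by auto

lemma not_both: "z \<in> V \<Longrightarrow> inverse z \<in> V \<Longrightarrow> z \<noteq> 0 \<Longrightarrow> \<phi> (inverse z) \<noteq> 0"
  using mult(2)[of z "inverse z"] one by auto

lemma root_in: assumes "n > 0" "z ^ n \<in> V" shows "z \<in> V"
proof (rule ccontr)
  assume z: "z \<notin> V"
  then have "\<phi> (inverse z ^ n) = 0" using not_in[OF z] assms(1) by (simp add: power)
  moreover have "inverse z ^ n \<in> V" using not_in[OF z] by (simp add: power)
  moreover have "inverse z ^ n = inverse (z ^ n)" by (simp add: power_inverse)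
  ultimately show False using not_both[OF assms(2)] not_in[OF z] by simp
qed

end

text \<open>The graph of a place, \<open>G z c\<close> meaning that z is regular with value c. Local
  rings are easily given in this form, by fractions; \<open>total\<close> says that such a local
  ring is already a valuation ring.\<close>

locale place_graph =
  fixes G :: "'k::field \<Rightarrow> 'f::field \<Rightarrow> bool"
  assumes fn: "G z c \<Longrightarrow> G z c' \<Longrightarrow> c = c'"
    and one: "G 1 1" and minus_one: "G (- 1) (- 1)"
    and add: "G z c \<Longrightarrow> G z' c' \<Longrightarrow> G (z + z') (c + c')"
    and mult: "G z c \<Longrightarrow> G z' c' \<Longrightarrow> G (z * z') (c * c')"
    and total: "(\<exists>c. G z c) \<or> (z \<noteq> 0 \<and> G (inverse z) 0)"
    and proper: "\<exists>z. \<forall>c. \<not> G z c"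
    and inv: "G z c \<Longrightarrow> c \<noteq> 0 \<Longrightarrow> G (inverse z) (inverse c)"
begin

definition gdom :: "'k set" where "gdom = {z. \<exists>c. G z c}"
definition gval :: "'k \<Rightarrow> 'f" where "gval = (\<lambda>z\<in>gdom. THE c. G z c)"

lemma val: "G z c \<Longrightarrow> z \<in> gdom \<and> gval z = c"
  unfolding gdom_def gval_def by (auto intro: fn)

lemma domD: "z \<in> gdom \<Longrightarrow> G z (gval z)"
  using val gdom_def by fastforce

lemma place_dom: "is_place gdom gval"
  unfolding is_place_def
proof (intro conjI ballI allI impI)
  show "gdom \<noteq> UNIV" using proper by (auto simp: gdom_def)
  show "1 \<in> gdom" "- 1 \<in> gdom" "gval 1 = 1" using val[OF one] val[OF minus_one] by auto
  fix z assume "z \<noteq> (0 :: 'k)"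
  then show "z \<in> gdom \<or> inverse z \<in> gdom" using total[of z] by (auto simp: gdom_def)
next
  fix a b assume ab: "a \<in> gdom" "b \<in> gdom"
  show "a + b \<in> gdom" "gval (a + b) = gval a + gval b" using val[OF add[OF ab[THEN domD]]] by auto
  show "a * b \<in> gdom" "gval (a * b) = gval a * gval b" using val[OF mult[OF ab[THEN domD]]] by auto
next
  fix z assume z: "z \<in> gdom" "z = 0 \<or> inverse z \<notin> gdom"
  show "gval z = 0"
  proof (rule ccontr)
    assume nz: "gval z \<noteq> 0"
    from val[OF inv[OF domD[OF z(1)] nz]] z have "z = 0" by auto
    moreover have "G 0 0" using add[OF one minus_one] by simp
    ultimately show False using val nz by auto
  qed
qed

text \<open>Valuation rings are maximal for domination: an element of V outside the domain of G
  would have its inverse mapped to 0 by G, hence by \<phi>, which is impossible for a unit of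
  V.\<close>

lemma unique:
  assumes "is_place V \<phi>" "\<phi> \<in> extensional V" and G: "\<And>z c. G z c \<Longrightarrow> z \<in> V \<and> \<phi> z = c"
  shows "V = gdom" "\<phi> = gval"
proof -
  interpret V: place V \<phi> by unfold_locales fact
  show *: "V = gdom"
  proof (intro equalityI subsetI)
    fix z assume z: "z \<in> V"
    show "z \<in> gdom"
    proof (rule ccontr)
      assume "z \<notin> gdom"
      then have "z \<noteq> 0" "G (inverse z) 0" using total[of z] by (auto simp: gdom_def)
      then show False using G[of "inverse z" 0] V.not_both[OF z] by auto
    qed
  qed (use G in \<open>auto simp: gdom_def\<close>)
  show "\<phi> = gval"
  proof
    fix z show "\<phi> z = gval z"
    proof (cases "z \<in> gdom")
      case True
      then show ?thesis using G[OF domD[OF True]] by simp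
    next
      case False
      then show ?thesis using assms(2) * by (simp add: gval_def extensional_def)
    qed
  qed
qed

end

section \<open>Points of the Artin-Schreier curve\<close>

text \<open>A bivariate polynomial is an element of \<open>\<int>[x][y]\<close>; \<open>x\<close> has weight \<open>p\<close> and \<open>y\<close> has weight \<open>d\<close>,
  which are their pole orders at infinity.\<close>

definition mon :: "int \<Rightarrow> nat \<Rightarrow> nat \<Rightarrow> int poly poly" where
  "mon c a i = Polynomial.monom (Polynomial.monom c a) i"

lemma coeff_mon: "coeff (coeff (mon c a i) j) b = (if i = j \<and> a = b then c else 0)"
  by (simp add: mon_def)

lemma bev_mon [simp]: "bev x y (mon c a i) = of_int c * x ^ a * y ^ i"
  by (simp add: mon_def)

lemma sum_mon: "U = (\<Sum>i\<le>degree U. \<Sum>j\<le>degree (coeff U i). mon (coeff (coeff U i) j) j i)"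
proof -
  have "U = (\<Sum>i\<le>degree U. Polynomial.monom (coeff U i) i)" by (simp add: poly_as_sum_of_monoms)
  also have "\<dots> = (\<Sum>i\<le>degree U. Polynomial.monom (\<Sum>j\<le>degree (coeff U i). Polynomial.monom (coeff (coeff U i) j) j) i)"
    by (simp add: poly_as_sum_of_monoms)
  finally show ?thesis by (simp add: mon_def monom_sum)
qed

lemma coeff_mult_top:
  assumes "degree P \<le> m" "degree Q \<le> n"
  shows "coeff (P * Q) (m + n) = coeff P m * coeff Q n"
proof -
  have "coeff (P * Q) (m + n) = (\<Sum>i\<le>m + n. coeff P i * coeff Q (m + n - i))" by (rule coeff_mult)
  also have "\<dots> = (\<Sum>i\<in>{m}. coeff P i * coeff Q (m + n - i))"
  proof (rule sum.mono_neutral_right)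
    show "\<forall>i\<in>{..m + n} - {m}. coeff P i * coeff Q (m + n - i) = 0"
    proof
      fix i assume "i \<in> {..m + n} - {m}"
      then have "i > m \<or> m + n - i > n" by auto
      then show "coeff P i * coeff Q (m + n - i) = 0" using assms by (auto simp: coeff_eq_0)
    qed
  qed auto
  finally show ?thesis by simp
qed

locale weighted =
  fixes p d :: nat and h :: "int poly"
  assumes p: "prime p" and deg_h: "degree h = d" and monic: "lead_coeff h = 1"
    and d_pos: "d \<ge> 1" and coprime: "coprime d p"
begin

lemma p_gt_1: "p > 1" using p by (rule prime_gt_1_nat)

definition W :: "nat \<Rightarrow> int poly poly \<Rightarrow> bool" where
  "W m U \<longleftrightarrow> (\<forall>i j. coeff (coeff U i) j \<noteq> 0 \<longrightarrow> p * j + d * i \<le> m)"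

text \<open>Substituting T ^ p for x and T ^ d for y makes the leading coefficient at infinity of an
  element of weight m the coefficient of T ^ m. As the substitution is a ring homomorphism, symbols
  add and multiply.\<close>

definition sym :: "int poly poly \<Rightarrow> int poly" where
  "sym U = bev (Polynomial.monom 1 p) (Polynomial.monom 1 d) U"

definition s :: "nat \<Rightarrow> int poly poly \<Rightarrow> int" where
  "s m U = coeff (sym U) m"

lemma s_add: "s m (U + V) = s m U + s m V" and s_diff: "s m (U - V) = s m U - s m V"
  by (simp_all add: s_def sym_def)

lemma s_sum: "s m (sum f A) = (\<Sum>x\<in>A. s m (f x))"
  by (simp add: s_def sym_def coeff_sum)

lemma sym_mon: "sym (mon c a i) = Polynomial.monom c (p * a + d * i)"
  by (simp add: sym_def monom_power mult_monom of_int_poly flip: monom_0)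

lemma s_mon: "s m (mon c a i) = (if p * a + d * i = m then c else 0)"
  by (simp add: s_def sym_mon)

lemma s_altdef: "s m U = (\<Sum>i\<le>degree U. \<Sum>j\<le>degree (coeff U i). if p * j + d * i = m then coeff (coeff U i) j else 0)"
  by (subst sum_mon) (simp add: s_sum s_mon)

lemma W_0: "W m 0" and W_mon: "p * a + d * i \<le> m \<Longrightarrow> W m (mon c a i)"
  by (auto simp: W_def coeff_mon split: if_splits)

lemma W_add: "W m U \<Longrightarrow> W m V \<Longrightarrow> W m (U + V)"
  unfolding W_def by (metis coeff_add add_0)

lemma W_mono: "W m U \<Longrightarrow> m \<le> n \<Longrightarrow> W n U"
  unfolding W_def using le_trans by blast

lemma W_mult: assumes "W m U" "W n V" shows "W (m + n) (U * V)"
  unfolding W_def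
proof (intro allI impI)
  fix k l assume "coeff (coeff (U * V) k) l \<noteq> 0"
  then have "(\<Sum>i\<le>k. \<Sum>j\<le>l. coeff (coeff U i) j * coeff (coeff V (k - i)) (l - j)) \<noteq> 0"
    by (simp add: coeff_mult coeff_sum)
  then obtain i where i: "i \<le> k" "(\<Sum>j\<le>l. coeff (coeff U i) j * coeff (coeff V (k - i)) (l - j)) \<noteq> 0"
    by (metis (no_types, lifting) atMost_iff sum.not_neutral_contains_not_neutral)
  then obtain j where j: "j \<le> l" "coeff (coeff U i) j * coeff (coeff V (k - i)) (l - j) \<noteq> 0"
    by (metis (no_types, lifting) atMost_iff sum.not_neutral_contains_not_neutral)
  then have "p * j + d * i \<le> m" "p * (l - j) + d * (k - i) \<le> n" using assms by (auto simp: W_def)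
  moreover have "p * j + p * (l - j) = p * l" "d * i + d * (k - i) = d * k"
    using i(1) j(1) by (simp_all flip: distrib_left)
  ultimately show "p * l + d * k \<le> m + n" by linarith
qed

lemma degree_sym: assumes "W m U" shows "degree (sym U) \<le> m"
proof -
  have "sym U = (\<Sum>i\<le>degree U. \<Sum>j\<le>degree (coeff U i). sym (mon (coeff (coeff U i) j) j i))"
    by (subst sum_mon) (simp add: sym_def)
  also have "degree \<dots> \<le> m"
  proof (intro degree_sum_le)
    fix i j
    show "degree (sym (mon (coeff (coeff U i) j) j i)) \<le> m"
      using assms degree_monom_le[of "coeff (coeff U i) j" "p * j + d * i"]
      by (cases "coeff (coeff U i) j = 0") (auto simp: sym_mon W_def intro: le_trans)
  qed auto
  finally show ?thesis .
qed

lemma s_mult: "W m U \<Longrightarrow> W n V \<Longrightarrow> s (m + n) (U * V) = s m U * s n V"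
  using coeff_mult_top[OF degree_sym degree_sym] by (simp add: s_def sym_def)

lemma s_gt: "W m U \<Longrightarrow> m < n \<Longrightarrow> s n U = 0"
  using degree_sym[of m U] by (simp add: s_def coeff_eq_0)

lemma s_witness: assumes "s m U \<noteq> 0" obtains i j where "p * j + d * i = m"
proof -
  have "\<exists>i j. p * j + d * i = m"
  proof (rule ccontr)
    assume "\<not> ?thesis"
    then have "s m U = 0" unfolding s_altdef by simp
    with assms show False by simp
  qed
  with that show ?thesis by blast
qed

definition F :: "int poly poly" where
  "F = mon 1 0 p - mon 1 0 1 - [:h:]"

lemma bev_F: "bev x y F = y ^ p - y - ipe x h"
  by (simp add: F_def)

definition reducible :: "nat \<Rightarrow> int poly poly \<Rightarrow> int \<Rightarrow> bool" where
  "reducible m U c \<longleftrightarrow> (\<exists>R G. U = R + F * G \<and> degree R < p \<and> W m R \<and> s m R = c)"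

lemma reducible_add: "reducible m U c \<Longrightarrow> reducible m U' c' \<Longrightarrow> reducible m (U + U') (c + c')"
  unfolding reducible_def
proof (elim exE conjE)
  fix R G R' G'
  assume "U = R + F * G" "degree R < p" "W m R" "s m R = c"
    "U' = R' + F * G'" "degree R' < p" "W m R'" "s m R' = c'"
  then show "\<exists>R G. U + U' = R + F * G \<and> degree R < p \<and> W m R \<and> s m R = c + c'"
    by (intro exI[of _ "R + R'"] exI[of _ "G + G'"]) (auto simp: algebra_simps degree_add_less W_add s_add)
qed

lemma reducible_0: "reducible m 0 0"
  unfolding reducible_def using p_gt_1
  by (intro exI[of _ 0]) (auto simp: W_0 s_def sym_def)

lemma reducible_sum: "(\<And>x. x \<in> A \<Longrightarrow> reducible m (f x) (g x)) \<Longrightarrow> reducible m (sum f A) (sum g A)"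
  by (induction A rule: infinite_finite_induct) (auto intro: reducible_0 reducible_add)

lemma reducible_F: "reducible m U c \<Longrightarrow> reducible m (U + F * G) c"
  unfolding reducible_def by (metis add.assoc distrib_left)

text \<open>Replacing \<open>y ^ p\<close> by \<open>y + h\<close> changes neither the weight nor the symbol, as \<open>h\<close> is monic.\<close>

lemma reducible_mon: "p * a + d * i \<le> m \<Longrightarrow> reducible m (mon c a i) (s m (mon c a i))"
proof (induction i arbitrary: a c rule: less_induct)
  case (less i)
  show ?case
  proof (cases "i < p")
    case True
    have "degree (mon c a i) < p" using True degree_monom_le[of "Polynomial.monom c a" i] by (simp add: mon_def)
    then show ?thesis unfolding reducible_def using W_mon[OF less.prems]
      by (intro exI[of _ "mon c a i"] exI[of _ 0]) auto
  next
    case False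
    define j where "j = i - p"
    have i: "i = j + p" using False by (simp add: j_def)
    have mm: "mon a b c * mon a' b' c' = mon (a * a') (b + b') (c + c')" for a b c a' b' c'
      by (simp add: mon_def mult_monom)
    have hs: "[:h:] = (\<Sum>k\<le>d. mon (coeff h k) k 0)"
      unfolding mon_def monom_sum[symmetric] deg_h[symmetric] by (simp only: poly_as_sum_of_monoms monom_0)
    have "mon c a i = mon c a (j + 1) + [:h:] * mon c a j + F * mon c a j"
      unfolding F_def i by (simp add: left_diff_distrib mm add_ac)
    also have "[:h:] * mon c a j = (\<Sum>k\<le>d. mon (coeff h k * c) (a + k) j)"
      unfolding hs sum_distrib_right by (simp add: mm add_ac)
    finally have eq: "mon c a i = mon c a (j + 1) + (\<Sum>k\<le>d. mon (coeff h k * c) (a + k) j) + F * mon c a j" .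
    have w1: "p * a + d * (j + 1) < p * a + d * i"
      using d_pos p_gt_1 by (simp add: i)
    have w2: "p * (a + k) + d * j \<le> p * a + d * i \<and> (k < d \<longrightarrow> p * (a + k) + d * j < p * a + d * i)" if "k \<le> d" for k
      using that p_gt_1 by (simp add: i distrib_left mult.commute)
    have r: "reducible m (mon c a (j + 1) + (\<Sum>k\<le>d. mon (coeff h k * c) (a + k) j))
      (s m (mon c a (j + 1)) + (\<Sum>k\<le>d. s m (mon (coeff h k * c) (a + k) j)))"
    proof (intro reducible_add reducible_sum less.IH)
      show "j + 1 < i" using p_gt_1 by (simp add: i)
      show "p * a + d * (j + 1) \<le> m" using w1 less.prems by linarith
      fix k assume k: "k \<in> {..d}"
      then show "p * (a + k) + d * j \<le> m" using w2[of k] less.prems by simp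
      show "j < i" using p_gt_1 by (simp add: i)
    qed
    have c: "s m (mon c a (j + 1)) + (\<Sum>k\<le>d. s m (mon (coeff h k * c) (a + k) j)) = s m (mon c a i)"
    proof -
      have "p * a + d * (j + 1) \<noteq> m" using w1 less.prems by linarith
      then have "s m (mon c a (j + 1)) = 0" by (simp add: s_mon)
      moreover have "(\<Sum>k<d. s m (mon (coeff h k * c) (a + k) j)) = 0"
      proof (intro sum.neutral ballI)
        fix k assume "k \<in> {..<d}"
        then have "p * (a + k) + d * j \<noteq> m" using w2[of k] less.prems by auto
        then show "s m (mon (coeff h k * c) (a + k) j) = 0" by (simp add: s_mon)
      qed
      moreover have "p * (a + d) + d * j = p * a + d * i" by (simp add: i algebra_simps)
      ultimately show ?thesis using monic deg_h by (simp add: s_mon flip: lessThan_Suc_atMost)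
    qed
    show ?thesis using reducible_F[OF r, of "mon c a j"] by (simp only: c eq[symmetric])
  qed
qed

lemma reduction:
  assumes "W m U"
  obtains R G where "U = R + F * G" "degree R < p" "W m R" "s m R = s m U"
proof -
  have "reducible m (\<Sum>i\<le>degree U. \<Sum>j\<le>degree (coeff U i). mon (coeff (coeff U i) j) j i)
     (\<Sum>i\<le>degree U. \<Sum>j\<le>degree (coeff U i). s m (mon (coeff (coeff U i) j) j i))"
  proof (intro reducible_sum)
    fix i j
    show "reducible m (mon (coeff (coeff U i) j) j i) (s m (mon (coeff (coeff U i) j) j i))"
    proof (cases "coeff (coeff U i) j = 0")
      case True
      have "mon 0 j i = 0" by (simp add: mon_def)
      then show ?thesis using True reducible_0 by (simp add: s_def sym_def)
    next
      case False
      then show ?thesis using assms by (intro reducible_mon) (auto simp: W_def)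
    qed
  qed
  moreover have "(\<Sum>i\<le>degree U. \<Sum>j\<le>degree (coeff U i). s m (mon (coeff (coeff U i) j) j i)) = s m U"
    by (subst (5) sum_mon) (simp add: s_sum)
  ultimately have "reducible m U (s m U)" by (simp only: sum_mon[symmetric])
  with that show ?thesis unfolding reducible_def by blast
qed

lemma W_exists: "\<exists>m. W m U"
proof -
  have "W (\<Sum>i\<le>degree U. \<Sum>j\<le>degree (coeff U i). p * j + d * i) U"
    unfolding W_def
  proof (intro allI impI)
    fix i j assume "coeff (coeff U i) j \<noteq> 0"
    then have "j \<le> degree (coeff U i)" "coeff U i \<noteq> 0" by (auto intro: le_degree)
    moreover from this have "i \<le> degree U" by (intro le_degree)
    ultimately have "p * j + d * i \<le> (\<Sum>j\<le>degree (coeff U i). p * j + d * i)"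
        "(\<Sum>j\<le>degree (coeff U i). p * j + d * i) \<le> (\<Sum>i\<le>degree U. \<Sum>j\<le>degree (coeff U i). p * j + d * i)"
      by (auto intro: member_le_sum[of j _ "\<lambda>j. p * j + d * i"]
        member_le_sum[of i _ "\<lambda>i. \<Sum>j\<le>degree (coeff U i). p * j + d * i"])
    then show "p * j + d * i \<le> (\<Sum>i\<le>degree U. \<Sum>j\<le>degree (coeff U i). p * j + d * i)" by linarith
  qed
  then show ?thesis by blast
qed

lemma reduction': obtains R G where "U = R + F * G" "degree R < p"
  using W_exists reduction by metis

definition pdvd :: "int poly poly \<Rightarrow> bool" where
  "pdvd U \<longleftrightarrow> (\<forall>i j. int p dvd coeff (coeff U i) j)"

lemma pdvdE: assumes "pdvd U" obtains U' where "U = Polynomial.smult [:int p:] U'"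
proof -
  define U' where "U' = map_poly (map_poly (\<lambda>c. c div int p)) U"
  have "U = Polynomial.smult [:int p:] U'"
    by (intro poly_eqI) (use assms in \<open>simp add: U'_def coeff_map_poly pdvd_def\<close>)
  with that show ?thesis by blast
qed

lemma pdvd_bev: "pdvd U \<Longrightarrow> of_nat p = (0 :: 'r::comm_ring_1) \<Longrightarrow> bev x y U = (0 :: 'r)"
  by (elim pdvdE) simp

lemma pdvd_s: "pdvd U \<Longrightarrow> int p dvd s m U"
  by (elim pdvdE) (simp add: s_def sym_def of_nat_poly)

text \<open>Two distinct monomials of \<open>y\<close>-degree less than \<open>p\<close> have different weights.\<close>

lemma symbol_nonzero:
  assumes R: "degree R < p" "\<not> pdvd R"
  obtains m R' where "W m R'" "\<not> int p dvd s m R'" "pdvd (R - R')" "degree R' < p"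
proof -
  \<comment> \<open>With residues in 0..p-1 as coefficients, the top weight of R' is attained by a
    term that survives modulo p.\<close>
  define R' where "R' = map_poly (map_poly (\<lambda>c. c mod int p)) R"
  have cR': "coeff (coeff R' i) j = coeff (coeff R i) j mod int p" for i j
    by (simp add: R'_def coeff_map_poly)
  have dR': "degree R' < p" 
    by (rule le_less_trans[OF degree_le R(1)]) (simp add: R'_def coeff_map_poly coeff_eq_0)
  define A where "A = {(i, j). coeff (coeff R' i) j \<noteq> 0}"
  have "A \<subseteq> (SIGMA i:{..degree R'}. {..degree (coeff R' i)})"
  proof
    fix x assume "x \<in> A"
    then obtain i j where x: "x = (i, j)" "coeff (coeff R' i) j \<noteq> 0" by (auto simp: A_def)
    then have "j \<le> degree (coeff R' i)" "coeff R' i \<noteq> 0" by (auto intro: le_degree)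
    with x show "x \<in> (SIGMA i:{..degree R'}. {..degree (coeff R' i)})" by (auto intro: le_degree)
  qed
  then have fin: "finite A" by (rule finite_subset) auto
  obtain i j where "\<not> int p dvd coeff (coeff R i) j" using R(2) by (auto simp: pdvd_def)
  then have "coeff (coeff R i) j mod int p \<noteq> 0" by (meson mod_0_imp_dvd)
  then have "(i, j) \<in> A" by (simp only: A_def cR' mem_Collect_eq case_prod_conv simp_thms)
  then have "A \<noteq> {}" by blast
  define wt where "wt = (\<lambda>(i, j). p * j + d * i)"
  define m where "m = Max (wt ` A)"
  have Wm: "W m R'" unfolding W_def
  proof (intro allI impI)
    fix i j assume "coeff (coeff R' i) j \<noteq> 0"
    then have "wt (i, j) \<in> wt ` A" by (auto simp: A_def)
    then have "wt (i, j) \<le> m" unfolding m_def using fin by (intro Max_ge) auto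
    then show "p * j + d * i \<le> m" by (simp add: wt_def)
  qed
  have "m \<in> wt ` A" unfolding m_def using fin \<open>A \<noteq> {}\<close> by (intro Max_in) auto
  then obtain a b where ab: "coeff (coeff R' a) b \<noteq> 0" "p * b + d * a = m" by (auto simp: A_def wt_def)
  have uniq: "i = a \<and> j = b" if "coeff (coeff R' i) j \<noteq> 0" "p * j + d * i = m" for i j
  proof -
    have lt: "i < p" "a < p"
      using that(1) ab(1) dR' by (metis coeff_0 le_degree le_less_trans)+
    have "[d * i = d * a] (mod p)" using that(2) ab(2) unfolding cong_def by (metis mod_mult_self4)
    then have "[i = a] (mod p)" using coprime by (simp add: cong_mult_lcancel_nat)
    then have "i = a" using lt by (simp add: cong_def)
    then show ?thesis using that(2) ab(2) p_gt_1 by auto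
  qed
  have "s m R' = (\<Sum>i\<le>degree R'. \<Sum>j\<le>degree (coeff R' i). if i = a \<and> j = b then coeff (coeff R' a) b else 0)"
    unfolding s_altdef using uniq ab(2) by (intro sum.cong refl) (auto split: if_splits)
  also have "\<dots> = (\<Sum>i\<le>degree R'. if i = a then coeff (coeff R' a) b else 0)"
    using ab(1) by (intro sum.cong refl) (auto simp: le_degree)
  also have "\<dots> = coeff (coeff R' a) b"
    using ab(1) by (auto simp: not_le coeff_eq_0)
  finally have "\<not> int p dvd s m R'" using ab(1) by (simp add: cR' mod_eq_0_iff_dvd dvd_mod_iff)
  moreover have "pdvd (R - R')" by (simp add: pdvd_def cR')
  ultimately show ?thesis using that Wm dR' by blast
qed

end

text \<open>The function field by generators: every element is a quotient of polynomials in \<xi>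
  and \<eta>, and \<open>kernel\<close> says that the powers of \<eta> below p are independent over
  F_p[\<xi>]. This separates the study of places from the construction of the field.\<close>

locale AS_field = weighted p d h for p d :: nat and h :: "int poly" +
  fixes \<xi> \<eta> :: "'k::field"
  assumes charK: "of_nat p = (0 :: 'k)"
    and eq_AS: "\<eta> ^ p - \<eta> = ipe \<xi> h"
    and quotients: "\<exists>U V. bev \<xi> \<eta> V \<noteq> 0 \<and> z * bev \<xi> \<eta> V = bev \<xi> \<eta> U"
    and kernel: "degree U < p \<Longrightarrow> bev \<xi> \<eta> U = 0 \<Longrightarrow> pdvd U"
begin

lemma p_pos: "p > 0" using p_gt_1 by simp

text \<open>The remainder of U modulo F vanishes modulo p by \<open>kernel\<close>. So every
  solution of the equation in characteristic p defines a homomorphism from the coordinate ring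
  F_p[\<xi>, \<eta>].\<close>

lemma kernel_point:
  assumes U: "bev \<xi> \<eta> U = 0" and r: "of_nat p = (0 :: 'r::comm_ring_1)" "y ^ p - y = ipe (x :: 'r) h"
  shows "bev x y U = 0"
proof -
  obtain R G where RG: "U = R + F * G" "degree R < p" by (rule reduction')
  have "bev \<xi> \<eta> R = 0" using U eq_AS by (simp add: RG bev_F)
  then have "bev x y R = 0" using kernel[OF RG(2)] pdvd_bev[OF _ r(1)] by blast
  then show ?thesis using r(2) by (simp add: RG bev_F)
qed

lemma kernel_symbol:
  assumes U: "bev \<xi> \<eta> U = 0" "W m U"
  shows "int p dvd s m U"
proof -
  obtain R G where RG: "U = R + F * G" "degree R < p" "W m R" "s m R = s m U" using reduction[OF U(2)] .
  have "bev \<xi> \<eta> R = 0" using U eq_AS by (simp add: RG bev_F)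
  then show ?thesis using kernel[OF RG(2)] pdvd_s RG(4) by metis
qed

text \<open>A suitable representative of a nonzero element of F_p[\<xi>, \<eta>] has a top-weight
  symbol that is nonzero modulo p; this weight is the pole order at infinity.\<close>

lemma nonzero_symbol:
  assumes "bev \<xi> \<eta> U \<noteq> 0"
  obtains m U' where "W m U'" "bev \<xi> \<eta> U' = bev \<xi> \<eta> U" "\<not> int p dvd s m U'"
proof -
  obtain R G where RG: "U = R + F * G" "degree R < p" by (rule reduction')
  have R: "bev \<xi> \<eta> R = bev \<xi> \<eta> U" using eq_AS by (simp add: RG bev_F)
  have "\<not> pdvd R"
  proof
    assume "pdvd R"
    then show False using pdvd_bev[OF _ charK, of R \<xi> \<eta>] assms R by simp
  qed
  from symbol_nonzero[OF RG(2) this] obtain m R' where R': "W m R'" "\<not> int p dvd s m R'" "pdvd (R - R')"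
    by blast
  have "bev \<xi> \<eta> R' = bev \<xi> \<eta> U" using pdvd_bev[OF R'(3) charK, of \<xi> \<eta>] R by simp
  with that R' show ?thesis by blast
qed

lemma charK_eq: "CHAR('k) = p"
proof -
  have "CHAR('k) dvd p" using charK by (simp add: of_nat_eq_0_iff_char_dvd)
  then show ?thesis using p by (metis CHAR_not_1' One_nat_def prime_nat_iff)
qed

lemma frobK_morphism: "ring_morphism (\<lambda>x::'k. x ^ (p ^ n))"
proof
  show "(a + b :: 'k) ^ (p ^ n) = a ^ (p ^ n) + b ^ (p ^ n)" for a b
    by (rule freshmans_dream') (simp_all add: charK_eq p)
qed (simp_all add: power_mult_distrib)

lemma frobK_bev: "bev x y U ^ (p ^ n) = bev (x ^ (p ^ n)) (y ^ (p ^ n)) U" for x y :: 'k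
proof -
  interpret fr: ring_morphism "\<lambda>x::'k. x ^ (p ^ n)" by (rule frobK_morphism)
  have ip: "ipe x q ^ (p ^ n) = ipe (x ^ (p ^ n)) q" for q
  proof (induction q)
    case (pCons a q)
    then show ?case using fr.hom_add[of "of_int a" "x * ipe x q"] fr.hom_of_int[of a]
      by (simp add: power_mult_distrib)
  qed (use fr.hom_zero in simp)
  show ?thesis
  proof (induction U)
    case (pCons a U)
    then show ?case using fr.hom_add[of "ipe x a" "y * bev x y U"] by (simp add: power_mult_distrib ip)
  qed (use fr.hom_zero in simp)
qed

lemma frobK_ipe: "ipe x q ^ (p ^ n) = ipe (x ^ (p ^ n)) q" for x :: 'k
  using frobK_bev[of x 0 "[:q:]" n] p_pos by simp

text \<open>The norm of \<open>U (\<xi>, \<eta>)\<close> is \<open>\<Prod>c<p. U (\<xi>, \<eta> + c)\<close>; it is invariant under \<open>\<eta> \<mapsto> \<eta> + 1\<close> and hence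
  lies in \<open>\<bbbF>\<^sub>p[\<xi>]\<close>.\<close>

lemma eq_shift: "(\<eta> + of_nat c) ^ p - (\<eta> + of_nat c) = ipe \<xi> h"
proof -
  interpret fr: ring_morphism "\<lambda>x::'k. x ^ (p ^ 1)" by (rule frobK_morphism)
  have "(\<eta> + of_nat c) ^ p = \<eta> ^ p + of_nat c"
    using fr.hom_add[of \<eta> "of_nat c"] fr.hom_of_nat[of c] by (simp only: power_one_right)
  then show ?thesis using eq_AS by simp
qed

definition shift :: "nat \<Rightarrow> int poly poly \<Rightarrow> int poly poly" where
  "shift c U = pcompose U [:of_nat c, 1:]"

lemma bev_shift: "bev x y (shift c U) = bev x (y + of_nat c) U"
  by (induction U) (simp_all add: shift_def pcompose_pCons algebra_simps)

lemma shift_monom: "shift 1 (Polynomial.monom q k) = Polynomial.smult q ([:1, 1:] ^ k)"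
  by (induction k) (simp_all add: shift_def monom_0 monom_Suc pcompose_pCons)

lemma shift_nonzero: assumes "bev \<xi> \<eta> U \<noteq> 0" shows "bev \<xi> (\<eta> + of_nat c) U \<noteq> 0"
proof
  assume "bev \<xi> (\<eta> + of_nat c) U = 0"
  then have "bev \<xi> \<eta> (shift c U) = 0" by (simp add: bev_shift)
  \<comment> \<open>Shifting by (p - 1) c as well undoes the shift by c, as p c = 0.\<close>
  from kernel_point[OF this charK eq_shift[of "(p - 1) * c"]]
  have "bev \<xi> (\<eta> + of_nat ((p - 1) * c) + of_nat c) U = 0" by (simp add: bev_shift)
  moreover have "(p - 1) * c + c = p * c" using p_pos by (cases p) auto
  then have "of_nat ((p - 1) * c) + of_nat c = (of_nat (p * c) :: 'k)" by (simp only: of_nat_add[symmetric])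
  ultimately show False using assms charK by (simp add: add.assoc)
qed

lemma norm_exists:
  assumes u: "bev \<xi> \<eta> U \<noteq> 0"
  obtains V g where "bev \<xi> \<eta> V * bev \<xi> \<eta> U = ipe \<xi> g" "ipe \<xi> g \<noteq> 0"
proof -
  define V where "V = (\<Prod>c\<in>{1..<p}. shift c U)"
  have N: "bev \<xi> \<eta> (V * U) = (\<Prod>c<p. bev \<xi> (\<eta> + of_nat c) U)"
  proof -
    have "{..<p} = insert 0 {1..<p}" using p_pos by auto
    then show ?thesis by (simp add: V_def bev_shift mult.commute)
  qed
  obtain R G where RG: "V * U = R + F * G" "degree R < p" by (rule reduction')
  have R: "bev \<xi> \<eta> R = bev \<xi> \<eta> (V * U)" using eq_AS by (simp add: RG bev_F)
  have inv: "bev \<xi> (\<eta> + 1) (V * U) = bev \<xi> \<eta> (V * U)"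
  proof -
    have "bev \<xi> (\<eta> + 1) (V * U) = (\<Prod>c<p. bev \<xi> (\<eta> + of_nat (Suc c)) U)"
    proof -
      have "{..<p} = insert 0 {1..<p}" using p_pos by auto
      then show ?thesis by (simp add: V_def bev_shift mult.commute add_ac)
    qed
    also have "\<dots> = (\<Prod>c\<in>Suc ` {..<p}. bev \<xi> (\<eta> + of_nat c) U)" by (simp add: prod.reindex)
    also have "Suc ` {..<p} = insert p {1..<p}" using p_pos by (subst image_Suc_lessThan) auto
    also have "(\<Prod>c\<in>insert p {1..<p}. bev \<xi> (\<eta> + of_nat c) U) = (\<Prod>c\<in>insert 0 {1..<p}. bev \<xi> (\<eta> + of_nat c) U)"
      by (simp add: charK)
    also have "insert 0 {1..<p} = {..<p}" using p_pos by auto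
    finally show ?thesis using N by simp
  qed
  have "bev \<xi> (\<eta> + 1) R = bev \<xi> \<eta> R"
  proof -
    have "bev \<xi> (\<eta> + 1) F = 0" using eq_shift[of 1] by (simp add: bev_F)
    then have "bev \<xi> (\<eta> + 1) (V * U) = bev \<xi> (\<eta> + 1) R"
      unfolding RG(1) by (simp only: bev_simps mult_zero_left add_0_right)
    then show ?thesis using inv R by (simp only:)
  qed
  then have "bev \<xi> \<eta> (shift 1 R - R) = 0" by (simp add: bev_shift)
  moreover have dsR: "degree (shift 1 R) \<le> degree R"
    using degree_pcompose_le[of R "[:of_nat 1, 1:]"] by (simp add: shift_def)
  then have "degree (shift 1 R - R) < p"
    using RG(2) by (intro degree_diff_less) linarith+
  ultimately have dvd: "pdvd (shift 1 R - R)" by (rule kernel[rotated])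
  have cs: "coeff (shift 1 R) j = (\<Sum>k\<le>degree R. of_nat (k choose j) * coeff R k)" for j
  proof -
    have "shift 1 R = shift 1 (\<Sum>k\<le>degree R. Polynomial.monom (coeff R k) k)"
      by (simp only: poly_as_sum_of_monoms)
    also have "\<dots> = (\<Sum>k\<le>degree R. shift 1 (Polynomial.monom (coeff R k) k))"
      by (simp only: shift_def pcompose_sum)
    also have "\<dots> = (\<Sum>k\<le>degree R. Polynomial.smult (coeff R k) ([:1, 1:] ^ k))"
      by (simp only: shift_monom)
    finally have "coeff (shift 1 R) j = (\<Sum>k\<le>degree R. coeff R k * coeff ([:1, 1:] ^ k) j)"
      by (simp add: coeff_sum)
    also have "\<dots> = (\<Sum>k\<le>degree R. of_nat (k choose j) * coeff R k)"
    proof (intro sum.cong refl)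
      fix k
      show "coeff R k * coeff ([:1, 1:] ^ k) j = of_nat (k choose j) * coeff R k"
        by (cases "j \<le> k")
          (auto simp: coeff_linear_poly_power coeff_eq_0 degree_linear_power not_le binomial_eq_0 mult.commute)
    qed
    finally show ?thesis .
  qed
  \<comment> \<open>If e is the largest positive index at which the coefficient of x ^ l survives
    modulo p, then in R(y + 1) - R(y) the coefficient at y ^ (e - 1) is e times it modulo p; as e <
    p, this contradicts the invariance.\<close>
  have high: "int p dvd coeff (coeff R i) l" if "i \<ge> 1" for i l
  proof (rule ccontr)
    assume nd: "\<not> int p dvd coeff (coeff R i) l"
    define I where "I = {i. i \<ge> 1 \<and> \<not> int p dvd coeff (coeff R i) l}"
    have I: "I \<subseteq> {..degree R}" 
    proof
      fix i assume "i \<in> I"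
      then have "coeff R i \<noteq> 0" by (auto simp: I_def)
      then show "i \<in> {..degree R}" by (simp add: le_degree)
    qed
    then have fI: "finite I" by (rule finite_subset) simp
    define e where "e = Max I"
    have "i \<in> I" using nd that by (simp add: I_def)
    then have eI: "e \<in> I" unfolding e_def using fI by (intro Max_in) auto
    then have e: "1 \<le> e" "e \<le> degree R" "\<not> int p dvd coeff (coeff R e) l" using I by (auto simp: I_def)
    have gt: "int p dvd coeff (coeff R k) l" if "k > e" for k
    proof (rule ccontr)
      assume "\<not> int p dvd coeff (coeff R k) l"
      then have "k \<in> I" using that e(1) by (simp add: I_def)
      then have "k \<le> e" unfolding e_def using fI by (rule Max_ge[rotated])
      then show False using that by simp
    qed
    have "int p dvd coeff (coeff (shift 1 R - R) (e - 1)) l" using dvd by (simp add: pdvd_def)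
    also have "coeff (coeff (shift 1 R - R) (e - 1)) l =
        (\<Sum>k\<le>degree R. int (k choose (e - 1)) * coeff (coeff R k) l) - coeff (coeff R (e - 1)) l"
      by (simp add: cs coeff_sum of_nat_poly)
    also have "{..degree R} = insert (e - 1) (insert e ({..<e - 1} \<union> {e<..degree R}))" using e by auto
    also have "(\<Sum>k\<in>\<dots>. int (k choose (e - 1)) * coeff (coeff R k) l) - coeff (coeff R (e - 1)) l =
        int e * coeff (coeff R e) l + (\<Sum>k\<in>{e<..degree R}. int (k choose (e - 1)) * coeff (coeff R k) l)"
    proof -
      have "(\<Sum>k\<in>{..<e - 1} \<union> {e<..degree R}. int (k choose (e - 1)) * coeff (coeff R k) l) =
          (\<Sum>k\<in>{e<..degree R}. int (k choose (e - 1)) * coeff (coeff R k) l)"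
        by (rule sum.mono_neutral_right) (auto simp: binomial_eq_0)
      moreover have "e choose (e - 1) = e" using e(1) by (cases e) auto
      moreover have "e - 1 \<notin> insert e ({..<e - 1} \<union> {e<..degree R})" "e \<notin> {..<e - 1} \<union> {e<..degree R}"
        "finite ({..<e - 1} \<union> {e<..degree R})" using e(1) by auto
      ultimately show ?thesis by (simp only: sum.insert finite_insert simp_thms) simp
    qed
    finally have "int p dvd int e * coeff (coeff R e) l"
      using gt by (subst (asm) dvd_add_left_iff) (auto intro!: dvd_sum)
    moreover have "\<not> int p dvd int e" using e RG(2) by (auto dest!: dvd_imp_le)
    ultimately show False using e(3) p by (simp add: prime_dvd_mult_iff)
  qed
  have "pdvd (R - [:coeff R 0:])"
    unfolding pdvd_def
  proof (intro allI)
    fix i j show "int p dvd coeff (coeff (R - [:coeff R 0:]) i) j" using high[of i j] by (cases i) auto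
  qed
  from pdvd_bev[OF this charK, of \<xi> \<eta>] have "bev \<xi> \<eta> R \<in> range (ipe \<xi>)" by simp
  then obtain g where "bev \<xi> \<eta> (V * U) = ipe \<xi> g" using R by auto
  moreover have "bev \<xi> \<eta> (V * U) \<noteq> 0" unfolding N using shift_nonzero[OF u] by simp
  ultimately show ?thesis using that[of V g] by simp
qed

end

locale AS_curve = AS_field p d h \<xi> \<eta> + f: alg_closed_char p T
  for p d :: nat and h :: "int poly" and \<xi> \<eta> :: "'k::field" and T :: "'f::alg_closed_field itself"
begin

lemma charF: "of_nat p = (0 :: 'f)" by (rule f.of_nat_p)

lemma of_int_eq_0F: "of_int c = (0 :: 'f) \<longleftrightarrow> int p dvd c"
  by (simp add: of_int_eq_0_iff_char_dvd f.char)

lemma eval_cong: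
  assumes "bev \<xi> \<eta> U = bev \<xi> \<eta> V" "of_nat p = (0 :: 'r::comm_ring_1)" "y ^ p - y = ipe (x :: 'r) h"
  shows "bev x y U = bev x y V"
  using kernel_point[of "U - V", OF _ assms(2,3)] assms(1) by simp

section \<open>The local rings at the affine points\<close>

definition ufp :: "nat \<Rightarrow> int poly poly" where
  "ufp N = [:Polynomial.monom 1 (p ^ N) - Polynomial.monom 1 1:]"

lemma bev_ufp: "bev x y (ufp N) = x ^ (p ^ N) - x"
  by (simp add: ufp_def)

lemma ufp_nonzero: assumes "N > 0" shows "bev \<xi> \<eta> (ufp N) \<noteq> 0"
proof
  assume "bev \<xi> \<eta> (ufp N) = 0"
  then have "pdvd (ufp N)" using p_pos by (intro kernel) (simp_all add: ufp_def)
  then have "int p dvd coeff (coeff (ufp N) 0) (p ^ N)" by (simp only: pdvd_def)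
  moreover have "1 < p ^ N" using p_gt_1 assms by (simp add: one_less_power)
  ultimately show False using p_gt_1 by (simp add: ufp_def)
qed

text \<open>Congruence modulo X ^ (p ^ N) - X, for elements of the field. The multiplier G has to be
  a polynomial: with quotients any two elements would be congruent when N > 0.\<close>

definition eqm :: "nat \<Rightarrow> 'k \<Rightarrow> 'k \<Rightarrow> bool" where
  "eqm N a b \<longleftrightarrow> (\<exists>G. a - b = bev \<xi> \<eta> (ufp N * G))"

lemma eqm_refl: "eqm N a a"
  unfolding eqm_def by (intro exI[of _ 0]) simp

lemma eqm_trans: "eqm N a b \<Longrightarrow> eqm N b c \<Longrightarrow> eqm N a c"
  unfolding eqm_def
proof (elim exE)
  fix G H assume "a - b = bev \<xi> \<eta> (ufp N * G)" "b - c = bev \<xi> \<eta> (ufp N * H)"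
  then have "a - c = bev \<xi> \<eta> (ufp N * (G + H))" by (simp add: algebra_simps)
  then show "\<exists>G. a - c = bev \<xi> \<eta> (ufp N * G)" ..
qed

lemma eqm_add: "eqm N a b \<Longrightarrow> eqm N a' b' \<Longrightarrow> eqm N (a + a') (b + b')"
  unfolding eqm_def
proof (elim exE)
  fix G H assume "a - b = bev \<xi> \<eta> (ufp N * G)" "a' - b' = bev \<xi> \<eta> (ufp N * H)"
  then have "a + a' - (b + b') = bev \<xi> \<eta> (ufp N * (G + H))" by (simp add: algebra_simps)
  then show "\<exists>G. a + a' - (b + b') = bev \<xi> \<eta> (ufp N * G)" ..
qed

text \<open>In a a' - b b' = a (a' - b') + (a - b) b' only the factors a and b' have to lie in the
  coordinate ring.\<close>

lemma eqm_mult: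
  assumes "eqm N a b" "eqm N a' b'" "a = bev \<xi> \<eta> A" "b' = bev \<xi> \<eta> B"
  shows "eqm N (a * a') (b * b')"
proof -
  obtain G H where "a - b = bev \<xi> \<eta> (ufp N * G)" "a' - b' = bev \<xi> \<eta> (ufp N * H)"
    using assms by (auto simp: eqm_def)
  then have "a * a' - b * b' = bev \<xi> \<eta> (ufp N * (A * H + G * B))"
    unfolding assms(3,4) by (simp add: algebra_simps)
  then show ?thesis unfolding eqm_def ..
qed

lemma eqm_power: "eqm N (bev \<xi> \<eta> A) (bev \<xi> \<eta> B) \<Longrightarrow> eqm N (bev \<xi> \<eta> A ^ n) (bev \<xi> \<eta> B ^ n)"
proof (induction n)
  case (Suc n)
  have "bev \<xi> \<eta> B ^ n = bev \<xi> \<eta> (B ^ n)" by simp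
  from eqm_mult[OF Suc.prems Suc.IH[OF Suc.prems] refl this] show ?case by simp
qed (simp add: eqm_refl)

lemma eqm_bev:
  assumes "eqm N (bev \<xi> \<eta> A) (bev \<xi> \<eta> A')" "eqm N (bev \<xi> \<eta> B) (bev \<xi> \<eta> B')"
  shows "eqm N (bev (bev \<xi> \<eta> A) (bev \<xi> \<eta> B) U) (bev (bev \<xi> \<eta> A') (bev \<xi> \<eta> B') U)"
proof -
  have ip: "\<exists>C. ipe (bev \<xi> \<eta> A) q = bev \<xi> \<eta> C" for A q
  proof (induction q)
    case (pCons a q)
    then obtain C where "ipe (bev \<xi> \<eta> A) q = bev \<xi> \<eta> C" by blast
    then show ?case by (intro exI[of _ "of_int a + A * C"]) simp
  qed (auto intro: exI[of _ 0])
  have bv: "\<exists>C. bev (bev \<xi> \<eta> A) (bev \<xi> \<eta> B) U = bev \<xi> \<eta> C" for A B U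
  proof (induction U)
    case (pCons q U)
    then obtain C where "bev (bev \<xi> \<eta> A) (bev \<xi> \<eta> B) U = bev \<xi> \<eta> C" by blast
    moreover obtain C' where "ipe (bev \<xi> \<eta> A) q = bev \<xi> \<eta> C'" using ip by blast
    ultimately show ?case by (intro exI[of _ "C' + B * C"]) simp
  qed (auto intro: exI[of _ 0])
  have ip_eq: "eqm N (ipe (bev \<xi> \<eta> A) q) (ipe (bev \<xi> \<eta> A') q)" for q
  proof (induction q)
    case (pCons a q)
    obtain C where "ipe (bev \<xi> \<eta> A') q = bev \<xi> \<eta> C" using ip by blast
    from eqm_mult[OF assms(1) pCons.IH refl this] show ?case by (simp add: eqm_add eqm_refl)
  qed (simp add: eqm_refl)
  show ?thesis
  proof (induction U)
    case (pCons q U)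
    obtain C where "bev (bev \<xi> \<eta> A') (bev \<xi> \<eta> B') U = bev \<xi> \<eta> C" using bv by blast
    from eqm_mult[OF assms(2) pCons.IH refl this] show ?case by (simp add: eqm_add ip_eq)
  qed (simp add: eqm_refl)
qed

text \<open>The reduced ring \<open>\<bbbF>\<^sub>p[X, Y] / (X ^ (p ^ N) - X)\<close> is fixed elementwise by the \<open>p * N\<close>-fold Frobenius
  map. So \<open>X ^ (p ^ N) - X\<close> is a uniformizer at all points over \<open>\<bbbF>\<^bsub>p ^ N\<^esub>\<close>: if \<open>u\<close> vanishes at one
  of them then it divides \<open>u * (u ^ (Q - 1) - 1)\<close>, whose second factor does not vanish there.\<close>

lemma eqm_frob: "eqm N (bev \<xi> \<eta> U ^ (p ^ (N * p))) (bev \<xi> \<eta> U)"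
proof -
  \<comment> \<open>The trace of h(\<xi>), for which \<eta> ^ (p ^ N) = \<eta> + t. Modulo X ^ (p ^
    N) - X it is fixed by Frobenius, as its two ends h(\<xi>) ^ (p ^ N) and h(\<xi>) agree.\<close>
  define t where "t = (\<Sum>j<N. mon 1 0 0 * [:h:] ^ (p ^ j))"
  have t: "bev \<xi> \<eta> t = (\<Sum>j<N. ipe \<xi> h ^ (p ^ j))" by (simp add: t_def)
  have x: "eqm N (\<xi> ^ (p ^ N)) \<xi>"
    unfolding eqm_def by (intro exI[of _ 1]) (simp add: bev_ufp)
  have bx: "\<xi> = bev \<xi> \<eta> (mon 1 1 0)" "\<eta> = bev \<xi> \<eta> (mon 1 0 1)" by simp_all
  have xk: "eqm N (\<xi> ^ (p ^ (N * k))) \<xi>" for k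
  proof (induction k)
    case (Suc k)
    have "eqm N ((\<xi> ^ (p ^ N)) ^ (p ^ (N * k))) (\<xi> ^ (p ^ (N * k)))"
      using eqm_power[of N "mon 1 (p ^ N) 0" "mon 1 1 0" "p ^ (N * k)"] x by simp
    from eqm_trans[OF this Suc] show ?case by (simp add: power_add power_mult mult.commute[of p] flip: power_mult)
  qed (simp add: eqm_refl)
  have y: "\<eta> ^ (p ^ i) = \<eta> + (\<Sum>j<i. ipe \<xi> h ^ (p ^ j))" for i
  proof (induction i)
    case (Suc i)
    interpret fr: ring_morphism "\<lambda>x::'k. x ^ (p ^ i)" by (rule frobK_morphism)
    have "\<eta> ^ (p ^ Suc i) = (\<eta> ^ p) ^ (p ^ i)" by (simp add: power_mult)
    also have "\<eta> ^ p = \<eta> + ipe \<xi> h" using eq_AS by (simp add: algebra_simps)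
    also have "(\<eta> + ipe \<xi> h) ^ (p ^ i) = \<eta> ^ (p ^ i) + ipe \<xi> h ^ (p ^ i)" by (rule fr.hom_add)
    finally show ?case using Suc by simp
  qed simp
  have tp: "eqm N (bev \<xi> \<eta> t ^ (p ^ i)) (bev \<xi> \<eta> t)" for i
  proof (induction i)
    case (Suc i)
    have "eqm N (bev \<xi> \<eta> t ^ p) (bev \<xi> \<eta> t)"
    proof -
      interpret fr: ring_morphism "\<lambda>x::'k. x ^ (p ^ 1)" by (rule frobK_morphism)
      have "bev \<xi> \<eta> t ^ p = (\<Sum>j<N. (ipe \<xi> h ^ (p ^ j)) ^ p)"
        using fr.hom_sum[of "\<lambda>j. ipe \<xi> h ^ (p ^ j)" "{..<N}"] by (simp add: t)
      also have "\<dots> = (\<Sum>j<N. ipe \<xi> h ^ (p ^ Suc j))" by (simp add: mult.commute flip: power_mult)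
      also have "\<dots> = (\<Sum>j<Suc N. ipe \<xi> h ^ (p ^ j)) - ipe \<xi> h" by (subst sum.lessThan_Suc_shift) simp
      finally have "bev \<xi> \<eta> t ^ p = bev \<xi> \<eta> t + (ipe (\<xi> ^ (p ^ N)) h - ipe \<xi> h)" by (simp add: t frobK_ipe)
      moreover obtain G where "ipe (\<xi> ^ (p ^ N)) h - ipe \<xi> h = bev \<xi> \<eta> (ufp N * G)"
        using eqm_bev[of N "mon 1 (p ^ N) 0" "mon 1 1 0" 0 0 "[:h:]"] x eqm_refl[of N 0] by (auto simp: eqm_def)
      ultimately show ?thesis by (auto simp: eqm_def)
    qed
    from eqm_power[of N "t ^ p" t "p ^ i"] this have "eqm N ((bev \<xi> \<eta> t ^ p) ^ (p ^ i)) (bev \<xi> \<eta> t ^ (p ^ i))"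
      by simp
    from eqm_trans[OF this Suc] show ?case by (simp add: power_mult)
  qed (simp add: eqm_refl)
  \<comment> \<open>Each round of N Frobenius steps adds t, so p rounds add p t = 0; this is the
    origin of the exponent N * p.\<close>
  have yk: "eqm N (\<eta> ^ (p ^ (N * k))) (\<eta> + of_nat k * bev \<xi> \<eta> t)" for k
  proof (induction k)
    case (Suc k)
    interpret fr: ring_morphism "\<lambda>x::'k. x ^ (p ^ N)" by (rule frobK_morphism)
    have "eqm N ((\<eta> ^ (p ^ (N * k))) ^ (p ^ N)) ((\<eta> + of_nat k * bev \<xi> \<eta> t) ^ (p ^ N))"
      using eqm_power[of N "mon 1 0 (p ^ (N * k))" "mon 1 0 1 + of_nat k * t" "p ^ N"] Suc by simp
    also have "(\<eta> ^ (p ^ (N * k))) ^ (p ^ N) = \<eta> ^ (p ^ (N * Suc k))" by (simp add: power_add mult.commute flip: power_mult)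
    also have "(\<eta> + of_nat k * bev \<xi> \<eta> t) ^ (p ^ N) = (\<eta> + bev \<xi> \<eta> t) + of_nat k * bev \<xi> \<eta> t ^ (p ^ N)"
      using fr.hom_add[of \<eta> "of_nat k * bev \<xi> \<eta> t"] fr.hom_of_nat[of k] y[of N] by (simp add: power_mult_distrib t)
    finally have 1: "eqm N (\<eta> ^ (p ^ (N * Suc k))) ((\<eta> + bev \<xi> \<eta> t) + of_nat k * bev \<xi> \<eta> t ^ (p ^ N))" .
    have "eqm N (bev \<xi> \<eta> (of_nat k) * bev \<xi> \<eta> t ^ (p ^ N)) (bev \<xi> \<eta> (of_nat k) * bev \<xi> \<eta> t)"
      by (rule eqm_mult[OF eqm_refl tp refl refl])
    then have "eqm N ((\<eta> + bev \<xi> \<eta> t) + of_nat k * bev \<xi> \<eta> t ^ (p ^ N)) ((\<eta> + bev \<xi> \<eta> t) + of_nat k * bev \<xi> \<eta> t)"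
      by (intro eqm_add eqm_refl) simp
    from eqm_trans[OF 1 this] show ?case by (simp add: algebra_simps)
  qed (simp add: eqm_refl)
  have yp: "eqm N (\<eta> ^ (p ^ (N * p))) \<eta>" using yk[of p] charK by simp
  have "eqm N (bev (\<xi> ^ (p ^ (N * p))) (\<eta> ^ (p ^ (N * p))) U) (bev \<xi> \<eta> U)"
    using eqm_bev[of N "mon 1 (p ^ (N * p)) 0" "mon 1 1 0" "mon 1 0 (p ^ (N * p))" "mon 1 0 1" U] xk[of p] yp by simp
  then show ?thesis by (simp add: frobK_bev)
qed

lemma vanishing_multiple:
  fixes x y :: 'f
  assumes N: "N > 0" and U: "bev x y U = 0"
  obtains B A where "bev x y B \<noteq> 0" "bev \<xi> \<eta> B * bev \<xi> \<eta> U = bev \<xi> \<eta> (ufp N) * bev \<xi> \<eta> A"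
proof -
  define Q where "Q = p ^ (N * p)"
  define B where "B = U ^ (Q - 1) - 1"
  obtain A where A: "bev \<xi> \<eta> U ^ Q - bev \<xi> \<eta> U = bev \<xi> \<eta> (ufp N * A)"
    using eqm_frob[of N U] by (auto simp: eqm_def Q_def)
  have Q: "Q > 1" using N p_gt_1 p_pos by (simp add: Q_def one_less_power)
    have "bev \<xi> \<eta> U ^ Q = bev \<xi> \<eta> U ^ (Q - 1) * bev \<xi> \<eta> U" using Q by (simp flip: power_Suc2)
    then have "bev \<xi> \<eta> B * bev \<xi> \<eta> U = bev \<xi> \<eta> (ufp N) * bev \<xi> \<eta> A"
      using A by (simp add: B_def algebra_simps)
    moreover have "bev x y B = - 1" using U Q by (simp add: B_def power_0_left)
    ultimately show ?thesis using that[of B A] by simp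
qed

definition bar :: "int poly \<Rightarrow> 'f poly" where
  "bar q = map_poly of_int q"

lemma bar_morphism: "ring_morphism bar"
  unfolding bar_def
  by standard (simp_all add: ring_morphism.map_poly_mult[OF of_int_morphism] map_poly_1' poly_eq_iff coeff_map_poly)

lemma poly_bar: "poly (bar q) x = ipe x q"
  by (simp add: bar_def ipe_def pev_def)

lemma bar_eq_0_iff: "bar q = 0 \<longleftrightarrow> (\<forall>i. int p dvd coeff q i)"
  by (auto simp: poly_eq_iff bar_def coeff_map_poly of_int_eq_0F)

lemma ipe_nonzero_bar: assumes "ipe \<xi> g \<noteq> 0" shows "bar g \<noteq> 0"
proof
  assume "bar g = 0"
  then have "pdvd [:g:]" by (auto simp: bar_eq_0_iff pdvd_def coeff_pCons split: nat.splits)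
  then show False using pdvd_bev[OF _ charK, of "[:g:]" \<xi> \<eta>] assms by simp
qed

text \<open>Reduce A and B to y-degree below p and compare coefficients of y ^ i: (X - x) ^ e
  divides g times each coefficient of B. If e exceeded the order of g at x, all these coefficients
  would vanish at x, and with them B at (x, y).\<close>

lemma multiplicity_bound:
  assumes N: "x ^ (p ^ N) = (x :: 'f)" "y ^ p - y = ipe x h" and B: "bev x y B \<noteq> 0" and g: "ipe \<xi> g \<noteq> 0"
    and eq: "bev \<xi> \<eta> B * ipe \<xi> g = bev \<xi> \<eta> (ufp N) ^ e * bev \<xi> \<eta> A"
  shows "e \<le> order x (bar g)"
proof (rule ccontr)
  assume e: "\<not> ?thesis"
  interpret bar: ring_morphism bar by (rule bar_morphism)
  obtain R G where RG: "B = R + F * G" "degree R < p" by (rule reduction')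
  obtain R' G' where RG': "A = R' + F * G'" "degree R' < p" by (rule reduction')
  define w where "w = Polynomial.monom (1::int) (p ^ N) - Polynomial.monom 1 1"
  define T where "T = Polynomial.smult g R - Polynomial.smult (w ^ e) R'"
  have "degree T < p" unfolding T_def
    using RG(2) RG'(2) degree_smult_le[of g R] degree_smult_le[of "w ^ e" R'] by (intro degree_diff_less) linarith+
  moreover have "bev \<xi> \<eta> T = 0"
  proof -
    have "bev \<xi> \<eta> R = bev \<xi> \<eta> B" "bev \<xi> \<eta> R' = bev \<xi> \<eta> A" using eq_AS by (simp_all add: RG RG' bev_F)
    moreover have "ipe \<xi> w = bev \<xi> \<eta> (ufp N)" by (simp add: w_def ufp_def)
    ultimately show ?thesis using eq by (simp add: T_def mult.commute)
  qed
  ultimately have T: "pdvd T" by (rule kernel)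
  have "ipe x (coeff R i) = 0" for i
  proof -
    have "bar (coeff T i) = 0" using T by (simp add: bar_eq_0_iff pdvd_def)
    then have b: "bar g * bar (coeff R i) = bar w ^ e * bar (coeff R' i)"
      by (simp add: T_def bar.hom_diff bar.hom_mult bar.hom_power)
    have "poly (bar w) x = 0" using N by (simp add: poly_bar w_def)
    then have "[:- x, 1:] dvd bar w" by (simp add: poly_eq_0_iff_dvd)
    then have "[:- x, 1:] ^ e dvd bar g * bar (coeff R i)" unfolding b by (intro dvd_mult2 dvd_power_same)
    moreover have "bar g \<noteq> 0" by (rule ipe_nonzero_bar[OF g])
    ultimately have "bar (coeff R i) = 0 \<or> e \<le> order x (bar g) + order x (bar (coeff R i))"
      using order_divides[of x e "bar g * bar (coeff R i)"] order_mult[of "bar g" "bar (coeff R i)" x]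
      by (cases "bar (coeff R i) = 0") auto
    then have "poly (bar (coeff R i)) x = 0" using e by (auto simp: order_root)
    then show ?thesis by (simp add: poly_bar)
  qed
  then have "bev x y R = 0" by (simp add: bev_altdef)
  moreover have "bev x y R = bev x y B" using N(2) by (simp add: RG bev_F)
  ultimately show False using B by simp
qed

text \<open>As long as the cofactor vanishes at the point, \<open>vanishing_multiple\<close> splits
  off one more uniformizer. The order at x of the norm g of U bounds the number of such
  steps.\<close>

lemma local_factorization:
  fixes x y :: 'f
  assumes N: "N > 0" "x ^ (p ^ N) = x" "y ^ p - y = ipe x h" and u: "bev \<xi> \<eta> U \<noteq> 0"
  obtains e A B where "bev x y A \<noteq> 0" "bev x y B \<noteq> 0"
    "bev \<xi> \<eta> B * bev \<xi> \<eta> U = bev \<xi> \<eta> (ufp N) ^ e * bev \<xi> \<eta> A"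
proof (rule ccontr)
  assume no: "\<not> thesis"
  obtain V g where Vg: "bev \<xi> \<eta> V * bev \<xi> \<eta> U = ipe \<xi> g" "ipe \<xi> g \<noteq> 0" using norm_exists[OF u] .
  have "\<exists>A B. bev x y B \<noteq> 0 \<and> bev \<xi> \<eta> B * bev \<xi> \<eta> U = bev \<xi> \<eta> (ufp N) ^ e * bev \<xi> \<eta> A" for e
  proof (induction e)
    case 0
    show ?case by (intro exI[of _ U] exI[of _ 1]) simp
  next
    case (Suc e)
    then obtain A B where AB: "bev x y B \<noteq> 0" "bev \<xi> \<eta> B * bev \<xi> \<eta> U = bev \<xi> \<eta> (ufp N) ^ e * bev \<xi> \<eta> A" by blast
    have "bev x y A = 0" using no AB that by blast
    then obtain B' A' where AB': "bev x y B' \<noteq> 0" "bev \<xi> \<eta> B' * bev \<xi> \<eta> A = bev \<xi> \<eta> (ufp N) * bev \<xi> \<eta> A'"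
      using vanishing_multiple[OF N(1)] by blast
    have "bev \<xi> \<eta> (B' * B) * bev \<xi> \<eta> U = bev \<xi> \<eta> (ufp N) ^ e * (bev \<xi> \<eta> B' * bev \<xi> \<eta> A)"
      using AB(2) by (simp add: mult_ac)
    then have "bev \<xi> \<eta> (B' * B) * bev \<xi> \<eta> U = bev \<xi> \<eta> (ufp N) ^ Suc e * bev \<xi> \<eta> A'"
      unfolding AB'(2) by (simp add: mult_ac)
    then show ?case using AB(1) AB'(1) by (intro exI[of _ A'] exI[of _ "B' * B"]) simp
  qed
  from this[of "Suc (order x (bar g))"] obtain A B where AB: "bev x y B \<noteq> 0"
    "bev \<xi> \<eta> B * bev \<xi> \<eta> U = bev \<xi> \<eta> (ufp N) ^ Suc (order x (bar g)) * bev \<xi> \<eta> A" by blast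
  have "bev \<xi> \<eta> B * ipe \<xi> g = bev \<xi> \<eta> V * (bev \<xi> \<eta> B * bev \<xi> \<eta> U)" unfolding Vg(1)[symmetric] by (simp add: mult_ac)
  also have "\<dots> = bev \<xi> \<eta> (ufp N) ^ Suc (order x (bar g)) * bev \<xi> \<eta> (A * V)" unfolding AB(2) by (simp add: mult_ac)
  finally have "Suc (order x (bar g)) \<le> order x (bar g)" by (rule multiplicity_bound[OF N(2,3) AB(1) Vg(2)])
  then show False by simp
qed

text \<open>The local ring at (x, y): z is a fraction whose denominator does not vanish there, and c
  is its value.\<close>

definition Gfin :: "'f \<Rightarrow> 'f \<Rightarrow> 'k \<Rightarrow> 'f \<Rightarrow> bool" where
  "Gfin x y z c \<longleftrightarrow> (\<exists>U V. bev x y V \<noteq> 0 \<and> bev \<xi> \<eta> V * z = bev \<xi> \<eta> U \<and> c * bev x y V = bev x y U)"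

text \<open>By \<open>local_factorization\<close> a nonzero z is an integral power of the
  uniformizer times a unit of the local ring; the sign of the exponent decides whether z or its
  inverse is regular. The inverse of the uniformizer is not regular.\<close>

lemma place_graph_finite:
  assumes N: "N > 0" "x ^ (p ^ N) = x" "y ^ p - y = ipe (x :: 'f) h"
  shows "place_graph (Gfin x y)"
proof
  have nz: "bev \<xi> \<eta> V \<noteq> 0" if "bev x y V \<noteq> 0" for V
    using that kernel_point[OF _ charF N(3), of V] by auto
  have cong: "bev x y U = bev x y V" if "bev \<xi> \<eta> U = bev \<xi> \<eta> V" for U V
    by (rule eval_cong[OF that charF N(3)])
  {
    fix z c c' assume "Gfin x y z c" "Gfin x y z c'"
    then obtain U V U' V' where UV: "bev x y V \<noteq> 0" "bev \<xi> \<eta> V * z = bev \<xi> \<eta> U" "c * bev x y V = bev x y U"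
      "bev x y V' \<noteq> 0" "bev \<xi> \<eta> V' * z = bev \<xi> \<eta> U'" "c' * bev x y V' = bev x y U'"
      unfolding Gfin_def by blast
    have "bev \<xi> \<eta> (U * V') = bev \<xi> \<eta> (U' * V)"
      by (simp add: UV(2,5)[symmetric] mult_ac)
    from cong[OF this] have "c * bev x y V * bev x y V' = c' * bev x y V' * bev x y V"
      by (simp add: UV(3,6))
    then show "c = c'" using UV(1,4) by simp
  next
    show "Gfin x y 1 1" unfolding Gfin_def by (intro exI[of _ 1]) simp
    show "Gfin x y (- 1) (- 1)" unfolding Gfin_def by (intro exI[of _ "- 1"] exI[of _ 1]) simp
  next
    fix z c z' c' assume "Gfin x y z c" "Gfin x y z' c'"
    then obtain U V U' V' where UV: "bev x y V \<noteq> 0" "bev \<xi> \<eta> V * z = bev \<xi> \<eta> U" "c * bev x y V = bev x y U"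
      "bev x y V' \<noteq> 0" "bev \<xi> \<eta> V' * z' = bev \<xi> \<eta> U'" "c' * bev x y V' = bev x y U'"
      unfolding Gfin_def by blast
    show "Gfin x y (z + z') (c + c')" unfolding Gfin_def
      using UV(1,4) by (intro exI[of _ "U * V' + U' * V"] exI[of _ "V * V'"])
        (simp add: UV(2,3,5,6)[symmetric] algebra_simps)
    show "Gfin x y (z * z') (c * c')" unfolding Gfin_def
      using UV(1,4) by (intro exI[of _ "U * U'"] exI[of _ "V * V'"])
        (simp add: UV(2,3,5,6)[symmetric] algebra_simps)
  next
    fix z
    obtain U V where UV: "bev \<xi> \<eta> V \<noteq> 0" "z * bev \<xi> \<eta> V = bev \<xi> \<eta> U" using quotients by blast
    show "(\<exists>c. Gfin x y z c) \<or> (z \<noteq> 0 \<and> Gfin x y (inverse z) 0)"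
    proof (cases "z = 0")
      case True
      then have "Gfin x y z 0" unfolding Gfin_def by (intro exI[of _ 0] exI[of _ 1]) simp
      then show ?thesis by blast
    next
      case False
      then have "bev \<xi> \<eta> U \<noteq> 0" using UV by (metis mult_eq_0_iff)
      from local_factorization[OF N this] obtain e A B where 1: "bev x y A \<noteq> 0" "bev x y B \<noteq> 0"
        "bev \<xi> \<eta> B * bev \<xi> \<eta> U = bev \<xi> \<eta> (ufp N) ^ e * bev \<xi> \<eta> A" .
      from local_factorization[OF N UV(1)] obtain e' A' B' where 2: "bev x y A' \<noteq> 0" "bev x y B' \<noteq> 0"
        "bev \<xi> \<eta> B' * bev \<xi> \<eta> V = bev \<xi> \<eta> (ufp N) ^ e' * bev \<xi> \<eta> A'" .
      define w where "w = bev \<xi> \<eta> (ufp N)"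
      have w: "w \<noteq> 0" unfolding w_def by (rule ufp_nonzero[OF N(1)])
      have "w ^ e' * (bev \<xi> \<eta> (A' * B) * z) = z * bev \<xi> \<eta> B * (w ^ e' * bev \<xi> \<eta> A')" by (simp add: mult_ac)
      also have "\<dots> = (bev \<xi> \<eta> B * (z * bev \<xi> \<eta> V)) * bev \<xi> \<eta> B'"
        unfolding w_def 2(3)[symmetric] by (simp only: mult_ac)
      also have "\<dots> = w ^ e * bev \<xi> \<eta> (A * B')" unfolding UV(2) 1(3) w_def by (simp add: mult_ac)
      finally have main: "w ^ e' * (bev \<xi> \<eta> (A' * B) * z) = w ^ e * bev \<xi> \<eta> (A * B')" .
      show ?thesis
      proof (cases "e' \<le> e")
        case True
        then have "w ^ e = w ^ e' * w ^ (e - e')" by (simp flip: power_add)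
        then have "bev \<xi> \<eta> (A' * B) * z = bev \<xi> \<eta> (ufp N ^ (e - e') * (A * B'))"
          using main w by (simp add: w_def mult.assoc)
        then have "Gfin x y z (bev x y (ufp N ^ (e - e') * (A * B')) / bev x y (A' * B))"
          unfolding Gfin_def using 1 2 by (intro exI[of _ "ufp N ^ (e - e') * (A * B')"] exI[of _ "A' * B"]) simp
        then show ?thesis by blast
      next
        case False
        then have "w ^ e' = w ^ e * w ^ (e' - e)" by (simp flip: power_add)
        then have "bev \<xi> \<eta> (ufp N ^ (e' - e) * (A' * B)) * z = bev \<xi> \<eta> (A * B')"
          using main w by (simp add: w_def mult.assoc)
        then have "bev \<xi> \<eta> (A * B') * inverse z = bev \<xi> \<eta> (ufp N ^ (e' - e) * (A' * B))"
          using \<open>z \<noteq> 0\<close> by (simp add: field_simps)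
        moreover have "bev x y (ufp N) = 0" using N by (simp add: bev_ufp)
        then have "bev x y (ufp N ^ (e' - e) * (A' * B)) = 0" using False by (simp add: power_0_left)
        ultimately have "Gfin x y (inverse z) 0"
          unfolding Gfin_def using 1 2 by (intro exI[of _ "ufp N ^ (e' - e) * (A' * B)"] exI[of _ "A * B'"]) simp
        then show ?thesis using \<open>z \<noteq> 0\<close> by blast
      qed
    qed
  next
    show "\<exists>z. \<forall>c. \<not> Gfin x y z c"
    proof (intro exI allI notI)
      fix c assume "Gfin x y (inverse (bev \<xi> \<eta> (ufp N))) c"
      then obtain U V where UV: "bev x y V \<noteq> 0" "bev \<xi> \<eta> V * inverse (bev \<xi> \<eta> (ufp N)) = bev \<xi> \<eta> U"
        unfolding Gfin_def by blast
      then have "bev \<xi> \<eta> V = bev \<xi> \<eta> (U * ufp N)" using ufp_nonzero[OF N(1)] by (simp add: field_simps)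
      from cong[OF this] have "bev x y V = 0" using N by (simp add: bev_ufp)
      with UV(1) show False by simp
    qed
  next
    fix z c assume "Gfin x y z c" and c: "c \<noteq> 0"
    then obtain U V where UV: "bev x y V \<noteq> 0" "bev \<xi> \<eta> V * z = bev \<xi> \<eta> U" "c * bev x y V = bev x y U"
      unfolding Gfin_def by blast
    then have U: "bev x y U \<noteq> 0" using c by (metis mult_eq_0_iff)
    have "z \<noteq> 0" using UV(2) nz[OF U] by auto
    have "bev \<xi> \<eta> U * inverse z = bev \<xi> \<eta> V" unfolding UV(2)[symmetric] using \<open>z \<noteq> 0\<close> by simp
    moreover have "inverse c * bev x y U = bev x y V" unfolding UV(3)[symmetric] using c by simp
    ultimately show "Gfin x y (inverse z) (inverse c)" unfolding Gfin_def using U by blast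
  }
qed

text \<open>A place where \<xi> and \<eta> take the values x and y inverts every denominator that is
  nonzero at (x, y), so it contains the local ring there, with the same values.\<close>

lemma finite_dominated:
  assumes "is_place V \<phi>" "\<xi> \<in> V" "\<eta> \<in> V" "\<phi> \<xi> = x" "\<phi> \<eta> = y" and G: "Gfin x y z c"
  shows "z \<in> V \<and> \<phi> z = c"
proof -
  interpret V: place V \<phi> by unfold_locales fact
  obtain A B where AB: "bev x y B \<noteq> 0" "bev \<xi> \<eta> B * z = bev \<xi> \<eta> A" "c * bev x y B = bev x y A"
    using G unfolding Gfin_def by blast
  have b: "bev \<xi> \<eta> B \<in> V" "\<phi> (bev \<xi> \<eta> B) = bev x y B" and a: "bev \<xi> \<eta> A \<in> V" "\<phi> (bev \<xi> \<eta> A) = bev x y A"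
    using V.bev[OF assms(2,3)] assms(4,5) by auto
  note i = V.inv[OF b(1)]
  have nz: "\<phi> (bev \<xi> \<eta> B) \<noteq> 0" using AB b by simp
  have z: "z = inverse (bev \<xi> \<eta> B) * bev \<xi> \<eta> A" using AB(2) i(1)[OF nz] by (simp add: field_simps)
  have "z \<in> V" "\<phi> z = inverse (bev x y B) * bev x y A"
    unfolding z using V.mult[OF i(2)[OF nz] a(1)] i(3)[OF nz] a(2) b(2) by simp_all
  moreover from this(2) have "\<phi> z * bev x y B = c * bev x y B" using AB(1,3) by (simp add: field_simps)
  ultimately show ?thesis using AB(1) by simp
qed

section \<open>The place at infinity\<close>

definition Ginf :: "'k \<Rightarrow> 'f \<Rightarrow> bool" where
  "Ginf z c \<longleftrightarrow> (\<exists>m U V. W m U \<and> W m V \<and> \<not> int p dvd s m V \<and>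
     bev \<xi> \<eta> V * z = bev \<xi> \<eta> U \<and> c * of_int (s m V) = of_int (s m U))"

lemma GinfI:
  "W m U \<Longrightarrow> W m V \<Longrightarrow> \<not> int p dvd s m V \<Longrightarrow> bev \<xi> \<eta> V * z = bev \<xi> \<eta> U \<Longrightarrow>
    c * of_int (s m V) = of_int (s m U) \<Longrightarrow> Ginf z c"
  unfolding Ginf_def by blast

lemma not_dvd_mult: "\<not> int p dvd a \<Longrightarrow> \<not> int p dvd b \<Longrightarrow> \<not> int p dvd a * b"
  using p prime_dvd_mult_iff[of "int p" a b] by auto

lemma xi_mult: "W m V \<Longrightarrow> W (m + p) (mon 1 1 0 * V) \<and> s (m + p) (mon 1 1 0 * V) = s m V"
  using W_mult[of p "mon 1 1 0" m V] s_mult[of p "mon 1 1 0" m V] W_mon[of 1 0 p 1]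
  by (simp add: s_mon add.commute)

text \<open>\<open>Ginf\<close> consists of the fractions whose numerator has no larger pole order
  than the denominator, the value being the quotient of the symbols. Totality compares the two
  weights; \<xi>, of weight p > 0, is not regular.\<close>

lemma place_graph_infinite: "place_graph Ginf"
proof
  have nz: "bev \<xi> \<eta> V \<noteq> 0" if "W m V" "\<not> int p dvd s m V" for m V
    using that kernel_symbol by blast
  have cong: "of_int (s m U) = (of_int (s m V) :: 'f)" if "bev \<xi> \<eta> U = bev \<xi> \<eta> V" "W m U" "W m V" for m U V
  proof -
    have "W m (U + (- 1) * V)" using W_add[OF that(2), of "(- 1) * V"] W_mult[of 0 "- 1" m V] that(3)
      by (simp add: W_def)
    then have "W m (U - V)" by simp
    then have "int p dvd s m (U - V)" using that(1) by (intro kernel_symbol) simp_all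
    then have "of_int (s m (U - V)) = (0 :: 'f)" by (simp only: of_int_eq_0F)
    then show ?thesis by (simp add: s_diff)
  qed
  have s1: "W 0 1" "s 0 1 = 1" "W 0 (- 1)" "s 0 (- 1) = - 1"
    by (auto simp: W_def s_def sym_def one_pCons coeff_pCons split: nat.splits)
  {
    fix z c c' assume "Ginf z c" "Ginf z c'"
    then obtain m U V n U' V' where UV: "W m U" "W m V" "\<not> int p dvd s m V" "bev \<xi> \<eta> V * z = bev \<xi> \<eta> U"
      "c * of_int (s m V) = of_int (s m U)" "W n U'" "W n V'" "\<not> int p dvd s n V'"
      "bev \<xi> \<eta> V' * z = bev \<xi> \<eta> U'" "c' * of_int (s n V') = of_int (s n U')"
      unfolding Ginf_def by blast
    have "bev \<xi> \<eta> (U * V') = bev \<xi> \<eta> (V * U')" by (simp add: UV(4,9)[symmetric] mult_ac)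
    from cong[OF this W_mult[OF UV(1,7)] W_mult[OF UV(2,6)]]
    have "of_int (s m U) * of_int (s n V') = of_int (s m V) * (of_int (s n U') :: 'f)"
      using UV by (simp add: s_mult)
    then have "c * (of_int (s m V) * of_int (s n V')) = c' * (of_int (s m V) * of_int (s n V'))"
      unfolding UV(5,10)[symmetric] by (simp add: mult_ac)
    then show "c = c'" using UV(3,8) by (simp add: of_int_eq_0F)
  next
    show "Ginf 1 1" unfolding Ginf_def using s1 p_gt_1
      by (intro exI[of _ "0::nat"] exI[of _ "1 :: int poly poly"]) simp
    show "Ginf (- 1) (- 1)" unfolding Ginf_def using s1 p_gt_1
      by (intro exI[of _ "0::nat"] exI[of _ "- 1 :: int poly poly"] exI[of _ "1 :: int poly poly"]) simp
  next
    fix z c z' c' assume "Ginf z c" "Ginf z' c'"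
    then obtain m U V n U' V' where UV: "W m U" "W m V" "\<not> int p dvd s m V" "bev \<xi> \<eta> V * z = bev \<xi> \<eta> U"
      "c * of_int (s m V) = of_int (s m U)" "W n U'" "W n V'" "\<not> int p dvd s n V'"
      "bev \<xi> \<eta> V' * z' = bev \<xi> \<eta> U'" "c' * of_int (s n V') = of_int (s n U')"
      unfolding Ginf_def by blast
    have ss: "s (m + n) (U * V') = s m U * s n V'" "s (m + n) (V * U') = s m V * s n U'"
      "s (m + n) (U * U') = s m U * s n U'" "s (m + n) (V * V') = s m V * s n V'"
      using UV by (simp_all add: s_mult)
    have V: "W (m + n) (V * V')" "\<not> int p dvd s (m + n) (V * V')"
      using UV by (simp_all add: W_mult ss not_dvd_mult)
    show "Ginf (z + z') (c + c')"
    proof (rule GinfI[OF _ V])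
      show "W (m + n) (U * V' + V * U')" using UV by (intro W_add W_mult)
      show "bev \<xi> \<eta> (V * V') * (z + z') = bev \<xi> \<eta> (U * V' + V * U')"
        by (simp add: UV(4,9)[symmetric] algebra_simps)
      show "(c + c') * of_int (s (m + n) (V * V')) = of_int (s (m + n) (U * V' + V * U'))"
        by (simp only: s_add ss of_int_add of_int_mult UV(5,10)[symmetric]) (simp add: algebra_simps)
    qed
    show "Ginf (z * z') (c * c')"
    proof (rule GinfI[OF _ V])
      show "W (m + n) (U * U')" using UV by (intro W_mult)
      show "bev \<xi> \<eta> (V * V') * (z * z') = bev \<xi> \<eta> (U * U')"
        by (simp add: UV(4,9)[symmetric] mult_ac)
      show "(c * c') * of_int (s (m + n) (V * V')) = of_int (s (m + n) (U * U'))"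
        by (simp only: ss of_int_mult UV(5,10)[symmetric]) (simp add: algebra_simps)
    qed
  next
    fix z
    obtain U V where UV: "bev \<xi> \<eta> V \<noteq> 0" "z * bev \<xi> \<eta> V = bev \<xi> \<eta> U" using quotients by blast
    show "(\<exists>c. Ginf z c) \<or> (z \<noteq> 0 \<and> Ginf (inverse z) 0)"
    proof (cases "z = 0")
      case True
      then have "Ginf z 0" unfolding Ginf_def using s1 p_gt_1
        by (intro exI[of _ 0] exI[of _ 0] exI[of _ 1]) (simp add: W_0 s_def sym_def)
      then show ?thesis by blast
    next
      case False
      then have "bev \<xi> \<eta> U \<noteq> 0" using UV by (metis mult_eq_0_iff)
      from nonzero_symbol[OF this] obtain m U' where U': "W m U'" "bev \<xi> \<eta> U' = bev \<xi> \<eta> U" "\<not> int p dvd s m U'" .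
      from nonzero_symbol[OF UV(1)] obtain n V' where V': "W n V'" "bev \<xi> \<eta> V' = bev \<xi> \<eta> V" "\<not> int p dvd s n V'" .
      show ?thesis
      proof (cases "m \<le> n")
        case True
        then have "W n U'" using U' W_mono by blast
        then have "Ginf z (of_int (s n U') / of_int (s n V'))" unfolding Ginf_def
          using U' V' UV(2) by (intro exI[of _ n] exI[of _ U'] exI[of _ V']) (simp add: of_int_eq_0F mult.commute)
        then show ?thesis by blast
      next
        case False
        then have "W m V'" "s m V' = 0" using V' W_mono[of n V' m] s_gt[of n V' m] by simp_all
        moreover have "bev \<xi> \<eta> U' * inverse z = bev \<xi> \<eta> V'" using UV(2) U' V' \<open>z \<noteq> 0\<close> by (simp add: field_simps)
        ultimately have "Ginf (inverse z) 0" unfolding Ginf_def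
          using U' by (intro exI[of _ m] exI[of _ V'] exI[of _ U']) simp
        then show ?thesis using \<open>z \<noteq> 0\<close> by blast
      qed
    qed
  next
    show "\<exists>z. \<forall>c. \<not> Ginf z c"
    proof (intro exI allI notI)
      fix c assume "Ginf \<xi> c"
      then obtain m U V where UV: "W m U" "W m V" "\<not> int p dvd s m V" "bev \<xi> \<eta> V * \<xi> = bev \<xi> \<eta> U"
        unfolding Ginf_def by blast
      have "bev \<xi> \<eta> (mon 1 1 0 * V) = bev \<xi> \<eta> U" using UV(4) by (simp add: mult.commute)
      from cong[OF this, of "m + p"] have "of_int (s m V) = (of_int (s (m + p) U) :: 'f)"
        using xi_mult[OF UV(2)] W_mono[OF UV(1)] by simp
      also have "s (m + p) U = 0" using UV(1) p_pos by (intro s_gt) auto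
      finally have "int p dvd s m V" by (simp add: of_int_eq_0F)
      with UV(3) show False by blast
    qed
  next
    fix z c assume "Ginf z c" and c: "c \<noteq> 0"
    then obtain m U V where UV: "W m U" "W m V" "\<not> int p dvd s m V" "bev \<xi> \<eta> V * z = bev \<xi> \<eta> U"
      "c * of_int (s m V) = of_int (s m U)" unfolding Ginf_def by blast
    have "of_int (s m V) \<noteq> (0 :: 'f)" using UV(3) by (simp add: of_int_eq_0F)
    then have "of_int (s m U) \<noteq> (0 :: 'f)" using UV(5) c by (metis mult_eq_0_iff)
    then have sU: "\<not> int p dvd s m U" by (simp add: of_int_eq_0F)
    have "z \<noteq> 0" using UV(4) nz[OF UV(1) sU] by auto
    have "bev \<xi> \<eta> U * inverse z = bev \<xi> \<eta> V" unfolding UV(4)[symmetric] using \<open>z \<noteq> 0\<close> by simp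
    moreover have "inverse c * of_int (s m U) = of_int (s m V)" unfolding UV(5)[symmetric] using c by simp
    ultimately show "Ginf (inverse z) (inverse c)" using UV(1,2) sU by (intro GinfI)
  }
qed

text \<open>At a place where \<open>X\<close> has a pole, the quotient of two monomials is integral as soon as the weight
  of the numerator is at most that of the denominator: its \<open>p\<close>-th power is a power of \<open>1 / X\<close> times a
  power of the unit \<open>Y ^ p / X ^ d\<close>.\<close>

lemma infinite_monomials:
  assumes pl: "is_place V \<phi>" and xi: "\<xi> \<notin> V" and le: "p * a + d * i \<le> p * b + d * j"
  shows "\<xi> ^ a * \<eta> ^ i / (\<xi> ^ b * \<eta> ^ j) \<in> V"
    and "\<phi> (\<xi> ^ a * \<eta> ^ i / (\<xi> ^ b * \<eta> ^ j)) = (if p * a + d * i = p * b + d * j then 1 else (0 :: 'f))"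
proof -
  interpret V: place V \<phi> by unfold_locales (rule pl)
  define x where "x = inverse \<xi>"
  have x: "\<xi> \<noteq> 0" "x \<in> V" "\<phi> x = 0" using V.not_in[OF xi] by (simp_all add: x_def)
  define \<beta> where "\<beta> = ipe \<xi> h / \<xi> ^ d"
  have "\<beta> = (\<Sum>k\<le>d. of_int (coeff h k) * x ^ (d - k))"
    unfolding \<beta>_def ipe_altdef deg_h sum_divide_distrib
  proof (intro sum.cong refl)
    fix k assume "k \<in> {..d}"
    then have "\<xi> ^ d = \<xi> ^ k * \<xi> ^ (d - k)" by (simp flip: power_add)
    then show "of_int (coeff h k) * \<xi> ^ k / \<xi> ^ d = of_int (coeff h k) * x ^ (d - k)"
      using x(1) by (simp add: x_def field_simps)
  qed
  also have "\<dots> = 1 + (\<Sum>k<d. of_int (coeff h k) * x ^ (d - k))"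
    using monic deg_h by (simp flip: lessThan_Suc_atMost)
  finally have \<beta>: "\<beta> = 1 + (\<Sum>k<d. of_int (coeff h k) * x ^ (d - k))" .
  have xs: "of_int (coeff h k) * x ^ (d - k) \<in> V" "k < d \<Longrightarrow> \<phi> (of_int (coeff h k) * x ^ (d - k)) = 0" for k
    using x by (simp_all add: V.mult V.of_int V.power power_0_left)
  have \<beta>V: "\<beta> \<in> V" "\<phi> \<beta> = 1"
    unfolding \<beta> using xs by (simp_all add: V.add V.one V.sum)
  have "\<eta> \<notin> V"
  proof
    assume "\<eta> \<in> V"
    then have "ipe \<xi> h \<in> V" unfolding eq_AS[symmetric] by (intro V.diff V.power)
    then have "\<phi> (ipe \<xi> h * x ^ d) = 0" "ipe \<xi> h * x ^ d \<in> V" using x d_pos by (simp_all add: V.mult V.power power_0_left)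
    moreover have "ipe \<xi> h * x ^ d = \<beta>" by (simp add: \<beta>_def x_def field_simps)
    ultimately show False using \<beta>V by simp
  qed
  define y where "y = inverse \<eta>"
  have y: "\<eta> \<noteq> 0" "y \<in> V" "\<phi> y = 0" using V.not_in[OF \<open>\<eta> \<notin> V\<close>] by (simp_all add: y_def)
  define \<alpha> where "\<alpha> = 1 - y ^ (p - 1)"
  have \<alpha>V: "\<alpha> \<in> V" "\<phi> \<alpha> = 1" using y p_gt_1 by (simp_all add: \<alpha>_def V.diff V.one V.power power_0_left)
  note \<alpha>i = V.inv[OF \<alpha>V(1), unfolded \<alpha>V(2)]
  define u where "u = \<eta> ^ p / \<xi> ^ d"
  have "u * \<alpha> = \<beta>"
  proof -
    have "\<eta> ^ p = \<eta> ^ (p - 1) * \<eta>" using p_pos by (simp flip: power_Suc2)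
    then have "\<eta> ^ p * \<alpha> = \<eta> ^ p - \<eta>" using y(1) by (simp add: \<alpha>_def y_def field_simps)
    then show ?thesis by (simp add: u_def \<beta>_def eq_AS)
  qed
  then have u: "u = \<beta> * inverse \<alpha>" using \<alpha>i by (simp add: field_simps)
  have uV: "u \<in> V" "\<phi> u = 1" using \<beta>V \<alpha>i by (simp_all add: u V.mult)
  have u0: "u \<noteq> 0" and ui: "inverse u \<in> V" "\<phi> (inverse u) = 1" using V.inv[OF uV(1)] uV(2) by simp_all
  define r where "r = \<xi> ^ a * \<eta> ^ i / (\<xi> ^ b * \<eta> ^ j)"
  define e where "e = p * b + d * j - (p * a + d * i)"
  have rp: "r ^ p = x ^ e * u ^ i * inverse u ^ j"
  proof -
    have yp: "\<eta> ^ p = u * \<xi> ^ d" using x(1) by (simp add: u_def)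
    have "r ^ p = \<xi> ^ (p * a) * (\<eta> ^ p) ^ i / (\<xi> ^ (p * b) * (\<eta> ^ p) ^ j)"
      by (simp add: r_def power_divide power_mult_distrib mult.commute flip: power_mult)
    also have "\<dots> = \<xi> ^ (p * a + d * i) * u ^ i / (\<xi> ^ (p * b + d * j) * u ^ j)"
      unfolding yp by (simp add: power_mult_distrib power_add mult_ac flip: power_mult)
    also have "\<xi> ^ (p * b + d * j) = \<xi> ^ (p * a + d * i) * \<xi> ^ e" using le by (simp add: e_def flip: power_add)
    finally show ?thesis using x(1) u0 by (simp add: x_def field_simps)
  qed
  have "x ^ e * u ^ i * inverse u ^ j \<in> V" "\<phi> (x ^ e * u ^ i * inverse u ^ j) = 0 ^ e"
    using x uV ui by (simp_all add: V.mult V.power)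
  then have rpV: "r ^ p \<in> V" "\<phi> (r ^ p) = 0 ^ e" by (simp_all only: rp)
  show rV: "r \<in> V" using V.root_in[OF p_pos rpV(1)] .
  have "\<phi> r ^ p = 0 ^ e" using rpV(2) rV by (simp add: V.power)
  show "\<phi> r = (if p * a + d * i = p * b + d * j then 1 else 0)"
  proof (cases "e = 0")
    case True
    \<comment> \<open>The p-th power of the value is 1, and Frobenius is injective, so the value is
      1.\<close>
    then have "\<phi> r ^ (p ^ 1) = 1 ^ (p ^ 1)" using \<open>\<phi> r ^ p = 0 ^ e\<close> by simp
    then have "\<phi> r = 1" by (rule f.frob_inj)
    then show ?thesis using True le by (auto simp: e_def)
  next
    case False
    then show ?thesis using \<open>\<phi> r ^ p = 0 ^ e\<close> le by (auto simp: e_def power_0_left)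
  qed
qed

text \<open>Numerator and denominator are divided by one monomial \<mu> of weight m, which exists
  because the symbol of the denominator is nonzero. The monomials over \<mu> are integral, with
  value 1 in weight m and 0 below, so U / \<mu> has the symbol of U as its value.\<close>

lemma infinite_dominated:
  assumes pl: "is_place V \<phi>" and xi: "\<xi> \<notin> V" and G: "Ginf z c"
  shows "z \<in> V \<and> \<phi> z = (c :: 'f)"
proof -
  interpret V: place V \<phi> by unfold_locales (rule pl)
  obtain m A B where AB: "W m A" "W m B" "\<not> int p dvd s m B" "bev \<xi> \<eta> B * z = bev \<xi> \<eta> A"
    "c * of_int (s m B) = of_int (s m A)" using G unfolding Ginf_def by blast
  have "s m B \<noteq> 0" using AB(3) by auto
  then obtain j b where jb: "p * b + d * j = m" by (rule s_witness)
  define \<mu> where "\<mu> = \<xi> ^ b * \<eta> ^ j"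
  have *: "bev \<xi> \<eta> U / \<mu> \<in> V \<and> \<phi> (bev \<xi> \<eta> U / \<mu>) = of_int (s m U)" if "W m U" for U
  proof -
    define g where "g = (\<lambda>i a. of_int (coeff (coeff U i) a) * (\<xi> ^ a * \<eta> ^ i / \<mu>))"
    have g: "g i a \<in> V \<and> \<phi> (g i a) = of_int (if p * a + d * i = m then coeff (coeff U i) a else 0)" for i a
    proof (cases "coeff (coeff U i) a = 0")
      case True
      then show ?thesis by (simp add: g_def V.zero)
    next
      case False
      then have le: "p * a + d * i \<le> p * b + d * j" using that by (auto simp: W_def jb)
      note im = infinite_monomials[OF pl xi le]
      have "g i a \<in> V" unfolding g_def \<mu>_def by (rule V.mult[OF V.of_int(1) im(1)])
      moreover have "\<phi> (g i a) = of_int (coeff (coeff U i) a) * (if p * a + d * i = p * b + d * j then 1 else 0)"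
        unfolding g_def \<mu>_def by (simp only: V.mult(2)[OF V.of_int(1) im(1)] V.of_int(2) im(2))
      ultimately show ?thesis by (simp add: jb)
    qed
    have "bev \<xi> \<eta> U / \<mu> = (\<Sum>i\<le>degree U. \<Sum>a\<le>degree (coeff U i). g i a)"
      by (subst sum_mon) (simp add: g_def sum_divide_distrib mult.assoc)
    then show ?thesis using g by (simp add: V.sum s_altdef)
  qed
  note a = *[OF AB(1)] and b = *[OF AB(2)]
  have sB: "of_int (s m B) \<noteq> (0 :: 'f)" using AB(3) by (simp add: of_int_eq_0F)
  have nz: "\<phi> (bev \<xi> \<eta> B / \<mu>) \<noteq> 0" using b sB by simp
  note i = V.inv[OF conjunct1[OF b] nz]
  have "z = inverse (bev \<xi> \<eta> B / \<mu>) * (bev \<xi> \<eta> A / \<mu>)" using AB(4)[symmetric] i(1) by (simp add: field_simps)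
  then have "z \<in> V" "\<phi> z = inverse (of_int (s m B)) * of_int (s m A)"
    using V.mult[OF i(2) conjunct1[OF a]] i(3) a b by simp_all
  moreover from this(2) have "\<phi> z * of_int (s m B) = c * of_int (s m B)" using AB(5) sB by (simp add: field_simps)
  ultimately show ?thesis using sB by simp
qed

text \<open>A place is determined by the image of (\<xi>, \<eta>) if \<xi> is integral and is the
  one at infinity otherwise. Its values are quotients of polynomials in that image, respectively of
  integers, and so lie in \<open>gf n\<close> if the point does.\<close>

theorem card_places:
  assumes n: "n > 0"
  shows "card {(V, \<phi> :: 'k \<Rightarrow> 'f). is_place V \<phi> \<and> \<phi> \<in> extensional V \<and> \<phi> ` V \<subseteq> f.gf n} =
    1 + card {(x, y). x \<in> f.gf n \<and> y \<in> f.gf n \<and> y ^ p - y = ipe x h}"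
proof -
  define P where "P = {(V, \<phi> :: 'k \<Rightarrow> 'f). is_place V \<phi> \<and> \<phi> \<in> extensional V \<and> \<phi> ` V \<subseteq> f.gf n}"
  define A where "A = {(x, y). x \<in> f.gf n \<and> y \<in> f.gf n \<and> y ^ p - y = ipe x h}"
  define pt where "pt = (\<lambda>(V, \<phi> :: 'k \<Rightarrow> 'f). if \<xi> \<in> V then Some (\<phi> \<xi>, \<phi> \<eta>) else None)"
  \<comment> \<open>With \<xi> integral, a pole of \<eta> is impossible: dividing \<eta> ^ p -
    \<eta> = h(\<xi>) by \<eta> ^ p would give 1 = 0 in the residue field.\<close>
  have etaV: "\<eta> \<in> V" if "is_place V (\<phi> :: 'k \<Rightarrow> 'f)" "\<xi> \<in> V" for V \<phi>
  proof (rule ccontr)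
    interpret V: place V \<phi> by unfold_locales fact
    assume "\<eta> \<notin> V"
    note y = V.not_in[OF this]
    have h: "ipe \<xi> h \<in> V" using that(2) by (rule V.ipe)
    have "1 - inverse \<eta> ^ (p - 1) = ipe \<xi> h * inverse \<eta> ^ p"
    proof -
      have "\<eta> ^ p = \<eta> ^ (p - 1) * \<eta>" using p_pos by (simp flip: power_Suc2)
      then show ?thesis unfolding eq_AS[symmetric] using y(1) by (simp add: field_simps)
    qed
    moreover have "\<phi> (1 - inverse \<eta> ^ (p - 1)) = 1"
      using y p_gt_1 by (simp add: V.diff V.one V.power power_0_left del: power_inverse)
    moreover have "\<phi> (ipe \<xi> h * inverse \<eta> ^ p) = 0"
      using y h p_pos by (simp add: V.mult V.power power_0_left del: power_inverse)
    ultimately show False by simp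
  qed
  have "bij_betw pt P (insert None (Some ` A))"
  proof (rule bij_betwI')
    fix v w assume v: "v \<in> P" and w: "w \<in> P"
    obtain V \<phi> where v': "v = (V, \<phi>)" by force
    obtain V' \<phi>' where w': "w = (V', \<phi>')" by force
    have pv: "is_place V \<phi>" "\<phi> \<in> extensional V" and pw: "is_place V' \<phi>'" "\<phi>' \<in> extensional V'"
      and rv: "\<phi> ` V \<subseteq> f.gf n"
      using v w by (auto simp: P_def v' w')
    show "pt v = pt w \<longleftrightarrow> v = w"
    proof
      assume eq: "pt v = pt w"
      show "v = w"
      proof (cases "\<xi> \<in> V")
        case True
        then have T': "\<xi> \<in> V'" and xy: "\<phi>' \<xi> = \<phi> \<xi>" "\<phi>' \<eta> = \<phi> \<eta>"
          using eq by (auto simp: pt_def v' w' split: if_splits)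
        have e: "\<eta> \<in> V" "\<eta> \<in> V'" using etaV pv(1) pw(1) True T' by blast+
        interpret V: place V \<phi> by unfold_locales (rule pv)
        have "\<phi> (\<eta> ^ p - \<eta>) = \<phi> (ipe \<xi> h)" by (simp only: eq_AS)
        then have "\<phi> \<eta> ^ p - \<phi> \<eta> = ipe (\<phi> \<xi>) h" using e True by (simp add: V.diff V.power V.ipe)
        then interpret G: place_graph "Gfin (\<phi> \<xi>) (\<phi> \<eta>)"
          using rv True by (intro place_graph_finite[OF n] f.gfD) auto
        note uv = G.unique[OF pv finite_dominated[OF pv(1) True e(1) refl refl]]
        note uw = G.unique[OF pw finite_dominated[OF pw(1) T' e(2) xy]]
        have "V = V'" by (rule trans[OF uv(1) uw(1)[symmetric]])
        moreover have "\<phi> = \<phi>'" by (rule trans[OF uv(2) uw(2)[symmetric]])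
        ultimately show ?thesis unfolding v' w' by (rule arg_cong2)
      next
        case False
        then have F': "\<xi> \<notin> V'" using eq by (auto simp: pt_def v' w' split: if_splits)
        interpret G: place_graph Ginf by (rule place_graph_infinite)
        note uv = G.unique[OF pv infinite_dominated[OF pv(1) False]]
        note uw = G.unique[OF pw infinite_dominated[OF pw(1) F']]
        have "V = V'" by (rule trans[OF uv(1) uw(1)[symmetric]])
        moreover have "\<phi> = \<phi>'" by (rule trans[OF uv(2) uw(2)[symmetric]])
        ultimately show ?thesis unfolding v' w' by (rule arg_cong2)
      qed
    qed simp
  next
    fix v assume v: "v \<in> P"
    obtain V \<phi> where v': "v = (V, \<phi>)" by force
    have pv: "is_place V \<phi>" "\<phi> ` V \<subseteq> f.gf n" using v by (auto simp: P_def v')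
    interpret V: place V \<phi> by unfold_locales (rule pv)
    show "pt v \<in> insert None (Some ` A)"
    proof (cases "\<xi> \<in> V")
      case True
      have e: "\<eta> \<in> V" by (rule etaV[OF pv(1) True])
      have "\<phi> (\<eta> ^ p - \<eta>) = \<phi> (ipe \<xi> h)" by (simp only: eq_AS)
      then have "\<phi> \<eta> ^ p - \<phi> \<eta> = ipe (\<phi> \<xi>) h" using e True by (simp add: V.diff V.power V.ipe)
      then show ?thesis using pv(2) True e by (auto simp: pt_def v' A_def)
    qed (simp add: pt_def v')
  next
    fix q assume "q \<in> insert None (Some ` A)"
    then consider "q = None" | x y where "q = Some (x, y)" "x \<in> f.gf n" "y \<in> f.gf n" "y ^ p - y = ipe x h"
      by (auto simp: A_def)
    then show "\<exists>v\<in>P. q = pt v"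
    proof cases
      case 1
      interpret G: place_graph Ginf by (rule place_graph_infinite)
      have "\<xi> \<notin> G.gdom"
      proof
        assume "\<xi> \<in> G.gdom"
        then obtain c where "Ginf \<xi> c" by (auto simp: G.gdom_def)
        then obtain m U V where UV: "W m U" "W m V" "\<not> int p dvd s m V" "bev \<xi> \<eta> V * \<xi> = bev \<xi> \<eta> U"
          unfolding Ginf_def by blast
        have "bev \<xi> \<eta> (mon 1 1 0 * V + (- 1) * U) = 0" using UV(4) by (simp add: mult.commute)
        moreover have "W (m + p) ((- 1) * U)" using W_mult[of 0 "- 1" m U] UV(1) W_mono[of m U "m + p"]
          by (simp add: W_def)
        then have "W (m + p) (mon 1 1 0 * V + (- 1) * U)" using xi_mult[OF UV(2)] by (intro W_add) auto
        ultimately have "int p dvd s (m + p) (mon 1 1 0 * V + (- 1) * U)" by (rule kernel_symbol)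
        moreover have "s (m + p) U = 0" using UV(1) p_pos by (intro s_gt) auto
        ultimately show False using UV(3) xi_mult[OF UV(2)] by (simp add: s_diff)
      qed
      moreover have "G.gval z \<in> f.gf n" if "z \<in> G.gdom" for z
      proof -
        note z = G.domD[OF that]
        obtain m U V where UV: "\<not> int p dvd s m V" "G.gval z * of_int (s m V) = of_int (s m U)"
          using z unfolding Ginf_def by blast
        then have "G.gval z = of_int (s m U) / of_int (s m V)" by (simp add: of_int_eq_0F field_simps)
        then show ?thesis by (simp add: f.gf_divide f.gf_of_int)
      qed
      ultimately show ?thesis using G.place_dom 1
        by (intro bexI[of _ "(G.gdom, G.gval)"]) (auto simp: pt_def P_def G.gval_def)
    next
      case (2 x y)
      interpret G: place_graph "Gfin x y" using 2 by (intro place_graph_finite[OF n] f.gfD)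
      have 3: "Gfin x y \<xi> x" unfolding Gfin_def by (intro exI[of _ "mon 1 1 0"] exI[of _ 1]) simp
      have 4: "Gfin x y \<eta> y" unfolding Gfin_def by (intro exI[of _ "mon 1 0 1"] exI[of _ 1]) simp
      have 5: "G.gval z \<in> f.gf n" if "z \<in> G.gdom" for z
      proof -
        note z = G.domD[OF that]
        obtain U V where UV: "bev x y V \<noteq> 0" "G.gval z * bev x y V = bev x y U"
          using z unfolding Gfin_def by blast
        then have "G.gval z = bev x y U / bev x y V" by (simp add: field_simps)
        then show ?thesis using 2 by (simp add: f.gf_divide f.gf_bev)
      qed
      have "G.gval \<in> extensional G.gdom" by (simp add: G.gval_def)
      then have "(G.gdom, G.gval) \<in> P" using G.place_dom 5 by (auto simp: P_def)
      moreover have "pt (G.gdom, G.gval) = q" using G.val[OF 3] G.val[OF 4] by (simp add: pt_def 2(1))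
      ultimately show ?thesis by blast
    qed
  qed
  then have "card P = card (insert None (Some ` A))" by (rule bij_betw_same_card)
  also have "finite A"
    using f.finite_gf[OF n] by (intro finite_subset[of A "f.gf n \<times> f.gf n"]) (auto simp: A_def)
  then have "card (insert None (Some ` A)) = 1 + card A" by (simp add: card_image)
  finally show ?thesis by (simp add: P_def A_def)
qed

end

section \<open>The coordinate ring as a quotient of \<open>\<int>[x][y]\<close>\<close>

locale to_ring = cring R for R :: "('b, 'm) ring_scheme" (structure) +
  fixes \<theta> :: "'a::comm_ring_1 \<Rightarrow> 'b"
  assumes closed [simp]: "\<theta> a \<in> carrier R"
    and add: "\<theta> (a + b) = \<theta> a \<oplus> \<theta> b"
    and mult: "\<theta> (a * b) = \<theta> a \<otimes> \<theta> b"
    and one: "\<theta> 1 = \<one>"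
begin

lemma zero: "\<theta> 0 = \<zero>"
proof -
  have "\<theta> 0 \<oplus> \<theta> 0 = \<theta> 0" using add[of 0 0] by simp
  then show ?thesis using closed[of 0] by (metis add.l_cancel_one zero_closed)
qed

lemma uminus: "\<theta> (- a) = \<ominus> \<theta> a"
proof -
  have "\<theta> (- a) \<oplus> \<theta> a = \<zero>" using add[of "- a" a] zero by simp
  then show ?thesis using closed by (metis minus_equality)
qed

lemma diff: "\<theta> (a - b) = \<theta> a \<ominus> \<theta> b"
  using add[of a "- b"] by (simp add: uminus minus_eq)

lemma power: "\<theta> (a ^ n) = \<theta> a [^] n"
  by (induction n) (simp_all add: one mult m_comm)

lemma finsum: "finite A \<Longrightarrow> \<theta> (sum f A) = (\<Oplus>i\<in>A. \<theta> (f i))"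
  by (induction A rule: finite_induct) (simp_all add: zero add)

end

definition lift :: "('a::comm_ring_1 \<Rightarrow> 'b) \<Rightarrow> 'a poly \<Rightarrow> nat \<Rightarrow> 'b" where
  "lift \<theta> U = (\<lambda>i. \<theta> (coeff U i))"

context to_ring
begin

interpretation UPc: UP_cring R "UP R"
  by unfold_locales

lemma lift_up: "lift \<theta> U \<in> up R"
proof (rule mem_upI)
  show "\<exists>n. bound \<zero> n (lift \<theta> U)"
    by (intro exI[of _ "degree U"] bound.intro) (simp add: lift_def coeff_eq_0 zero)
qed (simp add: lift_def)

lemma lift_carrier [simp]: "lift \<theta> U \<in> carrier (UP R)"
  using lift_up by (simp add: UP_def)

lemma to_ring_lift: "to_ring (UP R) (lift \<theta>)"
proof (intro to_ring.intro to_ring_axioms.intro)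
  show "cring (UP R)" by (rule UPc.UP_cring)
  fix U V :: "'a poly"
  show "lift \<theta> U \<in> carrier (UP R)" by simp
  show "lift \<theta> (U + V) = lift \<theta> U \<oplus>\<^bsub>UP R\<^esub> lift \<theta> V"
    by (simp add: UP_def lift_up) (simp add: lift_def add)
  show "lift \<theta> (U * V) = lift \<theta> U \<otimes>\<^bsub>UP R\<^esub> lift \<theta> V"
    by (simp add: UP_def lift_up) (simp add: lift_def coeff_mult finsum mult)
  show "lift \<theta> 1 = \<one>\<^bsub>UP R\<^esub>"
    by (auto simp: UP_def lift_def one zero)
qed

lemma lift_surj:
  assumes surj: "\<And>b. b \<in> carrier R \<Longrightarrow> \<exists>a. \<theta> a = b" and f: "f \<in> carrier (UP R)"
  shows "\<exists>U. lift \<theta> U = f"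
proof -
  have f': "f i \<in> carrier R" for i using f by (auto simp: UP_def)
  obtain n where n: "bound \<zero> n f" using f by (auto simp: UP_def)
  define g where "g = (\<lambda>i. SOME a. \<theta> a = f i)"
  have g: "\<theta> (g i) = f i" for i unfolding g_def using surj[OF f'] by (rule someI_ex)
  define U where "U = (\<Sum>i\<le>n. Polynomial.monom (g i) i)"
  have "Polynomial.coeff U i = (if i \<le> n then g i else 0)" for i by (simp add: U_def coeff_sum)
  then have "lift \<theta> U = f" using g n by (auto simp: lift_def zero bound.bound)
  then show ?thesis ..
qed

lemma lift_monom: "lift \<theta> (Polynomial.monom a n) = up_ring.monom (UP R) (\<theta> a) n"
  by (auto simp: UP_def lift_def zero)

end

definition zmod :: "nat \<Rightarrow> int \<Rightarrow> int" where
  "zmod p a = a mod int p"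

lemma to_ring_zmod:
  assumes "prime p" shows "to_ring (residue_ring (int p)) (zmod p)"
proof -
  interpret residues_prime p "residue_ring (int p)" using assms by unfold_locales (auto simp: prime_gt_1_nat)
  show ?thesis
    using prime_gt_1_nat[OF assms]
    by unfold_locales (auto simp: zmod_def residue_ring_def mod_simps)
qed

lemma zmod_surj: "prime p \<Longrightarrow> b \<in> carrier (residue_ring (int p)) \<Longrightarrow> \<exists>a. zmod p a = b"
  by (intro exI[of _ b]) (auto simp: residue_ring_def zmod_def)

section \<open>Reduction to F_p[x][y] and the ideal of the curve\<close>

context weighted
begin

abbreviation "Rp \<equiv> residue_ring (int p)"
abbreviation "Sp \<equiv> UP (UP Rp)"

definition \<Theta> :: "int poly poly \<Rightarrow> nat \<Rightarrow> nat \<Rightarrow> int" where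
  "\<Theta> = lift (lift (zmod p))"

lemma \<Theta>_to_ring: "to_ring Sp \<Theta>"
  unfolding \<Theta>_def by (intro to_ring.to_ring_lift to_ring_zmod p)

lemma \<Theta>_surj: "f \<in> carrier Sp \<Longrightarrow> \<exists>U. \<Theta> U = f"
  unfolding \<Theta>_def
  by (intro to_ring.lift_surj[OF to_ring.to_ring_lift[OF to_ring_zmod[OF p]]]
      to_ring.lift_surj[OF to_ring_zmod[OF p]] zmod_surj p)

lemma \<Theta>_eq_0_iff: "\<Theta> U = \<zero>\<^bsub>Sp\<^esub> \<longleftrightarrow> pdvd U"
proof -
  have "\<zero>\<^bsub>Sp\<^esub> = (\<lambda>i j. 0)" by (simp add: UP_def residue_ring_def)
  then show ?thesis by (simp only: \<Theta>_def lift_def zmod_def pdvd_def fun_eq_iff dvd_eq_mod_eq_0)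
qed

text \<open>Membership in the ideal (p, F) of \<int>[x][y], the kernel of the map to the coordinate
  ring.\<close>

definition zc :: "int poly poly \<Rightarrow> bool" where
  "zc U \<longleftrightarrow> (\<exists>G. pdvd (U - F * G))"

lemma pdvd_add: "pdvd U \<Longrightarrow> pdvd V \<Longrightarrow> pdvd (U + V)"
  by (simp add: pdvd_def)

lemma pdvd_mult: "pdvd U \<Longrightarrow> pdvd (V * U)"
proof (elim pdvdE)
  fix U' assume "U = Polynomial.smult [:int p:] U'"
  then have "V * U = Polynomial.smult [:int p:] (V * U')" by simp
  then show "pdvd (V * U)" by (simp add: pdvd_def)
qed

lemma zc_add: assumes "zc U" "zc V" shows "zc (U + V)"
proof -
  obtain G H where "pdvd (U - F * G)" "pdvd (V - F * H)" using assms by (auto simp: zc_def)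
  from pdvd_add[OF this] have "pdvd (U + V - F * (G + H))" by (simp add: algebra_simps)
  then show ?thesis by (auto simp: zc_def)
qed

lemma zc_mult: assumes "zc U" shows "zc (V * U)"
proof -
  obtain G where "pdvd (U - F * G)" using assms by (auto simp: zc_def)
  from pdvd_mult[OF this, of V] have "pdvd (V * U - F * (V * G))" by (simp add: algebra_simps)
  then show ?thesis by (auto simp: zc_def)
qed

lemma zc_diff: assumes "zc U" "zc V" shows "zc (U - V)"
  using zc_add[OF assms(1) zc_mult[OF assms(2), of "- 1"]] by simp

lemma zc_pdvd: "pdvd U \<Longrightarrow> zc U"
  unfolding zc_def by (intro exI[of _ 0]) simp

lemma zc_F: "zc (F * G)"
  unfolding zc_def by (intro exI[of _ G]) (simp add: pdvd_def)

text \<open>F is monic in y of degree p, so F G has y-degree at least p modulo p unless G vanishes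
  modulo p: if e is the top index of G modulo p, the coefficients of F G at y ^ (p + e) and of G at
  y ^ e agree modulo p.\<close>

lemma zc_degree:
  assumes "zc U" "degree U < p"
  shows "pdvd U"
proof -
  obtain G where G: "pdvd (U - F * G)" using assms by (auto simp: zc_def)
  have "pdvd G"
  proof (rule ccontr)
    assume "\<not> pdvd G"
    then obtain i l where il: "\<not> int p dvd coeff (coeff G i) l" by (auto simp: pdvd_def)
    define I where "I = {i. \<exists>l. \<not> int p dvd coeff (coeff G i) l}"
    have "I \<subseteq> {..degree G}"
    proof
      fix i assume "i \<in> I"
      then have "coeff G i \<noteq> 0" by (auto simp: I_def)
      then show "i \<in> {..degree G}" by (simp add: le_degree)
    qed
    then have fI: "finite I" by (rule finite_subset) simp
    have "i \<in> I" using il by (auto simp: I_def)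
    define e where "e = Max I"
    have "e \<in> I" unfolding e_def using fI \<open>i \<in> I\<close> by (intro Max_in) auto
    then obtain l where l: "\<not> int p dvd coeff (coeff G e) l" by (auto simp: I_def)
    have gt: "int p dvd coeff (coeff G k) j" if "k > e" for k j
      using that Max_ge[OF fI, of k] unfolding e_def[symmetric] by (force simp: I_def)
    have F: "F * G = Polynomial.monom 1 p * G - Polynomial.monom 1 1 * G - Polynomial.smult h G"
      by (simp add: F_def mon_def monom_0 left_diff_distrib flip: one_pCons)
    have "coeff (F * G) (p + e) = coeff G e - coeff G (p + e - 1) - h * coeff G (p + e)"
      unfolding F using p_gt_1 by (simp add: coeff_monom_mult)
    moreover have "coeff U (p + e) = 0" using assms(2) by (simp add: coeff_eq_0)
    ultimately have "coeff (coeff (U - F * G) (p + e)) l =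
        - coeff (coeff G e) l + (coeff (coeff G (p + e - 1)) l + coeff (h * coeff G (p + e)) l)" by simp
    then have "int p dvd - coeff (coeff G e) l + (coeff (coeff G (p + e - 1)) l + coeff (h * coeff G (p + e)) l)"
      using G unfolding pdvd_def by metis
    moreover have "int p dvd coeff (coeff G (p + e - 1)) l" using p_gt_1 by (intro gt) auto
    moreover have "int p dvd coeff (h * coeff G (p + e)) l"
      unfolding coeff_mult using p_gt_1 by (intro dvd_sum dvd_mult gt) auto
    ultimately have "int p dvd - coeff (coeff G e) l" by (meson dvd_add dvd_add_left_iff)
    with l show False by simp
  qed
  then show ?thesis using pdvd_add[OF G pdvd_mult, of G F] by simp
qed

lemma not_zc_symbol:
  assumes "\<not> zc U"
  obtains m U' where "W m U'" "\<not> int p dvd s m U'" "zc (U - U')"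
proof -
  obtain R G where RG: "U = R + F * G" "degree R < p" by (rule reduction')
  have "\<not> pdvd R"
  proof
    assume "pdvd R"
    then have "zc (R + F * G)" by (intro zc_add zc_pdvd zc_F)
    then show False using assms RG by simp
  qed
  from symbol_nonzero[OF RG(2) this] obtain m R' where R': "W m R'" "\<not> int p dvd s m R'" "pdvd (R - R')"
    by blast
  have "zc ((R - R') + F * G)" using R' by (intro zc_add zc_pdvd zc_F)
  then have "zc (U - R')" by (simp add: RG algebra_simps)
  with that R' show ?thesis by blast
qed

lemma zc_symbol: assumes "zc U" "W m U" shows "int p dvd s m U"
proof -
  obtain R G where RG: "U = R + F * G" "degree R < p" "W m R" "s m R = s m U" using reduction[OF assms(2)] .
  have "zc (U - F * G)" using assms zc_F by (intro zc_diff)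
  then have "pdvd R" using RG by (intro zc_degree) simp_all
  then show ?thesis using pdvd_s RG(4) by metis
qed

text \<open>Outside the ideal, suitable representatives have symbols that are nonzero modulo p;
  symbols multiply and p is prime, so the product stays outside. This is the irreducibility of the
  curve over F_p.\<close>

lemma zc_prime: assumes "zc (U * V)" shows "zc U \<or> zc V"
proof (rule ccontr)
  assume "\<not> ?thesis"
  then obtain m U' n V' where UV: "W m U'" "\<not> int p dvd s m U'" "zc (U - U')"
    "W n V'" "\<not> int p dvd s n V'" "zc (V - V')" using not_zc_symbol by metis
  have "zc (U * V - (V * (U - U') + U' * (V - V')))"
    by (rule zc_diff[OF assms zc_add[OF zc_mult[OF UV(3)] zc_mult[OF UV(6)]]])
  then have "zc (U' * V')" by (simp add: algebra_simps)
  from zc_symbol[OF this W_mult[OF UV(1,4)]] have "int p dvd s m U' * s n V'"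
    using UV by (simp add: s_mult)
  then show False using UV p prime_dvd_mult_iff[of "int p"] by auto
qed

lemma not_zc_1: "\<not> zc 1"
proof
  assume "zc 1"
  moreover have "W 0 1" by (auto simp: W_def one_pCons coeff_pCons split: nat.splits)
  ultimately have "int p dvd s 0 1" by (rule zc_symbol)
  then show False using p_gt_1 by (simp add: s_def sym_def)
qed

abbreviation "Fp \<equiv> PIdl\<^bsub>Sp\<^esub> (\<Theta> F)"

interpretation \<Theta>: to_ring Sp \<Theta> by (rule \<Theta>_to_ring)

lemma \<Theta>_mem_iff: "\<Theta> U \<in> Fp \<longleftrightarrow> zc U"
proof
  assume "\<Theta> U \<in> Fp"
  then obtain g where g: "g \<in> carrier Sp" "\<Theta> U = g \<otimes>\<^bsub>Sp\<^esub> \<Theta> F" by (auto simp: cgenideal_def)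
  obtain G where "g = \<Theta> G" using \<Theta>_surj[OF g(1)] by blast
  then have "\<Theta> (U - F * G) = \<zero>\<^bsub>Sp\<^esub>" using g
    by (simp add: \<Theta>.diff \<Theta>.mult mult.commute[of F] \<Theta>.minus_eq \<Theta>.r_neg)
  then show "zc U" by (auto simp: \<Theta>_eq_0_iff zc_def)
next
  assume "zc U"
  then obtain G where "\<Theta> (U - F * G) = \<zero>\<^bsub>Sp\<^esub>" by (auto simp: \<Theta>_eq_0_iff zc_def)
  moreover have "\<Theta> U = \<Theta> ((U - F * G) + G * F)" by (simp add: mult.commute)
  ultimately have "\<Theta> U = \<Theta> G \<otimes>\<^bsub>Sp\<^esub> \<Theta> F" by (simp only: \<Theta>.add \<Theta>.mult) simp
  then show "\<Theta> U \<in> Fp" by (auto simp: cgenideal_def)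
qed

lemma Fp_primeideal: "primeideal Fp Sp"
proof (rule primeidealI)
  show "ideal Fp Sp" by (rule \<Theta>.cgenideal_ideal) simp
  show "cring Sp" by (rule \<Theta>.is_cring)
  have "\<Theta> 1 \<notin> Fp" using not_zc_1 by (simp add: \<Theta>_mem_iff)
  then show "carrier Sp \<noteq> Fp" using \<Theta>.closed by blast
  fix a b assume ab: "a \<in> carrier Sp" "b \<in> carrier Sp" "a \<otimes>\<^bsub>Sp\<^esub> b \<in> Fp"
  obtain U V where "a = \<Theta> U" "b = \<Theta> V" using \<Theta>_surj ab by metis
  then show "a \<in> Fp \<or> b \<in> Fp" using ab zc_prime by (simp add: \<Theta>_mem_iff flip: \<Theta>.mult)
qed

lemma coordinate_ring_eq: "AS_coordinate_ring p (lift (zmod p) h) = Sp Quot Fp"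
proof -
  interpret z: to_ring Rp "zmod p" by (rule to_ring_zmod[OF p])
  interpret A: to_ring "UP Rp" "lift (zmod p)" by (rule z.to_ring_lift)
  have "\<Theta> F = up_ring.monom Sp \<one>\<^bsub>UP Rp\<^esub> 1 [^]\<^bsub>Sp\<^esub> p \<ominus>\<^bsub>Sp\<^esub> up_ring.monom Sp \<one>\<^bsub>UP Rp\<^esub> 1 \<ominus>\<^bsub>Sp\<^esub> up_ring.monom Sp (lift (zmod p) h) 0"
  proof -
    have y: "\<Theta> (Polynomial.monom 1 1) = up_ring.monom Sp \<one>\<^bsub>UP Rp\<^esub> 1"
      unfolding \<Theta>_def by (simp add: A.lift_monom A.one)
    have c: "\<Theta> (Polynomial.monom h 0) = up_ring.monom Sp (lift (zmod p) h) 0"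
      unfolding \<Theta>_def by (simp add: A.lift_monom)
    have "F = Polynomial.monom 1 1 ^ p - Polynomial.monom 1 1 - Polynomial.monom h 0"
      by (simp add: F_def mon_def monom_power monom_0 flip: one_pCons)
    then have "\<Theta> F = \<Theta> (Polynomial.monom 1 1) [^]\<^bsub>Sp\<^esub> p \<ominus>\<^bsub>Sp\<^esub> \<Theta> (Polynomial.monom 1 1) \<ominus>\<^bsub>Sp\<^esub> \<Theta> (Polynomial.monom h 0)"
      by (simp only: \<Theta>.diff \<Theta>.power)
    then show ?thesis by (simp only: y c)
  qed
  then show ?thesis by (simp add: AS_coordinate_ring_def Let_def)
qed

abbreviation "Qp \<equiv> Sp Quot Fp"

definition \<rho> :: "int poly poly \<Rightarrow> (nat \<Rightarrow> nat \<Rightarrow> int) set" where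
  "\<rho> U = Fp +>\<^bsub>Sp\<^esub> \<Theta> U"

lemma Qp_domain: "domain Qp"
  by (rule primeideal.quotient_is_domain[OF Fp_primeideal])

lemma \<rho>_to_ring: "to_ring Qp \<rho>"
proof -
  interpret I: primeideal Fp Sp by (rule Fp_primeideal)
  interpret Q: "domain" Qp by (rule Qp_domain)
  note hom = I.rcos_ring_hom
  show ?thesis
    by unfold_locales
      (simp_all add: \<rho>_def \<Theta>.add \<Theta>.mult \<Theta>.one ring_hom_closed[OF hom] ring_hom_add[OF hom] ring_hom_mult[OF hom] ring_hom_one[OF hom])
qed

lemma \<rho>_surj: assumes "b \<in> carrier Qp" shows "\<exists>U. \<rho> U = b"
proof -
  obtain a where "a \<in> carrier Sp" "b = Fp +>\<^bsub>Sp\<^esub> a" using assms by (auto simp: FactRing_simps)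
  then show ?thesis using \<Theta>_surj by (metis \<rho>_def)
qed

lemma \<rho>_eq_0_iff: "\<rho> U = \<zero>\<^bsub>Qp\<^esub> \<longleftrightarrow> zc U"
proof -
  interpret I: primeideal Fp Sp by (rule Fp_primeideal)
  have "\<rho> U = Fp \<longleftrightarrow> \<Theta> U \<in> Fp"
    unfolding \<rho>_def using I.rcos_const_imp_mem[of "\<Theta> U"] I.a_rcos_const[of "\<Theta> U"] \<Theta>.closed by blast
  then show ?thesis by (simp add: FactRing_def \<Theta>_mem_iff)
qed

definition \<kappa> :: "int poly poly \<Rightarrow> ((nat \<Rightarrow> nat \<Rightarrow> int) set \<times> (nat \<Rightarrow> nat \<Rightarrow> int) set) set" where
  "\<kappa> U = fraction Qp (\<rho> U) \<one>\<^bsub>Qp\<^esub>"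

lemma \<kappa>_to_ring: "to_ring (fraction_field Qp) \<kappa>"
proof -
  interpret Q: "domain" Qp by (rule Qp_domain)
  interpret \<rho>: to_ring Qp \<rho> by (rule \<rho>_to_ring)
  interpret K: field "fraction_field Qp" by (rule Q.fraction_field_is_field)
  show ?thesis
    by unfold_locales
      (simp_all add: \<kappa>_def \<rho>.add \<rho>.mult \<rho>.one Q.fraction_in_carrier Q.fraction_field_add Q.fraction_field_mult,
       simp add: fraction_field_def)
qed

lemma \<kappa>_eq_0_iff: "\<kappa> U = \<zero>\<^bsub>fraction_field Qp\<^esub> \<longleftrightarrow> zc U"
proof -
  interpret Q: "domain" Qp by (rule Qp_domain)
  interpret \<rho>: to_ring Qp \<rho> by (rule \<rho>_to_ring)
  have "\<zero>\<^bsub>fraction_field Qp\<^esub> = fraction Qp \<zero>\<^bsub>Qp\<^esub> \<one>\<^bsub>Qp\<^esub>" by (simp add: fraction_field_def)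
  then show ?thesis by (simp add: \<kappa>_def Q.fraction_eq_iff \<rho>_eq_0_iff)
qed

lemma \<kappa>_quotients:
  assumes "z \<in> carrier (fraction_field Qp)"
  shows "\<exists>U V. \<not> zc V \<and> z \<otimes>\<^bsub>fraction_field Qp\<^esub> \<kappa> V = \<kappa> U"
proof -
  interpret Q: "domain" Qp by (rule Qp_domain)
  interpret \<rho>: to_ring Qp \<rho> by (rule \<rho>_to_ring)
  obtain a b where ab: "a \<in> carrier Qp" "b \<in> carrier Qp - {\<zero>\<^bsub>Qp\<^esub>}" "z = fraction Qp a b"
    using assms by (rule Q.fraction_cases)
  obtain U V where UV: "a = \<rho> U" "b = \<rho> V" using ab \<rho>_surj by (metis Diff_iff)
  have "\<not> zc V" using ab UV \<rho>_eq_0_iff by auto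
  moreover have "z \<otimes>\<^bsub>fraction_field Qp\<^esub> \<kappa> V = \<kappa> U"
    using ab unfolding \<kappa>_def UV by (simp add: Q.fraction_field_mult Q.fraction_eq_iff Q.integral_iff)
  ultimately show ?thesis by blast
qed

end

section \<open>Fields given by a carrier set and fields given by a type\<close>

locale field_rep =
  fixes L :: "('a, 'm) ring_scheme" (structure) and rep :: "'t::field \<Rightarrow> 'a"
  assumes is_field: "field L"
    and bij: "bij_betw rep UNIV (carrier L)"
    and rep_add: "rep (x + y) = rep x \<oplus> rep y"
    and rep_mult: "rep (x * y) = rep x \<otimes> rep y"
    and rep_one: "rep 1 = \<one>"
begin

sublocale to_ring L rep
proof -
  interpret L: field L by (rule is_field)
  show "to_ring L rep"
    using bij by unfold_locales (auto simp: bij_betw_def rep_add rep_mult rep_one)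
qed

lemma rep_inject [simp]: "rep x = rep y \<longleftrightarrow> x = y"
  using bij by (auto simp: bij_betw_def inj_eq)

lemma rep_surj: "a \<in> carrier L \<Longrightarrow> \<exists>x. a = rep x"
  using bij by (auto simp: bij_betw_def)

lemma rep_eq_0_iff [simp]: "rep x = \<zero> \<longleftrightarrow> x = 0"
  using rep_inject[of x 0] zero by simp

lemma rep_inverse: "x \<noteq> 0 \<Longrightarrow> rep (inverse x) = inv (rep x)"
  by (rule comm_inv_char[symmetric]) (simp_all flip: mult one)

end

text \<open>Points are transported along the bijections \<open>repK\<close> and \<open>repC\<close>.
  The locality condition of \<open>curve_points\<close> speaks of the units of V as a ring; these
  are the nonzero elements whose inverse lies in V.\<close>

lemma card_curve_points:
  fixes K :: "('a, 'm) ring_scheme" and C :: "('b, 'n) ring_scheme"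
    and repK :: "'k::field \<Rightarrow> 'a" and repC :: "'f::field \<Rightarrow> 'b"
  assumes "field_rep K repK" "field_rep C repC"
  shows "card (curve_points K (C\<lparr>carrier := repC ` G\<rparr>)) =
    card {(V, \<phi> :: 'k \<Rightarrow> 'f). is_place V \<phi> \<and> \<phi> \<in> extensional V \<and> \<phi> ` V \<subseteq> G}"
proof -
  interpret K: field_rep K repK by fact
  interpret C: field_rep C repC by fact
  define absK where "absK = (\<lambda>a. THE x. repK x = a)"
  have absK [simp]: "absK (repK x) = x" for x unfolding absK_def by simp
  define absC where "absC = (\<lambda>a. THE x. repC x = a)"
  have absC [simp]: "absC (repC x) = x" for x unfolding absC_def by simp
  define b where "b = (\<lambda>(V, \<phi> :: 'k \<Rightarrow> 'f). (repK ` V, \<lambda>z\<in>repK ` V. repC (\<phi> (absK z))))"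
  have units: "repK x \<in> Units (K\<lparr>carrier := repK ` V\<rparr>) \<longleftrightarrow> x \<noteq> 0 \<and> inverse x \<in> V" if x: "x \<in> V" for x V
  proof
    assume "repK x \<in> Units (K\<lparr>carrier := repK ` V\<rparr>)"
    then obtain y where y: "y \<in> V" "repK y \<otimes>\<^bsub>K\<^esub> repK x = \<one>\<^bsub>K\<^esub>" by (auto simp: Units_def)
    then have "y * x = 1" by (simp flip: K.mult K.one)
    moreover from this have "y = inverse x" by (metis inverse_unique mult.commute)
    ultimately show "x \<noteq> 0 \<and> inverse x \<in> V" using y by auto
  next
    assume "x \<noteq> 0 \<and> inverse x \<in> V"
    then show "repK x \<in> Units (K\<lparr>carrier := repK ` V\<rparr>)"
      using x by (auto simp: Units_def simp flip: K.mult K.one intro!: bexI[of _ "inverse x"])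
  qed
  have val: "repK ` V \<in> valuation_rings K \<longleftrightarrow> V \<noteq> UNIV \<and> 1 \<in> V \<and> - 1 \<in> V \<and>
      (\<forall>a\<in>V. \<forall>b\<in>V. a + b \<in> V \<and> a * b \<in> V) \<and> (\<forall>z. z \<noteq> 0 \<longrightarrow> z \<in> V \<or> inverse z \<in> V)" (is "_ \<longleftrightarrow> ?r") for V
  proof -
    have mem: "repK x \<in> repK ` V \<longleftrightarrow> x \<in> V" for x by auto
    have "repK ` V \<noteq> carrier K \<longleftrightarrow> V \<noteq> UNIV"
      using K.bij mem by (auto simp: bij_betw_def)
    moreover have "(\<forall>z \<in> carrier K - {\<zero>\<^bsub>K\<^esub>}. z \<in> repK ` V \<or> inv\<^bsub>K\<^esub> z \<in> repK ` V) \<longleftrightarrow>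
        (\<forall>z. z \<noteq> 0 \<longrightarrow> z \<in> V \<or> inverse z \<in> V)"
    proof (intro iffI allI impI ballI)
      fix z assume *: "\<forall>z \<in> carrier K - {\<zero>\<^bsub>K\<^esub>}. z \<in> repK ` V \<or> inv\<^bsub>K\<^esub> z \<in> repK ` V" and z: "z \<noteq> (0 :: 'k)"
      then have "repK z \<in> repK ` V \<or> inv\<^bsub>K\<^esub> repK z \<in> repK ` V" by simp
      then show "z \<in> V \<or> inverse z \<in> V" using K.rep_inverse[OF z] mem by metis
    next
      fix z assume *: "\<forall>z. z \<noteq> 0 \<longrightarrow> z \<in> V \<or> inverse z \<in> V" and z: "z \<in> carrier K - {\<zero>\<^bsub>K\<^esub>}"
      obtain x where x: "z = repK x" using K.rep_surj z by blast
      then have "x \<noteq> 0" using z by auto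
      then show "z \<in> repK ` V \<or> inv\<^bsub>K\<^esub> z \<in> repK ` V" using * x K.rep_inverse mem by metis
    qed
    moreover have "subring (repK ` V) K \<longleftrightarrow> 1 \<in> V \<and> - 1 \<in> V \<and> (\<forall>a\<in>V. \<forall>b\<in>V. a + b \<in> V \<and> a * b \<in> V)"
    proof
      assume sr: "subring (repK ` V) K"
      have "repK 1 \<in> repK ` V" "repK (- 1) \<in> repK ` V" 
        using subringE(3)[OF sr] subringE(5)[OF sr] by (auto simp: K.one K.uminus)
      moreover have "repK (a + b) \<in> repK ` V" "repK (a * b) \<in> repK ` V" if "a \<in> V" "b \<in> V" for a b
        unfolding K.add K.mult using that subringE(6,7)[OF sr] by blast+
      ultimately show "1 \<in> V \<and> - 1 \<in> V \<and> (\<forall>a\<in>V. \<forall>b\<in>V. a + b \<in> V \<and> a * b \<in> V)"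
        unfolding mem by simp
    next
      assume r: "1 \<in> V \<and> - 1 \<in> V \<and> (\<forall>a\<in>V. \<forall>b\<in>V. a + b \<in> V \<and> a * b \<in> V)"
      have neg: "- a \<in> V" if "a \<in> V" for a using r that by (metis mult_minus1)
      show "subring (repK ` V) K"
      proof (rule K.subringI)
        show "\<one>\<^bsub>K\<^esub> \<in> repK ` V" using r K.one by (metis imageI)
        show "repK ` V \<subseteq> carrier K" by auto
        fix x assume "x \<in> repK ` V"
        then obtain a where a: "x = repK a" "a \<in> V" by blast
        show "\<ominus>\<^bsub>K\<^esub> x \<in> repK ` V" unfolding a(1) K.uminus[symmetric] mem by (rule neg[OF a(2)])
        fix y assume "y \<in> repK ` V"
        then obtain b where b: "y = repK b" "b \<in> V" by blast
        show "x \<otimes>\<^bsub>K\<^esub> y \<in> repK ` V" unfolding a(1) b(1) K.mult[symmetric] mem using r a(2) b(2) by simp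
        show "x \<oplus>\<^bsub>K\<^esub> y \<in> repK ` V" unfolding a(1) b(1) K.add[symmetric] mem using r a(2) b(2) by simp
      qed
    qed
    ultimately show ?thesis by (simp add: valuation_rings_def) blast
  qed
  have "bij_betw b {(V, \<phi> :: 'k \<Rightarrow> 'f). is_place V \<phi> \<and> \<phi> \<in> extensional V \<and> \<phi> ` V \<subseteq> G}
     (curve_points K (C\<lparr>carrier := repC ` G\<rparr>))"
  proof (rule bij_betwI')
    fix v w :: "'k set \<times> ('k \<Rightarrow> 'f)"
    assume v: "v \<in> {(V, \<phi>). is_place V \<phi> \<and> \<phi> \<in> extensional V \<and> \<phi> ` V \<subseteq> G}"
      and w: "w \<in> {(V, \<phi>). is_place V \<phi> \<and> \<phi> \<in> extensional V \<and> \<phi> ` V \<subseteq> G}"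
    obtain V \<phi> V' \<phi>' where vw: "v = (V, \<phi>)" "w = (V', \<phi>')" by force
    show "b v = b w \<longleftrightarrow> v = w"
    proof
      assume "b v = b w"
      then have eq: "repK ` V = repK ` V'" "(\<lambda>z\<in>repK ` V. repC (\<phi> (absK z))) = (\<lambda>z\<in>repK ` V'. repC (\<phi>' (absK z)))"
        unfolding b_def vw prod.case prod.inject by blast+
      have "inj repK" using K.bij by (simp add: bij_betw_def)
      then have V: "V = V'" using eq(1) by (simp add: inj_image_eq_iff)
      have "\<phi> z = \<phi>' z" for z
      proof (cases "z \<in> V")
        case True
        then show ?thesis using fun_cong[OF eq(2), of "repK z"] V by simp
      next
        case False
        then show ?thesis using v w V by (auto simp: vw extensional_def)
      qed
      then show "v = w" using V by (auto simp: vw)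
    qed simp
  next
    fix v :: "'k set \<times> ('k \<Rightarrow> 'f)"
    assume v: "v \<in> {(V, \<phi>). is_place V \<phi> \<and> \<phi> \<in> extensional V \<and> \<phi> ` V \<subseteq> G}"
    obtain V \<phi> where v': "v = (V, \<phi>)" by force
    have pl: "is_place V \<phi>" "\<phi> ` V \<subseteq> G" using v by (auto simp: v')
    have ho: "(\<lambda>z\<in>repK ` V. repC (\<phi> (absK z))) \<in> ring_hom (K\<lparr>carrier := repK ` V\<rparr>) (C\<lparr>carrier := repC ` G\<rparr>)"
    proof (rule ring_hom_memI)
      fix x y assume "x \<in> carrier (K\<lparr>carrier := repK ` V\<rparr>)"
      then obtain x' where x: "x = repK x'" "x' \<in> V" by auto
      then show "(\<lambda>z\<in>repK ` V. repC (\<phi> (absK z))) x \<in> carrier (C\<lparr>carrier := repC ` G\<rparr>)" using pl by auto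
      assume "y \<in> carrier (K\<lparr>carrier := repK ` V\<rparr>)"
      then obtain y' where y: "y = repK y'" "y' \<in> V" by auto
      show "(\<lambda>z\<in>repK ` V. repC (\<phi> (absK z))) (x \<otimes>\<^bsub>K\<lparr>carrier := repK ` V\<rparr>\<^esub> y) =
        (\<lambda>z\<in>repK ` V. repC (\<phi> (absK z))) x \<otimes>\<^bsub>C\<lparr>carrier := repC ` G\<rparr>\<^esub> (\<lambda>z\<in>repK ` V. repC (\<phi> (absK z))) y"
        using pl x y by (simp add: is_place_def flip: K.mult C.mult)
      show "(\<lambda>z\<in>repK ` V. repC (\<phi> (absK z))) (x \<oplus>\<^bsub>K\<lparr>carrier := repK ` V\<rparr>\<^esub> y) =
        (\<lambda>z\<in>repK ` V. repC (\<phi> (absK z))) x \<oplus>\<^bsub>C\<lparr>carrier := repC ` G\<rparr>\<^esub> (\<lambda>z\<in>repK ` V. repC (\<phi> (absK z))) y"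
        using pl x y by (simp add: is_place_def flip: K.add C.add)
    next
      show "(\<lambda>z\<in>repK ` V. repC (\<phi> (absK z))) \<one>\<^bsub>K\<lparr>carrier := repK ` V\<rparr>\<^esub> = \<one>\<^bsub>C\<lparr>carrier := repC ` G\<rparr>\<^esub>"
        using pl by (simp add: is_place_def flip: K.one C.one)
    qed
    have "\<forall>z\<in>repK ` V - Units (K\<lparr>carrier := repK ` V\<rparr>). (\<lambda>z\<in>repK ` V. repC (\<phi> (absK z))) z = \<zero>\<^bsub>C\<^esub>"
    proof
      fix z assume z: "z \<in> repK ` V - Units (K\<lparr>carrier := repK ` V\<rparr>)"
      then obtain x where x: "z = repK x" "x \<in> V" by auto
      then have "\<not> (x \<noteq> 0 \<and> inverse x \<in> V)" using units z by blast
      then have "\<phi> x = 0" using pl x by (auto simp: is_place_def)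
      then show "(\<lambda>z\<in>repK ` V. repC (\<phi> (absK z))) z = \<zero>\<^bsub>C\<^esub>" using x by simp
    qed
    moreover have "repK ` V \<in> valuation_rings K" unfolding val using pl by (auto simp: is_place_def)
    ultimately show "b v \<in> curve_points K (C\<lparr>carrier := repC ` G\<rparr>)"
      using ho by (simp add: b_def v' curve_points_def)
  next
    fix q assume q: "q \<in> curve_points K (C\<lparr>carrier := repC ` G\<rparr>)"
    obtain V' \<psi> where q': "q = (V', \<psi>)" by force
    have V': "V' \<in> valuation_rings K" and hom: "\<psi> \<in> ring_hom (K\<lparr>carrier := V'\<rparr>) (C\<lparr>carrier := repC ` G\<rparr>)"
      and ext: "\<psi> \<in> extensional V'" and loc: "\<And>z. z \<in> V' \<Longrightarrow> z \<notin> Units (K\<lparr>carrier := V'\<rparr>) \<Longrightarrow> \<psi> z = \<zero>\<^bsub>C\<^esub>"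
      using q by (auto simp: q' curve_points_def)
    define V where "V = {x. repK x \<in> V'}"
    have "V' \<subseteq> carrier K" using V' subringE(1) by (auto simp: valuation_rings_def)
    then have VV: "V' = repK ` V" using K.rep_surj by (auto simp: V_def)
    define \<phi> where "\<phi> = (\<lambda>x\<in>V. absC (\<psi> (repK x)))"
    have range: "\<psi> (repK x) \<in> repC ` G" if "x \<in> V" for x
      using ring_hom_closed[OF hom, of "repK x"] that by (simp add: VV)
    then have \<phi>: "repC (\<phi> x) = \<psi> (repK x)" if "x \<in> V" for x
  proof -
    have "\<psi> (repK x) \<in> repC ` G" by (rule range[OF that])
    then obtain c where "\<psi> (repK x) = repC c" by blast
    then show ?thesis using \<open>x \<in> V\<close> by (simp add: \<phi>_def)
  qed
    have \<phi>G: "\<phi> ` V \<subseteq> G"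
    proof
      fix c assume "c \<in> \<phi> ` V"
      then obtain x where x: "x \<in> V" "c = \<phi> x" by auto
      then have "repC c \<in> repC ` G" using \<phi> range by metis
      then show "c \<in> G" by auto
    qed
    note val' = V'[unfolded VV val]
    have "is_place V \<phi>"
      unfolding is_place_def
    proof (intro conjI ballI)
      show "V \<noteq> UNIV" "1 \<in> V" "- 1 \<in> V" "\<forall>z. z \<noteq> 0 \<longrightarrow> z \<in> V \<or> inverse z \<in> V" using val' by blast+
      show "\<phi> 1 = 1"
      proof -
        have "repC (\<phi> 1) = repC 1" using ring_hom_one[OF hom] val' by (simp add: \<phi> K.one C.one)
        then show ?thesis by simp
      qed
      fix a assume a: "a \<in> V"
      {
        fix b assume b: "b \<in> V"
        show ab: "a + b \<in> V" "a * b \<in> V" using a b val' by blast+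
        have "repC (\<phi> (a + b)) = repC (\<phi> a + \<phi> b)"
          using ring_hom_add[OF hom, of "repK a" "repK b"] a b ab by (simp add: \<phi> K.add C.add VV)
        then show "\<phi> (a + b) = \<phi> a + \<phi> b" by simp
        have "repC (\<phi> (a * b)) = repC (\<phi> a * \<phi> b)"
          using ring_hom_mult[OF hom, of "repK a" "repK b"] a b ab by (simp add: \<phi> K.mult C.mult VV)
        then show "\<phi> (a * b) = \<phi> a * \<phi> b" by simp
      }
      show "a = 0 \<or> inverse a \<notin> V \<longrightarrow> \<phi> a = 0"
      proof
        assume "a = 0 \<or> inverse a \<notin> V"
        then have "\<psi> (repK a) = \<zero>\<^bsub>C\<^esub>" using loc[of "repK a"] units[OF a] a by (auto simp: VV)
        then have "repC (\<phi> a) = repC 0" using \<phi>[OF a] C.zero by simp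
        then show "\<phi> a = 0" by simp
      qed
    qed
    moreover have "b (V, \<phi>) = q"
    proof -
      have "(\<lambda>z\<in>repK ` V. repC (\<phi> (absK z))) = \<psi>"
      proof
        fix z show "(\<lambda>z\<in>repK ` V. repC (\<phi> (absK z))) z = \<psi> z"
          using ext \<phi> by (cases "z \<in> repK ` V") (auto simp: VV extensional_def)
      qed
      then show ?thesis by (simp add: b_def q' VV)
    qed
    ultimately show "\<exists>v\<in>{(V, \<phi>). is_place V \<phi> \<and> \<phi> \<in> extensional V \<and> \<phi> ` V \<subseteq> G}. q = b v"
      using \<phi>G by (intro bexI[of _ "(V, \<phi>)"]) (auto simp: \<phi>_def)
  qed
  then show ?thesis by (rule bij_betw_same_card[symmetric])
qed

section \<open>Transfer to types\<close>

text \<open>The fields attached to a prime \<open>p\<close> and a polynomial \<open>h\<close> cannot be turned into types inside a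
  proof, as types do not depend on terms. Hence \<open>p\<close> and \<open>h\<close> are fixed globally, as a counterexample
  to the statement to be proved if there is one. What is shown for this one pair then holds for all.\<close>

definition admissible :: "nat \<Rightarrow> int poly \<Rightarrow> bool" where
  "admissible p h \<longleftrightarrow> prime p \<and> degree h \<ge> 1 \<and> lead_coeff h = 1 \<and> coprime (degree h) p \<and>
     (\<forall>i. coeff h i \<in> {0..<int p})"

definition point_count_formula :: "nat \<Rightarrow> int poly \<Rightarrow> bool" where
  "point_count_formula p h \<longleftrightarrow> (\<exists>S :: int \<Rightarrow> nat \<Rightarrow> complex.
     (\<forall>n>0. of_nat (AS_point_count p (coeff h) n) = 1 + of_nat p ^ n + (\<Sum>a\<in>{1..<p}. S (int a) n)) \<and>
     (\<forall>a n. of_nat n * expsum p h a n = (\<Sum>j\<in>{1..n}. S a j * expsum p h a (n - j))))"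

definition counterexample :: "nat \<times> int poly" where
  "counterexample = (SOME (p, h). admissible p h \<and>
     ((\<exists>p h. admissible p h \<and> \<not> point_count_formula p h) \<longrightarrow> \<not> point_count_formula p h))"

definition p\<^sub>0 :: nat where "p\<^sub>0 = fst counterexample"
definition h\<^sub>0 :: "int poly" where "h\<^sub>0 = snd counterexample"

text \<open>A pair to fall back on when there is no counterexample, so that the fields below exist
  in any event.\<close>

lemma admissible_exists: "admissible 2 [:0, 1:]"
  by (auto simp: admissible_def coeff_pCons split: nat.splits)

lemma counterexample:
  shows admissible_0: "admissible p\<^sub>0 h\<^sub>0"
    and formula_0: "point_count_formula p\<^sub>0 h\<^sub>0 \<Longrightarrow> admissible p h \<Longrightarrow> point_count_formula p h"
proof -
  define P where "P = (\<lambda>(p, h). admissible p h \<and>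
     ((\<exists>p h. admissible p h \<and> \<not> point_count_formula p h) \<longrightarrow> \<not> point_count_formula p h))"
  have "\<exists>x. P x"
  proof (cases "\<exists>p h. admissible p h \<and> \<not> point_count_formula p h")
    case True
    then obtain p h where "admissible p h" "\<not> point_count_formula p h" by blast
    then show ?thesis by (intro exI[of _ "(p, h)"]) (simp add: P_def)
  next
    case False
    then show ?thesis using admissible_exists by (intro exI[of _ "(2, [:0, 1:])"]) (simp add: P_def)
  qed
  then have "P counterexample" unfolding counterexample_def P_def[symmetric] by (rule someI_ex)
  then show "admissible p\<^sub>0 h\<^sub>0"
    "point_count_formula p\<^sub>0 h\<^sub>0 \<Longrightarrow> admissible p h \<Longrightarrow> point_count_formula p h"
    by (auto simp: P_def p\<^sub>0_def h\<^sub>0_def case_prod_beta)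
qed

lemma prime_0: "prime p\<^sub>0"
  using admissible_0 by (simp add: admissible_def)

interpretation w\<^sub>0: weighted p\<^sub>0 "degree h\<^sub>0" h\<^sub>0
  using admissible_0 by unfold_locales (simp_all add: admissible_def)

lemma coeff_h\<^sub>0: "lift (zmod p\<^sub>0) h\<^sub>0 = coeff h\<^sub>0"
  using admissible_0 by (auto simp: admissible_def lift_def zmod_def)

section \<open>Field types for the algebraic closure and the function field\<close>

locale typed_field = type_definition rep abs "carrier L"
  for L :: "('a, 'm) ring_scheme" (structure) and rep :: "'t \<Rightarrow> 'a" and abs :: "'a \<Rightarrow> 't" +
  assumes is_field: "field L"
begin

interpretation L: field L by (rule is_field)

lemma rep_closed [simp]: "rep x \<in> carrier L"
  by (rule Rep)

lemma rep_abs [simp]: "a \<in> carrier L \<Longrightarrow> rep (abs a) = a"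
  by (rule Abs_inverse)

lemma rep_inject [simp]: "rep x = rep y \<longleftrightarrow> x = y"
  by (rule Rep_inject)

lemma abs_eq_zero: "rep x \<noteq> \<zero> \<longleftrightarrow> x \<noteq> abs \<zero>"
  by (metis rep_abs rep_inject L.zero_closed)

lemma rep_bij: "bij_betw rep UNIV (carrier L)"
  unfolding bij_betw_def using Rep_range by (auto intro: injI)

end

definition L\<^sub>0 :: "((int list \<times> nat) multiset \<Rightarrow> int) ring" where
  "L\<^sub>0 = field.alg_closure (residue_ring (int p\<^sub>0))"

definition K\<^sub>0 :: "((nat \<Rightarrow> nat \<Rightarrow> int) set \<times> (nat \<Rightarrow> nat \<Rightarrow> int) set) set ring" where
  "K\<^sub>0 = AS_function_field p\<^sub>0 (coeff h\<^sub>0)"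

lemma residue_field: "field (residue_ring (int p\<^sub>0))"
proof -
  interpret residues_prime p\<^sub>0 "residue_ring (int p\<^sub>0)"
    using prime_0 by unfold_locales (auto simp: prime_gt_1_nat)
  show ?thesis by (rule is_field)
qed

lemma L\<^sub>0_closure: "algebraic_closure L\<^sub>0 (ring.indexed_const (residue_ring (int p\<^sub>0)) ` carrier (residue_ring (int p\<^sub>0)))"
  and L\<^sub>0_hom: "ring.indexed_const (residue_ring (int p\<^sub>0)) \<in> ring_hom (residue_ring (int p\<^sub>0)) L\<^sub>0"
  unfolding L\<^sub>0_def using field.alg_closureE[OF residue_field] .

lemma L\<^sub>0_field: "field L\<^sub>0"
proof -
  interpret algebraic_closure L\<^sub>0 "ring.indexed_const (residue_ring (int p\<^sub>0)) ` carrier (residue_ring (int p\<^sub>0))"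
    by (rule L\<^sub>0_closure)
  show ?thesis by unfold_locales
qed

lemma L\<^sub>0_root:
  assumes P: "P \<in> carrier (poly_ring L\<^sub>0)" "Polynomials.degree P > 0"
  shows "\<exists>x\<in>carrier L\<^sub>0. ring.eval L\<^sub>0 P x = \<zero>\<^bsub>L\<^sub>0\<^esub>"
proof -
  interpret algebraic_closure L\<^sub>0 "ring.indexed_const (residue_ring (int p\<^sub>0)) ` carrier (residue_ring (int p\<^sub>0))"
    by (rule L\<^sub>0_closure)
  have "splitted P" using P(1) by (rule roots_over_carrier)
  then have "roots P \<noteq> {#}" unfolding splitted_def using P(2) by auto
  then obtain x where "x \<in># roots P" by blast
  then have "is_root P x" using roots_mem_iff_is_root[OF P(1)] by auto
  then show ?thesis by (auto simp: is_root_def)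
qed

lemma K\<^sub>0_eq: "K\<^sub>0 = fraction_field w\<^sub>0.Qp"
  unfolding K\<^sub>0_def AS_function_field_def coeff_h\<^sub>0[symmetric] w\<^sub>0.coordinate_ring_eq ..

lemma K\<^sub>0_field: "field K\<^sub>0"
proof -
  interpret Q: "domain" w\<^sub>0.Qp by (rule w\<^sub>0.Qp_domain)
  show ?thesis unfolding K\<^sub>0_eq by (rule Q.fraction_field_is_field)
qed

typedef ac\<^sub>0 = "carrier L\<^sub>0"
proof -
  interpret field L\<^sub>0 by (rule L\<^sub>0_field)
  show ?thesis by (rule exI[of _ "\<zero>\<^bsub>L\<^sub>0\<^esub>"]) simp
qed

typedef ff\<^sub>0 = "carrier K\<^sub>0"
proof -
  interpret field K\<^sub>0 by (rule K\<^sub>0_field)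
  show ?thesis by (rule exI[of _ "\<zero>\<^bsub>K\<^sub>0\<^esub>"]) simp
qed

interpretation L\<^sub>0: typed_field L\<^sub>0 Rep_ac\<^sub>0 Abs_ac\<^sub>0
  by (intro typed_field.intro typed_field_axioms.intro L\<^sub>0_field type_definition_ac\<^sub>0)

interpretation K\<^sub>0: typed_field K\<^sub>0 Rep_ff\<^sub>0 Abs_ff\<^sub>0
  by (intro typed_field.intro typed_field_axioms.intro K\<^sub>0_field type_definition_ff\<^sub>0)

context typed_field
begin

interpretation L: field L by (rule is_field)

definition tinv :: "'t \<Rightarrow> 't" where
  "tinv x = (if rep x = \<zero> then abs \<zero> else abs (inv (rep x)))"

lemma rep_ops:
  "rep (abs (rep x \<oplus> rep y)) = rep x \<oplus> rep y" "rep (abs (rep x \<otimes> rep y)) = rep x \<otimes> rep y"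
  "rep (abs \<one>) = \<one>" "rep (abs \<zero>) = \<zero>" "rep (abs (\<ominus> rep x)) = \<ominus> rep x"
  by simp_all

lemma class_field_axioms:
  "abs (rep (abs (rep x \<otimes> rep y)) \<otimes> rep z) = abs (rep x \<otimes> rep (abs (rep y \<otimes> rep z)))"
  "abs (rep x \<otimes> rep y) = abs (rep y \<otimes> rep x)"
  "abs (rep (abs \<one>) \<otimes> rep x) = x"
  "abs (rep (abs (rep x \<oplus> rep y)) \<oplus> rep z) = abs (rep x \<oplus> rep (abs (rep y \<oplus> rep z)))"
  "abs (rep x \<oplus> rep y) = abs (rep y \<oplus> rep x)"
  "abs (rep (abs \<zero>) \<oplus> rep x) = x"
  "abs (rep (abs (\<ominus> rep x)) \<oplus> rep x) = abs \<zero>"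
  "abs (rep x \<ominus> rep y) = abs (rep x \<oplus> rep (abs (\<ominus> rep y)))"
  "abs (rep (abs (rep x \<oplus> rep y)) \<otimes> rep z) = abs (rep (abs (rep x \<otimes> rep z)) \<oplus> rep (abs (rep y \<otimes> rep z)))"
  "abs \<zero> \<noteq> abs \<one>"
  "x \<noteq> abs \<zero> \<Longrightarrow> abs (rep (tinv x) \<otimes> rep x) = abs \<one>"
  "tinv (abs \<zero>) = abs \<zero>"
proof -
  show "abs \<zero> \<noteq> abs \<one>" by (metis L.one_closed rep_abs L.zero_closed L.zero_not_one)
  show "abs (rep (tinv x) \<otimes> rep x) = abs \<one>" if "x \<noteq> abs \<zero>"
  proof -
    have "rep x \<in> Units L" using that abs_eq_zero by (simp add: L.field_Units)
    moreover have "rep x \<noteq> \<zero>" using that abs_eq_zero by simp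
    ultimately show ?thesis by (simp add: tinv_def)
  qed
  show "abs (rep x \<otimes> rep y) = abs (rep y \<otimes> rep x)" "abs (rep x \<oplus> rep y) = abs (rep y \<oplus> rep x)"
    by (simp_all add: L.m_comm L.a_comm)
qed (simp_all add: L.m_assoc L.a_assoc L.l_distr L.l_neg L.minus_eq Rep_inverse tinv_def)

end

instantiation ac\<^sub>0 :: field
begin
definition "0 = Abs_ac\<^sub>0 \<zero>\<^bsub>L\<^sub>0\<^esub>"
definition "1 = Abs_ac\<^sub>0 \<one>\<^bsub>L\<^sub>0\<^esub>"
definition "x + y = Abs_ac\<^sub>0 (Rep_ac\<^sub>0 x \<oplus>\<^bsub>L\<^sub>0\<^esub> Rep_ac\<^sub>0 y)"
definition "x * y = Abs_ac\<^sub>0 (Rep_ac\<^sub>0 x \<otimes>\<^bsub>L\<^sub>0\<^esub> Rep_ac\<^sub>0 y)"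
definition "- x = Abs_ac\<^sub>0 (\<ominus>\<^bsub>L\<^sub>0\<^esub> Rep_ac\<^sub>0 x)"
definition "x - y = Abs_ac\<^sub>0 (Rep_ac\<^sub>0 x \<ominus>\<^bsub>L\<^sub>0\<^esub> Rep_ac\<^sub>0 y)"
definition "inverse x = L\<^sub>0.tinv x"
definition "x div y = Abs_ac\<^sub>0 (Rep_ac\<^sub>0 x \<otimes>\<^bsub>L\<^sub>0\<^esub> Rep_ac\<^sub>0 (L\<^sub>0.tinv y))"
instance
  by (standard; unfold zero_ac\<^sub>0_def one_ac\<^sub>0_def plus_ac\<^sub>0_def times_ac\<^sub>0_def uminus_ac\<^sub>0_def
      minus_ac\<^sub>0_def inverse_ac\<^sub>0_def divide_ac\<^sub>0_def)
    (rule refl L\<^sub>0.class_field_axioms; assumption?)+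
end

instantiation ff\<^sub>0 :: field
begin
definition "0 = Abs_ff\<^sub>0 \<zero>\<^bsub>K\<^sub>0\<^esub>"
definition "1 = Abs_ff\<^sub>0 \<one>\<^bsub>K\<^sub>0\<^esub>"
definition "x + y = Abs_ff\<^sub>0 (Rep_ff\<^sub>0 x \<oplus>\<^bsub>K\<^sub>0\<^esub> Rep_ff\<^sub>0 y)"
definition "x * y = Abs_ff\<^sub>0 (Rep_ff\<^sub>0 x \<otimes>\<^bsub>K\<^sub>0\<^esub> Rep_ff\<^sub>0 y)"
definition "- x = Abs_ff\<^sub>0 (\<ominus>\<^bsub>K\<^sub>0\<^esub> Rep_ff\<^sub>0 x)"
definition "x - y = Abs_ff\<^sub>0 (Rep_ff\<^sub>0 x \<ominus>\<^bsub>K\<^sub>0\<^esub> Rep_ff\<^sub>0 y)"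
definition "inverse x = K\<^sub>0.tinv x"
definition "x div y = Abs_ff\<^sub>0 (Rep_ff\<^sub>0 x \<otimes>\<^bsub>K\<^sub>0\<^esub> Rep_ff\<^sub>0 (K\<^sub>0.tinv y))"
instance
  by (standard; unfold zero_ff\<^sub>0_def one_ff\<^sub>0_def plus_ff\<^sub>0_def times_ff\<^sub>0_def uminus_ff\<^sub>0_def
      minus_ff\<^sub>0_def inverse_ff\<^sub>0_def divide_ff\<^sub>0_def)
    (rule refl K\<^sub>0.class_field_axioms; assumption?)+
end

interpretation C\<^sub>0: field_rep L\<^sub>0 Rep_ac\<^sub>0
  by (intro field_rep.intro L\<^sub>0_field) (simp_all add: L\<^sub>0.rep_bij L\<^sub>0.rep_ops plus_ac\<^sub>0_def times_ac\<^sub>0_def one_ac\<^sub>0_def)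

interpretation R\<^sub>0: field_rep K\<^sub>0 Rep_ff\<^sub>0
  by (intro field_rep.intro K\<^sub>0_field) (simp_all add: K\<^sub>0.rep_bij K\<^sub>0.rep_ops plus_ff\<^sub>0_def times_ff\<^sub>0_def one_ff\<^sub>0_def)

instance ac\<^sub>0 :: alg_closed_field
proof
  fix q :: "ac\<^sub>0 poly" assume q: "degree q > 0" "lead_coeff q = 1"
  \<comment> \<open>The list representation of polynomials starts with the leading coefficient,
    \<open>coeffs\<close> with the constant term.\<close>
  define P where "P = rev (map Rep_ac\<^sub>0 (Polynomial.coeffs q))"
  have deg: "Polynomials.degree P = degree q"
    by (auto simp: P_def degree_eq_length_coeffs)
  have "q \<noteq> 0" using q by auto
  then have "hd P = Rep_ac\<^sub>0 (lead_coeff q)" "P \<noteq> []"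
    by (simp_all add: P_def hd_rev last_map last_coeffs_eq_coeff_degree)
  moreover have "set P \<subseteq> carrier L\<^sub>0" by (auto simp: P_def)
  ultimately have carrier_P: "P \<in> carrier (poly_ring L\<^sub>0)"
    using \<open>q \<noteq> 0\<close> C\<^sub>0.rep_eq_0_iff[of "lead_coeff q"] by (simp add: univ_poly_def polynomial_def)
  have "Polynomials.degree P > 0" using q(1) by (simp only: deg)
  from L\<^sub>0_root[OF carrier_P this]
  obtain x where xc: "x \<in> carrier L\<^sub>0" and x: "C\<^sub>0.eval P x = \<zero>\<^bsub>L\<^sub>0\<^esub>" by blast
  from xc obtain x' where x': "x = Rep_ac\<^sub>0 x'" using C\<^sub>0.rep_surj by blast
  have "C\<^sub>0.eval (map Rep_ac\<^sub>0 xs) x = Rep_ac\<^sub>0 (poly (Poly (rev xs)) x')" for xs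
    by (induction xs)
      (auto simp: C\<^sub>0.zero C\<^sub>0.add C\<^sub>0.mult C\<^sub>0.power x' Poly_append poly_monom C\<^sub>0.a_comm C\<^sub>0.m_comm)
  from this[of "rev (Polynomial.coeffs q)"] have "Rep_ac\<^sub>0 (poly q x') = \<zero>\<^bsub>L\<^sub>0\<^esub>"
    using x by (simp add: P_def rev_map)
  then show "\<exists>x. poly q x = 0" by auto
qed

lemma CHAR_ac\<^sub>0: "CHAR(ac\<^sub>0) = p\<^sub>0"
proof -
  interpret z: to_ring "residue_ring (int p\<^sub>0)" "zmod p\<^sub>0" by (rule to_ring_zmod[OF prime_0])
  define c where "c = (\<lambda>a. Abs_ac\<^sub>0 (ring.indexed_const (residue_ring (int p\<^sub>0)) (zmod p\<^sub>0 a)))"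
  have cl: "ring.indexed_const (residue_ring (int p\<^sub>0)) (zmod p\<^sub>0 a) \<in> carrier L\<^sub>0" for a
    using ring_hom_closed[OF L\<^sub>0_hom] by simp
  interpret c: ring_morphism c
    by standard
      (simp_all add: c_def z.add z.mult z.one plus_ac\<^sub>0_def times_ac\<^sub>0_def one_ac\<^sub>0_def cl
        ring_hom_add[OF L\<^sub>0_hom] ring_hom_mult[OF L\<^sub>0_hom] ring_hom_one[OF L\<^sub>0_hom])
  have "of_nat p\<^sub>0 = c (of_nat p\<^sub>0)" by (simp only: c.hom_of_nat)
  also have "\<dots> = c 0" by (simp add: c_def zmod_def)
  also have "\<dots> = 0" by (rule c.hom_zero)
  finally have "CHAR(ac\<^sub>0) dvd p\<^sub>0" by (simp add: of_nat_eq_0_iff_char_dvd)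
  then show ?thesis using prime_0 by (metis CHAR_not_1' One_nat_def prime_nat_iff)
qed

definition \<iota>\<^sub>0 :: "int poly poly \<Rightarrow> ff\<^sub>0" where
  "\<iota>\<^sub>0 U = Abs_ff\<^sub>0 (w\<^sub>0.\<kappa> U)"

lemma Rep_\<iota>\<^sub>0: "Rep_ff\<^sub>0 (\<iota>\<^sub>0 U) = w\<^sub>0.\<kappa> U"
proof -
  interpret \<kappa>: to_ring K\<^sub>0 w\<^sub>0.\<kappa> unfolding K\<^sub>0_eq by (rule w\<^sub>0.\<kappa>_to_ring)
  show ?thesis by (simp add: \<iota>\<^sub>0_def)
qed

lemma \<iota>\<^sub>0_morphism: "ring_morphism \<iota>\<^sub>0"
proof -
  interpret \<kappa>: to_ring K\<^sub>0 w\<^sub>0.\<kappa> unfolding K\<^sub>0_eq by (rule w\<^sub>0.\<kappa>_to_ring)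
  show ?thesis
    by standard (simp_all add: \<iota>\<^sub>0_def plus_ff\<^sub>0_def times_ff\<^sub>0_def one_ff\<^sub>0_def \<kappa>.add \<kappa>.mult \<kappa>.one)
qed

definition "\<xi>\<^sub>0 = \<iota>\<^sub>0 (mon 1 1 0)"
definition "\<eta>\<^sub>0 = \<iota>\<^sub>0 (mon 1 0 1)"

lemma \<iota>\<^sub>0_bev: "\<iota>\<^sub>0 U = bev \<xi>\<^sub>0 \<eta>\<^sub>0 U"
proof -
  interpret \<iota>: ring_morphism \<iota>\<^sub>0 by (rule \<iota>\<^sub>0_morphism)
  have e: "mon c a i = of_int c * mon 1 1 0 ^ a * mon 1 0 1 ^ i" for c a i
    by (simp add: mon_def monom_power mult_monom of_int_poly smult_monom flip: monom_0)
  have m: "\<iota>\<^sub>0 (mon c a i) = bev \<xi>\<^sub>0 \<eta>\<^sub>0 (mon c a i)" for c a i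
    unfolding bev_mon \<xi>\<^sub>0_def \<eta>\<^sub>0_def by (subst e) (simp only: \<iota>.hom_mult \<iota>.hom_power \<iota>.hom_of_int)
  show ?thesis by (subst (1 2) sum_mon) (simp add: \<iota>.hom_sum m del: bev_mon)
qed

lemma \<iota>\<^sub>0_eq_0_iff: "\<iota>\<^sub>0 U = 0 \<longleftrightarrow> w\<^sub>0.zc U"
  using w\<^sub>0.\<kappa>_eq_0_iff[of U] R\<^sub>0.rep_eq_0_iff[of "\<iota>\<^sub>0 U"] by (simp add: Rep_\<iota>\<^sub>0 K\<^sub>0_eq)

interpretation AS\<^sub>0: AS_curve p\<^sub>0 "degree h\<^sub>0" h\<^sub>0 \<xi>\<^sub>0 \<eta>\<^sub>0 "TYPE(ac\<^sub>0)"
proof unfold_locales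
  show "of_nat p\<^sub>0 = (0 :: ff\<^sub>0)"
  proof -
    have "w\<^sub>0.pdvd (of_nat p\<^sub>0)" by (simp add: w\<^sub>0.pdvd_def of_nat_poly coeff_pCons split: nat.splits)
    then have "\<iota>\<^sub>0 (of_nat p\<^sub>0) = 0" unfolding \<iota>\<^sub>0_eq_0_iff by (rule w\<^sub>0.zc_pdvd)
    then show ?thesis by (simp add: \<iota>\<^sub>0_bev)
  qed
  show "\<eta>\<^sub>0 ^ p\<^sub>0 - \<eta>\<^sub>0 = ipe \<xi>\<^sub>0 h\<^sub>0"
  proof -
    have "\<iota>\<^sub>0 w\<^sub>0.F = 0" unfolding \<iota>\<^sub>0_eq_0_iff using w\<^sub>0.zc_F[of 1] by simp
    then show ?thesis by (simp add: \<iota>\<^sub>0_bev w\<^sub>0.bev_F)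
  qed
  fix z
  have "Rep_ff\<^sub>0 z \<in> carrier (fraction_field w\<^sub>0.Qp)" using K\<^sub>0.rep_closed[of z] by (simp only: K\<^sub>0_eq)
  then obtain U V where UV: "\<not> w\<^sub>0.zc V" "Rep_ff\<^sub>0 z \<otimes>\<^bsub>K\<^sub>0\<^esub> w\<^sub>0.\<kappa> V = w\<^sub>0.\<kappa> U"
    using w\<^sub>0.\<kappa>_quotients unfolding K\<^sub>0_eq by metis
  have "Rep_ff\<^sub>0 (z * \<iota>\<^sub>0 V) = Rep_ff\<^sub>0 (\<iota>\<^sub>0 U)" using UV(2) by (simp only: R\<^sub>0.mult Rep_\<iota>\<^sub>0)
  then have "z * \<iota>\<^sub>0 V = \<iota>\<^sub>0 U" by simp
  then show "\<exists>U V. bev \<xi>\<^sub>0 \<eta>\<^sub>0 V \<noteq> 0 \<and> z * bev \<xi>\<^sub>0 \<eta>\<^sub>0 V = bev \<xi>\<^sub>0 \<eta>\<^sub>0 U"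
    using UV(1) \<iota>\<^sub>0_eq_0_iff by (auto simp flip: \<iota>\<^sub>0_bev)
next
  fix U assume "degree U < p\<^sub>0" "bev \<xi>\<^sub>0 \<eta>\<^sub>0 U = 0"
  then show "w\<^sub>0.pdvd U" by (intro w\<^sub>0.zc_degree) (simp_all flip: \<iota>\<^sub>0_bev add: \<iota>\<^sub>0_eq_0_iff)
qed (rule prime_0, rule CHAR_ac\<^sub>0)

lemma point_count_formula_0: "point_count_formula p\<^sub>0 h\<^sub>0"
  unfolding point_count_formula_def
proof (intro exI conjI allI impI)
  fix n :: nat assume n: "n > 0"
  have "GF p\<^sub>0 n = L\<^sub>0\<lparr>carrier := Rep_ac\<^sub>0 ` AS\<^sub>0.f.gf n\<rparr>"
  proof -
    have "{x \<in> carrier L\<^sub>0. x [^]\<^bsub>L\<^sub>0\<^esub> (p\<^sub>0 ^ n) = x} = Rep_ac\<^sub>0 ` AS\<^sub>0.f.gf n"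
    proof (intro equalityI subsetI)
      fix x assume x: "x \<in> {x \<in> carrier L\<^sub>0. x [^]\<^bsub>L\<^sub>0\<^esub> (p\<^sub>0 ^ n) = x}"
      then obtain y where y: "x = Rep_ac\<^sub>0 y" using C\<^sub>0.rep_surj by blast
      then have "Rep_ac\<^sub>0 (y ^ (p\<^sub>0 ^ n)) = Rep_ac\<^sub>0 y" using x by (simp add: C\<^sub>0.power)
      then show "x \<in> Rep_ac\<^sub>0 ` AS\<^sub>0.f.gf n" using y by (auto simp: AS\<^sub>0.f.gf_def)
    qed (auto simp: AS\<^sub>0.f.gf_def simp flip: C\<^sub>0.power)
    then show ?thesis by (simp add: GF_def L\<^sub>0_def[symmetric] Let_def)
  qed
  then have "AS_point_count p\<^sub>0 (coeff h\<^sub>0) n =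
      card {(V, \<phi> :: ff\<^sub>0 \<Rightarrow> ac\<^sub>0). is_place V \<phi> \<and> \<phi> \<in> extensional V \<and> \<phi> ` V \<subseteq> AS\<^sub>0.f.gf n}"
    unfolding AS_point_count_def K\<^sub>0_def[symmetric]
    using card_curve_points[OF R\<^sub>0.field_rep_axioms C\<^sub>0.field_rep_axioms, of "AS\<^sub>0.f.gf n"] by simp
  also have "\<dots> = 1 + card {(x, y). x \<in> AS\<^sub>0.f.gf n \<and> y \<in> AS\<^sub>0.f.gf n \<and> y ^ p\<^sub>0 - y = ipe x h\<^sub>0}"
    by (rule AS\<^sub>0.card_places[OF n])
  finally show "of_nat (AS_point_count p\<^sub>0 (coeff h\<^sub>0) n) =
      1 + of_nat p\<^sub>0 ^ n + (\<Sum>a\<in>{1..<p\<^sub>0}. AS\<^sub>0.f.S h\<^sub>0 (int a) n)"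
    using AS\<^sub>0.f.affine_count[OF n, of h\<^sub>0] by simp
next
  fix a n
  show "of_nat n * expsum p\<^sub>0 h\<^sub>0 a n = (\<Sum>j\<in>{1..n}. AS\<^sub>0.f.S h\<^sub>0 a j * expsum p\<^sub>0 h\<^sub>0 a (n - j))"
    by (rule AS\<^sub>0.f.expsum_recurrence)
qed

theorem point_count: "admissible p h \<Longrightarrow> point_count_formula p h"
  by (rule formula_0[OF point_count_formula_0])

section \<open>The zeta function as a product of L-functions\<close>

text \<open>T F' = F K is a recursion for the coefficients of F; in characteristic 0 it determines F
  from K and the constant term.\<close>

lemma fps_log_deriv_iff:
  fixes F K :: "'a::field fps"
  assumes "fps_nth K 0 = 0"
  shows "fps_X * fps_deriv F = F * K \<longleftrightarrow>
    (\<forall>n. of_nat n * fps_nth F n = (\<Sum>j\<in>{1..n}. fps_nth K j * fps_nth F (n - j)))"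
proof -
  have "fps_nth (fps_X * fps_deriv F) n = of_nat n * fps_nth F n" for n
    by (cases n) (simp_all add: Suc_eq_plus1)
  moreover have "fps_nth (F * K) n = (\<Sum>j\<in>{1..n}. fps_nth K j * fps_nth F (n - j))" for n
  proof -
    have "fps_nth (K * F) n = (\<Sum>j\<in>{0..n}. fps_nth K j * fps_nth F (n - j))" by (rule fps_mult_nth)
    also have "{0..n} = insert 0 {1..n}" by auto
    finally show ?thesis using assms by (simp add: mult.commute)
  qed
  ultimately show ?thesis by (simp add: fps_eq_iff)
qed

lemma fps_log_deriv_prod:
  fixes F K :: "'b \<Rightarrow> 'a::field fps"
  assumes "finite A" "\<And>a. a \<in> A \<Longrightarrow> fps_X * fps_deriv (F a) = F a * K a"
  shows "fps_X * fps_deriv (\<Prod>a\<in>A. F a) = (\<Prod>a\<in>A. F a) * (\<Sum>a\<in>A. K a)"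
  using assms
proof (induction A rule: finite_induct)
  case (insert x A)
  define P Q where "P = prod F A" and "Q = sum K A"
  have IH: "fps_X * fps_deriv P = P * Q" using insert by (simp add: P_def Q_def)
  have x: "fps_X * fps_deriv (F x) = F x * K x" using insert by simp
  have "fps_X * fps_deriv (F x * P) = F x * (fps_X * fps_deriv P) + P * (fps_X * fps_deriv (F x))"
    by (simp add: algebra_simps)
  also have "\<dots> = F x * P * (K x + Q)" unfolding IH x by (simp add: algebra_simps)
  finally show ?case using insert by (simp add: P_def Q_def)
qed simp

lemma zeta_numerator_recurrence:
  "fps_nth (zeta_numerator q N) 0 = 1"
  "of_nat n * fps_nth (zeta_numerator q N) n =
     (\<Sum>j\<in>{1..n}. (of_nat (N j) - of_nat q ^ j - 1) * fps_nth (zeta_numerator q N) (n - j))"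
proof -
  define G where "G = Abs_fps (\<lambda>n. if n = 0 then 0 else (of_nat q ^ n + 1 - of_nat (N n)) / of_nat n :: rat)"
  define E where "E = fps_exp 1 oo G"
  define P where "P = zeta_numerator q N"
  have P: "P = inverse E" by (simp add: P_def zeta_numerator_def E_def G_def)
  have E0: "fps_nth E 0 = 1" by (simp add: E_def)
  have "fps_deriv E = E * fps_deriv G"
    unfolding E_def by (subst fps_compose_deriv) (simp_all add: G_def)
  then have "fps_deriv P = - (fps_deriv G * P)"
    unfolding P using E0 by (simp add: fps_inverse_deriv power2_eq_square inverse_mult_eq_1' mult_ac)
  then have "fps_X * fps_deriv P = P * (- (fps_X * fps_deriv G))" by (simp add: algebra_simps)
  then have "of_nat n * fps_nth P n = (\<Sum>j\<in>{1..n}. fps_nth (- (fps_X * fps_deriv G)) j * fps_nth P (n - j))"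
    using fps_log_deriv_iff[of "- (fps_X * fps_deriv G)" P] by simp
  also have "\<dots> = (\<Sum>j\<in>{1..n}. (of_nat (N j) - of_nat q ^ j - 1) * fps_nth P (n - j))"
  proof (intro sum.cong refl)
    fix j assume "j \<in> {1..n}"
    then obtain i where j: "j = Suc i" by (cases j) auto
    have "fps_nth (- (fps_X * fps_deriv G)) j = of_nat (N j) - of_nat q ^ j - 1"
      unfolding j by (simp add: G_def Suc_eq_plus1 del: of_nat_add)
    then show "fps_nth (- (fps_X * fps_deriv G)) j * fps_nth P (n - j) = (of_nat (N j) - of_nat q ^ j - 1) * fps_nth P (n - j)"
      by simp
  qed
  finally show "of_nat n * fps_nth (zeta_numerator q N) n =
     (\<Sum>j\<in>{1..n}. (of_nat (N j) - of_nat q ^ j - 1) * fps_nth (zeta_numerator q N) (n - j))"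
    by (simp add: P_def)
  show "fps_nth (zeta_numerator q N) 0 = 1" using E0 by (simp add: P flip: P_def)
qed

definition lfun :: "nat \<Rightarrow> int poly \<Rightarrow> nat \<Rightarrow> complex fps" where
  "lfun p h a = Abs_fps (expsum p h (int a))"

text \<open>Both series have constant term 1 and the same logarithmic derivative: in N j - p ^ j - 1
  the point at infinity and the trivial character cancel, which leaves the sum of
  \<open>S a j\<close> over the nontrivial characters.\<close>

lemma zeta_numerator_eq_prod:
  assumes N: "\<And>n. n > 0 \<Longrightarrow> of_nat (N n) = 1 + of_nat p ^ n + (\<Sum>a\<in>{1..<p}. S (int a) n :: complex)"
    and S: "\<And>a n. of_nat n * expsum p h a n = (\<Sum>j\<in>{1..n}. S a j * expsum p h a (n - j))"
  shows "of_rat (fps_nth (zeta_numerator p N) n) = fps_nth (\<Prod>a\<in>{1..<p}. lfun p h a) n"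
proof -
  define K where "K = (\<lambda>a::nat. Abs_fps (\<lambda>n. if n = 0 then 0 else S (int a) n))"
  define C where "C = (\<Prod>a\<in>{1..<p}. lfun p h a)"
  have "fps_X * fps_deriv (lfun p h a) = lfun p h a * K a" for a
  proof (subst fps_log_deriv_iff)
    show "\<forall>n. of_nat n * fps_nth (lfun p h a) n = (\<Sum>j\<in>{1..n}. fps_nth (K a) j * fps_nth (lfun p h a) (n - j))"
      by (auto simp: lfun_def K_def S intro!: sum.cong)
  qed (simp add: K_def)
  then have "fps_X * fps_deriv C = C * (\<Sum>a\<in>{1..<p}. K a)"
    unfolding C_def by (intro fps_log_deriv_prod) auto
  then have C: "of_nat n * fps_nth C n = (\<Sum>j\<in>{1..n}. fps_nth (\<Sum>a\<in>{1..<p}. K a) j * fps_nth C (n - j))" for n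
    by (subst (asm) fps_log_deriv_iff) (simp_all add: K_def fps_sum_nth)
  have C0: "fps_nth C 0 = 1"
  proof -
    have "fps_nth (\<Prod>a\<in>A. lfun p h a) 0 = 1" if "finite A" for A
      using that by induction (simp_all add: lfun_def expsum_0)
    then show ?thesis by (simp add: C_def)
  qed
  have "of_rat (fps_nth (zeta_numerator p N) n) = fps_nth C n"
  proof (induction n rule: less_induct)
    case (less n)
    show ?case
    proof (cases "n = 0")
      case True
      then show ?thesis using C0 zeta_numerator_recurrence(1)[of p N] by simp
    next
      case False
      have "of_nat n * of_rat (fps_nth (zeta_numerator p N) n) =
          (of_rat (of_nat n * fps_nth (zeta_numerator p N) n) :: complex)" by (simp add: of_rat_mult)
      also have "\<dots> = (\<Sum>j\<in>{1..n}. (of_nat (N j) - of_nat p ^ j - 1) * of_rat (fps_nth (zeta_numerator p N) (n - j)))"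
        by (subst zeta_numerator_recurrence(2)) (simp add: of_rat_sum of_rat_mult of_rat_diff of_rat_power)
      also have "\<dots> = (\<Sum>j\<in>{1..n}. fps_nth (\<Sum>a\<in>{1..<p}. K a) j * fps_nth C (n - j))"
        using less by (intro sum.cong refl arg_cong2[where f = "(*)"]) (auto simp: N K_def fps_sum_nth)
      also have "\<dots> = of_nat n * fps_nth C n" by (rule C[symmetric])
      finally show ?thesis using False by simp
    qed
  qed
  then show ?thesis by (simp add: C_def)
qed

section \<open>Slopes of power series over \<open>\<int>[\<zeta>]\<close>\<close>

text \<open>The bound x is real because the lines \<mu> i of a Newton polygon need not have integral
  heights; 0 satisfies every such bound.\<close>

definition pge :: "nat \<Rightarrow> real \<Rightarrow> complex \<Rightarrow> bool" where
  "pge p x z \<longleftrightarrow> (\<exists>k. real k \<ge> x \<and> z \<in> pip p k)"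

definition pgt :: "nat \<Rightarrow> real \<Rightarrow> complex \<Rightarrow> bool" where
  "pgt p x z \<longleftrightarrow> (\<exists>k. real k > x \<and> z \<in> pip p k)"

lemma pge_mult: assumes "pge p x z" "pge p y w" shows "pge p (x + y) (z * w)"
proof -
  obtain k l where "real k \<ge> x" "z \<in> pip p k" "real l \<ge> y" "w \<in> pip p l" using assms by (auto simp: pge_def)
  then show ?thesis unfolding pge_def using pip_mult by (intro exI[of _ "k + l"]) auto
qed

lemma pgt_mult: assumes "pgt p x z" "pge p y w" shows "pgt p (x + y) (z * w)"
proof -
  obtain k l where "real k > x" "z \<in> pip p k" "real l \<ge> y" "w \<in> pip p l" using assms by (auto simp: pge_def pgt_def)
  then show ?thesis unfolding pgt_def using pip_mult by (intro exI[of _ "k + l"]) auto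
qed

lemma pge_0: "pge p x 0" and pgt_0: "pgt p x 0"
proof -
  obtain k where "real k > x" using reals_Archimedean2 by blast
  then show "pge p x 0" "pgt p x 0" unfolding pge_def pgt_def by (auto intro!: exI[of _ k])
qed

lemma pge_add: assumes "p > 0" "pge p x z" "pge p x w" shows "pge p x (z + w)"
proof -
  obtain k l where kl: "real k \<ge> x" "z \<in> pip p k" "real l \<ge> x" "w \<in> pip p l" using assms by (auto simp: pge_def)
  have "z \<in> pip p (min k l)" "w \<in> pip p (min k l)"
    using pip_mono[of "min k l" k p z] pip_mono[of "min k l" l p w] kl assms(1) by simp_all
  then have "z + w \<in> pip p (min k l)" by (rule pip_add)
  moreover have "real (min k l) \<ge> x" using kl by (simp add: min_def)
  ultimately show ?thesis unfolding pge_def by blast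
qed

lemma pgt_add: assumes "p > 0" "pgt p x z" "pgt p x w" shows "pgt p x (z + w)"
proof -
  obtain k l where kl: "real k > x" "z \<in> pip p k" "real l > x" "w \<in> pip p l" using assms by (auto simp: pgt_def)
  have "z \<in> pip p (min k l)" "w \<in> pip p (min k l)"
    using pip_mono[of "min k l" k p z] pip_mono[of "min k l" l p w] kl assms(1) by simp_all
  then have "z + w \<in> pip p (min k l)" by (rule pip_add)
  moreover have "real (min k l) > x" using kl by (simp add: min_def)
  ultimately show ?thesis unfolding pgt_def by blast
qed

lemma pge_sum: "p > 0 \<Longrightarrow> (\<And>i. i \<in> A \<Longrightarrow> pge p x (f i)) \<Longrightarrow> pge p x (sum f A)"
  by (induction A rule: infinite_finite_induct) (auto intro: pge_0 pge_add)

lemma pgt_sum: "p > 0 \<Longrightarrow> (\<And>i. i \<in> A \<Longrightarrow> pgt p x (f i)) \<Longrightarrow> pgt p x (sum f A)"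
  by (induction A rule: infinite_finite_induct) (auto intro: pgt_0 pgt_add)

lemma pgt_Suc: assumes "p > 0" "pgt p (real k) z" shows "z \<in> pip p (Suc k)"
proof -
  obtain l where l: "real l > real k" "z \<in> pip p l" using assms by (auto simp: pgt_def)
  then have "Suc k \<le> l" by simp
  then show ?thesis using pip_mono l assms(1) by blast
qed

text \<open>The Newton polygon of \<open>F\<close> starts with a segment of slope \<open>\<mu>\<close> from \<open>0\<close> to \<open>n\<close>.\<close>

definition slope_at :: "nat \<Rightarrow> real \<Rightarrow> nat \<Rightarrow> complex fps \<Rightarrow> bool" where
  "slope_at p \<mu> n F \<longleftrightarrow> (\<forall>i. pge p (\<mu> * real i) (fps_nth F i)) \<and> (\<forall>i>n. pgt p (\<mu> * real i) (fps_nth F i)) \<and>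
     (\<exists>k. real k = \<mu> * real n \<and> vex p k (fps_nth F n))"

text \<open>In the coefficient of index m + n only the product of the m-th and the n-th coefficient
  can have order exactly \<mu> (m + n); in every other term one index exceeds m or n. So initial
  segments of equal slope add up.\<close>

lemma slope_at_mult:
  assumes p: "prime p" and F: "slope_at p \<mu> m F" and G: "slope_at p \<mu> n G"
  shows "slope_at p \<mu> (m + n) (F * G)"
proof -
  have p0: "p > 0" using p prime_gt_0_nat by blast
  have term_ge: "pge p (\<mu> * real N) (fps_nth F i * fps_nth G (N - i))" if "i \<le> N" for i N
  proof -
    have "pge p (\<mu> * real i + \<mu> * real (N - i)) (fps_nth F i * fps_nth G (N - i))"
      using F G by (intro pge_mult) (auto simp: slope_at_def)
    also have "\<mu> * real i + \<mu> * real (N - i) = \<mu> * real N" using that by (simp flip: distrib_left of_nat_add)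
    finally show ?thesis .
  qed
  have term_gt: "pgt p (\<mu> * real N) (fps_nth F i * fps_nth G (N - i))" if "i \<le> N" "i > m \<or> N - i > n" for i N
  proof -
    have e: "\<mu> * real i + \<mu> * real (N - i) = \<mu> * real N" using that(1) by (simp flip: distrib_left of_nat_add)
    show ?thesis
    proof (cases "i > m")
      case True
      then have "pgt p (\<mu> * real i + \<mu> * real (N - i)) (fps_nth F i * fps_nth G (N - i))"
        using F G by (intro pgt_mult) (auto simp: slope_at_def)
      then show ?thesis by (simp only: e)
    next
      case False
      then have "pgt p (\<mu> * real (N - i) + \<mu> * real i) (fps_nth G (N - i) * fps_nth F i)"
        using F G that by (intro pgt_mult) (auto simp: slope_at_def)
      then show ?thesis using e by (simp add: add.commute mult.commute)
    qed
  qed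
  obtain k where k: "real k = \<mu> * real m" "vex p k (fps_nth F m)" using F by (auto simp: slope_at_def)
  obtain l where l: "real l = \<mu> * real n" "vex p l (fps_nth G n)" using G by (auto simp: slope_at_def)
  have kl: "real (k + l) = \<mu> * real (m + n)" using k l by (simp add: algebra_simps)
  have "pgt p (\<mu> * real (m + n)) (\<Sum>i\<in>{0..m + n} - {m}. fps_nth F i * fps_nth G (m + n - i))"
    using p0 by (intro pgt_sum term_gt) auto
  then have "(\<Sum>i\<in>{0..m + n} - {m}. fps_nth F i * fps_nth G (m + n - i)) \<in> pip p (Suc (k + l))"
    using p0 unfolding kl[symmetric] by (intro pgt_Suc)
  then have "vex p (k + l) (fps_nth F m * fps_nth G n + (\<Sum>i\<in>{0..m + n} - {m}. fps_nth F i * fps_nth G (m + n - i)))"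
    using p0 by (intro vex_add vex_mult[OF p] k l)
  also have "fps_nth F m * fps_nth G n + (\<Sum>i\<in>{0..m + n} - {m}. fps_nth F i * fps_nth G (m + n - i)) = fps_nth (F * G) (m + n)"
    by (subst fps_mult_nth, subst sum.remove[of _ m]) auto
  finally have "\<exists>k. real k = \<mu> * real (m + n) \<and> vex p k (fps_nth (F * G) (m + n))" using kl by blast
  moreover have "pge p (\<mu> * real N) (fps_nth (F * G) N)" for N
    unfolding fps_mult_nth using p0 by (intro pge_sum term_ge) auto
  moreover have "pgt p (\<mu> * real N) (fps_nth (F * G) N)" if "N > m + n" for N
    unfolding fps_mult_nth using p0 that by (intro pgt_sum term_gt) auto
  ultimately show ?thesis unfolding slope_at_def by blast
qed

lemma slope_at_1: assumes p: "prime p" and "\<mu> \<ge> 0" shows "slope_at p \<mu> 0 1"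
proof -
  have "pge p (\<mu> * real i) (fps_nth 1 i)" for i 
  proof (cases "i = 0")
    case True
    then show ?thesis unfolding pge_def by (intro exI[of _ 0]) simp
  qed (simp add: pge_0)
  moreover have "vex p 0 1" using vex_0_of_int[OF p, of 1] prime_gt_1_nat[OF p] by simp
  ultimately show ?thesis by (auto simp: slope_at_def pgt_0)
qed

lemma slope_at_prod:
  assumes p: "prime p" "\<mu> \<ge> 0" "finite A" and "\<And>a. a \<in> A \<Longrightarrow> slope_at p \<mu> n (F a)"
  shows "slope_at p \<mu> (card A * n) (\<Prod>a\<in>A. F a)"
  using assms(3,4)
proof (induction A rule: finite_induct)
  case empty
  then show ?case using slope_at_1 p by simp
next
  case (insert x A)
  then have "slope_at p \<mu> (n + card A * n) (F x * prod F A)" by (intro slope_at_mult p) auto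
  then show ?case using insert by simp
qed

text \<open>The \<pi>-adic order of \<open>expsum p h a n\<close>, common to all a in 1..p-1, as far
  as the residues of the coefficients modulo p determine it: multiples of p may contribute from
  order p - 1 on.\<close>

definition cval :: "nat \<Rightarrow> int poly \<Rightarrow> nat \<Rightarrow> nat" where
  "cval p h n = (LEAST k. k = p - 1 \<or> \<not> int p dvd csum p h n k)"

lemma cval_le: "cval p h n \<le> p - 1"
  unfolding cval_def by (rule Least_le) simp

lemma cval_dvd: "k < cval p h n \<Longrightarrow> int p dvd csum p h n k"
  unfolding cval_def using not_less_Least by blast

lemma cval_not_dvd: "cval p h n < p - 1 \<Longrightarrow> \<not> int p dvd csum p h n (cval p h n)"
proof -
  assume l: "cval p h n < p - 1"
  have "cval p h n = p - 1 \<or> \<not> int p dvd csum p h n (cval p h n)"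
    unfolding cval_def by (rule LeastI[of _ "p - 1"]) simp
  with l show ?thesis by simp
qed

text \<open>The weight bound gives n (n + 1) / 2 \<ge> n times (p - 1) / d. At the cut-off p - 1 the
  claim reduces to n \<le> d.\<close>

lemma cval_ge:
  assumes p: "prime p" and h: "degree h \<le> d" and n: "1 \<le> n" "n < d"
  shows "(p - 1) * n \<le> cval p h n * d"
proof (cases "cval p h n = p - 1")
  case True
  then show ?thesis using n by simp
next
  case False
  then have l: "cval p h n < p - 1" using cval_le[of p h n] by simp
  have "(p - 1) * n * (n + 1) \<le> 2 * (cval p h n * d)"
  proof (rule ccontr)
    assume "\<not> ?thesis"
    then have "int p dvd csum p h n (cval p h n)" using l by (intro csum_dvd[OF p h]) auto
    then show False using cval_not_dvd[OF l] by blast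
  qed
  moreover have "(p - 1) * n * 2 \<le> (p - 1) * n * (n + 1)" using n by (intro mult_left_mono) auto
  ultimately show ?thesis by linarith
qed

lemma expsum_pip:
  assumes p: "prime p" and a: "0 < a" "a < p"
  shows "expsum p h (int a) n \<in> pip p (cval p h n)"
    and "cval p h n < p - 1 \<Longrightarrow> vex p (cval p h n) (expsum p h (int a) n)"
proof -
  show "expsum p h (int a) n \<in> pip p (cval p h n)"
    unfolding expsum_expansion[OF prime_gt_0_nat[OF p]]
    by (rule pip_expansion[OF p a cval_le]) (rule cval_dvd)
  assume l: "cval p h n < p - 1"
  then have "cval p h n < p" by simp
  then show "vex p (cval p h n) (expsum p h (int a) n)"
    unfolding expsum_expansion[OF prime_gt_0_nat[OF p]]
    by (rule vex_expansion[OF p a l]) (auto intro: cval_dvd simp: cval_not_dvd l)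
qed

text \<open>The slope is the least v n / n, and N is the last index where it is attained, so the
  segment is maximal. Both are determined by the orders \<open>cval\<close>, so one pair serves all
  characters.\<close>

lemma lfun_slope:
  assumes p: "prime p" "odd p" and h: "degree h = d" "lead_coeff h = 1" and d: "d \<ge> 2" and pd: "\<not> p dvd d"
    and k: "k * (d - 1) < p - 1" "k * d < 2 * (p - 1)" "(k - 1) * d < p - 1"
    and c: "\<not> int p dvd coeff (h ^ k) (p - 1)"
  obtains \<mu> n where "real (p - 1) / real d \<le> \<mu>" "\<mu> \<le> real k" "1 \<le> n" "n < d"
    "\<And>a. a \<in> {1..<p} \<Longrightarrow> slope_at p \<mu> n (lfun p h a)"
proof -
  have p0: "p > 0" using p prime_gt_0_nat by blast
  define v where "v = cval p h"
  have "k \<le> k * (d - 1)" using d mult_le_mono2[of 1 "d - 1" k] by (simp add: le_diff_conv2)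
  then have kp: "k < p - 1" using k(1) by linarith
  have "\<not> int p dvd csum p h 1 k"
    using csum_1_not_dvd[OF p, of h d k] h k kp c by simp
  then have v1: "v 1 \<le> k" unfolding v_def cval_def by (intro Least_le) simp
  define Q where "Q = (\<lambda>n. real (v n) / real n) ` {1..<d}"
  define \<mu> where "\<mu> = Min Q"
  have finQ: "finite Q" "Q \<noteq> {}" using d by (auto simp: Q_def)
  have \<mu>le: "\<mu> * real n \<le> real (v n)" if "1 \<le> n" "n < d" for n
  proof -
    have "\<mu> \<le> real (v n) / real n" unfolding \<mu>_def using finQ that by (intro Min_le) (auto simp: Q_def)
    then show ?thesis using that by (simp add: field_simps)
  qed
  define M where "M = {n \<in> {1..<d}. \<mu> * real n = real (v n)}"
  have "\<mu> \<in> Q" unfolding \<mu>_def using finQ by (rule Min_in)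
  then have "M \<noteq> {}" by (auto simp: M_def Q_def)
  define N where "N = Max M"
  have "finite M" by (simp add: M_def)
  then have NM: "N \<in> M" unfolding N_def using \<open>M \<noteq> {}\<close> by (rule Max_in)
  have Nmax: "n \<le> N" if "n \<in> M" for n unfolding N_def using \<open>finite M\<close> that by (rule Max_ge)
  have N: "1 \<le> N" "N < d" "\<mu> * real N = real (v N)" using NM by (auto simp: M_def)
  have \<mu>k: "\<mu> \<le> real k" using \<mu>le[of 1] v1 d by simp
  have \<mu>ge: "real (p - 1) / real d \<le> \<mu>"
  proof -
    have "real (p - 1) / real d \<le> real (v n) / real n" if "n \<in> {1..<d}" for n
    proof -
      have "(p - 1) * n \<le> v n * d" using that h unfolding v_def by (intro cval_ge[OF p(1)]) auto
      then have "real (p - 1) * real n \<le> real (v n) * real d" by (metis of_nat_le_iff of_nat_mult)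
      then show ?thesis using that d by (simp add: field_simps)
    qed
    then show ?thesis unfolding \<mu>_def using finQ by (intro Min.boundedI) (auto simp: Q_def)
  qed
  \<comment> \<open>The minimum is at most v 1 \<le> k, so v N \<le> k N \<le> k (d - 1) < p - 1;
    below the cut-off the order is exact.\<close>
  have vN: "v N < p - 1"
  proof -
    have "real (v N) \<le> real k * real N" using N(3) \<mu>k by (metis mult_right_mono of_nat_0_le_iff)
    also have "\<dots> \<le> real k * real (d - 1)" using N by (intro mult_left_mono) auto
    finally have "v N \<le> k * (d - 1)" by (metis of_nat_le_iff of_nat_mult)
    then show ?thesis using k(1) by linarith
  qed
  have "slope_at p \<mu> N (lfun p h a)" if a: "a \<in> {1..<p}" for a
    unfolding slope_at_def
  proof (intro conjI allI impI)
    have a': "0 < a" "a < p" using a by auto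
    have z: "expsum p h (int a) i = 0" if "i \<ge> d" for i
      using that d a pd by (intro expsum_eq_0[OF p(1) h]) (auto dest: zdvd_imp_le)
    fix i
    show "pge p (\<mu> * real i) (fps_nth (lfun p h a) i)"
    proof (cases "1 \<le> i \<and> i < d")
      case True
      then show ?thesis using \<mu>le[of i] expsum_pip(1)[OF p(1) a', of h i]
        by (auto simp: pge_def lfun_def v_def)
    next
      case False
      then consider "i = 0" | "i \<ge> d" by linarith
      then show ?thesis
      proof cases
        case 1
        then show ?thesis by (auto simp: lfun_def expsum_0 pge_def intro!: exI[of _ 0])
      next
        case 2
        then show ?thesis using z by (simp add: lfun_def pge_0)
      qed
    qed
    show "pgt p (\<mu> * real i) (fps_nth (lfun p h a) i)" if "i > N"
    proof (cases "i < d")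
      case True
      have "i \<notin> M" using Nmax that by fastforce
      then have "\<mu> * real i < real (v i)" using \<mu>le[of i] True that N(1) by (auto simp: M_def)
      then show ?thesis using expsum_pip(1)[OF p(1) a', of h i] by (auto simp: pgt_def lfun_def v_def)
    next
      case False
      then show ?thesis using z by (simp add: lfun_def pgt_0)
    qed
    show "\<exists>k. real k = \<mu> * real N \<and> vex p k (fps_nth (lfun p h a) N)"
      using expsum_pip(2)[OF p(1) a', of h N] vN N(3)
      by (intro exI[of _ "v N"]) (simp add: v_def lfun_def)
  qed
  with \<mu>ge \<mu>k N(1,2) that show ?thesis by blast
qed

section \<open>The first slope of a Newton polygon\<close>

text \<open>S lies on or above the line y = \<mu> x, and the hull follows this line from 0 to l. So
  \<mu> occurs as a slope, and convexity excludes smaller ones.\<close>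

lemma first_slope_eq:
  assumes S: "(0, 0) \<in> S" "\<And>x y. (x, y) \<in> S \<Longrightarrow> x \<ge> 0 \<and> y \<ge> \<mu> * x" and l: "l > 0" "(l, \<mu> * l) \<in> S"
  shows "first_slope (lower_convex_hull S) = \<mu>"
proof -
  define H where "H = convex hull S"
  define C where "C = lower_convex_hull S"
  have "S \<subseteq> {z. 0 \<le> fst z} \<inter> {z. \<mu> * fst z \<le> snd z}" using S(2) by auto
  moreover have "convex ({z::real \<times> real. 0 \<le> fst z} \<inter> {z. \<mu> * fst z \<le> snd z})"
  proof (intro convex_Int)
    show "convex {z::real \<times> real. 0 \<le> fst z}" by (auto simp: convex_def)
    have "{z::real \<times> real. \<mu> * fst z \<le> snd z} = {z. inner (- \<mu>, 1) z \<ge> 0}" by (auto simp: inner_prod_def)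
    then show "convex {z::real \<times> real. \<mu> * fst z \<le> snd z}" by (simp only: convex_halfspace_ge)
  qed
  ultimately have "H \<subseteq> {z. 0 \<le> fst z} \<inter> {z. \<mu> * fst z \<le> snd z}"
    unfolding H_def by (rule hull_minimal)
  then have H: "0 \<le> x \<and> \<mu> * x \<le> y" if "(x, y) \<in> H" for x y using that by auto
  have cH: "convex H" by (simp add: H_def)
  have SH: "S \<subseteq> H" by (simp add: H_def hull_subset)
  have C: "(x, y) \<in> C \<longleftrightarrow> (x, y) \<in> H \<and> (\<forall>y'. (x, y') \<in> H \<longrightarrow> y \<le> y')" for x y
    by (simp add: C_def lower_convex_hull_def H_def)
  have line: "(t, \<mu> * t) \<in> H" if "0 \<le> t" "t \<le> l" for t
  proof -
    have "(1 - t / l) *\<^sub>R (0, 0) + (t / l) *\<^sub>R (l, \<mu> * l) \<in> H"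
      using cH SH S(1) l that by (intro convexD) auto
    then show ?thesis using l by (simp add: mult.commute)
  qed
  have lineC: "(t, \<mu> * t) \<in> C" if "0 \<le> t" "t \<le> l" for t
    unfolding C using line[OF that] H by auto
  have "closed_segment (0, 0) (l, \<mu> * l) \<subseteq> C"
  proof
    fix z assume "z \<in> closed_segment (0, 0) (l, \<mu> * l)"
    then obtain u where u: "0 \<le> u" "u \<le> 1" "z = (u * l, u * (\<mu> * l))" by (auto simp: closed_segment_def)
    then have z: "z = (u * l, \<mu> * (u * l))" by simp
    show "z \<in> C" unfolding z using u l by (intro lineC) (simp_all add: mult_left_le_one_le)
  qed
  then have mem: "\<mu> \<in> slopes C" unfolding slopes_def using l(1)
    by (intro CollectI exI[of _ 0] exI[of _ "\<mu> * l"] exI[of _ l]) auto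
  have min: "\<mu> \<le> s" if sC: "s \<in> slopes C" for s
  proof -
    obtain a u b v where s: "s = (v - u) / (b - a)" "a < b" "closed_segment (a, u) (b, v) \<subseteq> C"
      using sC by (auto simp: slopes_def)
    have au: "(a, u) \<in> C" and bv: "(b, v) \<in> C" using s(3) by auto
    have ge: "a \<ge> 0" "u \<ge> \<mu> * a" "v \<ge> \<mu> * b" using au bv H unfolding C by auto
    \<comment> \<open>The height above the line does not decrease from a to b: it is 0 at a if a
      \<le> l, and otherwise (a, u) lies on or below the chord from (l, \<mu> l) to (b, v).\<close>
    have "u - \<mu> * a \<le> v - \<mu> * b"
    proof (cases "a \<le> l")
      case True
      then have "u \<le> \<mu> * a" using au line[of a] ge unfolding C by blast
      then show ?thesis using ge by linarith
    next
      case False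
      define r where "r = (a - l) / (b - l)"
      have r: "0 \<le> r" "r \<le> 1" using False s(2) by (auto simp: r_def)
      have "(1 - r) *\<^sub>R (l, \<mu> * l) + r *\<^sub>R (b, v) \<in> H"
        using cH SH l bv r unfolding C by (intro convexD) auto
      moreover have ra: "(1 - r) * l + r * b = a"
      proof -
        have "r * (b - l) = a - l" using False s(2) by (simp add: r_def)
        moreover have "(1 - r) * l + r * b = l + r * (b - l)" by (simp add: algebra_simps)
        ultimately show ?thesis by simp
      qed
      ultimately have "(a, (1 - r) * (\<mu> * l) + r * v) \<in> H" by simp
      then have "u \<le> (1 - r) * (\<mu> * l) + r * v" using au unfolding C by blast
      also have "\<dots> = \<mu> * a + r * (v - \<mu> * b)" unfolding ra[symmetric] by (simp add: algebra_simps)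
      finally have "u - \<mu> * a \<le> r * (v - \<mu> * b)" by simp
      also have "\<dots> \<le> 1 * (v - \<mu> * b)" using r ge by (intro mult_right_mono) auto
      finally show ?thesis by simp
    qed
    then have "\<mu> * (b - a) \<le> v - u" by (simp add: algebra_simps)
    then show ?thesis using s(2) unfolding s(1) by (simp add: pos_le_divide_eq)
  qed
  show ?thesis unfolding first_slope_def C_def[symmetric]
    by (rule Least_equality) (use mem min in auto)
qed

lemma NP_first_slope:
  assumes p: "prime p" and \<mu>: "slope_at p \<mu> n F" and n: "0 < n" "n \<le> 2 * g"
    and F: "\<And>i. of_rat (fps_nth (zeta_numerator p N) i) = fps_nth F i"
  shows "first_slope (NP p 1 g N) = \<mu> / real (p - 1)"
proof -
  define P where "P = zeta_numerator p N"
  have p1: "p > 1" using p prime_gt_1_nat by blast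
  obtain k where k: "real k = \<mu> * real n" "vex p k (of_rat (fps_nth P n))" using \<mu> F by (auto simp: slope_at_def P_def)
  then have nz: "fps_nth P n \<noteq> 0" by (auto simp: vex_def)
  have kn: "int k = int (p - 1) * ord_rat p (fps_nth P n)" by (rule vex_of_rat(2)[OF p nz k(2)])
  then have on: "real_of_int (ord_rat p (fps_nth P n)) = \<mu> / real (p - 1) * real n"
  proof -
    have "real k = real (p - 1) * real_of_int (ord_rat p (fps_nth P n))"
      using arg_cong[OF kn, of real_of_int] by simp
    then show ?thesis using k(1) p1 by (simp add: field_simps)
  qed
  have og: "real_of_int (ord_rat p (fps_nth P i)) \<ge> \<mu> / real (p - 1) * real i" if i: "fps_nth P i \<noteq> 0" for i
  proof -
    have "pge p (\<mu> * real i) (of_rat (fps_nth P i))" using \<mu> F by (simp add: slope_at_def P_def)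
    then obtain l where l: "real l \<ge> \<mu> * real i" "of_rat (fps_nth P i) \<in> pip p l"
      unfolding pge_def by blast
    have "int l \<le> int (p - 1) * ord_rat p (fps_nth P i)" by (rule vex_of_rat(1)[OF p i l(2)])
    then have "real_of_int (int l) \<le> real_of_int (int (p - 1) * ord_rat p (fps_nth P i))" by (simp only: of_int_le_iff)
    then have "real l \<le> real (p - 1) * real_of_int (ord_rat p (fps_nth P i))" by simp
    then show ?thesis using l(1) p1 by (simp add: field_simps)
  qed
  show ?thesis unfolding NP_def power_one_right P_def[symmetric]
  proof (rule first_slope_eq[where l = "real n"])
    show "(0, 0) \<in> newton_points p 1 g P" by (simp add: newton_points_def)
    show "0 < real n" using n by simp
    show "(real n, \<mu> / real (p - 1) * real n) \<in> newton_points p 1 g P"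
      unfolding newton_points_def using n nz on by (intro insertI2 CollectI exI[of _ n]) auto
    fix x y assume "(x, y) \<in> newton_points p 1 g P"
    then show "x \<ge> 0 \<and> y \<ge> \<mu> / real (p - 1) * x" using og by (auto simp: newton_points_def)
  qed
qed

section \<open>The coefficient deciding the first slope\<close>

text \<open>The coefficient of T ^ r in (\<Sum> g i T ^ i) ^ m as a polynomial expression in the
  values of g. In this form it makes sense over \<int> and \<rat> alike, is compatible with
  reduction modulo p and is a polynomial function of the coordinates.\<close>

primrec cpow :: "(nat \<Rightarrow> 'a::comm_ring_1) \<Rightarrow> nat \<Rightarrow> nat \<Rightarrow> 'a" where
  "cpow g 0 = (\<lambda>r. if r = 0 then 1 else 0)"
| "cpow g (Suc m) = (\<lambda>r. \<Sum>i\<le>r. g i * cpow g m (r - i))"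

lemma coeff_power_eq_cpow: "coeff (q ^ m) r = cpow (coeff q) m r"
proof (induction m arbitrary: r)
  case 0
  then show ?case by (simp add: coeff_1)
next
  case (Suc m)
  then show ?case by (simp add: coeff_mult)
qed

lemma cpow_eq_0: "g 0 = 0 \<Longrightarrow> r < m \<Longrightarrow> cpow g m r = 0"
proof (induction m arbitrary: r)
  case (Suc m)
  have "g i * cpow g m (r - i) = 0" if "i \<le> r" for i
    using Suc that by (cases "i = 0") auto
  then show ?case by simp
qed simp

lemma cpow_unit: "cpow (\<lambda>i. if i = 1 then 1 else 0) m r = (if r = m then 1 else 0)"
proof (induction m arbitrary: r)
  case (Suc m)
  have "cpow (\<lambda>i. if i = 1 then 1 else 0) (Suc m) r =
      (\<Sum>i\<le>r. if i = 1 then cpow (\<lambda>i. if i = 1 then 1 else 0) m (r - 1) else 0 :: 'a)"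
    unfolding cpow.simps by (intro sum.cong) auto
  also have "\<dots> = (if r \<ge> 1 \<and> r - 1 = m then 1 else 0)" by (simp add: Suc.IH)
  also have "\<dots> = (if r = Suc m then 1 else 0)" by (cases r) auto
  finally show ?case .
qed simp

text \<open>This is \<open>d ^ r * r! * C((r - 1) / d, m)\<close>.\<close>

definition ecoef :: "nat \<Rightarrow> nat \<Rightarrow> nat \<Rightarrow> int" where
  "ecoef d r m = int (d ^ (r - m)) * int (fact r div fact m) * (\<Prod>j<m. int r - 1 - int d * int j)"

definition tail_coeff :: "nat \<Rightarrow> (nat \<Rightarrow> 'a::comm_ring_1) \<Rightarrow> nat \<Rightarrow> 'a" where
  "tail_coeff d a i = (if 1 \<le> i \<and> i \<le> d then a (d - i) else 0)"

text \<open>This is d ^ r r! times the coefficient of T ^ r in (1 + \<Sum> a (d - i) T ^ i) ^ ((r -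
  1) / d), with i running over 1..d. The factor clears all denominators.\<close>

definition slope_form :: "nat \<Rightarrow> nat \<Rightarrow> (nat \<Rightarrow> 'a::comm_ring_1) \<Rightarrow> 'a" where
  "slope_form d r a = (\<Sum>m\<le>r. of_int (ecoef d r m) * cpow (tail_coeff d a) m r)"

lemma fact_choose_eq_prod: "int (fact m) * int (k choose m) = (\<Prod>j<m. int k - int j)"
proof -
  have "(of_int (int (fact m) * int (k choose m)) :: rat) = fact m * (of_nat k gchoose m)"
    by (simp add: binomial_gbinomial)
  also have "\<dots> = (\<Prod>j<m. of_nat k - of_nat j)"
    by (simp add: gbinomial_prod_rev lessThan_atLeast0)
  also have "\<dots> = of_int (\<Prod>j<m. int k - int j)" by simp
  finally show ?thesis by (simp only: of_int_eq_iff)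
qed

text \<open>From k d = p - 1 + r follows d k = r - 1 modulo p, so each factor d (k - j) of the
  falling factorial can be replaced by r - 1 - d j.\<close>

lemma ecoef_cong:
  assumes k: "k * d = p - 1 + r" "p > 0" and m: "m \<le> r"
  shows "[int (d ^ r * fact r) * int (k choose m) = ecoef d r m] (mod int p)"
proof -
  have "d ^ r = d ^ (r - m) * d ^ m" using m by (simp flip: power_add)
  moreover have "fact r = fact r div fact m * (fact m :: nat)" using fact_dvd[OF m, where 'a = nat] by simp
  ultimately have "int (d ^ r * fact r) * int (k choose m) =
      int (d ^ (r - m)) * int (fact r div fact m) * (int (d ^ m) * (int (fact m) * int (k choose m)))"
    by (metis (no_types, lifting) mult.assoc mult.left_commute of_nat_mult)
  also have "int (d ^ m) * (int (fact m) * int (k choose m)) = (\<Prod>j<m. int d * (int k - int j))"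
    unfolding fact_choose_eq_prod by (simp add: prod.distrib)
  finally have *: "int (d ^ r * fact r) * int (k choose m) =
      int (d ^ (r - m)) * int (fact r div fact m) * (\<Prod>j<m. int d * (int k - int j))" .
  have dk: "int d * int k = int p + (int r - 1)"
    using arg_cong[OF k(1), of int] k(2) by (simp add: of_nat_diff mult.commute)
  have "[int d * (int k - int j) = int r - 1 - int d * int j] (mod int p)" for j
    
  proof -
    have "int d * (int k - int j) - (int r - 1 - int d * int j) = int p" using dk by (simp add: algebra_simps)
    then show ?thesis by (simp add: cong_iff_dvd_diff)
  qed
  then show ?thesis unfolding * ecoef_def by (intro cong_mult cong_prod cong_refl)
qed

text \<open>As h ^ k has degree p - 1 + r, its coefficient at x ^ (p - 1) is that of T ^ r in the
  reversed polynomial (1 + q) ^ k. Since q has no constant term, only q ^ m with m \<le> r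
  contributes.\<close>

lemma coeff_power_cong:
  assumes h: "degree h = d" "lead_coeff h = 1" and k: "k * d = p - 1 + r" "p > 0"
  shows "[int (d ^ r * fact r) * coeff (h ^ k) (p - 1) = slope_form d r (coeff h)] (mod int p)"
proof -
  define q where "q = reflect_poly h - 1"
  have h0: "h \<noteq> 0" using h by auto
  have q: "coeff q = tail_coeff d (coeff h)"
  proof
    fix i show "coeff q i = tail_coeff d (coeff h) i"
      using h by (cases "i = 0") (auto simp: q_def tail_coeff_def coeff_reflect_poly coeff_1)
  qed
  have q0: "coeff q 0 = 0" by (simp add: q tail_coeff_def)
  have "coeff (h ^ k) (p - 1) = coeff (reflect_poly (h ^ k)) r"
    using h h0 k by (simp add: coeff_reflect_poly degree_power_eq)
  also have "reflect_poly (h ^ k) = (q + 1) ^ k" by (simp add: q_def reflect_poly_power)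
  also have "coeff ((q + 1) ^ k) r = (\<Sum>m\<le>k. int (k choose m) * cpow (coeff q) m r)"
    by (simp add: binomial_ring coeff_sum coeff_power_eq_cpow[symmetric] of_nat_poly)
  also have "\<dots> = (\<Sum>m\<le>max k r. int (k choose m) * cpow (coeff q) m r)"
    by (intro sum.mono_neutral_left) auto
  also have "\<dots> = (\<Sum>m\<le>r. int (k choose m) * cpow (coeff q) m r)"
    by (intro sum.mono_neutral_right) (auto simp: cpow_eq_0[of "coeff q", OF q0])
  finally have "int (d ^ r * fact r) * coeff (h ^ k) (p - 1) =
      (\<Sum>m\<le>r. int (d ^ r * fact r) * int (k choose m) * cpow (coeff q) m r)"
    by (simp add: sum_distrib_left mult.assoc)
  then show ?thesis unfolding slope_form_def q
    by (simp only:) (intro cong_sum cong_mult, simp only: of_int_eq_id id_apply atMost_iff ecoef_cong[OF k], simp)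
qed

text \<open>Here the tail is T itself, so only m = r remains, and the value is the product of r - 1
  - d j over j < r. The factor for j = 0 is nonzero by r \<noteq> 1, the others are negative as d >
  r - 1.\<close>

lemma slope_form_nonzero:
  assumes d: "d \<ge> 2" and r: "r < d" "r \<noteq> 1"
  shows "slope_form d r (\<lambda>i. if i = d - 1 then 1 else 0 :: rat) \<noteq> 0"
proof -
  have t: "tail_coeff d (\<lambda>i. if i = d - 1 then 1 else 0 :: rat) = (\<lambda>i. if i = 1 then 1 else 0)"
    using d by (auto simp: tail_coeff_def fun_eq_iff)
  have "int r - 1 - int d * int j \<noteq> 0" if "j < r" for j
  proof (cases "j = 0")
    case False
    then have "int d * 1 \<le> int d * int j" by (intro mult_left_mono) auto
    then show ?thesis using r by linarith
  qed (use r that in auto)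
  then have "ecoef d r r \<noteq> 0" by (simp add: ecoef_def)
  moreover have "slope_form d r (\<lambda>i. if i = d - 1 then 1 else 0 :: rat) = of_int (ecoef d r r)"
    unfolding slope_form_def t cpow_unit by (simp add: if_distrib[of "(*) _"] cong: if_cong)
  ultimately show ?thesis by simp
qed

section \<open>Reduction of rational numbers\<close>

text \<open>Neither is the fraction in lowest terms nor b reduced, which makes the relation stable
  under sums and products.\<close>

definition rep_mod :: "nat \<Rightarrow> rat \<Rightarrow> int \<Rightarrow> bool" where
  "rep_mod p a b \<longleftrightarrow> (\<exists>u v. a = of_int u / of_int v \<and> \<not> int p dvd v \<and> int p dvd v * b - u)"

lemma rep_mod_of_int: "prime p \<Longrightarrow> rep_mod p (of_int n) n"
  unfolding rep_mod_def by (intro exI[of _ n] exI[of _ 1]) (auto dest: prime_gt_1_nat)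

lemma rep_mod_add:
  assumes p: "prime p" and "rep_mod p a b" "rep_mod p a' b'"
  shows "rep_mod p (a + a') (b + b')"
proof -
  obtain u v where 1: "a = of_int u / of_int v" "\<not> int p dvd v" "int p dvd v * b - u"
    using assms unfolding rep_mod_def by blast
  obtain u' v' where 2: "a' = of_int u' / of_int v'" "\<not> int p dvd v'" "int p dvd v' * b' - u'"
    using assms unfolding rep_mod_def by blast
  have "v \<noteq> 0" "v' \<noteq> 0" using 1 2 by auto
  then have "a + a' = of_int (u * v' + u' * v) / of_int (v * v')" unfolding 1 2 by (simp add: field_simps)
  moreover have "\<not> int p dvd v * v'" using 1 2 p by (simp add: prime_dvd_mult_iff)
  moreover have "v * v' * (b + b') - (u * v' + u' * v) = v' * (v * b - u) + v * (v' * b' - u')"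
    by (simp add: algebra_simps)
  then have "int p dvd v * v' * (b + b') - (u * v' + u' * v)" using 1 2 by simp
  ultimately show ?thesis unfolding rep_mod_def by blast
qed

lemma rep_mod_mult:
  assumes p: "prime p" and "rep_mod p a b" "rep_mod p a' b'"
  shows "rep_mod p (a * a') (b * b')"
proof -
  obtain u v where 1: "a = of_int u / of_int v" "\<not> int p dvd v" "int p dvd v * b - u"
    using assms unfolding rep_mod_def by blast
  obtain u' v' where 2: "a' = of_int u' / of_int v'" "\<not> int p dvd v'" "int p dvd v' * b' - u'"
    using assms unfolding rep_mod_def by blast
  have "a * a' = of_int (u * u') / of_int (v * v')" unfolding 1 2 by simp
  moreover have "\<not> int p dvd v * v'" using 1 2 p by (simp add: prime_dvd_mult_iff)
  moreover have "v * v' * (b * b') - u * u' = (v * b - u) * (v' * b') + u * (v' * b' - u')"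
    by (simp add: algebra_simps)
  then have "int p dvd v * v' * (b * b') - u * u'" using 1 2 by simp
  ultimately show ?thesis unfolding rep_mod_def by blast
qed

lemma rep_mod_sum:
  assumes p: "prime p" and "\<And>i. i \<in> A \<Longrightarrow> rep_mod p (f i) (g i)"
  shows "rep_mod p (sum f A) (sum g A)"
  using assms(2)
proof (induction A rule: infinite_finite_induct)
  case (insert x A)
  then show ?case using rep_mod_add[OF p] by simp
qed (use rep_mod_of_int[OF p, of 0] in simp_all)

lemma rep_mod_cpow:
  assumes p: "prime p" and g: "\<And>i. rep_mod p (g i) (g' i)"
  shows "rep_mod p (cpow g m r) (cpow g' m r)"
proof (induction m arbitrary: r)
  case 0
  then show ?case using rep_mod_of_int[OF p, of 0] rep_mod_of_int[OF p, of 1] by simp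
next
  case (Suc m)
  then show ?case using g by (auto intro!: rep_mod_sum rep_mod_mult p)
qed

lemma rep_mod_slope_form:
  assumes p: "prime p" and a: "\<And>i. rep_mod p (a i) (b i)"
  shows "rep_mod p (slope_form d r a) (slope_form d r b)"
proof -
  have t: "rep_mod p (tail_coeff d a i) (tail_coeff d b i)" for i
    using a rep_mod_of_int[OF p, of 0] by (simp add: tail_coeff_def)
  have "rep_mod p (of_int (ecoef d r m) * cpow (tail_coeff d a) m r)
      (of_int (ecoef d r m) * cpow (tail_coeff d b) m r)" for m
    using rep_mod_of_int[OF p, of "ecoef d r m"] t by (intro rep_mod_mult rep_mod_cpow p) auto
  then show ?thesis unfolding slope_form_def by (rule rep_mod_sum[OF p])
qed

text \<open>The reduction can vanish only if p divides the numerator of x in lowest terms, which is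
  nonzero and smaller than p in absolute value.\<close>

lemma rep_mod_not_dvd:
  assumes p: "prime p" and r: "rep_mod p x b" and x: "x \<noteq> 0" "int p > \<bar>fst (quotient_of x)\<bar>"
  shows "\<not> int p dvd b"
proof
  assume b: "int p dvd b"
  obtain u v where uv: "x = of_int u / of_int v" "\<not> int p dvd v" "int p dvd v * b - u"
    using r unfolding rep_mod_def by blast
  obtain n m where nm: "quotient_of x = (n, m)" by force
  then have m: "m > 0" and x': "x = of_int n / of_int m"
    using quotient_of_denom_pos quotient_of_div by blast+
  have "int p dvd v * b - (v * b - u)" by (rule dvd_diff[OF dvd_mult[OF b] uv(3)])
  moreover have "v * b - (v * b - u) = u" by simp
  ultimately have pu: "int p dvd u" by (simp only:)
  have "v \<noteq> 0" using uv by auto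
  then have "of_int (u * m) = (of_int (n * v) :: rat)" using uv(1) x' m by (simp add: field_simps)
  then have "u * m = n * v" by (simp only: of_int_eq_iff)
  then have "int p dvd n * v" using pu by (metis dvd_mult2)
  then have "int p dvd n" using uv(2) p by (simp add: prime_dvd_mult_iff)
  moreover have "n \<noteq> 0" using x x' by auto
  ultimately show False using x(2) nm dvd_imp_le_int[of n "int p"] by simp
qed

lemma rat_mod:
  assumes p: "prime p" and a: "p_integral p a"
  shows "rat_mod p a \<in> {0..<int p}" "rep_mod p a (rat_mod p a)"
proof -
  interpret residues_prime p "residue_ring (int p)" by unfold_locales (use p in auto)
  obtain u v where uv: "quotient_of a = (u, v)" by force
  then have a': "a = of_int u / of_int v" using quotient_of_div by blast
  have v: "\<not> int p dvd v" using a uv by (simp add: p_integral_def)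
  define w where "w = v mod int p"
  have "w \<in> {0..<int p}" "w \<noteq> 0" using v p prime_gt_0_nat by (auto simp: w_def dvd_eq_mod_eq_0)
  then have w: "w \<in> carrier (residue_ring (int p))" "w \<noteq> \<zero>\<^bsub>residue_ring (int p)\<^esub>"
    by (auto simp: residue_ring_def)
  define z where "z = inv\<^bsub>residue_ring (int p)\<^esub> w"
  have "w \<otimes>\<^bsub>residue_ring (int p)\<^esub> z = \<one>\<^bsub>residue_ring (int p)\<^esub>"
    unfolding z_def using w by (metis DiffI Units_r_inv field_Units singletonD)
  then have wz: "w * z mod int p = 1" by (simp add: residue_ring_def)
  have rm: "rat_mod p a = u * z mod int p"
    unfolding rat_mod_def Let_def uv fst_conv snd_conv w_def[symmetric] z_def[symmetric]
    by (simp add: residue_ring_def mod_mult_left_eq)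
  show "rat_mod p a \<in> {0..<int p}" using rm p prime_gt_0_nat by simp
  have "[v * z = 1] (mod int p)" using wz p prime_gt_1_nat[of p] by (simp add: w_def cong_def mod_mult_left_eq)
  then have "[u * (v * z) = u * 1] (mod int p)" by (intro cong_mult cong_refl)
  moreover have "[v * rat_mod p a = v * (u * z)] (mod int p)" unfolding rm by (simp add: cong_def mod_mult_right_eq)
  ultimately have "[v * rat_mod p a = u] (mod int p)" by (simp add: mult.left_commute cong_def)
  then show "rep_mod p a (rat_mod p a)" unfolding rep_mod_def using a' v by (auto simp: cong_iff_dvd_diff)
qed

lemma rat_mod_of_int_eq:
  assumes p: "prime p" and n: "n \<in> {0..<int p}"
  shows "rat_mod p (of_int n) = n"
proof -
  have "p_integral p (of_int n)" using p by (auto simp: p_integral_def dest: prime_gt_1_nat)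
  from rat_mod[OF p this] obtain u v where uv: "of_int n = (of_int u / of_int v :: rat)" "\<not> int p dvd v"
    "int p dvd v * rat_mod p (of_int n) - u" and r: "rat_mod p (of_int n) \<in> {0..<int p}"
    unfolding rep_mod_def by blast
  have "v \<noteq> 0" using uv(2) by auto
  then have "of_int u = (of_int (n * v) :: rat)" using uv(1) by (simp add: field_simps)
  then have "u = n * v" by (simp only: of_int_eq_iff)
  then have "int p dvd v * (rat_mod p (of_int n) - n)" using uv(3) by (simp add: algebra_simps)
  then have "int p dvd rat_mod p (of_int n) - n" using uv(2) p by (simp add: prime_dvd_mult_iff)
  then have "[rat_mod p (of_int n) = n] (mod int p)" by (simp add: cong_iff_dvd_diff)
  then show ?thesis using r n by (auto intro: cong_less_imp_eq_int)
qed

lemma poly_mod_admissible: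
  assumes p: "prime p" "\<And>i. p_integral p (coeff f i)" and f: "f \<in> monic_polys d" and d: "d \<ge> 1" "coprime p d"
  obtains h where "coeff h = poly_mod p f" "admissible p h" "degree h = d" "lead_coeff h = 1"
    "\<And>i. rep_mod p (coeff f i) (coeff h i)"
proof
  define h where "h = map_poly (rat_mod p) f"
  have r0: "rat_mod p 0 = 0" and r1: "rat_mod p 1 = 1"
    using rat_mod_of_int_eq[OF p(1), of 0] rat_mod_of_int_eq[OF p(1), of 1] prime_gt_1_nat[OF p(1)] by simp_all
  show ch: "coeff h = poly_mod p f" by (simp add: fun_eq_iff h_def poly_mod_def coeff_map_poly r0)
  have f': "degree f = d" "coeff f d = 1" using f by (auto simp: monic_polys_def)
  have hd: "coeff h d = 1" by (simp add: ch poly_mod_def f' r1)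
  have "coeff h i = 0" if "i > d" for i using that f' by (simp add: ch poly_mod_def coeff_eq_0 r0)
  then have "degree h \<le> d" by (auto intro: degree_le)
  moreover have "d \<le> degree h" using hd by (intro le_degree) simp
  ultimately show dh: "degree h = d" by simp
  then show lh: "lead_coeff h = 1" using hd by simp
  have "coeff h i \<in> {0..<int p}" for i unfolding ch poly_mod_def by (rule rat_mod(1)[OF p])
  then show "admissible p h" unfolding admissible_def using dh lh p d by (simp add: coprime_commute)
  show "rep_mod p (coeff f i) (coeff h i)" for i unfolding ch poly_mod_def by (rule rat_mod(2)[OF p])
qed

section \<open>Bounds for the first slope\<close>

lemma AS_NP1_bounds:
  assumes d: "d \<ge> 2" and f: "f \<in> monic_polys d"
    and nz: "\<And>r. r < d \<Longrightarrow> r \<noteq> 1 \<Longrightarrow> slope_form d r (coeff f) \<noteq> 0"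
    and p: "prime p" "coprime p d" "\<And>i. p_integral p (coeff f i)" "p > d * d"
      "\<And>r. r < d \<Longrightarrow> \<bar>fst (quotient_of (slope_form d r (coeff f)))\<bar> < int p"
  shows "1 / real d \<le> AS_NP1 p f \<and> AS_NP1 p f \<le> 1 / real d + 1 / real (p - 1)"
proof -
  have d1: "d \<ge> 1" using d by simp
  obtain h where h: "coeff h = poly_mod p f" "admissible p h" "degree h = d" "lead_coeff h = 1"
    "\<And>i. rep_mod p (coeff f i) (coeff h i)"
    using poly_mod_admissible[OF p(1,3) f d1 p(2)] by blast
  have p2: "p > 2" and pd: "p > d" using p(4) d mult_le_mono[of 2 d 2 d] mult_le_mono2[of 2 d d] by linarith+
  have p1: "p > 1" using p2 by simp
  have oddp: "odd p" using p(1) p2 prime_odd_nat by blast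
  have npd: "\<not> p dvd d" using pd d by (auto dest: dvd_imp_le)
  \<comment> \<open>k is (p - 1) / d rounded up, so the excess r is below d.\<close>
  define k where "k = (p - 1 + (d - 1)) div d"
  define r where "r = k * d - (p - 1)"
  have kd: "k * d = p - 1 + (d - 1) - (p - 1 + (d - 1)) mod d"
    unfolding k_def by (metis minus_mod_eq_div_mult)
  have "(p - 1 + (d - 1)) mod d \<le> d - 1" using d mod_less_divisor[of d "p - 1 + (d - 1)"] by linarith
  then have kr: "k * d = p - 1 + r" "r < d" unfolding r_def using kd d by linarith+
  have k1: "k \<ge> 1" using kr p1 by (cases "k = 0") auto
  \<comment> \<open>r = 1 would mean k d = p, impossible for 2 \<le> d < p.\<close>
  have r1: "r \<noteq> 1"
  proof
    assume "r = 1"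
    then have "k * d = p" using kr p1 by simp
    then have "d dvd p" by (metis dvd_triv_right)
    then have "d = 1 \<or> d = p" using p(1) by (auto simp: prime_nat_iff)
    then show False using d pd by simp
  qed
  have c: "\<not> int p dvd coeff (h ^ k) (p - 1)"
  proof
    assume "int p dvd coeff (h ^ k) (p - 1)"
    then have "int p dvd int (d ^ r * fact r) * coeff (h ^ k) (p - 1)" by simp
    then have "int p dvd slope_form d r (coeff h)"
      using coeff_power_cong[OF h(3,4) kr(1)] p1 cong_dvd_iff by auto
    moreover have "rep_mod p (slope_form d r (coeff f)) (slope_form d r (coeff h))"
      using h(5) by (rule rep_mod_slope_form[OF p(1)])
    ultimately show False
      using rep_mod_not_dvd[OF p(1)] nz[OF kr(2) r1] p(5)[OF kr(2)] by blast
  qed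
  \<comment> \<open>Here p > d ^ 2 enters: the rounding in k costs r (d - 1) \<le> (d - 1) ^ 2,
    which must stay below p - 1.\<close>
  have "k * (d - 1) * d < (p - 1) * d"
  proof -
    obtain e where e: "d = Suc e" using d by (cases d) auto
    have "k * (d - 1) * d = (p - 1 + r) * e" using kr e by (metis diff_Suc_1 mult.commute mult.left_commute)
    also have "\<dots> \<le> (p - 1) * e + e * e" using kr(2) e by (simp add: add_mult_distrib)
    also have "\<dots> < (p - 1) * e + (p - 1)" using p(4) e by simp
    also have "\<dots> = (p - 1) * d" using e by simp
    finally show ?thesis .
  qed
  then have b1: "k * (d - 1) < p - 1" by (metis mult_less_cancel2)
  have b2: "k * d < 2 * (p - 1)" using kr pd by linarith
  have b3: "(k - 1) * d < p - 1"
    using kr k1 p1 by (simp add: diff_mult_distrib)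
  obtain \<mu> n where \<mu>: "real (p - 1) / real d \<le> \<mu>" "\<mu> \<le> real k" and n: "1 \<le> n" "n < d"
    and sl: "\<And>a. a \<in> {1..<p} \<Longrightarrow> slope_at p \<mu> n (lfun p h a)"
    using lfun_slope[OF p(1) oddp h(3,4) d npd b1 b2 b3 c] by blast
  have "0 \<le> real (p - 1) / real d" by simp
  then have \<mu>0: "\<mu> \<ge> 0" using \<mu>(1) by linarith
  have sp: "slope_at p \<mu> ((p - 1) * n) (\<Prod>a\<in>{1..<p}. lfun p h a)"
    using slope_at_prod[OF p(1) \<mu>0 _ sl, of "{1..<p}"] by simp
  obtain S where S: "\<And>n. n > 0 \<Longrightarrow> of_nat (AS_point_count p (coeff h) n) = 1 + of_nat p ^ n + (\<Sum>a\<in>{1..<p}. S (int a) n :: complex)"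
    "\<And>a n. of_nat n * expsum p h a n = (\<Sum>j\<in>{1..n}. S a j * expsum p h a (n - j))"
    using point_count[OF h(2)] unfolding point_count_formula_def by blast
  have z: "of_rat (fps_nth (zeta_numerator p (AS_point_count p (coeff h))) i) =
      fps_nth (\<Prod>a\<in>{1..<p}. lfun p h a) i" for i
    using S by (rule zeta_numerator_eq_prod)
  \<comment> \<open>p is odd, so the division by 2 in the genus is exact.\<close>
  have "2 * ((p - 1) * (d - 1) div 2) = (p - 1) * (d - 1)" using oddp by simp
  then have g: "(p - 1) * n \<le> 2 * ((p - 1) * (d - 1) div 2)" using n mult_le_mono2[of n "d - 1" "p - 1"] by linarith
  have "AS_NP1 p f = first_slope (NP p 1 ((p - 1) * (d - 1) div 2) (AS_point_count p (coeff h)))"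
    using f by (simp add: AS_NP1_def monic_polys_def h(1))
  also have "\<dots> = \<mu> / real (p - 1)"
    by (rule NP_first_slope[OF p(1) sp _ g z]) (use n p1 in simp)
  finally have NP1: "AS_NP1 p f = \<mu> / real (p - 1)" .
  have "1 / real d \<le> \<mu> / real (p - 1)" using \<mu>(1) p1 d by (simp add: field_simps)
  moreover have "\<mu> / real (p - 1) \<le> 1 / real d + 1 / real (p - 1)"
  proof -
    have "real k * real d \<le> real (p - 1) + real d"
      using kr by (metis add_left_mono less_imp_le_nat of_nat_add of_nat_le_iff of_nat_mult)
    then have "real k \<le> (real (p - 1) + real d) / real d" using d by (simp add: field_simps)
    then have "\<mu> / real (p - 1) \<le> (real (p - 1) + real d) / real d / real (p - 1)"
      using \<mu>(2) p1 by (intro divide_right_mono) auto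
    also have "\<dots> = 1 / real d + 1 / real (p - 1)" using p1 d by (simp add: field_simps)
    finally show ?thesis .
  qed
  ultimately show ?thesis unfolding NP1 by blast
qed

lemma AS_NP1_tendsto:
  assumes d: "d \<ge> 2" and f: "f \<in> monic_polys d"
    and nz: "\<And>r. r < d \<Longrightarrow> r \<noteq> 1 \<Longrightarrow> slope_form d r (coeff f) \<noteq> 0"
  shows "((\<lambda>p. AS_NP1 p f) \<longlongrightarrow> 1 / real d)
    (inf at_top (principal {p. prime p \<and> coprime p d \<and> (\<forall>i. p_integral p (coeff f i))}))"
    (is "(_ \<longlongrightarrow> _) ?F")
proof (rule tendsto_sandwich)
  \<comment> \<open>r varies with p, but among d values only, so one bound beyond all the numerators
    serves every large p.\<close>
  define B where "B = d * d + (\<Sum>r<d. nat \<bar>fst (quotient_of (slope_form d r (coeff f)))\<bar>)"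
  have "eventually (\<lambda>p. 1 / real d \<le> AS_NP1 p f \<and> AS_NP1 p f \<le> 1 / real d + 1 / real (p - 1)) ?F"
    unfolding eventually_inf_principal
  proof (rule eventually_mono[OF eventually_gt_at_top[of B]], rule impI)
    fix p assume B: "p > B" and p: "p \<in> {p. prime p \<and> coprime p d \<and> (\<forall>i. p_integral p (coeff f i))}"
    have "\<bar>fst (quotient_of (slope_form d r (coeff f)))\<bar> < int p" if "r < d" for r
    proof -
      have "nat \<bar>fst (quotient_of (slope_form d r (coeff f)))\<bar> \<le> (\<Sum>r<d. nat \<bar>fst (quotient_of (slope_form d r (coeff f)))\<bar>)"
        using that by (intro member_le_sum) auto
      then show ?thesis using B unfolding B_def by linarith
    qed
    moreover have "p > d * d" using B unfolding B_def by linarith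
    ultimately show "1 / real d \<le> AS_NP1 p f \<and> AS_NP1 p f \<le> 1 / real d + 1 / real (p - 1)"
      using p by (intro AS_NP1_bounds[OF d f nz]) auto
  qed
  then show "eventually (\<lambda>p. 1 / real d \<le> AS_NP1 p f) ?F"
    "eventually (\<lambda>p. AS_NP1 p f \<le> 1 / real d + 1 / real (p - 1)) ?F"
    by (auto elim: eventually_mono)
  show "((\<lambda>p. 1 / real d) \<longlongrightarrow> 1 / real d) ?F" by simp
  have "((\<lambda>p::nat. 1 / real d + 1 / real (p - 1)) \<longlongrightarrow> 1 / real d) at_top" by real_asymp
  then show "((\<lambda>p. 1 / real d + 1 / real (p - 1)) \<longlongrightarrow> 1 / real d) ?F"
    by (rule tendsto_mono[OF inf_le1])
qed

section \<open>Density\<close>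

lemma polyfuns_sum: "(\<And>i. i \<in> A \<Longrightarrow> F i \<in> polyfuns d) \<Longrightarrow> (\<lambda>a. \<Sum>i\<in>A. F i a) \<in> polyfuns d"
proof (induction A rule: infinite_finite_induct)
  case (insert x A)
  then show ?case using polyfuns.add[of "F x" d "\<lambda>a. \<Sum>i\<in>A. F i a"] by simp
qed (auto intro: polyfuns.const)

lemma slope_form_polyfun: "slope_form d r \<in> polyfuns d"
proof -
  have t: "(\<lambda>a. tail_coeff d a i) \<in> polyfuns d" for i
    unfolding tail_coeff_def by (cases "1 \<le> i \<and> i \<le> d") (auto intro: polyfuns.const polyfuns.coord)
  have "(\<lambda>a. cpow (tail_coeff d a) m s) \<in> polyfuns d" for m s
  proof (induction m arbitrary: s)
    case 0
    then show ?case by (simp add: polyfuns.const)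
  next
    case (Suc m)
    then show ?case unfolding cpow.simps by (intro polyfuns_sum polyfuns.mult t)
  qed
  then have "(\<lambda>a. slope_form d r a) \<in> polyfuns d"
    unfolding slope_form_def by (intro polyfuns_sum polyfuns.mult polyfuns.const)
  then show ?thesis by simp
qed

lemma polyfun_cong: "P \<in> polyfuns d \<Longrightarrow> (\<And>i. i < d \<Longrightarrow> a i = b i) \<Longrightarrow> P a = P b"
  by (induction rule: polyfuns.induct) auto

lemma polyfun_line: "P \<in> polyfuns d \<Longrightarrow> \<exists>G. \<forall>t. P (\<lambda>i. a i + t * (b i - a i)) = poly G t"
proof (induction rule: polyfuns.induct)
  case (const c)
  show ?case by (intro exI[of _ "[:c:]"]) simp
next
  case (coord i)
  show ?case by (intro exI[of _ "[:a i, b i - a i:]"]) (simp add: mult.commute)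
next
  case (add P Q)
  then obtain G H where "\<forall>t. P (\<lambda>i. a i + t * (b i - a i)) = poly G t" "\<forall>t. Q (\<lambda>i. a i + t * (b i - a i)) = poly H t" by blast
  then show ?case by (intro exI[of _ "G + H"]) simp
next
  case (mult P Q)
  then obtain G H where "\<forall>t. P (\<lambda>i. a i + t * (b i - a i)) = poly G t" "\<forall>t. Q (\<lambda>i. a i + t * (b i - a i)) = poly H t" by blast
  then show ?case by (intro exI[of _ "G * H"]) simp
qed

text \<open>On the line through a and b all these functions become polynomials in t, nonzero because
  P does not vanish at t = 0 nor the \<open>N r\<close> at t = 1. Their product has finitely many
  roots in the infinite field \<rat>.\<close>

lemma polyfuns_common_nonzero:
  assumes P: "P \<in> polyfuns d" "P a \<noteq> 0" and A: "finite A" "\<And>r. r \<in> A \<Longrightarrow> N r \<in> polyfuns d" "\<And>r. r \<in> A \<Longrightarrow> N r b \<noteq> 0"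
  shows "\<exists>c. P c \<noteq> 0 \<and> (\<forall>r\<in>A. N r c \<noteq> 0)"
proof -
  define l where "l = (\<lambda>t i. a i + t * (b i - a i))"
  obtain G where G: "\<And>t. P (l t) = poly G t" using polyfun_line[OF P(1)] unfolding l_def by blast
  have "\<exists>H. \<forall>t. N r (l t) = poly H t" if "r \<in> A" for r using polyfun_line[OF A(2)[OF that]] unfolding l_def by blast
  then obtain H where H: "\<And>r t. r \<in> A \<Longrightarrow> N r (l t) = poly (H r) t" by metis
  have l01: "l 0 = a" "l 1 = b" by (simp_all add: l_def fun_eq_iff)
  have "G \<noteq> 0" using G[of 0] P(2) l01 by auto
  moreover have "H r \<noteq> 0" if "r \<in> A" for r using H[OF that, of 1] A(3)[OF that] l01 by auto
  ultimately have "G * (\<Prod>r\<in>A. H r) \<noteq> 0" using A(1) by simp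
  then have "finite {t. poly (G * (\<Prod>r\<in>A. H r)) t = 0}" by (rule poly_roots_finite)
  then obtain t where "poly (G * (\<Prod>r\<in>A. H r)) t \<noteq> 0"
    using infinite_UNIV_char_0[where 'a = rat] by (metis (mono_tags, lifting) Collect_cong UNIV_def)
  then show ?thesis using A(1) by (intro exI[of _ "l t"]) (auto simp: G H poly_prod)
qed

lemma exists_monic_poly:
  fixes c :: "nat \<Rightarrow> rat"
  obtains f where "f \<in> monic_polys d" "\<And>i. i < d \<Longrightarrow> coeff f i = c i"
proof
  define f where "f = monom 1 d + (\<Sum>i<d. monom (c i) i)"
  have cf: "coeff f i = (if i = d then 1 else if i < d then c i else 0)" for i
    by (auto simp: f_def coeff_sum)
  then show "coeff f i = c i" if "i < d" for i using that by simp
  have "degree f \<le> d" using cf by (intro degree_le) auto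
  moreover have "d \<le> degree f" using cf[of d] by (intro le_degree) simp
  ultimately have "degree f = d" by simp
  then show "f \<in> monic_polys d" using cf by (simp add: monic_polys_def)
qed

text \<open>A nonempty open set contains a nonempty set of the form P \<noteq> 0, so it is enough to
  find coordinates where P and all the \<open>N r\<close> are nonzero together.\<close>

lemma zariski_dense:
  assumes A: "finite A" "\<And>r. r \<in> A \<Longrightarrow> N r \<in> polyfuns d" "\<And>r. r \<in> A \<Longrightarrow> N r b \<noteq> 0"
  shows "zariski d closure_of {f \<in> monic_polys d. \<forall>r\<in>A. N r (coeff f) \<noteq> 0} = monic_polys d"
proof -
  have "{f \<in> monic_polys d. \<forall>r\<in>A. N r (coeff f) \<noteq> 0} \<inter> W \<noteq> {}" if W: "openin (zariski d) W" "W \<noteq> {}" for W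
  proof -
    obtain S where S: "S \<subseteq> polyfuns d" "W = monic_polys d - zero_locus d S" using W unfolding openin_zariski by blast
    obtain g P where P: "P \<in> S" "P (coeff g) \<noteq> 0" using W(2) unfolding S(2) zero_locus_def by blast
    have P': "P \<in> polyfuns d" using P S by blast
    obtain c where c: "P c \<noteq> 0" "\<forall>r\<in>A. N r c \<noteq> 0" using polyfuns_common_nonzero[of P d "coeff g" A N b, OF P' P(2) A] by blast
    obtain f where f: "f \<in> monic_polys d" "\<And>i. i < d \<Longrightarrow> coeff f i = c i" using exists_monic_poly by blast
    have e: "Q (coeff f) = Q c" if "Q \<in> polyfuns d" for Q using polyfun_cong[OF that] f(2) by blast
    have "f \<in> W" unfolding S(2) zero_locus_def using f(1) P c(1) e[OF P'] by force
    moreover have "\<forall>r\<in>A. N r (coeff f) \<noteq> 0" using c(2) by (simp add: e A(2))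
    ultimately show ?thesis using f(1) by blast
  qed
  then show ?thesis using dense_intersects_open[of "zariski d"] by simp
qed

theorem theorem1p2:
  fixes d :: nat
  assumes "d \<ge> 2"
  shows "\<exists>U \<subseteq> monic_polys d.
    zariski d closure_of U = monic_polys d \<and>
    (\<forall>f\<in>U. ((\<lambda>p. AS_NP1 p f) \<longlongrightarrow> 1 / real d)
       (inf at_top (principal {p. prime p \<and> coprime p d \<and> (\<forall>i. p_integral p (Polynomial.coeff f i))})))"
proof (intro exI conjI ballI)
  \<comment> \<open>The form for r = 1 is identically 0 and must be left out: its term m = 0 has no
    coefficient at T, and its term m = 1 carries the factor r - 1.\<close>
  let ?A = "{..<d} - {1}"
  let ?U = "{f \<in> monic_polys d. \<forall>r\<in>?A. slope_form d r (coeff f) \<noteq> 0}"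
  show "?U \<subseteq> monic_polys d" by blast
  show "zariski d closure_of ?U = monic_polys d"
    by (rule zariski_dense[where b = "\<lambda>i. if i = d - 1 then 1 else 0"])
      (auto intro: slope_form_polyfun simp: slope_form_nonzero[OF assms])
  fix f assume "f \<in> ?U"
  then show "((\<lambda>p. AS_NP1 p f) \<longlongrightarrow> 1 / real d)
      (inf at_top (principal {p. prime p \<and> coprime p d \<and> (\<forall>i. p_integral p (Polynomial.coeff f i))}))"
    by (intro AS_NP1_tendsto[OF assms]) auto
qed

end
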